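(* Let $b\ge2$ be an integer, $\gamma\in(0,1)$, and let $\phi:\mathbb{R}\to\mathbb{R}$ be a real analytic $\mathbb{Z}$-periodic function satisfying condition (H) for $b$ and $\gamma$, i.e. for all $\mathbf{i}\neq\mathbf{j}\in\Sigma$ the function $x\mapsto S(x,\mathbf{j})-S(x,\mathbf{i})$ is not identically zero on $[0,1]$. Then $$\dim(\omega)=\min\Big\{1+\frac{\log b}{\log(1/\gamma)},\,2\Big\},$$ where $\omega$ is the SRB measure of $T(x,y)=(bx\bmod 1,\gamma y+\phi(x))$ on $[0,1)\times\mathbb{R}$.
   Context: $\Lambda=\{0,1,\dots,b-1\}$, $\Sigma=\Lambda^{\mathbb{Z}_+}$. For a word $\mathbf{j}=j_1j_2\cdots j_p$ with $1\le p\le\infty$ and $x\in[0,1]$, $S(x,\mathbf{j})=\sum_{n=1}^{p}\gamma^{n-1}\phi\big(\frac{x+j_1+j_2b+\cdots+j_nb^{n-1}}{b^n}\big)$. The SRB measure $\omega$ of $T$ is the ergodic Borel probability measure on $[0,1)\times\mathbb{R}$ such that Lebesgue-a.e. point $z$ satisfies $\frac1n\sum_{k<n}\delta_{T^kz}\to\omega$ weakly; it equals the image of (Lebesgue on $[0,1)$)$\times\nu^{\mathbb{Z}_+}$ under $(x,\mathbf{j})\mapsto(x,S(x,\mathbf{j}))$, with $\nu$ the uniform measure on $\Lambda$. $\omega$ is exact dimensional (i.e. there is $\beta$ with $\lim_{r\to0}\log\omega(B(z,r))/\log r=\beta$ for $\omega$-a.e. $z$), and $\dim(\omega)$ denotes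 this $\beta$. *)

theory Defs
  imports "HOL-Probability.Probability"
begin

definition real_analytic :: "(real \<Rightarrow> real) \<Rightarrow> bool" where
  "real_analytic f \<longleftrightarrow> (\<forall>x0. \<exists>r>0. \<exists>a::nat \<Rightarrow> real.
      \<forall>y. \<bar>y - x0\<bar> < r \<longrightarrow> (\<lambda>n. a n * (y - x0) ^ n) sums f y)"

definition int_periodic :: "(real \<Rightarrow> real) \<Rightarrow> bool" where
  "int_periodic f \<longleftrightarrow> (\<forall>x. f (x + 1) = f x)"

text \<open>Sigma = Lambda^{Z+}; words are indexed from 0 (j 0 is the paper's j_1).\<close>
definition words :: "nat \<Rightarrow> (nat \<Rightarrow> nat) set" where
  "words b = {j. \<forall>n. j n < b}"

definition S_fun :: "nat \<Rightarrow> real \<Rightarrow> (real \<Rightarrow> real) \<Rightarrow> real \<Rightarrow> (nat \<Rightarrow> nat) \<Rightarrow> real" where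
  "S_fun b \<gamma> \<phi> x j = (\<Sum>n. \<gamma> ^ n *
      \<phi> ((x + (\<Sum>k\<le>n. real (j k) * real b ^ k)) / real b ^ (Suc n)))"

definition condition_H :: "nat \<Rightarrow> real \<Rightarrow> (real \<Rightarrow> real) \<Rightarrow> bool" where
  "condition_H b \<gamma> \<phi> \<longleftrightarrow> (\<forall>i\<in>words b. \<forall>j\<in>words b. i \<noteq> j \<longrightarrow>
      \<not> (\<forall>x\<in>{0..1}. S_fun b \<gamma> \<phi> x j - S_fun b \<gamma> \<phi> x i = 0))"

definition T_map :: "nat \<Rightarrow> real \<Rightarrow> (real \<Rightarrow> real) \<Rightarrow> real \<times> real \<Rightarrow> real \<times> real" where
  "T_map b \<gamma> \<phi> z = (frac (real b * fst z), \<gamma> * snd z + \<phi> (fst z))"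

definition ergodic_borel_prob :: "(real \<times> real \<Rightarrow> real \<times> real) \<Rightarrow> (real \<times> real) measure \<Rightarrow> bool" where
  "ergodic_borel_prob T \<omega> \<longleftrightarrow>
     sets \<omega> = sets borel \<and> prob_space \<omega> \<and>
     emeasure \<omega> ({0..<1} \<times> UNIV) = 1 \<and>
     T \<in> borel_measurable borel \<and>
     distr \<omega> \<omega> T = \<omega> \<and>
     (\<forall>A\<in>sets \<omega>. T -` A = A \<longrightarrow> measure \<omega> A = 0 \<or> measure \<omega> A = 1)"

definition SRB_measure :: "(real \<times> real \<Rightarrow> real \<times> real) \<Rightarrow> (real \<times> real) measure \<Rightarrow> bool" where
  "SRB_measure T \<omega> \<longleftrightarrow> ergodic_borel_prob T \<omega> \<and>
     (AE z in lborel. z \<in> {0..<1} \<times> UNIV \<longrightarrow>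
        (\<forall>f :: real \<times> real \<Rightarrow> real. continuous_on UNIV f \<and> bounded (range f) \<longrightarrow>
           (\<lambda>n. (\<Sum>k<n. f ((T ^^ k) z)) / real n) \<longlonglongrightarrow> integral\<^sup>L \<omega> f))"

definition exact_dimensional_with :: "(real \<times> real) measure \<Rightarrow> real \<Rightarrow> bool" where
  "exact_dimensional_with \<omega> \<beta> \<longleftrightarrow>
     (AE z in \<omega>. ((\<lambda>r. ln (measure \<omega> (ball z r)) / ln r) \<longlongrightarrow> \<beta>) (at_right 0))"

end

theory Submission
  imports Defs
begin

text \<open>
The SRB measure is the weak limit of the images under \<open>T ^^ n\<close> of Lebesgue measure on the graph of
\<open>G u = (\<Sum>k. \<gamma> ^ k * \<phi> (u / b ^ (k + 1)))\<close>, since \<open>T ^^ n\<close> maps \<open>(x, y)\<close> to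
\<open>(frac (b ^ n * x), G (b ^ n * x) + \<gamma> ^ n * (y - G x))\<close>. It therefore disintegrates into fibre measures that
are limits of the uniform distributions on \<open>G (x + w)\<close>, \<open>w < b ^ n\<close>, and everything reduces to their entropy
rate \<open>\<beta>\<close>. Condition (H) and compactness make \<open>G (x + w) - G (x + w')\<close> vanish to bounded order for words
with distinct first digits, so that for most \<open>x\<close> the points with \<open>w < b ^ N\<close> are separated at an
exponentially small scale. If \<open>\<beta>\<close> were smaller than both \<open>log b\<close> and \<open>log (1 / \<gamma>)\<close>, an inverse theorem for the
entropy of convolutions would force the separated points to carry almost no entropy between the two scales,
which is absurd. Submultiplicativity of small moments turns the entropy bound into a bound on almost every ball.
\<close>

text \<open>Every entropy is that of a function on a finite set of words under the uniform
  distribution, so conditioning is counting and errors are explicit constants. Two obstacles shape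
  the argument. The fibre over \<open>x\<close> depends on \<open>x\<close>, so the points over a
  concatenated word \<open>w v j\<close> do not split into a function of \<open>w\<close> plus a
  function of \<open>j\<close>; fixing a long middle block \<open>v\<close> fixes the base point
  seen by \<open>j\<close> almost exactly and makes the split accurate at the scale in question
  (\<open>split_error\<close>). And an inverse theorem must in general trace a measure scale by
  scale; here the second summand \<open>z\<close> is a fibre measure, all of whose pieces at all
  scales have at least the minimal entropy. If adding \<open>f\<close> gains almost nothing, the law
  of \<open>f w + z\<close> in a cell hardly depends on the fine digits of \<open>f w\<close>. Two
  values of \<open>f\<close> that differ in those digits would slide a law onto itself, which
  spreads it over more cells than an entropy rate below log (1/\<gamma>) allows. The gap between
  \<beta> and log b is what the prefixes would have to carry.\<close>

abbreviation rcard :: "'a set => real" where "rcard A == real (card A)"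

section \<open>Entropy of functions on finite sets\<close>

definition fib :: "'a set => ('a => 'b) => 'a => 'a set" where
 "fib A X a = {a' \<in> A. X a' = X a}"

text \<open>Conditional entropy, in bits, of \<open>X\<close> given \<open>Y\<close> for the uniform distribution on \<open>A\<close>.\<close>
definition cent :: "'a set => ('a => 'b) => ('a => 'c) => real" where
 "cent A X Y =
  (\<Sum>a\<in>A. log 2 (rcard (fib A Y a) / rcard (fib A (%t. (X t, Y t)) a))) / rcard A"

definition ent :: "'a set => ('a => 'b) => real" where
 "ent A X = cent A X (%_. ())"

definition refines :: "'a set => ('a => 'b) => ('a => 'c) => bool" where
 "refines A X' X \<longleftrightarrow> (\<forall>a\<in>A. \<forall>a'\<in>A. X' a = X' a' --> X a = X a')"

lemma cent_empty [simp]: "cent {} X Y = 0" and ent_empty [simp]: "ent {} X = 0"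
 by (simp_all add: cent_def ent_def)

lemma refinesI: "(!!a a'. a \<in> A ==> a' \<in> A ==> X' a = X' a' ==> X a = X a') ==> refines A X' X"
 unfolding refines_def by blast

lemma refines_comp: "refines A X (%t. g (X t))"
 by (auto simp: refines_def)

lemma fib_subset: "fib A X a \<subseteq> A"
 by (auto simp: fib_def)

lemma finite_fib: "finite A ==> finite (fib A X a)"
 by (auto simp: fib_def)

lemma self_in_fib: "a \<in> A ==> a \<in> fib A X a"
 by (auto simp: fib_def)

lemma card_fib_pos: "finite A ==> a \<in> A ==> 0 < card (fib A X a)"
 using finite_fib[of A X a] self_in_fib[of a A X] card_gt_0_iff by blast

lemma fib_const: "fib A (%_. c) a = A"
 by (auto simp: fib_def)

lemma fib_eq: "t \<in> fib A Y a ==> fib A Y t = fib A Y a"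
 by (auto simp: fib_def)

lemma cent_cong:
 assumes "!!a a'. a \<in> A ==> a' \<in> A ==> Y a = Y a' \<longleftrightarrow> Y' a = Y' a'"
  and "!!a a'. a \<in> A ==> a' \<in> A ==> Y a = Y a' ==> X a = X a' \<longleftrightarrow> X' a = X' a'"
 shows "cent A X Y = cent A X' Y'"
proof -
 have "fib A Y a = fib A Y' a" if "a \<in> A" for a
  using assms(1) that by (auto simp: fib_def)
 moreover have "fib A (%t. (X t, Y t)) a = fib A (%t. (X' t, Y' t)) a" if "a \<in> A" for a
  unfolding fib_def using assms(1)[OF _ that] assms(2)[OF _ that] by auto
 ultimately show ?thesis unfolding cent_def by simp
qed

lemma sum_fib: "finite A ==> (\<Sum>t\<in>fib A Y a. g t) = (\<Sum>t\<in>A. if Y t = Y a then g t else 0)"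
 for g :: "_ => real"
 unfolding fib_def by (rule sum.inter_filter)

text \<open>Double counting: each \<open>t\<close> is charged \<open>1 / rcard (fib A Y t)\<close>
  by every point of its own fibre. It is the tower property of conditional expectation for the
  uniform distribution.\<close>

lemma sum_fib_average:
 fixes g :: "'a => real"
 assumes "finite A"
 shows "(\<Sum>a\<in>A. (\<Sum>t\<in>fib A Y a. g t) / rcard (fib A Y a)) = (\<Sum>a\<in>A. g a)"
proof -
 have "(\<Sum>a\<in>A. (\<Sum>t\<in>fib A Y a. g t) / rcard (fib A Y a))
   = (\<Sum>a\<in>A. \<Sum>t\<in>A. if Y t = Y a then g t / rcard (fib A Y a) else 0)"
 proof (rule sum.cong[OF refl])
  fix a assume "a \<in> A"
  have "(\<Sum>t\<in>fib A Y a. g t) / rcard (fib A Y a) = (\<Sum>t\<in>fib A Y a. g t / rcard (fib A Y a))"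
   by (simp add: sum_divide_distrib)
  also have "... = (\<Sum>t\<in>A. if Y t = Y a then g t / rcard (fib A Y a) else 0)"
   by (rule sum_fib[OF assms])
  finally show "(\<Sum>t\<in>fib A Y a. g t) / rcard (fib A Y a) = ..." .
 qed
 also have "... = (\<Sum>t\<in>A. \<Sum>a\<in>A. if Y t = Y a then g t / rcard (fib A Y a) else 0)"
  by (rule sum.swap)
 also have "... = (\<Sum>t\<in>A. g t)"
 proof (rule sum.cong[OF refl])
  fix t assume t: "t \<in> A"
  have "(\<Sum>a\<in>A. if Y t = Y a then g t / rcard (fib A Y a) else 0)
   = (\<Sum>a\<in>fib A Y t. g t / rcard (fib A Y a))"
   unfolding sum_fib[OF assms] by (intro sum.cong refl if_cong) auto
  also have "... = (\<Sum>a\<in>fib A Y t. g t / rcard (fib A Y t))"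
   by (rule sum.cong) (auto simp: fib_eq)
  also have "... = g t"
   using card_fib_pos[OF assms t, of Y] by simp
  finally show "(\<Sum>a\<in>A. if Y t = Y a then g t / rcard (fib A Y a) else 0) = g t" .
 qed
 finally show ?thesis .
qed

lemma cent_fibers:
 assumes "finite A"
 shows "cent A X (%t. (Y t, Z t)) = (\<Sum>a\<in>A. cent (fib A Y a) X Z) / rcard A"
proof -
 let ?g = "%t. log 2 (rcard (fib A (%t. (Y t, Z t)) t) / rcard (fib A (%t. (X t, Y t, Z t)) t))"
 have "cent (fib A Y a) X Z = (\<Sum>t\<in>fib A Y a. ?g t) / rcard (fib A Y a)" for a
 proof -
  have "fib (fib A Y a) Z t = fib A (%t. (Y t, Z t)) t"
   "fib (fib A Y a) (%t. (X t, Z t)) t = fib A (%t. (X t, Y t, Z t)) t" if "t \<in> fib A Y a" for t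
   using that by (auto simp: fib_def)
  thus ?thesis unfolding cent_def by simp
 qed
 hence "(\<Sum>a\<in>A. cent (fib A Y a) X Z) = (\<Sum>a\<in>A. ?g a)"
  using sum_fib_average[OF assms, where Y=Y and g="?g"] by simp
 thus ?thesis unfolding cent_def by simp
qed

lemma cent_fibers_ent:
 assumes "finite A"
 shows "cent A X Y = (\<Sum>a\<in>A. ent (fib A Y a) X) / rcard A"
proof -
 have "cent A X Y = cent A X (%t. (Y t, ()))" by (rule cent_cong) auto
 thus ?thesis using cent_fibers[OF assms, of X Y "%_. ()"] by (simp add: ent_def)
qed

lemma card_fib_pair_le: "finite A ==> card (fib A (%t. (X t, Y t)) a) <= card (fib A Y a)"
 by (rule card_mono) (auto simp: fib_def)

lemma cent_nonneg: assumes "finite A" shows "0 <= cent A X Y"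
 unfolding cent_def
proof (intro divide_nonneg_nonneg sum_nonneg)
 fix a assume a: "a \<in> A"
 show "0 <= log 2 (rcard (fib A Y a) / rcard (fib A (%t. (X t, Y t)) a))"
  using card_fib_pos[OF assms a, of "%t. (X t, Y t)"] card_fib_pair_le[OF assms, of X Y a]
  by (subst zero_le_log_cancel_iff) (auto simp: field_simps)
qed auto

lemma cent_chain:
 assumes "finite A"
 shows "cent A (%t. (X t, Z t)) Y = cent A Z Y + cent A X (%t. (Y t, Z t))"
proof -
 have "log 2 (rcard (fib A Y a) / rcard (fib A (%t. ((X t, Z t), Y t)) a))
  = log 2 (rcard (fib A Y a) / rcard (fib A (%t. (Z t, Y t)) a)) +
   log 2 (rcard (fib A (%t. (Y t, Z t)) a) / rcard (fib A (%t. (X t, Y t, Z t)) a))"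
  if a: "a \<in> A" for a
 proof -
  have 1: "fib A (%t. (Z t, Y t)) a = fib A (%t. (Y t, Z t)) a"
   "fib A (%t. ((X t, Z t), Y t)) a = fib A (%t. (X t, Y t, Z t)) a"
   by (auto simp: fib_def)
  show ?thesis unfolding 1
   using card_fib_pos[OF assms a, of Y] card_fib_pos[OF assms a, of "%t. (Y t, Z t)"]
   card_fib_pos[OF assms a, of "%t. (X t, Y t, Z t)"]
   by (simp add: log_divide)
 qed
 thus ?thesis unfolding cent_def by (simp add: sum.distrib add_divide_distrib)
qed

text \<open>The ratio \<open>T a\<close> of the proof is the density of the coupling in which
  \<open>X\<close> and \<open>Z\<close> are conditionally independent given \<open>Y\<close>,
  relative to the actual joint law. Its mean is at most 1, and \<open>ln T <= T - 1\<close> turns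
  this into nonnegative conditional mutual information.\<close>

lemma cent_cond_pair_le:
 assumes fin: "finite A"
 shows "cent A X (%t. (Y t, Z t)) <= cent A X Y"
proof (cases "A = {}")
 case True thus ?thesis by (simp add: cent_def)
next
 case ne: False
 define y where "y a = rcard (fib A Y a)" for a
 define yz where "yz a = rcard (fib A (%t. (Y t, Z t)) a)" for a
 define xy where "xy a = rcard (fib A (%t. (X t, Y t)) a)" for a
 define xyz where "xyz a = rcard (fib A (%t. (X t, Y t, Z t)) a)" for a
 have pos: "0 < y a" "0 < yz a" "0 < xy a" "0 < xyz a" if "a \<in> A" for a
  unfolding y_def yz_def xy_def xyz_def using card_fib_pos[OF fin that] by auto
 define T where "T a = yz a * xy a / (y a * xyz a)" for a
 have "(\<Sum>a\<in>A. T a) = (\<Sum>a\<in>A. \<Sum>p\<in>A. \<Sum>q\<in>A.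
   if (Y p, Z p) = (Y a, Z a) & (X q, Y q) = (X a, Y a) then 1 / (y a * xyz a) else 0)"
 proof (rule sum.cong[OF refl])
  fix a assume "a \<in> A"
  have "(\<Sum>p\<in>A. \<Sum>q\<in>A. if (Y p, Z p) = (Y a, Z a) & (X q, Y q) = (X a, Y a) then 1 / (y a * xyz a) else 0)
   = (\<Sum>p\<in>A. \<Sum>q\<in>A. (if (Y p, Z p) = (Y a, Z a) then 1 else 0) *
   ((if (X q, Y q) = (X a, Y a) then 1 else 0) * (1 / (y a * xyz a))))"
   by (intro sum.cong refl) auto
  also have "... = (\<Sum>p\<in>A. if (Y p, Z p) = (Y a, Z a) then 1 else 0) *
   ((\<Sum>q\<in>A. if (X q, Y q) = (X a, Y a) then 1 else 0) * (1 / (y a * xyz a)))"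
   by (simp only: sum_product sum_distrib_right[where A=A and r="1 / (y a * xyz a)"])
  also have "(\<Sum>p\<in>A. if (Y p, Z p) = (Y a, Z a) then 1 else 0) = yz a"
   unfolding yz_def fib_def using fin by (subst sum.inter_filter[symmetric]) auto
  also have "(\<Sum>q\<in>A. if (X q, Y q) = (X a, Y a) then 1 else 0) = xy a"
   unfolding xy_def fib_def using fin by (subst sum.inter_filter[symmetric]) auto
  finally show "T a = (\<Sum>p\<in>A. \<Sum>q\<in>A. if (Y p, Z p) = (Y a, Z a) & (X q, Y q) = (X a, Y a)
   then 1 / (y a * xyz a) else 0)" by (simp add: T_def)
 qed
 also have "... = (\<Sum>p\<in>A. \<Sum>a\<in>A. \<Sum>q\<in>A.
   if (Y p, Z p) = (Y a, Z a) & (X q, Y q) = (X a, Y a) then 1 / (y a * xyz a) else 0)"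
  by (rule sum.swap)
 also have "... = (\<Sum>p\<in>A. \<Sum>q\<in>A. \<Sum>a\<in>A.
   if (Y p, Z p) = (Y a, Z a) & (X q, Y q) = (X a, Y a) then 1 / (y a * xyz a) else 0)"
  by (intro sum.cong refl sum.swap)
 \<comment> \<open>For fixed \<open>p\<close> and \<open>q\<close> the admissible \<open>a\<close>
   form a single fibre of \<open>(X, Y, Z)\<close> or none, so the inner sum is
   \<open>1 / y p\<close> or 0.\<close>
 also have "... <= (\<Sum>p\<in>A. \<Sum>q\<in>A. if Y q = Y p then 1 / y p else 0)"
 proof (intro sum_mono)
  fix p q assume p: "p \<in> A" and q: "q \<in> A"
  let ?S = "{a\<in>A. (Y p, Z p) = (Y a, Z a) & (X q, Y q) = (X a, Y a)}"
  have "(\<Sum>a\<in>A. if (Y p, Z p) = (Y a, Z a) & (X q, Y q) = (X a, Y a) then 1 / (y a * xyz a) else 0)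
   = (\<Sum>a\<in>?S. 1 / (y a * xyz a))"
   using fin by (subst sum.inter_filter[symmetric]) auto
  also have "... <= (if Y q = Y p then 1 / y p else 0)"
  proof (cases "?S = {}")
   case True
   thus ?thesis using pos(1)[OF p] by (simp only: True sum.empty) auto
  next
   case False
   then obtain a0 where a0: "a0 \<in> ?S" by auto
   have S: "?S = fib A (%t. (X t, Y t, Z t)) a0" using a0 by (auto simp: fib_def)
   have "(\<Sum>a\<in>?S. 1 / (y a * xyz a)) = (\<Sum>a\<in>?S. 1 / (y p * xyz a0))"
   proof (rule sum.cong[OF refl])
   fix a assume a: "a \<in> ?S"
   have "fib A Y a = fib A Y p" using a by (auto simp: fib_def)
   moreover have "fib A (%t. (X t, Y t, Z t)) a = fib A (%t. (X t, Y t, Z t)) a0"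
   using a a0 by (auto simp: fib_def)
   ultimately show "1 / (y a * xyz a) = 1 / (y p * xyz a0)"
   by (simp add: y_def xyz_def)
   qed
   also have "... = xyz a0 * (1 / (y p * xyz a0))"
   unfolding S by (simp add: xyz_def)
   also have "... = 1 / y p" using pos(4)[of a0] a0 by simp
   finally show ?thesis using a0 by auto
  qed
  finally show "(\<Sum>a\<in>A. if (Y p, Z p) = (Y a, Z a) & (X q, Y q) = (X a, Y a)
   then 1 / (y a * xyz a) else 0) <= (if Y q = Y p then 1 / y p else 0)" .
 qed
 also have "... = (\<Sum>p\<in>A. 1)"
 proof (rule sum.cong[OF refl])
  fix p assume p: "p \<in> A"
  have "(\<Sum>q\<in>A. if Y q = Y p then 1 / y p else 0) = (\<Sum>q\<in>fib A Y p. 1 / y p)"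
   unfolding fib_def using fin by (subst sum.inter_filter[symmetric]) auto
  also have "... = 1" using pos(1)[OF p] by (simp add: y_def)
  finally show "(\<Sum>q\<in>A. if Y q = Y p then 1 / y p else 0) = 1" .
 qed
 finally have sumT: "(\<Sum>a\<in>A. T a) <= rcard A" by simp
 have "log 2 (yz a / xyz a) - log 2 (y a / xy a) <= (T a - 1) / ln 2" if "a \<in> A" for a
 proof -
  have "log 2 (yz a / xyz a) - log 2 (y a / xy a) = log 2 (T a)"
   using pos[OF that] by (simp add: T_def log_divide log_mult)
  also have "... = ln (T a) / ln 2" by (simp add: log_def)
  also have "... <= (T a - 1) / ln 2"
   using ln_le_minus_one[of "T a"] pos[OF that] by (intro divide_right_mono) (auto simp: T_def)
  finally show ?thesis .
 qed
 hence "(\<Sum>a\<in>A. log 2 (yz a / xyz a) - log 2 (y a / xy a)) <= (\<Sum>a\<in>A. (T a - 1) / ln 2)"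
  by (rule sum_mono)
 also have "... = ((\<Sum>a\<in>A. T a) - rcard A) / ln 2"
  by (simp add: sum_divide_distrib[symmetric] sum_subtractf)
 also have "... <= 0" using sumT by (simp add: divide_nonpos_pos)
 finally have "(\<Sum>a\<in>A. log 2 (yz a / xyz a)) <= (\<Sum>a\<in>A. log 2 (y a / xy a))"
  by (simp add: sum_subtractf)
 thus ?thesis unfolding cent_def y_def yz_def xy_def xyz_def
  by (intro divide_right_mono) auto
qed

lemma cent_antimono:
 assumes "finite A" "refines A Y' Y"
 shows "cent A X Y' <= cent A X Y"
proof -
 have "cent A X Y' = cent A X (%t. (Y t, Y' t))"
  by (rule cent_cong; insert assms(2); unfold refines_def prod.inject; blast)
 thus ?thesis using cent_cond_pair_le[OF assms(1)] by simp
qed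

lemma cent_chain_refines:
 assumes "finite A" "refines A (%t. (X t, Y t)) Z"
 shows "cent A X Y = cent A Z Y + cent A X (%t. (Y t, Z t))"
proof -
 have "cent A X Y = cent A (%t. (X t, Z t)) Y"
  by (rule cent_cong; insert assms(2); unfold refines_def prod.inject; blast)
 thus ?thesis using cent_chain[OF assms(1)] by simp
qed

lemma cent_mono:
 assumes "finite A" "refines A X' X"
 shows "cent A X Y <= cent A X' Y"
proof -
 have "refines A (%t. (X' t, Y t)) X"
  using assms(2) unfolding refines_def prod.inject by blast
 thus ?thesis
  using cent_chain_refines[of A X' Y X] assms(1) cent_nonneg[OF assms(1), of X' "%t. (Y t, X t)"] by simp
qed

lemma cent_le_cond_add:
 assumes "finite A"
 shows "cent A X Y <= cent A X (%t. (Y t, Z t)) + cent A Z Y"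
 using cent_chain[OF assms, of X Z Y] cent_mono[OF assms refines_comp[of A "%t. (X t, Z t)" fst], of Y]
 by simp

lemma cent_triangle:
 assumes "finite A"
 shows "cent A X Y <= cent A X Z + cent A Z Y"
 using cent_le_cond_add[OF assms, of X Y Z]
  cent_antimono[OF assms refines_comp[of A "%t. (Y t, Z t)" snd], of X] by simp

text \<open>Data processing for the conditional mutual information of \<open>X\<close> and
  \<open>W\<close> given \<open>Y\<close>: a function of \<open>X\<close> learns no more about
  \<open>W\<close> than \<open>X\<close> does. It transfers an information bound from all digits of
  a sum to single yes/no tests.\<close>

lemma information_mono:
 assumes "finite A" "refines A X b"
 shows "cent A b Y - cent A b (%t. (Y t, W t)) <= cent A X Y - cent A X (%t. (Y t, W t))"
proof -
 have "cent A X Y = cent A b Y + cent A X (%t. (Y t, b t))"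
  by (rule cent_chain_refines[OF assms(1)]; insert assms(2); unfold refines_def prod.inject; blast)
 moreover have "cent A X (%t. (Y t, W t)) = cent A b (%t. (Y t, W t)) + cent A X (%t. ((Y t, W t), b t))"
  by (rule cent_chain_refines[OF assms(1)]; insert assms(2); unfold refines_def prod.inject; blast)
 moreover have "cent A X (%t. ((Y t, W t), b t)) <= cent A X (%t. (Y t, b t))"
  by (rule cent_antimono[OF assms(1)]; unfold refines_def prod.inject; blast)
 ultimately show ?thesis by simp
qed

text \<open>Gibbs' inequality against weights that are uniform on the values taken in each fibre of
  \<open>Y\<close>. The bound \<open>k\<close> may vary from point to point, which
  \<open>one_scale\<close> uses to charge exceptional points more.\<close>

lemma cent_le_log_values:
 assumes fin: "finite A" and k: "!!a. a \<in> A ==> rcard (X ` fib A Y a) <= k a"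
 shows "cent A X Y <= (\<Sum>a\<in>A. log 2 (k a)) / rcard A"
proof -
 define y where "y a = rcard (fib A Y a)" for a
 define xy where "xy a = rcard (fib A (%t. (X t, Y t)) a)" for a
 define v where "v a = rcard (X ` fib A Y a)" for a
 have pos: "0 < y a" "0 < xy a" if "a \<in> A" for a
  unfolding y_def xy_def using card_fib_pos[OF fin that] by auto
 have vpos: "0 < v a" if "a \<in> A" for a
  unfolding v_def using finite_fib[OF fin] self_in_fib[OF that, of Y] by (auto simp: card_gt_0_iff)
 have "(\<Sum>a\<in>A. y a / xy a / v a) = (\<Sum>a\<in>A. (\<Sum>t\<in>fib A Y a. y t / xy t / v t) / rcard (fib A Y a))"
  by (rule sum_fib_average[OF fin, symmetric])
 also have "... = (\<Sum>a\<in>A. 1)"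
 proof (rule sum.cong[OF refl])
  fix a assume a: "a \<in> A"
  have "(\<Sum>t\<in>fib A Y a. y t / xy t / v t) = (\<Sum>t\<in>fib A Y a. (y a / v a) * (1 / xy t))"
   by (rule sum.cong) (auto simp: y_def v_def fib_eq)
  also have "... = (y a / v a) * (\<Sum>t\<in>fib A Y a. 1 / xy t)" by (simp add: sum_distrib_left)
  also have "(\<Sum>t\<in>fib A Y a. 1 / xy t) = (\<Sum>x\<in>X ` fib A Y a. \<Sum>t\<in>{t\<in>fib A Y a. X t = x}. 1 / xy t)"
   by (rule sum.group[symmetric]) (auto simp: finite_fib[OF fin])
  also have "... = (\<Sum>x\<in>X ` fib A Y a. 1)"
  proof (rule sum.cong[OF refl])
   fix x assume "x \<in> X ` fib A Y a"
   then obtain t0 where t0: "t0 \<in> fib A Y a" "x = X t0" by auto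
   have S: "{t\<in>fib A Y a. X t = x} = fib A (%t. (X t, Y t)) t0"
   using t0 by (auto simp: fib_def)
   have "(\<Sum>t\<in>{t\<in>fib A Y a. X t = x}. 1 / xy t) = (\<Sum>t\<in>{t\<in>fib A Y a. X t = x}. 1 / xy t0)"
   unfolding S by (rule sum.cong) (auto simp: xy_def fib_eq)
   also have "... = 1" unfolding S using pos(2)[of t0] t0 fib_subset[of A Y a]
   by (auto simp: xy_def)
   finally show "(\<Sum>t\<in>{t\<in>fib A Y a. X t = x}. 1 / xy t) = 1" .
  qed
  also have "... = v a" by (simp add: v_def)
  finally show "(\<Sum>t\<in>fib A Y a. y t / xy t / v t) / rcard (fib A Y a) = 1"
   using pos[OF a] vpos[OF a] by (simp add: y_def)
 qed
 finally have S: "(\<Sum>a\<in>A. y a / xy a / v a) = rcard A" by simp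
 have "log 2 (y a / xy a) - log 2 (k a) <= (y a / xy a / v a - 1) / ln 2" if a: "a \<in> A" for a
 proof -
  have "log 2 (v a) <= log 2 (k a)" using k[OF a] vpos[OF a] by (simp add: v_def)
  hence "log 2 (y a / xy a) - log 2 (k a) <= log 2 (y a / xy a) - log 2 (v a)" by simp
  also have "... = ln (y a / xy a / v a) / ln 2"
   using pos[OF a] vpos[OF a] by (simp add: log_def ln_div ln_mult diff_divide_distrib add_divide_distrib)
  also have "... <= (y a / xy a / v a - 1) / ln 2"
   using ln_le_minus_one[of "y a / xy a / v a"] pos[OF a] vpos[OF a] by (intro divide_right_mono) auto
  finally show ?thesis .
 qed
 hence "(\<Sum>a\<in>A. log 2 (y a / xy a) - log 2 (k a)) <= (\<Sum>a\<in>A. (y a / xy a / v a - 1) / ln 2)"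
  by (rule sum_mono)
 also have "... = 0" using S by (simp add: sum_divide_distrib[symmetric] sum_subtractf)
 finally have "(\<Sum>a\<in>A. log 2 (y a / xy a)) <= (\<Sum>a\<in>A. log 2 (k a))" by (simp add: sum_subtractf)
 thus ?thesis unfolding cent_def y_def xy_def by (intro divide_right_mono) auto
qed

lemma cent_le_log_const:
 assumes "finite A" "!!a. a \<in> A ==> rcard (X ` fib A Y a) <= k" "1 <= k"
 shows "cent A X Y <= log 2 k"
proof (cases "A = {}")
 case True thus ?thesis using assms(3) by (simp add: cent_def)
next
 case False
 thus ?thesis using cent_le_log_values[of A X Y "%_. k"] assms(1,2) by (simp add: card_gt_0_iff)
qed

lemma card_fib_image:
 assumes "inj_on g A" "a \<in> A"
 shows "card (fib (g ` A) X (g a)) = card (fib A (%t. X (g t)) a)"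
proof -
 have "fib (g ` A) X (g a) = g ` fib A (%t. X (g t)) a" by (auto simp: fib_def)
 thus ?thesis using assms(1) by (simp add: card_image inj_on_subset[OF _ fib_subset])
qed

lemma cent_image:
 assumes "inj_on g A"
 shows "cent (g ` A) X Y = cent A (%t. X (g t)) (%t. Y (g t))"
 unfolding cent_def using assms by (simp add: sum.reindex card_image card_fib_image)

lemma ent_image: "inj_on g A ==> ent (g ` A) X = ent A (%t. X (g t))"
 by (simp add: ent_def cent_image)

lemma cent_Times_fst:
 assumes "finite A" "finite B"
 shows "cent (A \<times> B) X fst = (\<Sum>a\<in>A. ent B (%b. X (a, b))) / rcard A"
proof -
 have *: "ent (fib (A \<times> B) fst p) X = ent B (%b. X (fst p, b))" if "p \<in> A \<times> B" for p
 proof -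
  have "fib (A \<times> B) fst p = Pair (fst p) ` B" using that by (auto simp: fib_def)
  thus ?thesis by (simp add: ent_image inj_on_def)
 qed
 have "cent (A \<times> B) X fst = (\<Sum>p\<in>A \<times> B. ent B (%b. X (fst p, b))) / rcard (A \<times> B)"
  using cent_fibers_ent[of "A \<times> B" X fst] assms * by simp
 also have "(\<Sum>p\<in>A \<times> B. ent B (%b. X (fst p, b))) = (\<Sum>a\<in>A. \<Sum>b\<in>B. ent B (%b. X (a, b)))"
  unfolding sum.cartesian_product by (simp add: split_def)
 also have "... / rcard (A \<times> B) = (\<Sum>a\<in>A. ent B (%b. X (a, b))) / rcard A"
  by (cases "B = {}") (auto simp: card_cartesian_product sum_distrib_left[symmetric] card_gt_0_iff assms)
 finally show ?thesis .
qed

lemma cent_Times_fst_cond: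
 assumes "finite A" "finite B"
 shows "cent (A \<times> B) X (%p. (fst p, Y p)) = (\<Sum>a\<in>A. cent B (%b. X (a, b)) (%b. Y (a, b))) / rcard A"
proof -
 have *: "cent (fib (A \<times> B) fst p) X Y = cent B (%b. X (fst p, b)) (%b. Y (fst p, b))" if "p \<in> A \<times> B" for p
 proof -
  have "fib (A \<times> B) fst p = Pair (fst p) ` B" using that by (auto simp: fib_def)
  thus ?thesis by (simp add: cent_image inj_on_def)
 qed
 have "cent (A \<times> B) X (%p. (fst p, Y p)) = (\<Sum>p\<in>A \<times> B. cent B (%b. X (fst p, b)) (%b. Y (fst p, b))) / rcard (A \<times> B)"
  using cent_fibers[of "A \<times> B" X fst Y] assms * by simp
 also have "(\<Sum>p\<in>A \<times> B. cent B (%b. X (fst p, b)) (%b. Y (fst p, b))) = (\<Sum>a\<in>A. \<Sum>b\<in>B. cent B (%b. X (a, b)) (%b. Y (a, b)))"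
  unfolding sum.cartesian_product by (simp add: split_def)
 also have "... / rcard (A \<times> B) = (\<Sum>a\<in>A. cent B (%b. X (a, b)) (%b. Y (a, b))) / rcard A"
  by (cases "B = {}") (auto simp: card_cartesian_product sum_distrib_left[symmetric] card_gt_0_iff assms)
 finally show ?thesis .
qed

lemma cent_Times_snd_free:
 assumes "finite A" "finite B" "B ~= {}"
 shows "cent (A \<times> B) (%p. X (fst p)) (%p. Y (fst p)) = cent A X Y"
proof -
 have *: "card (fib (A \<times> B) (%p. Z (fst p)) q) = card (fib A Z (fst q)) * card B" for Z :: "'a => 'e" and q
 proof -
  have "fib (A \<times> B) (%p. Z (fst p)) q = fib A Z (fst q) \<times> B" by (auto simp: fib_def)
  thus ?thesis by (simp add: card_cartesian_product)
 qed
 have B: "rcard B ~= 0" using assms by auto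
 have "cent (A \<times> B) (%p. X (fst p)) (%p. Y (fst p)) =
   (\<Sum>p\<in>A \<times> B. log 2 (rcard (fib A Y (fst p)) / rcard (fib A (%t. (X t, Y t)) (fst p)))) / rcard (A \<times> B)"
  unfolding cent_def using B *[of Y] *[of "%t. (X t, Y t)"] by simp
 also have "(\<Sum>p\<in>A \<times> B. log 2 (rcard (fib A Y (fst p)) / rcard (fib A (%t. (X t, Y t)) (fst p))))
  = (\<Sum>a\<in>A. \<Sum>b\<in>B. log 2 (rcard (fib A Y a) / rcard (fib A (%t. (X t, Y t)) a)))"
  unfolding sum.cartesian_product by (simp add: split_def)
 finally show ?thesis unfolding cent_def using B
  by (simp add: card_cartesian_product sum_distrib_left[symmetric])
qed

lemma ent_ge_min_entropy:
 assumes fin: "finite A" and ne: "A ~= {}" and p: "0 < p"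
  and F: "!!a. a \<in> A ==> rcard (fib A X a) <= p * rcard A"
 shows "log 2 (1 / p) <= ent A X"
proof -
 have "log 2 (1 / p) <= log 2 (rcard (fib A (%_. ()) a) / rcard (fib A (%t. (X t, ())) a))"
  if a: "a \<in> A" for a
 proof -
  have 1: "fib A (%t. (X t, ())) a = fib A X a" by (auto simp: fib_def)
  have "1 / p <= rcard A / rcard (fib A X a)"
   using F[OF a] card_fib_pos[OF fin a, of X] p by (simp add: field_simps)
  thus ?thesis unfolding 1 fib_const using p by (intro log_mono) auto
 qed
 hence "(\<Sum>a\<in>A. log 2 (1 / p)) <= (\<Sum>a\<in>A. log 2 (rcard (fib A (%_. ()) a) / rcard (fib A (%t. (X t, ())) a)))"
  by (rule sum_mono)
 thus ?thesis unfolding ent_def cent_def using fin ne by (simp add: field_simps card_gt_0_iff)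
qed

section \<open>Entropy of discretised real functions\<close>

lemma card_floor_image_le:
 fixes F :: "'a => real"
 assumes "finite S" "!!a a'. a \<in> S ==> a' \<in> S ==> F a - F a' <= real M"
 shows "card ((%t. \<lfloor>F t\<rfloor>) ` S) <= M + 1"
proof (cases "S = {}")
 case False
 obtain a0 where a0: "a0 \<in> S" "!!a. a \<in> S ==> F a0 <= F a"
  using assms(1) False by (metis arg_min_if_finite(1) arg_min_if_finite(2) not_less)
 have "(%t. \<lfloor>F t\<rfloor>) ` S \<subseteq> {\<lfloor>F a0\<rfloor>..\<lfloor>F a0\<rfloor> + int M}"
 proof clarsimp
  fix t assume t: "t \<in> S"
  show "\<lfloor>F a0\<rfloor> <= \<lfloor>F t\<rfloor> & \<lfloor>F t\<rfloor> <= \<lfloor>F a0\<rfloor> + int M"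
   using floor_mono[OF a0(2)[OF t]] floor_mono[of "F t" "F a0 + real M"] assms(2)[OF t a0(1)] by simp
 qed
 from card_mono[OF _ this] show ?thesis by simp
qed auto

lemma cent_floor_le:
 fixes F :: "'a => real"
 assumes "finite A" "!!a a'. a \<in> A ==> a' \<in> A ==> Y a = Y a' ==> F a - F a' <= real M"
 shows "cent A (%t. \<lfloor>F t\<rfloor>) Y <= log 2 (real M + 1)"
proof (rule cent_le_log_const[OF assms(1)])
 fix a assume "a \<in> A"
 have "card ((%t. \<lfloor>F t\<rfloor>) ` fib A Y a) <= M + 1"
  using assms by (intro card_floor_image_le) (auto simp: fib_def)
 thus "rcard ((%t. \<lfloor>F t\<rfloor>) ` fib A Y a) <= real M + 1" by linarith
qed auto

lemma cent_floor_close: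
 fixes F F' :: "'a => real"
 assumes "finite A" "!!a. a \<in> A ==> \<bar>F a - F' a\<bar> <= real M"
 shows "cent A (%t. \<lfloor>F t\<rfloor>) (%t. \<lfloor>F' t\<rfloor>) <= log 2 (2 * real M + 2)"
proof -
 have "cent A (%t. \<lfloor>F t\<rfloor>) (%t. \<lfloor>F' t\<rfloor>) <= log 2 (real (2 * M + 1) + 1)"
 proof (rule cent_floor_le[OF assms(1)])
  fix a a' assume "a \<in> A" "a' \<in> A" "\<lfloor>F' a\<rfloor> = \<lfloor>F' a'\<rfloor>"
  hence "F' a - F' a' <= 1" by linarith
  thus "F a - F a' <= real (2 * M + 1)"
   using assms(2)[OF \<open>a \<in> A\<close>] assms(2)[OF \<open>a' \<in> A\<close>] by (simp add: abs_le_iff)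
 qed
 thus ?thesis by (simp add: add.commute)
qed

lemma cent_floor_num_close:
 fixes F F' :: "'a => real"
 assumes "finite A" "!!a. a \<in> A ==> \<bar>F a - F' a\<bar> <= real M"
 shows "cent A (%t. \<lfloor>F t\<rfloor>) Y <= cent A (%t. \<lfloor>F' t\<rfloor>) Y + log 2 (2 * real M + 2)"
 using cent_triangle[OF assms(1), of "%t. \<lfloor>F t\<rfloor>" Y "%t. \<lfloor>F' t\<rfloor>"] cent_floor_close[of A F F' M] assms by simp

lemma cent_floor_cond_close:
 fixes F F' :: "'a => real"
 assumes "finite A" "!!a. a \<in> A ==> \<bar>F a - F' a\<bar> <= real M"
 shows "cent A X (%t. \<lfloor>F t\<rfloor>) <= cent A X (%t. \<lfloor>F' t\<rfloor>) + log 2 (2 * real M + 2)"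
 using cent_triangle[OF assms(1), of X "%t. \<lfloor>F t\<rfloor>" "%t. \<lfloor>F' t\<rfloor>"]
  cent_floor_close[of A F' F M] assms by (simp add: abs_minus_commute)

lemma ent_floor_close:
 fixes F F' :: "'a => real"
 assumes "finite A" "!!a. a \<in> A ==> \<bar>F a - F' a\<bar> <= real M"
 shows "ent A (%t. \<lfloor>F t\<rfloor>) <= ent A (%t. \<lfloor>F' t\<rfloor>) + log 2 (2 * real M + 2)"
 unfolding ent_def by (rule cent_floor_num_close[OF assms])

text \<open>The integer part of the shift only relabels the cells, and the fractional part moves
  points by less than one cell; hence 2 bits suffice however large \<open>c\<close> is.\<close>

lemma ent_floor_translate:
 fixes F F' :: "'a => real"
 assumes "finite A" "!!a. a \<in> A ==> F' a = F a + c"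
 shows "ent A (%t. \<lfloor>F t\<rfloor>) <= ent A (%t. \<lfloor>F' t\<rfloor>) + 2"
proof -
 have "ent A (%t. \<lfloor>F t\<rfloor>) <= ent A (%t. \<lfloor>F t + frac c\<rfloor>) + log 2 (2 * real 1 + 2)"
  using assms(1) by (intro ent_floor_close) (auto simp: abs_le_iff frac_lt_1 less_imp_le order.trans[OF _ frac_ge_0])
 also have "ent A (%t. \<lfloor>F t + frac c\<rfloor>) = ent A (%t. \<lfloor>F' t\<rfloor>)"
  unfolding ent_def
 proof (rule cent_cong)
  fix a a' assume "a \<in> A" "a' \<in> A"
  have "\<lfloor>F' t\<rfloor> = \<lfloor>F t + frac c\<rfloor> + \<lfloor>c\<rfloor>" if "t \<in> A" for t
   unfolding assms(2)[OF that] frac_def by linarith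
  thus "\<lfloor>F a + frac c\<rfloor> = \<lfloor>F a' + frac c\<rfloor> \<longleftrightarrow> \<lfloor>F' a\<rfloor> = \<lfloor>F' a'\<rfloor>" using \<open>a \<in> A\<close> \<open>a' \<in> A\<close> by simp
 qed auto
 also have "log 2 (2 * real 1 + 2) = (2::real)"
  using log_nat_power[of 2 2 2] by simp
 finally show ?thesis .
qed

section \<open>Dyadic digits and windows of scales\<close>

definition dya :: "nat => real => int" where "dya s y = \<lfloor>2 ^ s * y\<rfloor>"

lemma dya_shift: "dya (s + k) y = dya k (2 ^ s * y)"
 by (simp add: dya_def power_add mult_ac)

lemma dya_div: "dya s y = dya (s + k) y div 2 ^ k"
proof -
 have "dya (s + k) y div 2 ^ k = \<lfloor>2 ^ (s + k) * y / real_of_int (2 ^ k)\<rfloor>"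
  unfolding dya_def by (rule floor_divide_real_eq_div[symmetric]) simp
 thus ?thesis by (simp add: dya_def power_add)
qed

lemma dya_eq_mono: "dya t y = dya t y' ==> s <= t ==> dya s y = dya s y'"
 using dya_div[of s y "t - s"] dya_div[of s y' "t - s"] by simp

text \<open>The chain rule over successive scales. The side variable \<open>W\<close> stays in the
  condition throughout, so one identity serves for \<open>W\<close> constant, \<open>W\<close> the
  word, and \<open>W\<close> the finest level of the sum.\<close>

lemma cent_telescope:
 fixes s n :: nat
 assumes "finite A" and R: "!!i j. i <= j ==> refines A (X j) (X i)"
 shows "cent A (X (s + n)) (%t. (X s t, W t)) = (\<Sum>i<n. cent A (X (s + i + 1)) (%t. (X (s + i) t, W t)))"
proof (induction n)
 case 0
 have "cent A (X s) (%t. (X s t, W t)) = cent A (%_. ()) (%t. (X s t, W t))"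
  by (rule cent_cong) auto
 also have "... <= log 2 1"
 proof (rule cent_le_log_const[OF assms(1)])
  fix a assume "a \<in> A"
  have "card ((%_. ()) ` fib A (%t. (X s t, W t)) a) <= card {()}" by (rule card_mono) auto
  thus "rcard ((%_. ()) ` fib A (%t. (X s t, W t)) a) <= 1" by simp
 qed auto
 finally show ?case using cent_nonneg[OF assms(1), of "X s" "%t. (X s t, W t)"] by simp
next
 case (Suc n)
 have "cent A (X (s + Suc n)) (%t. (X s t, W t)) = cent A (X (s + n)) (%t. (X s t, W t)) +
   cent A (X (s + Suc n)) (%t. ((X s t, W t), X (s + n) t))"
 proof (rule cent_chain_refines[OF assms(1)])
  have "refines A (X (s + Suc n)) (X (s + n))" by (rule R) simp
  thus "refines A (%t. (X (s + Suc n) t, X s t, W t)) (X (s + n))"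
   unfolding refines_def prod.inject by blast
 qed
 also have "cent A (X (s + Suc n)) (%t. ((X s t, W t), X (s + n) t)) =
   cent A (X (s + n + 1)) (%t. (X (s + n) t, W t))"
 proof -
  have r: "refines A (X (s + n)) (X s)" by (rule R) simp
  have "cent A (X (s + Suc n)) (%t. ((X s t, W t), X (s + n) t)) =
   cent A (X (s + Suc n)) (%t. (X (s + n) t, W t))"
   by (rule cent_cong; insert r; unfold refines_def prod.inject; blast)
  thus ?thesis by simp
 qed
 finally show ?case using Suc by simp
qed

text \<open>For each offset \<open>i\<close> the shifted indices \<open>s + i\<close> are distinct
  and below \<open>K\<close>, so each of the \<open>A\<close> offsets contributes at most the full
  sum.\<close>

lemma sum_windows_le:
 fixes a :: "nat => real"
 assumes "!!t. 0 <= a t" "A <= K"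
 shows "(\<Sum>s\<le>K - A. \<Sum>i<A. a (s + i)) <= real A * (\<Sum>t<K. a t)"
proof -
 have "(\<Sum>s\<le>K - A. \<Sum>i<A. a (s + i)) = (\<Sum>i<A. \<Sum>s\<le>K - A. a (s + i))" by (rule sum.swap)
 also have "... <= (\<Sum>i<A. \<Sum>t<K. a t)"
 proof (rule sum_mono)
  fix i assume "i \<in> {..<A}"
  have "(\<Sum>s\<le>K - A. a (s + i)) = (\<Sum>t\<in>(%s. s + i) ` {..K - A}. a t)"
   by (subst sum.reindex) (auto simp: inj_on_def)
  also have "... <= (\<Sum>t<K. a t)"
   using \<open>i \<in> {..<A}\<close> assms by (intro sum_mono2) auto
  finally show "(\<Sum>s\<le>K - A. a (s + i)) <= (\<Sum>t<K. a t)" .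
 qed
 finally show ?thesis by simp
qed

text \<open>For each offset \<open>i\<close> the windows miss at most \<open>A\<close> of the
  \<open>K\<close> scales, and each missed term is at most 1.\<close>

lemma sum_windows_ge:
 fixes a :: "nat => real"
 assumes "!!t. 0 <= a t" "!!t. a t <= 1" "A <= K" "A' <= A"
 shows "real (A - A') * ((\<Sum>t<K. a t) - real A) <= (\<Sum>s\<le>K - A. \<Sum>i=A'..<A. a (s + i))"
proof -
 have "real (A - A') * ((\<Sum>t<K. a t) - real A) = (\<Sum>i=A'..<A. (\<Sum>t<K. a t) - real A)" by simp
 also have "... <= (\<Sum>i=A'..<A. \<Sum>s\<le>K - A. a (s + i))"
 proof (rule sum_mono)
  fix i assume i: "i \<in> {A'..<A}"
  let ?I = "(%s. s + i) ` {..K - A}"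
  have sub: "?I \<subseteq> {..<K}" using i assms(3) by auto
  have "(\<Sum>t<K. a t) = (\<Sum>t\<in>?I. a t) + (\<Sum>t\<in>{..<K} - ?I. a t)"
   using sum.subset_diff[OF sub, of a] by simp
  also have "(\<Sum>t\<in>{..<K} - ?I. a t) <= rcard ({..<K} - ?I) * 1"
   using assms(2) by (intro sum_bounded_above) auto
  also have "card ({..<K} - ?I) = K - (K - A + 1)"
   using sub by (subst card_Diff_subset) (auto simp: card_image inj_on_def)
  also have "real (K - (K - A + 1)) * 1 <= real A" by simp
  also have "(\<Sum>t\<in>?I. a t) = (\<Sum>s\<le>K - A. a (s + i))"
   by (subst sum.reindex) (auto simp: inj_on_def)
  finally show "(\<Sum>t<K. a t) - real A <= (\<Sum>s\<le>K - A. a (s + i))" by simp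
 qed
 also have "... = (\<Sum>s\<le>K - A. \<Sum>i=A'..<A. a (s + i))" by (rule sum.swap)
 finally show ?thesis .
qed

text \<open>The conditional probability of the event \<open>b\<close> given the value of
  \<open>Y\<close> at \<open>a\<close>.\<close>

definition cfrac :: "'a set => ('a => 'b) => 'a => ('a => bool) => real" where
 "cfrac A Y a b = rcard {t \<in> fib A Y a. b t} / rcard (fib A Y a)"

lemma cfrac_bounds: assumes "finite A" shows "0 <= cfrac A Y a b" "cfrac A Y a b <= 1"
proof -
 have "card {t \<in> fib A Y a. b t} <= card (fib A Y a)"
  by (rule card_mono) (auto simp: finite_fib[OF assms])
 thus "cfrac A Y a b <= 1" unfolding cfrac_def by (auto simp: divide_le_eq)
qed (auto simp: cfrac_def)

lemma sum_cfrac: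
 assumes "finite A"
 shows "(\<Sum>a\<in>A. cfrac A Y a b) = rcard {a \<in> A. b a}"
proof -
 have "cfrac A Y a b = (\<Sum>t\<in>fib A Y a. if b t then 1 else 0) / rcard (fib A Y a)" for a
  unfolding cfrac_def using finite_fib[OF assms, of Y a] by (simp add: sum.inter_filter[symmetric])
 hence "(\<Sum>a\<in>A. cfrac A Y a b) = (\<Sum>a\<in>A. if b a then 1 else 0)"
  using sum_fib_average[OF assms, where Y=Y and g="%t. if b t then 1 else 0"] by simp
 thus ?thesis using assms by (simp add: sum.inter_filter[symmetric])
qed

text \<open>The right side is the unnormalised squared Hellinger distance of two laws on two points.
  The factorisation \<open>u - v = (sqrt u - sqrt v) * (sqrt u + sqrt v)\<close>, with second factor
  at most 2, compares it with the difference of the probabilities.\<close>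

lemma hellinger_bound:
 fixes p q :: real
 assumes "0 <= p" "p <= 1" "0 <= q" "q <= 1"
 shows "(p - q)\<^sup>2 / 2 <= 2 * (1 - sqrt (p * q) - sqrt ((1 - p) * (1 - q)))"
proof -
 have *: "(u - v)\<^sup>2 / 4 <= u + v - 2 * sqrt (u * v)" if "0 <= u" "u <= 1" "0 <= v" "v <= 1" for u v :: real
 proof -
  have "u - v = (sqrt u - sqrt v) * (sqrt u + sqrt v)" using that by (simp add: algebra_simps)
  hence "(u - v)\<^sup>2 = (sqrt u - sqrt v)\<^sup>2 * (sqrt u + sqrt v)\<^sup>2" by (simp add: power_mult_distrib)
  also have "... <= (sqrt u - sqrt v)\<^sup>2 * 2\<^sup>2"
  proof (intro mult_left_mono power_mono)
   have "sqrt u <= 1" "sqrt v <= 1" using that by auto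
   thus "sqrt u + sqrt v <= 2" by linarith
  qed (use that in auto)
  also have "(sqrt u - sqrt v)\<^sup>2 = u + v - 2 * sqrt (u * v)"
   using that by (simp add: power2_diff real_sqrt_mult)
  finally show ?thesis by simp
 qed
 have "(1 - p - (1 - q))\<^sup>2 = (p - q)\<^sup>2" by (simp add: power2_eq_square algebra_simps)
 thus ?thesis using *[of p q] *[of "1 - p" "1 - q"] assms by simp
qed

text \<open>A Pinsker inequality for one event: refining \<open>Y\<close> to \<open>Z\<close>
  changes the probability of \<open>b\<close> only as far as the information gained permits. The
  likelihood ratio \<open>r\<close> satisfies \<open>- ln r >= 2 * (1 - sqrt r)\<close>, and the
  average of \<open>sqrt r\<close> over a fibre of \<open>Z\<close> is the Bhattacharyya coefficient
  that occurs in \<open>hellinger_bound\<close>.\<close>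

lemma information_bool_ge:
 assumes fin: "finite A" and ref: "refines A Z Y"
 shows "(\<Sum>a\<in>A. (cfrac A Z a b - cfrac A Y a b)\<^sup>2) / (2 * rcard A) <= cent A b Y - cent A b Z"
proof -
 define zz where "zz a = rcard (fib A Z a)" for a
 define yy where "yy a = rcard (fib A Y a)" for a
 define bz where "bz a = rcard (fib A (%t. (b t, Z t)) a)" for a
 define bY where "bY a = rcard (fib A (%t. (b t, Y t)) a)" for a
 have pos: "0 < zz a" "0 < yy a" "0 < bz a" "0 < bY a" if "a \<in> A" for a
  unfolding zz_def yy_def bz_def bY_def using card_fib_pos[OF fin that] by auto
 define r where "r a = (bY a / yy a) / (bz a / zz a)" for a
 have rpos: "0 < r a" if "a \<in> A" for a using pos[OF that] by (simp add: r_def)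
 have split: "rcard (fib A (%t. (b t, W t)) a) / rcard (fib A W a) =
   (if b a then cfrac A W a b else 1 - cfrac A W a b)" if a: "a \<in> A" for a and W :: "'a => 'e"
 proof (cases "b a")
  case True
  have "fib A (%t. (b t, W t)) a = {t \<in> fib A W a. b t}" using True by (auto simp: fib_def)
  thus ?thesis using True by (simp add: cfrac_def)
 next
  case False
  have "fib A (%t. (b t, W t)) a = fib A W a - {t \<in> fib A W a. b t}" using False by (auto simp: fib_def)
  hence "card (fib A (%t. (b t, W t)) a) = card (fib A W a) - card {t \<in> fib A W a. b t}"
   using finite_fib[OF fin, of W a] by (simp add: card_Diff_subset)
  moreover have "card {t \<in> fib A W a. b t} <= card (fib A W a)"
   by (rule card_mono) (auto simp: finite_fib[OF fin])
  ultimately show ?thesis using False card_fib_pos[OF fin a, of W]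
   by (simp add: cfrac_def of_nat_diff field_simps)
 qed
 have fibavg: "(\<Sum>t\<in>fib A Z a. sqrt (r t)) / zz a =
   sqrt (cfrac A Z a b * cfrac A Y a b) + sqrt ((1 - cfrac A Z a b) * (1 - cfrac A Y a b))"
  if a: "a \<in> A" for a
 proof -
  define p where "p = cfrac A Z a b"
  define q where "q = cfrac A Y a b"
  have pq: "0 <= p" "p <= 1" "0 <= q" "q <= 1" unfolding p_def q_def using cfrac_bounds[OF fin] by auto
  have rt: "r t = (if b t then q / p else (1 - q) / (1 - p))" if t: "t \<in> fib A Z a" for t
  proof -
   have tA: "t \<in> A" using t by (auto simp: fib_def)
   have "Y t = Y a" using t ref a tA unfolding fib_def refines_def by blast
   hence "fib A Z t = fib A Z a" "fib A Y t = fib A Y a"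
   using fib_eq[OF t] by (auto simp: fib_def)
   hence "cfrac A Z t b = p" "cfrac A Y t b = q" unfolding cfrac_def p_def q_def by auto
   thus ?thesis unfolding r_def bY_def yy_def bz_def zz_def using split[OF tA, of Y] split[OF tA, of Z] by simp
  qed
  have c1: "rcard {t \<in> fib A Z a. b t} = p * zz a"
   using pos[OF a] by (simp add: p_def cfrac_def zz_def)
  have c2: "rcard {t \<in> fib A Z a. ~ b t} = (1 - p) * zz a"
  proof -
   have "{t \<in> fib A Z a. ~ b t} = fib A Z a - {t \<in> fib A Z a. b t}" by auto
   hence "card {t \<in> fib A Z a. ~ b t} = card (fib A Z a) - card {t \<in> fib A Z a. b t}"
   using finite_fib[OF fin, of Z a] by (simp add: card_Diff_subset)
   moreover have "card {t \<in> fib A Z a. b t} <= card (fib A Z a)"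
   by (rule card_mono) (auto simp: finite_fib[OF fin])
   ultimately show ?thesis using c1 by (simp add: of_nat_diff zz_def left_diff_distrib)
  qed
  have "(\<Sum>t\<in>fib A Z a. sqrt (r t)) = (\<Sum>t\<in>fib A Z a. if b t then sqrt (q / p) else sqrt ((1 - q) / (1 - p)))"
   by (rule sum.cong) (auto simp: rt)
  also have "... = (\<Sum>t\<in>fib A Z a \<inter> {t. b t}. sqrt (q / p)) + (\<Sum>t\<in>fib A Z a \<inter> - {t. b t}. sqrt ((1 - q) / (1 - p)))"
   by (rule sum.If_cases[OF finite_fib[OF fin]])
  also have "fib A Z a \<inter> {t. b t} = {t \<in> fib A Z a. b t}" by auto
  also have "fib A Z a \<inter> - {t. b t} = {t \<in> fib A Z a. ~ b t}" by auto
  finally have sumr: "(\<Sum>t\<in>fib A Z a. sqrt (r t)) = p * zz a * sqrt (q / p) + (1 - p) * zz a * sqrt ((1 - q) / (1 - p))"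
   using c1 c2 by simp
  have rt2: "u * sqrt (v / u) = sqrt (u * v)" if "0 <= u" "0 <= v" for u v :: real
  proof (cases "u = 0")
   case False
   have "u * sqrt (v / u) = sqrt (u\<^sup>2) * sqrt (v / u)" using that by simp
   also have "... = sqrt (u\<^sup>2 * (v / u))" by (rule real_sqrt_mult[symmetric])
   also have "u\<^sup>2 * (v / u) = u * v" using False by (simp add: power2_eq_square)
   finally show ?thesis .
  qed simp
  have "(\<Sum>t\<in>fib A Z a. sqrt (r t)) = zz a * (p * sqrt (q / p)) + zz a * ((1 - p) * sqrt ((1 - q) / (1 - p)))"
   using sumr by (simp add: mult_ac)
  also have "p * sqrt (q / p) = sqrt (p * q)" using pq by (intro rt2) auto
  also have "(1 - p) * sqrt ((1 - q) / (1 - p)) = sqrt ((1 - p) * (1 - q))" using pq by (intro rt2) auto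
  finally have "(\<Sum>t\<in>fib A Z a. sqrt (r t)) = zz a * (sqrt (p * q) + sqrt ((1 - p) * (1 - q)))"
   by (simp add: distrib_left)
  thus ?thesis using pos(1)[OF a] by (simp add: p_def q_def)
 qed
 have "(\<Sum>a\<in>A. (cfrac A Z a b - cfrac A Y a b)\<^sup>2 / 2)
   <= (\<Sum>a\<in>A. 2 * (1 - (\<Sum>t\<in>fib A Z a. sqrt (r t)) / zz a))"
 proof (rule sum_mono)
  fix a assume a: "a \<in> A"
  show "(cfrac A Z a b - cfrac A Y a b)\<^sup>2 / 2 <= 2 * (1 - (\<Sum>t\<in>fib A Z a. sqrt (r t)) / zz a)"
   unfolding fibavg[OF a]
   using hellinger_bound[OF cfrac_bounds[OF fin, of Z a b] cfrac_bounds[OF fin, of Y a b]]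
   by (simp only: diff_diff_eq)
 qed
 also have "... = 2 * (rcard A - (\<Sum>a\<in>A. (\<Sum>t\<in>fib A Z a. sqrt (r t)) / zz a))"
  by (simp only: sum_distrib_left[symmetric] sum_subtractf) simp
 also have "(\<Sum>a\<in>A. (\<Sum>t\<in>fib A Z a. sqrt (r t)) / zz a) = (\<Sum>a\<in>A. sqrt (r a))"
  unfolding zz_def by (rule sum_fib_average[OF fin])
 also have "2 * (rcard A - (\<Sum>a\<in>A. sqrt (r a))) = (\<Sum>a\<in>A. 2 * (1 - sqrt (r a)))"
  by (simp only: sum_distrib_left[symmetric] sum_subtractf) simp
 also have "... <= (\<Sum>a\<in>A. ln 2 * (log 2 (yy a / bY a) - log 2 (zz a / bz a)))"
 proof (rule sum_mono)
  fix a assume a: "a \<in> A"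
  have "log 2 (yy a / bY a) - log 2 (zz a / bz a) = - log 2 (r a)"
   using pos[OF a] by (simp add: r_def log_divide log_mult)
  hence "ln 2 * (log 2 (yy a / bY a) - log 2 (zz a / bz a)) = - ln (r a)" by (simp add: log_def)
  moreover have "ln (r a) = 2 * ln (sqrt (r a))" using rpos[OF a] by (simp add: ln_sqrt)
  moreover have "ln (sqrt (r a)) <= sqrt (r a) - 1" using ln_le_minus_one[of "sqrt (r a)"] rpos[OF a] by simp
  ultimately show "2 * (1 - sqrt (r a)) <= ln 2 * (log 2 (yy a / bY a) - log 2 (zz a / bz a))" by simp
 qed
 also have "... = ln 2 * ((\<Sum>a\<in>A. log 2 (yy a / bY a)) - (\<Sum>a\<in>A. log 2 (zz a / bz a)))"
  by (simp only: sum_distrib_left[symmetric] sum_subtractf)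
 also have "(\<Sum>a\<in>A. log 2 (yy a / bY a)) = rcard A * cent A b Y"
  unfolding cent_def yy_def bY_def by (cases "A = {}") (auto simp: fin)
 also have "(\<Sum>a\<in>A. log 2 (zz a / bz a)) = rcard A * cent A b Z"
  unfolding cent_def zz_def bz_def by (cases "A = {}") (auto simp: fin)
 also have "rcard A * cent A b Y - rcard A * cent A b Z = rcard A * (cent A b Y - cent A b Z)"
  by (simp add: right_diff_distrib)
 finally have le: "(\<Sum>a\<in>A. (cfrac A Z a b - cfrac A Y a b)\<^sup>2 / 2) <= ln 2 * (rcard A * (cent A b Y - cent A b Z))" .
 have "0 <= (\<Sum>a\<in>A. (cfrac A Z a b - cfrac A Y a b)\<^sup>2 / 2)" by (intro sum_nonneg) auto
 hence "0 <= ln 2 * (rcard A * (cent A b Y - cent A b Z))" using le by linarith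
 hence "0 <= rcard A * (cent A b Y - cent A b Z)" by (simp add: zero_le_mult_iff)
 hence "ln 2 * (rcard A * (cent A b Y - cent A b Z)) <= 1 * (rcard A * (cent A b Y - cent A b Z))"
  using ln_2_less_1 by (intro mult_right_mono) auto
 hence fin_le: "(\<Sum>a\<in>A. (cfrac A Z a b - cfrac A Y a b)\<^sup>2) / 2 <= rcard A * (cent A b Y - cent A b Z)"
  using le by (simp add: sum_divide_distrib)
 show ?thesis
 proof (cases "A = {}")
  case False
  hence "0 < rcard A" using fin by (simp add: card_gt_0_iff)
  thus ?thesis using fin_le by (simp add: field_simps)
 qed simp
qed

section \<open>Translation and concentration at one scale\<close>

lemma div_pow2_bounds:
 assumes "(v::int) div 2 ^ n = e"
 shows "2 ^ n * e <= v" "v < 2 ^ n * e + 2 ^ n"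
proof -
 have "2 ^ n * e + v mod 2 ^ n = v" unfolding assms[symmetric] by (rule mult_div_mod_eq)
 moreover have "0 <= v mod 2 ^ n" "v mod 2 ^ n < 2 ^ n" by simp_all
 ultimately show "2 ^ n * e <= v" "v < 2 ^ n * e + 2 ^ n" by linarith+
qed

text \<open>The part of a unit cell that a translation by \<open>1 / 2 ^ a\<close> may push out of
  the cell.\<close>

definition near :: "nat => real => bool" where
 "near a y \<longleftrightarrow> frac y < 1 / 2 ^ a | 1 - 1 / 2 ^ a <= frac y"

text \<open>If the laws of \<open>f w + z\<close> and \<open>f w' + z\<close> in the unit cell \<open>c\<close> almost agree on initial segments,
 then sliding the second onto the first bounds the mass of every subcell by the discrepancy.\<close>
lemma shifted_cells_spread:
 fixes z :: "'b => real" and y y' dl :: real and Om :: "'b set" and A A' :: nat and c :: int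
 defines "J == %y c. {j \<in> Om. \<lfloor>y + z j\<rfloor> = (c::int)}"
 defines "u == %y k c. rcard {j \<in> J y c. \<lfloor>2 ^ A * (y + z j)\<rfloor> < 2 ^ A * c + k} / rcard (J y c)"
 defines "bd == %y c. rcard {j \<in> J y c. near A' (y + z j)} / rcard (J y c)"
 assumes fin: "finite Om" and d: "1 / 2 ^ A <= y' - y" "y' - y <= 1 / 2 ^ A'"
  and dl: "0 < dl"
  and t: "t \<in> J y c" and ne': "J y' c ~= {}"
  and u: "!!k. 0 <= k ==> k <= 2 ^ A ==> u y k c <= u y' k c + 2 * dl"
  and bd: "bd y c <= dl" "bd y' c <= dl"
 shows "rcard {j \<in> J y c. \<lfloor>2 ^ A * (y + z j)\<rfloor> = \<lfloor>2 ^ A * (y + z t)\<rfloor>} <= 4 * dl * rcard (J y c)"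
proof -
 define m where "m = \<lfloor>2 ^ A * (y + z t)\<rfloor> - 2 ^ A * c"
 define n where "n = rcard (J y c)"
 define n' where "n' = rcard (J y' c)"
 have finJ: "finite (J y0 c)" for y0 unfolding J_def using fin by auto
 have npos: "0 < n" unfolding n_def using t finJ[of y] by (auto simp: card_gt_0_iff)
 have n'pos: "0 < n'" unfolding n'_def using ne' finJ[of y'] by (auto simp: card_gt_0_iff)
 have div: "\<lfloor>2 ^ A * r\<rfloor> div 2 ^ A = \<lfloor>r\<rfloor>" for r :: real
  using dya_div[of 0 r A] by (simp add: dya_def)
 have cell: "\<lfloor>2 ^ A * (y + z t)\<rfloor> div 2 ^ A = c" using div[of "y + z t"] t by (simp add: J_def)
 have m: "0 <= m" "m < 2 ^ A"
  using div_pow2_bounds[OF cell] unfolding m_def by linarith+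
 define k where "k = m + 1"
 have k: "0 <= k" "k <= 2 ^ A" using m by (auto simp: k_def)
 define F where "F = {j \<in> J y c. \<lfloor>2 ^ A * (y + z j)\<rfloor> = \<lfloor>2 ^ A * (y + z t)\<rfloor>}"
 define L where "L = {j \<in> J y c. \<lfloor>2 ^ A * (y + z j)\<rfloor> < 2 ^ A * c + k}"
 define L' where "L' = {j \<in> J y' c. \<lfloor>2 ^ A * (y' + z j)\<rfloor> < 2 ^ A * c + k}"
 define N where "N = {j \<in> J y c. near A' (y + z j)}"
 define N' where "N' = {j \<in> J y' c. near A' (y' + z j)}"
 have fins: "finite F" "finite L" "finite L'" "finite N" "finite N'"
  unfolding F_def L_def L'_def N_def N'_def using finJ by auto
 have FL: "F \<subseteq> L" unfolding F_def L_def k_def m_def by auto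
 have cL: "rcard L = u y k c * n" unfolding L_def u_def n_def using npos by (simp add: n_def)
 have cL': "rcard L' = u y' k c * n'" unfolding L'_def u_def n'_def using n'pos by (simp add: n'_def)
 have cN: "rcard N <= dl * n" using bd(1) npos unfolding N_def bd_def n_def by (simp add: field_simps)
 have cN': "rcard N' <= dl * n'" using bd(2) n'pos unfolding N'_def bd_def n'_def by (simp add: field_simps)
 have p2: "(0::real) < 2 ^ A" "(0::real) < 2 ^ A'" by auto
 \<comment> \<open>Going from \<open>y'\<close> back to \<open>y\<close> lowers every point by at
   least one subcell. A point at or below the subcell of \<open>t\<close> for \<open>y'\<close> is
   therefore strictly below it for \<open>y\<close>, unless it leaves through the lower end of the
   cell, and then it lies in \<open>N'\<close>.\<close>
 have "L' \<subseteq> (L - F) \<union> N'"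
 proof
  fix j assume j: "j \<in> L'"
  hence jO: "j \<in> Om" and fl: "\<lfloor>y' + z j\<rfloor> = c" and lt: "\<lfloor>2 ^ A * (y' + z j)\<rfloor> < 2 ^ A * c + k"
   by (auto simp: L'_def J_def)
  have "2 ^ A * (y' + z j) < real_of_int (2 ^ A * c + k)" using lt by (simp only: floor_less_iff)
  moreover have "2 ^ A * (y' - y) >= 1" using d(1) by (simp add: field_simps)
  ultimately have l2: "2 ^ A * (y + z j) < real_of_int (2 ^ A * c + m)"
   by (simp add: k_def algebra_simps)
  show "j \<in> (L - F) \<union> N'"
  proof (cases "c <= y + z j")
   case True
   have "y + z j < c + 1" using fl d(1) p2 by (smt (verit) divide_pos_pos floor_correct)
   hence fy: "\<lfloor>y + z j\<rfloor> = c" using True by (simp add: floor_eq_iff)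
   have "\<lfloor>2 ^ A * (y + z j)\<rfloor> < 2 ^ A * c + m" using l2 by (simp only: floor_less_iff)
   thus ?thesis using jO fy by (auto simp: L_def F_def J_def k_def m_def)
  next
   case False
   have "frac (y' + z j) = y' + z j - c" using fl by (simp add: frac_def)
   also have "... < 1 / 2 ^ A'" using False d(2) by linarith
   finally show ?thesis using jO fl by (auto simp: N'_def J_def near_def)
  qed
 qed
 hence "card L' <= card ((L - F) \<union> N')" using fins by (intro card_mono) auto
 also have "... <= card (L - F) + card N'" by (rule card_Un_le)
 also have "card (L - F) = card L - card F" using FL fins by (simp add: card_Diff_subset)
 finally have "rcard L' <= rcard L - rcard F + rcard N'"
  using card_mono[OF fins(2) FL] by linarith
 hence cF: "rcard F <= u y k c * n - u y' k c * n' + dl * n'"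
  using cL cL' cN' by linarith
 have cFL: "rcard F <= u y k c * n" using card_mono[OF fins(2) FL] cL by linarith
 \<comment> \<open>The fractions for \<open>y\<close> and \<open>y'\<close> have different
   denominators. This bounds the mass lost through the upper end of the cell and yields
   \<open>n' >= (1 - dl) * n\<close>.\<close>
 have "J y c \<subseteq> J y' c \<union> N"
 proof
  fix j assume j: "j \<in> J y c"
  hence jO: "j \<in> Om" and fl: "\<lfloor>y + z j\<rfloor> = c" by (auto simp: J_def)
  show "j \<in> J y' c \<union> N"
  proof (cases "y' + z j < c + 1")
   case True
   have "c <= y' + z j" using fl d(1) p2 by (smt (verit) divide_pos_pos floor_correct)
   hence "\<lfloor>y' + z j\<rfloor> = c" using True by (simp add: floor_eq_iff)
   thus ?thesis using jO by (auto simp: J_def)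
  next
   case False
   have "frac (y + z j) = y + z j - c" using fl by (simp add: frac_def)
   also have "... >= 1 - 1 / 2 ^ A'" using False d(2) by linarith
   finally show ?thesis using j by (auto simp: N_def near_def)
  qed
 qed
 hence "card (J y c) <= card (J y' c \<union> N)" using fins finJ by (intro card_mono) auto
 also have "... <= card (J y' c) + card N" by (rule card_Un_le)
 finally have "n <= n' + rcard N" unfolding n_def n'_def by linarith
 hence nn': "(1 - dl) * n <= n'" using cN by (simp add: algebra_simps)
 have u1: "u y' k c <= 1" "0 <= u y' k c"
 proof -
  have "card L' <= card (J y' c)" unfolding L'_def using finJ by (intro card_mono) auto
  hence "u y' k c * n' <= n'" using cL' unfolding n'_def by linarith
  thus "u y' k c <= 1" using n'pos by simp
 qed (simp add: u_def)
 have uu: "u y k c <= u y' k c + 2 * dl" using u[OF k] .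
 \<comment> \<open>The inequality \<open>(1 - dl) * n <= n'\<close> is to be multiplied by
   \<open>u y' k c - dl\<close>, so this factor must be nonnegative. Otherwise \<open>L\<close>,
   which contains \<open>F\<close>, has at most the fraction \<open>3 * dl\<close> of the
   mass.\<close>
 have "rcard F <= 4 * dl * n"
 proof (cases "u y' k c < dl")
  case True
  have "rcard F <= (3 * dl) * n"
   using cFL uu True npos by (smt (verit) mult_right_mono)
  also have "... <= 4 * dl * n" using npos dl by simp
  finally show ?thesis .
 next
  case False
  have "(u y' k c - dl) * ((1 - dl) * n) <= (u y' k c - dl) * n'"
   using nn' False by (intro mult_left_mono) auto
  moreover have "u y k c * n <= (u y' k c + 2 * dl) * n" using uu npos by (intro mult_right_mono) auto
  ultimately have "rcard F <= (u y' k c + 2 * dl) * n - (u y' k c - dl) * ((1 - dl) * n)"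
   using cF by (simp add: algebra_simps)
  also have "... = (3 * dl + dl * u y' k c - dl * dl) * n" by (simp add: algebra_simps)
  also have "... <= (4 * dl) * n"
  proof (intro mult_right_mono)
   have "dl * u y' k c <= dl * 1" using u1 dl by (intro mult_left_mono) auto
   moreover have "0 <= dl * dl" by simp
   ultimately show "3 * dl + dl * u y' k c - dl * dl <= 4 * dl" by linarith
  qed (use npos in simp)
  finally show ?thesis .
 qed
 thus ?thesis by (simp add: F_def n_def)
qed

lemma fib_Times_fst:
 assumes "p \<in> Om1 \<times> Om2"
 shows "fib (Om1 \<times> Om2) (%q. (c q, fst q)) p = Pair (fst p) ` {j \<in> Om2. c (fst p, j) = c p}"
 using assms by (auto simp: fib_def)

lemma card_Pair_filter:
 "card {q \<in> Pair w ` S. P q} = card {j \<in> S. P (w, j)}"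
proof -
 have "{q \<in> Pair w ` S. P q} = Pair w ` {j \<in> S. P (w, j)}" by auto
 thus ?thesis by (simp add: card_image inj_on_def)
qed

text \<open>Three kinds of points are exceptional: those where knowing the word visibly changes the
  law inside the cell (\<open>irreg\<close>, few by Pinsker), those whose cell has much mass near
  its boundary (\<open>bdy\<close>, few by Markov), and those whose cell is almost saturated
  (\<open>bad\<close>). Two other points with the same \<open>E\<close> have values of
  \<open>f\<close> less than \<open>1 / 2 ^ A\<close> apart by \<open>shifted_cells_spread\<close>,
  so there \<open>f\<close> takes at most two values at scale \<open>A\<close>. The factor
  \<open>2 ^ (A + 1)\<close> is twice the number of initial segments that are tested.\<close>

lemma one_scale:
 fixes f :: "'a => real" and z :: "'b => real" and A A' :: nat
  and Om1 :: "'a set" and Om2 :: "'b set" and dl :: real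
 defines "Y == %p. f (fst p) + z (snd p)"
 defines "V == %p. (\<lfloor>Y p\<rfloor>, fst p)"
 defines "E == %p. (dya A' (f (fst p)), \<lfloor>Y p\<rfloor>)"
 assumes fin: "finite Om1" "finite Om2" and ne: "Om1 ~= {}" "Om2 ~= {}" and A: "A' < A" and dl: "0 < dl"
 defines "Om == Om1 \<times> Om2"
 defines "Bad == {p \<in> Om. log 2 (1 / (4 * dl)) <= ent (fib Om V p) (%q. dya A (Y q))}"
 shows "cent Om (%p. dya A (f (fst p))) E <= 2 + real (A - A') *
  (2 ^ (A + 1) * (cent Om (%p. dya A (Y p)) E - cent Om (%p. dya A (Y p)) V) / dl\<^sup>2 +
  rcard {p \<in> Om. near A' (Y p)} / rcard Om / dl + rcard Bad / rcard Om)"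
proof -
 have finO: "finite Om" unfolding Om_def using fin by auto
 have cardO: "0 < rcard Om" unfolding Om_def using fin ne by (auto simp: card_gt_0_iff)
 have VE: "refines Om V E" unfolding refines_def V_def E_def by simp
 \<comment> \<open>\<open>b k\<close> tests whether the sum lies in the first \<open>k\<close>
   subcells of its cell. Every such test is a function of \<open>dya A (Y p)\<close>.\<close>
 define b where "b k = (%p. \<lfloor>2 ^ A * Y p\<rfloor> < 2 ^ A * \<lfloor>Y p\<rfloor> + k)" for k :: int
 define g where "g = cent Om (%p. dya A (Y p)) E - cent Om (%p. dya A (Y p)) V"
 \<comment> \<open>The tests run over \<open>k + 1\<close> since \<open>b 0\<close> is the empty
   event; \<open>k = 0\<close> is settled separately when \<open>ureg\<close> is proved.\<close>
 define irreg where "irreg p \<longleftrightarrow> (\<exists>k\<in>{0..2 ^ A - 1}. dl < \<bar>cfrac Om V p (b (k + 1)) - cfrac Om E p (b (k + 1))\<bar>)" for p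
 define bdy where "bdy p \<longleftrightarrow> dl < cfrac Om V p (%q. near A' (Y q))" for p
 define bad where "bad p \<longleftrightarrow> log 2 (1 / (4 * dl)) <= ent (fib Om V p) (%q. dya A (Y q))" for p
 define nice where "nice p \<longleftrightarrow> ~ irreg p & ~ bdy p & ~ bad p" for p
 have gb: "(\<Sum>p\<in>Om. (cfrac Om V p (b k) - cfrac Om E p (b k))\<^sup>2) <= 2 * rcard Om * g" for k
 proof -
  have "(\<Sum>p\<in>Om. (cfrac Om V p (b k) - cfrac Om E p (b k))\<^sup>2) / (2 * rcard Om) <= cent Om (b k) E - cent Om (b k) V"
   by (rule information_bool_ge[OF finO VE])
  also have "... <= g"
  proof -
   have r: "refines Om (%p. dya A (Y p)) (b k)"
   proof (rule refinesI)
   fix p q assume h: "dya A (Y p) = dya A (Y q)"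
   have "dya 0 (Y p) = dya 0 (Y q)" by (rule dya_eq_mono[OF h]) simp
   thus "b k p = b k q" using h by (simp add: b_def dya_def)
   qed
   have eq: "cent Om X V = cent Om X (%p. (E p, V p))" for X :: "'a \<times> 'b => 'e"
   by (rule cent_cong; insert VE; unfold refines_def prod.inject; blast)
   show ?thesis unfolding g_def eq by (rule information_mono[OF finO r])
  qed
  finally show ?thesis using cardO by (simp add: field_simps)
 qed
 have c_irreg: "rcard {p \<in> Om. irreg p} <= 2 ^ (A + 1) * g / dl\<^sup>2 * rcard Om"
 proof -
  have "dl\<^sup>2 * rcard {p \<in> Om. irreg p} = (\<Sum>p\<in>{p \<in> Om. irreg p}. dl\<^sup>2)" by simp
  also have "... <= (\<Sum>p\<in>{p \<in> Om. irreg p}. \<Sum>k\<in>{0..2 ^ A - 1}. (cfrac Om V p (b (k + 1)) - cfrac Om E p (b (k + 1)))\<^sup>2)"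
  proof (rule sum_mono)
   fix p assume "p \<in> {p \<in> Om. irreg p}"
   then obtain k where k: "k \<in> {0..2 ^ A - 1::int}" "dl < \<bar>cfrac Om V p (b (k + 1)) - cfrac Om E p (b (k + 1))\<bar>"
   by (auto simp: irreg_def)
   have "dl\<^sup>2 <= \<bar>cfrac Om V p (b (k + 1)) - cfrac Om E p (b (k + 1))\<bar>\<^sup>2"
   using k(2) dl by (intro power_mono) auto
   also have "... = (cfrac Om V p (b (k + 1)) - cfrac Om E p (b (k + 1)))\<^sup>2" by simp
   also have "... <= (\<Sum>k\<in>{0..2 ^ A - 1}. (cfrac Om V p (b (k + 1)) - cfrac Om E p (b (k + 1)))\<^sup>2)"
   using k(1) by (intro member_le_sum) auto
   finally show "dl\<^sup>2 <= ..." .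
  qed
  also have "... <= (\<Sum>p\<in>Om. \<Sum>k\<in>{0..2 ^ A - 1}. (cfrac Om V p (b (k + 1)) - cfrac Om E p (b (k + 1)))\<^sup>2)"
   using finO by (intro sum_mono2) (auto intro!: sum_nonneg)
  also have "... = (\<Sum>k\<in>{0..2 ^ A - 1}. \<Sum>p\<in>Om. (cfrac Om V p (b (k + 1)) - cfrac Om E p (b (k + 1)))\<^sup>2)"
   by (rule sum.swap)
  also have "... <= (\<Sum>k\<in>{0..2 ^ A - 1::int}. 2 * rcard Om * g)" by (intro sum_mono gb)
  also have "... = 2 ^ (A + 1) * g * rcard Om" by simp
  finally show ?thesis using dl by (simp add: field_simps)
 qed
 have c_bdy: "rcard {p \<in> Om. bdy p} <= rcard {p \<in> Om. near A' (Y p)} / dl"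
 proof -
  have "dl * rcard {p \<in> Om. bdy p} = (\<Sum>p\<in>{p \<in> Om. bdy p}. dl)" by simp
  also have "... <= (\<Sum>p\<in>{p \<in> Om. bdy p}. cfrac Om V p (%q. near A' (Y q)))"
   by (rule sum_mono) (auto simp: bdy_def)
  also have "... <= (\<Sum>p\<in>Om. cfrac Om V p (%q. near A' (Y q)))"
   using finO cfrac_bounds(1)[OF finO] by (intro sum_mono2) auto
  also have "... = rcard {p \<in> Om. near A' (Y p)}" by (rule sum_cfrac[OF finO])
  finally show ?thesis using dl by (simp add: field_simps)
 qed
 have key: "f (fst p') - f (fst p) < 1 / 2 ^ A"
  if p: "p \<in> Om" "nice p" and p': "p' \<in> Om" "nice p'" and Ep: "E p = E p'" for p p'
 proof (rule ccontr)
  assume "~ f (fst p') - f (fst p) < 1 / 2 ^ A"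
  hence d1: "1 / 2 ^ A <= f (fst p') - f (fst p)" by simp
  define c where "c = \<lfloor>Y p\<rfloor>"
  have c': "\<lfloor>Y p'\<rfloor> = c" and e: "\<lfloor>2 ^ A' * f (fst p)\<rfloor> = \<lfloor>2 ^ A' * f (fst p')\<rfloor>"
   using Ep by (auto simp: E_def c_def dya_def)
  have "2 ^ A' * f (fst p') - 2 ^ A' * f (fst p) <= 1" using e by linarith
  hence d2: "f (fst p') - f (fst p) <= 1 / 2 ^ A'" by (simp add: field_simps)
  let ?J = "%y. {j \<in> Om2. \<lfloor>y + z j\<rfloor> = c}"
  have fb: "fib Om V p = Pair (fst p) ` ?J (f (fst p))" "fib Om V p' = Pair (fst p') ` ?J (f (fst p'))"
   using fib_Times_fst[of p Om1 Om2 "%p. \<lfloor>Y p\<rfloor>"] fib_Times_fst[of p' Om1 Om2 "%p. \<lfloor>Y p\<rfloor>"] p(1) p'(1) c'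
   unfolding Om_def V_def c_def by (auto simp: Y_def)
  have cf: "cfrac Om V q P = rcard {j \<in> ?J (f (fst q)). P (fst q, j)} / rcard (?J (f (fst q)))"
   if "q = p | q = p'" for q P
   using that fb unfolding cfrac_def
   by (auto simp: card_Pair_filter card_image inj_on_def)
  have cb: "cfrac Om V q (b k) = rcard {j \<in> ?J (f (fst q)). \<lfloor>2 ^ A * (f (fst q) + z j)\<rfloor> < 2 ^ A * c + k} /
   rcard (?J (f (fst q)))" if "q = p | q = p'" for q k
  proof -
   have "{j \<in> ?J (f (fst q)). b k (fst q, j)} = {j \<in> ?J (f (fst q)). \<lfloor>2 ^ A * (f (fst q) + z j)\<rfloor> < 2 ^ A * c + k}"
   by (auto simp: b_def Y_def)
   thus ?thesis using cf[OF that, of "b k"] by simp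
  qed
  have "cfrac Om E p (b k) = cfrac Om E p' (b k)" for k
   unfolding cfrac_def fib_def Ep by simp
  hence ureg: "cfrac Om V p (b k) <= cfrac Om V p' (b k) + 2 * dl" if "0 <= k" "k <= 2 ^ A" for k
  proof (cases "k = 0")
   case True
   have "cfrac Om V p (b 0) = 0"
   proof -
   have "\<lfloor>2 ^ A * r\<rfloor> >= 2 ^ A * \<lfloor>r\<rfloor>" for r :: real
   using le_floor_iff[of "2 ^ A * \<lfloor>r\<rfloor>" "2 ^ A * r"] by simp
   hence "~ b 0 q" for q unfolding b_def by (simp add: not_less)
   thus ?thesis by (simp add: cfrac_def)
   qed
   thus ?thesis using True cfrac_bounds(1)[OF finO, of V p' "b 0"] dl by simp
  next
   case False
   hence "k - 1 \<in> {0..2 ^ A - 1}" using that by auto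
   hence "\<bar>cfrac Om V p (b k) - cfrac Om E p (b k)\<bar> <= dl" "\<bar>cfrac Om V p' (b k) - cfrac Om E p' (b k)\<bar> <= dl"
   using p(2) p'(2) unfolding nice_def irreg_def by (metis diff_add_cancel not_less)+
   thus ?thesis using \<open>!!k. cfrac Om E p (b k) = cfrac Om E p' (b k)\<close>[of k] by linarith
  qed
  have bd: "rcard {j \<in> ?J (f (fst q)). near A' (f (fst q) + z j)} / rcard (?J (f (fst q))) <= dl"
   if "q = p | q = p'" for q
   using cf[OF that, of "%q. near A' (Y q)"] p(2) p'(2) that by (auto simp: nice_def bdy_def Y_def)
  have ne': "?J (f (fst p')) ~= {}" using fb(2) self_in_fib[OF p'(1), of V] by auto
  have "log 2 (1 / (4 * dl)) <= ent (fib Om V p) (%q. dya A (Y q))"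
  proof (rule ent_ge_min_entropy)
   show "finite (fib Om V p)" by (rule finite_fib[OF finO])
   show "fib Om V p ~= {}" using self_in_fib[OF p(1), of V] by auto
   show "0 < 4 * dl" using dl by simp
   fix q assume "q \<in> fib Om V p"
   then obtain t where t: "t \<in> ?J (f (fst p))" "q = (fst p, t)" using fb(1) by auto
   have "rcard {j \<in> ?J (f (fst p)). \<lfloor>2 ^ A * (f (fst p) + z j)\<rfloor> = \<lfloor>2 ^ A * (f (fst p) + z t)\<rfloor>}
   <= 4 * dl * rcard (?J (f (fst p)))"
   by (rule shifted_cells_spread[OF fin(2) d1 d2 dl t(1) ne'])
   (use ureg cb[of p] cb[of p'] bd[of p] bd[of p'] in auto)
   moreover have "fib (fib Om V p) (%q. dya A (Y q)) q = {r \<in> Pair (fst p) ` ?J (f (fst p)). dya A (Y r) = dya A (Y q)}"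
   unfolding fb(1)[symmetric] by (auto simp: fib_def)
   hence "card (fib (fib Om V p) (%q. dya A (Y q)) q) =
   card {j \<in> ?J (f (fst p)). \<lfloor>2 ^ A * (f (fst p) + z j)\<rfloor> = \<lfloor>2 ^ A * (f (fst p) + z t)\<rfloor>}"
   using t(2) by (simp add: card_Pair_filter dya_def Y_def)
   ultimately show "rcard (fib (fib Om V p) (%q. dya A (Y q)) q) <= 4 * dl * rcard (fib Om V p)"
   unfolding fb(1) by (simp add: card_image inj_on_def)
  qed
  thus False using p(2) by (simp add: nice_def bad_def)
 qed
 have vals: "rcard ((%p. dya A (f (fst p))) ` fib Om (%p. (E p, nice p)) p) <= (if nice p then 2 else 2 ^ (A - A'))"
  if p: "p \<in> Om" for p
 proof (cases "nice p")
  case True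
  have "card ((%p. \<lfloor>2 ^ A * f (fst p)\<rfloor>) ` fib Om (%p. (E p, nice p)) p) <= 1 + 1"
  proof (rule card_floor_image_le)
   fix q q' assume "q \<in> fib Om (%p. (E p, nice p)) p" "q' \<in> fib Om (%p. (E p, nice p)) p"
   hence "f (fst q) - f (fst q') < 1 / 2 ^ A" using True by (intro key) (auto simp: fib_def)
   thus "2 ^ A * f (fst q) - 2 ^ A * f (fst q') <= real 1" by (simp add: field_simps)
  qed (rule finite_fib[OF finO])
  thus ?thesis using True by (simp add: dya_def)
 next
  case False
  define e where "e = dya A' (f (fst p))"
  have "(%p. dya A (f (fst p))) ` fib Om (%p. (E p, nice p)) p \<subseteq> {2 ^ (A - A') * e..<2 ^ (A - A') * e + 2 ^ (A - A')}"
  proof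
   fix v assume "v \<in> (%p. dya A (f (fst p))) ` fib Om (%p. (E p, nice p)) p"
   then obtain q where q: "dya A' (f (fst q)) = e" "v = dya A (f (fst q))" by (auto simp: fib_def E_def e_def)
   have "v div 2 ^ (A - A') = e" using dya_div[of A' "f (fst q)" "A - A'"] q A by simp
   thus "v \<in> {2 ^ (A - A') * e..<2 ^ (A - A') * e + 2 ^ (A - A')}"
   using div_pow2_bounds by force
  qed
  from card_mono[OF _ this] have "card ((%p. dya A (f (fst p))) ` fib Om (%p. (E p, nice p)) p) <= 2 ^ (A - A')"
   by (simp add: nat_power_eq)
  from of_nat_mono[OF this, where 'a=real] show ?thesis using False by simp
 qed
 have "cent Om (%p. dya A (f (fst p))) E <= cent Om (%p. dya A (f (fst p))) (%p. (E p, nice p)) + cent Om nice E"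
  by (rule cent_le_cond_add[OF finO])
 also have "cent Om nice E <= log 2 2"
 proof (rule cent_le_log_const[OF finO])
  fix a
  have "card (nice ` fib Om E a) <= card (UNIV :: bool set)" by (rule card_mono) auto
  thus "rcard (nice ` fib Om E a) <= 2" by simp
 qed simp
 also have "cent Om (%p. dya A (f (fst p))) (%p. (E p, nice p)) <=
   (\<Sum>p\<in>Om. log 2 (if nice p then 2 else 2 ^ (A - A'))) / rcard Om"
  by (rule cent_le_log_values[OF finO vals])
 also have "(\<Sum>p\<in>Om. log 2 (if nice p then 2 else 2 ^ (A - A'))) <= (\<Sum>p\<in>Om. 1 + (if nice p then 0 else real (A - A')))"
  by (intro sum_mono) (auto simp: log_nat_power)
 also have "... = rcard Om + real (A - A') * rcard {p \<in> Om. ~ nice p}"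
 proof -
  have "(\<Sum>p\<in>Om. if nice p then 0 else real (A - A')) = (\<Sum>p\<in>Om. if ~ nice p then real (A - A') else 0)"
   by (rule sum.cong) auto
  also have "... = (\<Sum>p\<in>{p \<in> Om. ~ nice p}. real (A - A'))"
   by (rule sum.inter_filter[OF finO, symmetric])
  finally show ?thesis by (simp add: sum.distrib)
 qed
 also have "rcard {p \<in> Om. ~ nice p} <= (2 ^ (A + 1) * g / dl\<^sup>2 +
  rcard {p \<in> Om. near A' (Y p)} / rcard Om / dl + rcard Bad / rcard Om) * rcard Om"
 proof -
  have "card {p \<in> Om. ~ nice p} <= card ({p \<in> Om. irreg p} \<union> {p \<in> Om. bdy p} \<union> Bad)"
   using finO by (intro card_mono) (auto simp: nice_def Bad_def bad_def)
  also have "... <= card {p \<in> Om. irreg p} + card {p \<in> Om. bdy p} + card Bad"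
   by (meson card_Un_le add_le_mono order_refl order_trans)
  finally have "rcard {p \<in> Om. ~ nice p} <= rcard {p \<in> Om. irreg p} + rcard {p \<in> Om. bdy p} + rcard Bad"
   by linarith
  also have "... <= 2 ^ (A + 1) * g / dl\<^sup>2 * rcard Om + rcard {p \<in> Om. near A' (Y p)} / dl + rcard Bad"
   using c_irreg c_bdy by simp
  also have "... = (2 ^ (A + 1) * g / dl\<^sup>2 +
  rcard {p \<in> Om. near A' (Y p)} / rcard Om / dl + rcard Bad / rcard Om) * rcard Om"
   using cardO by (simp add: distrib_right)
  finally show ?thesis .
 qed
 finally show ?thesis using cardO by (simp add: g_def add_divide_distrib divide_right_mono mult_left_mono)
qed

section \<open>Growth of entropy under convolution\<close>

text \<open>\<open>U\<close> cuts the family \<open>z\<close> into pieces of diameter at most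
  \<open>1 / 2 ^ s\<close>, each with entropy at least \<open>l T\<close> at \<open>T\<close>
  further binary digits. The bound \<open>K\<close> restricts this to the digits that words of the
  given length resolve.\<close>

abbreviation fat_at :: "(nat => real) => nat => 'b set => ('b => real) => nat => bool" where
 "fat_at l K Om2 z s == \<exists>U :: 'b => nat. (\<forall>j\<in>Om2. \<forall>j'\<in>Om2. U j = U j' --> \<bar>z j - z j'\<bar> <= 1 / 2 ^ s) \<and>
  (\<forall>j\<in>Om2. \<forall>T. s + T <= K --> l T <= ent (fib Om2 U j) (%j. dya (s + T) (z j)))"

text \<open>A piece that contains a point far from the boundary of the cell lies wholly inside the
  cell and keeps its entropy when the law is restricted to it. The 2 in the hypothesis pays for the
  translation by \<open>y\<close>; the alternative \<open>l = 0\<close> covers a target entropy that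
  was cut off at zero.\<close>

lemma component_entropy_ge:
 fixes z :: "'b => real" and U :: "'b => 'u" and y l :: real and c :: int and a A :: nat
  and Om2 :: "'b set"
 assumes fin: "finite Om2"
  and diam: "!!j j'. j \<in> Om2 ==> j' \<in> Om2 ==> U j = U j' ==> \<bar>z j - z j'\<bar> <= 1 / 2 ^ a"
  and ent: "!!j. j \<in> Om2 ==> l = 0 | l + 2 <= ent (fib Om2 U j) (%j. dya A (z j))"
  and l: "0 <= l"
 defines "J == {j \<in> Om2. \<lfloor>y + z j\<rfloor> = c}"
 assumes ne: "J ~= {}"
 shows "(1 - rcard {j \<in> J. near a (y + z j)} / rcard J) * l <= ent J (%j. dya A (y + z j))"
proof -
 have finJ: "finite J" unfolding J_def using fin by auto
 have cJ: "0 < rcard J" using finJ ne by (simp add: card_gt_0_iff)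
 have piece: "l <= ent (fib J U j) (%j. dya A (y + z j))" if j: "j \<in> J" "~ near a (y + z j)" for j
 proof -
  have jO: "j \<in> Om2" and fl: "\<lfloor>y + z j\<rfloor> = c" using j by (auto simp: J_def)
  have fr: "1 / 2 ^ a <= y + z j - c" "y + z j - c < 1 - 1 / 2 ^ a"
   using j(2) fl by (auto simp: near_def frac_def)
  have "j' \<in> J" if "j' \<in> Om2" "U j' = U j" for j'
  proof -
   have "\<bar>z j' - z j\<bar> <= 1 / 2 ^ a" using diam[of j' j] that jO by simp
   hence "of_int c <= y + z j'" "y + z j' < of_int c + 1" using fr by (auto simp: abs_le_iff)
   thus ?thesis using that by (simp add: J_def floor_eq_iff)
  qed
  hence eq: "fib J U j = fib Om2 U j" by (auto simp: fib_def J_def)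
  have "ent (fib Om2 U j) (%j. \<lfloor>2 ^ A * z j\<rfloor>) <= ent (fib Om2 U j) (%j. \<lfloor>2 ^ A * (y + z j)\<rfloor>) + 2"
   by (rule ent_floor_translate[where c="2 ^ A * y"]) (auto simp: finite_fib[OF fin] distrib_left)
  moreover have "0 <= ent (fib Om2 U j) (%j. \<lfloor>2 ^ A * (y + z j)\<rfloor>)"
   unfolding ent_def by (rule cent_nonneg[OF finite_fib[OF fin]])
  ultimately show ?thesis using ent[OF jO] unfolding eq dya_def by linarith
 qed
 have "(1 - rcard {j \<in> J. near a (y + z j)} / rcard J) * l
   = (rcard J - rcard {j \<in> J. near a (y + z j)}) * l / rcard J"
  using cJ by (simp add: field_simps)
 also have "rcard J - rcard {j \<in> J. near a (y + z j)} = rcard {j \<in> J. ~ near a (y + z j)}"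
 proof -
  have "J = {j \<in> J. near a (y + z j)} \<union> {j \<in> J. ~ near a (y + z j)}" by auto
  hence "card J = card {j \<in> J. near a (y + z j)} + card {j \<in> J. ~ near a (y + z j)}"
   using card_Un_disjoint[of "{j \<in> J. near a (y + z j)}" "{j \<in> J. ~ near a (y + z j)}"] finJ by fastforce
  thus ?thesis by linarith
 qed
 also have "... * l = (\<Sum>j\<in>{j \<in> J. ~ near a (y + z j)}. l)" by simp
 also have "... <= (\<Sum>j\<in>{j \<in> J. ~ near a (y + z j)}. ent (fib J U j) (%j. dya A (y + z j)))"
  by (rule sum_mono) (auto intro: piece)
 also have "... <= (\<Sum>j\<in>J. ent (fib J U j) (%j. dya A (y + z j)))"
  using finJ by (intro sum_mono2) (auto simp: ent_def intro!: cent_nonneg finite_fib)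
 also have "... / rcard J = cent J (%j. dya A (y + z j)) U"
  by (rule cent_fibers_ent[OF finJ, symmetric])
 also have "... <= ent J (%j. dya A (y + z j))"
  unfolding ent_def by (rule cent_antimono[OF finJ]) (simp add: refines_def)
 finally show ?thesis using cJ by (simp add: divide_right_mono)
qed

text \<open>Markov's inequality for the excess of the cell entropy over its minimum
  \<open>l\<close>: when the mean is close to \<open>l\<close>, few cells reach the level
  \<open>H\<close>. The boundary term makes the excess nonnegative.\<close>

lemma saturated_fraction:
 fixes f :: "'a => real" and z :: "'b => real" and U :: "'b => 'u" and a A :: nat
  and Om1 :: "'a set" and Om2 :: "'b set" and H l :: real
 defines "Y == %p. f (fst p) + z (snd p)"
 defines "V == %p. (\<lfloor>Y p\<rfloor>, fst p)"
 defines "Om == Om1 \<times> Om2"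
 defines "Bad == {p \<in> Om. H <= ent (fib Om V p) (%q. dya A (Y q))}"
 assumes fin: "finite Om1" "finite Om2" and ne: "Om1 ~= {}" "Om2 ~= {}"
  and diam: "!!j j'. j \<in> Om2 ==> j' \<in> Om2 ==> U j = U j' ==> \<bar>z j - z j'\<bar> <= 1 / 2 ^ a"
  and ent: "!!j. j \<in> Om2 ==> l = 0 | l + 2 <= ent (fib Om2 U j) (%j. dya A (z j))"
  and l: "0 <= l" and H: "l < H"
 shows "rcard Bad / rcard Om <=
  (cent Om (%p. dya A (Y p)) V - l + l * (rcard {p \<in> Om. near a (Y p)} / rcard Om)) / (H - l)"
proof -
 have finO: "finite Om" unfolding Om_def using fin by auto
 have cO: "0 < rcard Om" unfolding Om_def using fin ne by (auto simp: card_gt_0_iff)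
 define X where "X p = ent (fib Om V p) (%q. dya A (Y q))" for p
 have low: "(1 - cfrac Om V p (%q. near a (Y q))) * l <= X p" if p: "p \<in> Om" for p
 proof -
  let ?J = "{j \<in> Om2. \<lfloor>f (fst p) + z j\<rfloor> = \<lfloor>Y p\<rfloor>}"
  have fb: "fib Om V p = Pair (fst p) ` ?J"
   using fib_Times_fst[of p Om1 Om2 "%p. \<lfloor>Y p\<rfloor>"] p unfolding Om_def V_def by (auto simp: Y_def)
  have "?J ~= {}" using self_in_fib[OF p, of V] fb by auto
  hence "(1 - rcard {j \<in> ?J. near a (f (fst p) + z j)} / rcard ?J) * l
   <= ent ?J (%j. dya A (f (fst p) + z j))"
   using diam ent l by (intro component_entropy_ge[OF fin(2), of U]) auto
  moreover have "X p = ent ?J (%j. dya A (f (fst p) + z j))"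
   unfolding X_def fb by (subst ent_image) (auto simp: inj_on_def Y_def)
  moreover have "cfrac Om V p (%q. near a (Y q)) = rcard {j \<in> ?J. near a (f (fst p) + z j)} / rcard ?J"
   unfolding cfrac_def fb by (simp add: card_Pair_filter card_image inj_on_def Y_def)
  ultimately show ?thesis by simp
 qed
 have "rcard Bad * (H - l) = (\<Sum>p\<in>Bad. H - l)" by simp
 also have "... <= (\<Sum>p\<in>Bad. X p - l + l * cfrac Om V p (%q. near a (Y q)))"
 proof (rule sum_mono)
  fix p assume "p \<in> Bad"
  hence "H <= X p" by (simp add: Bad_def X_def)
  moreover have "0 <= l * cfrac Om V p (%q. near a (Y q))" by (intro mult_nonneg_nonneg l cfrac_bounds(1)[OF finO])
  ultimately show "H - l <= X p - l + l * cfrac Om V p (%q. near a (Y q))" by linarith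
 qed
 also have "... <= (\<Sum>p\<in>Om. X p - l + l * cfrac Om V p (%q. near a (Y q)))"
 proof (rule sum_mono2[OF finO])
  fix p assume "p \<in> Om - Bad"
  thus "0 <= X p - l + l * cfrac Om V p (%q. near a (Y q))" using low[of p] by (simp add: algebra_simps)
 qed (auto simp: Bad_def)
 also have "... = (\<Sum>p\<in>Om. X p) - rcard Om * l + l * (\<Sum>p\<in>Om. cfrac Om V p (%q. near a (Y q)))"
  by (simp add: sum.distrib sum_subtractf sum_distrib_left)
 also have "(\<Sum>p\<in>Om. cfrac Om V p (%q. near a (Y q))) = rcard {p \<in> Om. near a (Y p)}"
  by (rule sum_cfrac[OF finO])
 also have "(\<Sum>p\<in>Om. X p) = rcard Om * cent Om (%p. dya A (Y p)) V"
  unfolding X_def using cent_fibers_ent[OF finO, of "%p. dya A (Y p)" V] cO by simp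
 finally have "rcard Bad * (H - l) / rcard Om <= (rcard Om * cent Om (%p. dya A (Y p)) V -
   rcard Om * l + l * rcard {p \<in> Om. near a (Y p)}) / rcard Om"
  using cO by (intro divide_right_mono) auto
 also have "... = cent Om (%p. dya A (Y p)) V - l + l * (rcard {p \<in> Om. near a (Y p)} / rcard Om)"
  using cO by (simp add: add_divide_distrib diff_divide_distrib)
 finally show ?thesis using H by (simp add: pos_le_divide_eq)
qed

text \<open>\<open>one_scale\<close> is applied to \<open>2 ^ s * f\<close> and
  \<open>2 ^ s * z\<close> for every starting scale \<open>s\<close>, and the results are added.
  \<open>ph\<close>, \<open>J1\<close> and \<open>J2\<close> are the one-digit increments of the
  entropy of \<open>f\<close> given the sum, of the sum, and of the sum given the word; each
  increment is met by at most \<open>A\<close> windows, whence the factors \<open>A\<close>. Keeping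
  the full sum \<open>dya K (Y p)\<close> in the condition of \<open>ph\<close> makes its increments
  telescope over all \<open>K\<close> scales.\<close>

lemma multi_scale:
 fixes f :: "'a => real" and z :: "'b => real" and A A' A'' K :: nat
  and Om1 :: "'a set" and Om2 :: "'b set" and dl M :: real and l :: "nat => real"
 defines "Y == %p. f (fst p) + z (snd p)"
 defines "Om == Om1 \<times> Om2"
 defines "NB == %a. \<Sum>s\<le>K - A. rcard {p \<in> Om. near a (2 ^ s * Y p)} / rcard Om"
 assumes fin: "finite Om1" "finite Om2" and ne: "Om1 ~= {}" "Om2 ~= {}" and A: "A' < A" "A'' <= A" "A <= K"
  and dl: "0 < dl"
  and fat: "!!s. s <= K ==> fat_at l K Om2 z s"
  and M: "0 <= M" "M = 0 | M + 2 <= l (A - A'')" "M < log 2 (1 / (4 * dl))"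
 shows "cent Om (%p. dya K (f (fst p))) (%p. (dya 0 (f (fst p)), dya K (Y p))) <=
  real A + 2 * real (K - A + 1) / real (A - A') +
  2 ^ (A + 1) * real A * (cent Om (%p. dya K (Y p)) (%p. dya 0 (Y p)) -
   cent Om (%p. dya K (Y p)) (%p. (dya 0 (Y p), fst p))) / dl\<^sup>2 +
  NB A' / dl +
  (real A * cent Om (%p. dya K (Y p)) (%p. (dya 0 (Y p), fst p)) - real (K - A + 1) * M + M * NB A'') /
   (log 2 (1 / (4 * dl)) - M)"
proof -
 have finO: "finite Om" unfolding Om_def using fin by auto
 have cO: "0 < rcard Om" unfolding Om_def using fin ne by (auto simp: card_gt_0_iff)
 define H where "H = log 2 (1 / (4 * dl))"
 define ph where "ph t = cent Om (%p. dya (t + 1) (f (fst p))) (%p. (dya t (f (fst p)), dya K (Y p)))" for t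
 define J1 where "J1 t = cent Om (%p. dya (t + 1) (Y p)) (%p. (dya t (Y p), ()))" for t
 define J2 where "J2 t = cent Om (%p. dya (t + 1) (Y p)) (%p. (dya t (Y p), fst p))" for t
 have refY: "refines Om (%p. dya j (Y p)) (%p. dya i (Y p))" if "i <= j" for i j
  unfolding refines_def using dya_eq_mono[OF _ that] by blast
 have reff: "refines Om (%p. dya j (f (fst p))) (%p. dya i (f (fst p)))" if "i <= j" for i j
  unfolding refines_def using dya_eq_mono[OF _ that] by blast
 have ph0: "0 <= ph t" for t unfolding ph_def by (rule cent_nonneg[OF finO])
 have ph1: "ph t <= 1" for t
 proof -
  have "ph t <= log 2 (real 1 + 1)"
   unfolding ph_def dya_def
  proof (rule cent_le_log_const[OF finO])
   fix a assume "a \<in> Om"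
   let ?S = "fib Om (%p. (\<lfloor>2 ^ t * f (fst p)\<rfloor>, \<lfloor>2 ^ K * Y p\<rfloor>)) a"
   define e where "e = \<lfloor>2 ^ t * f (fst a)\<rfloor>"
   have "(%p. \<lfloor>2 ^ (t + 1) * f (fst p)\<rfloor>) ` ?S \<subseteq> {2 * e..<2 * e + 2}"
   proof
   fix v assume "v \<in> (%p. \<lfloor>2 ^ (t + 1) * f (fst p)\<rfloor>) ` ?S"
   then obtain p where p: "\<lfloor>2 ^ t * f (fst p)\<rfloor> = e" "v = \<lfloor>2 ^ (t + 1) * f (fst p)\<rfloor>"
   by (auto simp: fib_def e_def)
   have "v div 2 ^ 1 = e" using dya_div[of t "f (fst p)" 1] p by (simp add: dya_def)
   from div_pow2_bounds[OF this] show "v \<in> {2 * e..<2 * e + 2}" by simp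
   qed
   from card_mono[OF _ this] show "rcard ((%p. \<lfloor>2 ^ (t + 1) * f (fst p)\<rfloor>) ` ?S) <= real 1 + 1"
   by simp
  qed simp
  thus ?thesis by simp
 qed
 have J21: "J2 t <= J1 t" for t
  unfolding J1_def J2_def by (rule cent_antimono[OF finO]) (simp add: refines_def)
 have J20: "0 <= J2 t" for t unfolding J2_def by (rule cent_nonneg[OF finO])
 have tel1: "cent Om (%p. dya (s + n) (Y p)) (%p. dya s (Y p)) = (\<Sum>i<n. J1 (s + i))" for s n
 proof -
  have "cent Om (%p. dya (s + n) (Y p)) (%p. dya s (Y p)) = cent Om (%p. dya (s + n) (Y p)) (%p. (dya s (Y p), ()))"
   by (rule cent_cong) auto
  thus ?thesis using cent_telescope[OF finO, of "%i p. dya i (Y p)" s n "%_. ()"] refY by (simp add: J1_def)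
 qed
 have tel2: "cent Om (%p. dya (s + n) (Y p)) (%p. (dya s (Y p), fst p)) = (\<Sum>i<n. J2 (s + i))" for s n
  using cent_telescope[OF finO, of "%i p. dya i (Y p)" s n fst] refY by (simp add: J2_def)
 define I where "I = cent Om (%p. dya K (Y p)) (%p. dya 0 (Y p)) - cent Om (%p. dya K (Y p)) (%p. (dya 0 (Y p), fst p))"
 define X where "X = cent Om (%p. dya K (Y p)) (%p. (dya 0 (Y p), fst p))"
 have I: "I = (\<Sum>t<K. J1 t - J2 t)" unfolding I_def using tel1[of 0 K] tel2[of 0 K] by (simp add: sum_subtractf)
 have X: "X = (\<Sum>t<K. J2 t)" unfolding X_def using tel2[of 0 K] by simp
 define nb where "nb a s = rcard {p \<in> Om. near a (2 ^ s * Y p)} / rcard Om" for a s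
 have scale: "(\<Sum>i=A'..<A. ph (s + i)) <= 2 + real (A - A') *
   (2 ^ (A + 1) * (\<Sum>i<A. J1 (s + i) - J2 (s + i)) / dl\<^sup>2 + nb A' s / dl +
   ((\<Sum>i<A. J2 (s + i)) - M + M * nb A'' s) / (H - M))" if s: "s <= K - A" for s
 proof -
  let ?f = "%w. 2 ^ s * f w" and ?z = "%j. 2 ^ s * z j"
  have Ys: "?f (fst p) + ?z (snd p) = 2 ^ s * Y p" for p by (simp add: Y_def distrib_left)
  let ?V = "%p. (\<lfloor>?f (fst p) + ?z (snd p)\<rfloor>, fst p)"
  have V: "?V = (%p. (dya s (Y p), fst p))" unfolding Ys dya_def ..
  have DA: "dya A (?f (fst p) + ?z (snd p)) = dya (s + A) (Y p)" for p unfolding Ys dya_shift ..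
  have fA: "dya A (2 ^ s * f w) = dya (s + A) (f w)" for w by (rule dya_shift[symmetric])
  let ?E = "%p. (dya A' (?f (fst p)), \<lfloor>?f (fst p) + ?z (snd p)\<rfloor>)"
  have E: "?E = (%p. (dya (s + A') (f (fst p)), dya s (Y p)))"
   unfolding Ys dya_shift by (simp add: dya_def)
  let ?Bad = "{p \<in> Om. H <= ent (fib Om ?V p) (%q. dya A (?f (fst q) + ?z (snd q)))}"
  have 1: "cent Om (%p. dya A (?f (fst p))) ?E <= 2 + real (A - A') *
   (2 ^ (A + 1) * (cent Om (%p. dya A (?f (fst p) + ?z (snd p))) ?E - cent Om (%p. dya A (?f (fst p) + ?z (snd p))) ?V) / dl\<^sup>2 +
   rcard {p \<in> Om. near A' (?f (fst p) + ?z (snd p))} / rcard Om / dl + rcard ?Bad / rcard Om)"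
   unfolding Om_def H_def by (rule one_scale[OF fin ne A(1) dl])
  have sK: "s + A'' <= K" using s A by linarith
  obtain U :: "'b => nat" where
   U1: "\<forall>j\<in>Om2. \<forall>j'\<in>Om2. U j = U j' --> \<bar>z j - z j'\<bar> <= 1 / 2 ^ (s + A'')"
   and U2: "\<forall>j\<in>Om2. \<forall>T. s + A'' + T <= K --> l T <= ent (fib Om2 U j) (%j. dya (s + A'' + T) (z j))"
   using fat[OF sK] by blast
  have 2: "rcard ?Bad / rcard Om <=
   (cent Om (%p. dya A (?f (fst p) + ?z (snd p))) ?V - M +
   M * (rcard {p \<in> Om. near A'' (?f (fst p) + ?z (snd p))} / rcard Om)) / (H - M)"
   unfolding Om_def
  proof (rule saturated_fraction[OF fin ne, of U])
   fix j j' assume "j \<in> Om2" "j' \<in> Om2" "U j = U j'"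
   hence "\<bar>z j - z j'\<bar> <= 1 / 2 ^ (s + A'')" using U1 by blast
   hence "2 ^ s * \<bar>z j - z j'\<bar> <= 2 ^ s * (1 / 2 ^ (s + A''))" by (intro mult_left_mono) auto
   also have "2 ^ s * \<bar>z j - z j'\<bar> = \<bar>2 ^ s * (z j - z j')\<bar>" by (simp add: abs_mult)
   finally show "\<bar>2 ^ s * z j - 2 ^ s * z j'\<bar> <= 1 / 2 ^ A''" by (simp add: power_add right_diff_distrib)
  next
   fix j assume j: "j \<in> Om2"
   have "l (A - A'') <= ent (fib Om2 U j) (%j. dya (s + A'' + (A - A'')) (z j))"
   using U2[rule_format, OF j, of "A - A''"] s A by linarith
   also have "s + A'' + (A - A'') = s + A" using A by simp
   finally show "M = 0 | M + 2 <= ent (fib Om2 U j) (%j. dya A (2 ^ s * z j))" using M(2) by (auto simp: dya_shift)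
  qed (use M in \<open>auto simp: H_def\<close>)
  have 3: "cent Om (%p. dya (s + A) (Y p)) (%p. (dya (s + A') (f (fst p)), dya s (Y p))) <= (\<Sum>i<A. J1 (s + i))"
   unfolding tel1[symmetric] by (rule cent_antimono[OF finO]) (simp add: refines_def)
  have 4: "(\<Sum>i=A'..<A. ph (s + i)) <= cent Om (%p. dya (s + A) (f (fst p))) (%p. (dya (s + A') (f (fst p)), dya s (Y p)))"
  proof -
   have "(\<Sum>i=A'..<A. ph (s + i)) = (\<Sum>i<A - A'. ph (s + A' + i))"
   using sum.shift_bounds_nat_ivl[of "%i. ph (s + i)" 0 A' "A - A'"] A(1)
   by (simp add: lessThan_atLeast0 add_ac)
   also have "... = cent Om (%p. dya (s + A' + (A - A')) (f (fst p))) (%p. (dya (s + A') (f (fst p)), dya K (Y p)))"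
   using cent_telescope[OF finO, of "%i p. dya i (f (fst p))" "s + A'" "A - A'" "%p. dya K (Y p)"] reff
   by (simp add: ph_def)
   also have "s + A' + (A - A') = s + A" using A by simp
   also have "cent Om (%p. dya (s + A) (f (fst p))) (%p. (dya (s + A') (f (fst p)), dya K (Y p))) <=
   cent Om (%p. dya (s + A) (f (fst p))) (%p. (dya (s + A') (f (fst p)), dya s (Y p)))"
   proof (rule cent_antimono[OF finO])
   have "refines Om (%p. dya K (Y p)) (%p. dya s (Y p))" using s A by (intro refY) auto
   thus "refines Om (%p. (dya (s + A') (f (fst p)), dya K (Y p))) (%p. (dya (s + A') (f (fst p)), dya s (Y p)))"
   unfolding refines_def prod.inject by blast
   qed
   finally show ?thesis .
  qed
  have "(\<Sum>i=A'..<A. ph (s + i)) <= 2 + real (A - A') *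
   (2 ^ (A + 1) * (cent Om (%p. dya (s + A) (Y p)) (%p. (dya (s + A') (f (fst p)), dya s (Y p))) - (\<Sum>i<A. J2 (s + i))) / dl\<^sup>2 +
   nb A' s / dl + rcard ?Bad / rcard Om)"
   using order.trans[OF 4 1[unfolded E V, unfolded DA fA, unfolded Ys]]
   unfolding tel2 nb_def DA V .
  also have "... <= 2 + real (A - A') *
   (2 ^ (A + 1) * ((\<Sum>i<A. J1 (s + i)) - (\<Sum>i<A. J2 (s + i))) / dl\<^sup>2 +
   nb A' s / dl + ((\<Sum>i<A. J2 (s + i)) - M + M * nb A'' s) / (H - M))"
   using 2[unfolded DA V, unfolded Ys] 3 dl unfolding tel2 nb_def DA V
   by (intro add_mono mult_left_mono divide_right_mono order_refl diff_right_mono) auto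
  finally show ?thesis by (simp add: sum_subtractf)
 qed
 have HM: "0 < H - M" using M(3) by (simp add: H_def)
 define S where "S = real (K - A + 1)"
 have phsum: "cent Om (%p. dya K (f (fst p))) (%p. (dya 0 (f (fst p)), dya K (Y p))) = (\<Sum>t<K. ph t)"
  using cent_telescope[OF finO, of "%i p. dya i (f (fst p))" 0 K "%p. dya K (Y p)"] reff by (simp add: ph_def)
 have AA: "0 < real (A - A')" using A by simp
 have "real (A - A') * ((\<Sum>t<K. ph t) - real A) <= (\<Sum>s\<le>K - A. \<Sum>i=A'..<A. ph (s + i))"
  using A ph0 ph1 by (intro sum_windows_ge) auto
 also have "... <= (\<Sum>s\<le>K - A. 2 + real (A - A') *
   (2 ^ (A + 1) * (\<Sum>i<A. J1 (s + i) - J2 (s + i)) / dl\<^sup>2 + nb A' s / dl +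
   ((\<Sum>i<A. J2 (s + i)) - M + M * nb A'' s) / (H - M)))"
  by (intro sum_mono scale) auto
 also have "... = 2 * S + real (A - A') * (2 ^ (A + 1) * (\<Sum>s\<le>K - A. \<Sum>i<A. J1 (s + i) - J2 (s + i)) / dl\<^sup>2 + NB A' / dl +
   ((\<Sum>s\<le>K - A. \<Sum>i<A. J2 (s + i)) - S * M + M * NB A'') / (H - M))"
  unfolding NB_def nb_def[symmetric] S_def
  by (simp add: sum.distrib sum_subtractf sum_distrib_left[symmetric] sum_divide_distrib[symmetric])
 also have "... <= 2 * S + real (A - A') * (2 ^ (A + 1) * (real A * I) / dl\<^sup>2 + NB A' / dl +
   (real A * X - S * M + M * NB A'') / (H - M))"
 proof -
  have "(\<Sum>s\<le>K - A. \<Sum>i<A. J1 (s + i) - J2 (s + i)) <= real A * I"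
   unfolding I using J21 A by (intro sum_windows_le) auto
  moreover have "(\<Sum>s\<le>K - A. \<Sum>i<A. J2 (s + i)) <= real A * X"
   unfolding X using J20 A by (intro sum_windows_le) auto
  ultimately show ?thesis using HM
   by (intro add_mono mult_left_mono divide_right_mono order_refl diff_right_mono) auto
 qed
 finally have main: "real (A - A') * ((\<Sum>t<K. ph t) - real A) <= 2 * S + real (A - A') * (2 ^ (A + 1) * (real A * I) / dl\<^sup>2 + NB A' / dl +
   (real A * X - S * M + M * NB A'') / (H - M))" .
 have fin_le: "(\<Sum>t<K. ph t) <= real A + 2 * S / real (A - A') + (2 ^ (A + 1) * (real A * I) / dl\<^sup>2 + NB A' / dl +
   (real A * X - S * M + M * NB A'') / (H - M))"
 proof -
  define R where "R = 2 ^ (A + 1) * (real A * I) / dl\<^sup>2 + NB A' / dl + (real A * X - S * M + M * NB A'') / (H - M)"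
  have "real (A - A') * ((\<Sum>t<K. ph t) - real A) <= real (A - A') * (2 * S / real (A - A') + R)"
   using main AA by (simp add: R_def distrib_left)
  hence "(\<Sum>t<K. ph t) - real A <= 2 * S / real (A - A') + R" using AA by (simp only: mult_le_cancel_left_pos)
  thus ?thesis by (simp add: R_def)
 qed
 show ?thesis unfolding phsum using fin_le unfolding I_def X_def H_def S_def
  by (simp only: mult.assoc add.assoc)
qed

text \<open>Under the translations by \<open>t / 2 ^ M\<close> the binary digits of the point at the
  places \<open>s + 1\<close> to \<open>s + a\<close> run through all patterns equally often, and
  \<open>near\<close> means that these digits are all 0 or all 1.\<close>

lemma card_near_translates:
 fixes y :: real
 assumes sa: "s + a <= M"
 shows "card {t \<in> {..<2 ^ M :: nat}. near a (2 ^ s * (y + real t / 2 ^ M))} <= 2 * 2 ^ (M - a)"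
proof -
 define Q :: int where "Q = 2 ^ (M - s - a)"
 define n0 where "n0 = \<lfloor>2 ^ M * y\<rfloor>"
 have Q0: "0 < Q" by (simp add: Q_def)
 have QM: "(2::int) ^ M = Q * 2 ^ a * 2 ^ s"
  unfolding Q_def power_add[symmetric] using sa by simp
 define r where "r t = ((n0 + int t) div Q) mod 2 ^ a" for t
 define Rs where "Rs c = {t \<in> {..<2 ^ M :: nat}. r t = c}" for c
 have cRs: "card (Rs c) <= 2 ^ (M - a)" for c
 proof -
  define h where "h t = (((n0 + int t) mod 2 ^ M) div (Q * 2 ^ a), (n0 + int t) mod Q)" for t
  have inj: "inj_on h (Rs c)"
  proof (rule inj_onI)
   fix t t' assume t: "t \<in> Rs c" "t' \<in> Rs c" and h: "h t = h t'"
   have dec: "(n0 + int t) mod 2 ^ M = ((n0 + int t) mod 2 ^ M) div (Q * 2 ^ a) * (Q * 2 ^ a) + c * Q + (n0 + int t) mod Q"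
   if "r t = c" for t
   proof -
   let ?x = "n0 + int t"
   have "?x mod 2 ^ M = (?x mod 2 ^ M) div (Q * 2 ^ a) * (Q * 2 ^ a) + (?x mod 2 ^ M) mod (Q * 2 ^ a)"
   by (rule div_mult_mod_eq[symmetric])
   also have "(?x mod 2 ^ M) mod (Q * 2 ^ a) = ?x mod (Q * 2 ^ a)"
   unfolding QM by (simp add: mod_mod_cancel)
   also have "?x mod (Q * 2 ^ a) = Q * (?x div Q mod 2 ^ a) + ?x mod Q"
   using Q0 by (simp add: zmod_zmult2_eq)
   finally show ?thesis using that by (simp add: r_def mult.commute)
   qed
   have "(n0 + int t) mod 2 ^ M = (n0 + int t') mod 2 ^ M"
   using dec[of t] dec[of t'] t h by (auto simp: Rs_def h_def)
   hence "(int t) mod 2 ^ M = (int t') mod 2 ^ M"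
   by (metis add_diff_cancel_left' mod_diff_left_eq)
   thus "t = t'" using t by (simp add: Rs_def)
  qed
  have "h ` Rs c \<subseteq> {0..<2 ^ s} \<times> {0..<Q}"
  proof
   fix v assume "v \<in> h ` Rs c"
   then obtain t where v: "v = h t" by auto
   have "(n0 + int t) mod 2 ^ M < 2 ^ s * (Q * 2 ^ a)" "0 <= (n0 + int t) mod 2 ^ M"
   using pos_mod_bound[of "2 ^ M" "n0 + int t"] pos_mod_sign[of "2 ^ M" "n0 + int t"]
   by (simp_all only: zero_less_power zero_less_numeral) (simp only: QM mult_ac)
   have QP: "0 < Q * 2 ^ a" using Q0 by simp
   have "~ 2 ^ s <= ((n0 + int t) mod 2 ^ M) div (Q * 2 ^ a)"
   proof
   assume "2 ^ s <= ((n0 + int t) mod 2 ^ M) div (Q * 2 ^ a)"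
   hence "2 ^ s * (Q * 2 ^ a) <= ((n0 + int t) mod 2 ^ M) div (Q * 2 ^ a) * (Q * 2 ^ a)"
   using QP by (intro mult_right_mono) auto
   also have "... <= (n0 + int t) mod 2 ^ M"
   using div_mult_mod_eq[of "(n0 + int t) mod 2 ^ M" "Q * 2 ^ a"]
   pos_mod_sign[OF QP, of "(n0 + int t) mod 2 ^ M"] by linarith
   finally show False using \<open>(n0 + int t) mod 2 ^ M < 2 ^ s * (Q * 2 ^ a)\<close> by linarith
   qed
   moreover have "0 <= ((n0 + int t) mod 2 ^ M) div (Q * 2 ^ a)"
   using QP by (simp add: pos_imp_zdiv_nonneg_iff)
   ultimately have "((n0 + int t) mod 2 ^ M) div (Q * 2 ^ a) < 2 ^ s" "0 <= ((n0 + int t) mod 2 ^ M) div (Q * 2 ^ a)"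
   by linarith+
   thus "v \<in> {0..<2 ^ s} \<times> {0..<Q}" using Q0 by (simp add: v h_def)
  qed
  hence "card (h ` Rs c) <= card ({0..<2 ^ s :: int} \<times> {0..<Q})" by (intro card_mono) auto
  also have "... = 2 ^ s * nat Q" by (simp add: card_cartesian_product nat_power_eq)
  also have "... = 2 ^ (M - a)" unfolding Q_def using sa by (simp add: nat_power_eq power_add[symmetric])
  finally show ?thesis using inj by (simp add: card_image)
 qed
 have "{t \<in> {..<2 ^ M :: nat}. near a (2 ^ s * (y + real t / 2 ^ M))} \<subseteq> Rs 0 \<union> Rs (2 ^ a - 1)"
 proof
  fix t assume "t \<in> {t \<in> {..<2 ^ M :: nat}. near a (2 ^ s * (y + real t / 2 ^ M))}"
  hence t: "t < 2 ^ M" and nr: "near a (2 ^ s * (y + real t / 2 ^ M))" by auto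
  define x where "x = 2 ^ s * (y + real t / 2 ^ M)"
  have "2 ^ a * x = (2 ^ M * y + real t) / real_of_int Q"
  proof -
   have "(2::real) ^ M = 2 ^ s * 2 ^ a * real_of_int Q"
   unfolding Q_def using sa by (simp add: power_add[symmetric])
   thus ?thesis using Q0 by (simp add: x_def field_simps)
  qed
  hence "\<lfloor>2 ^ a * x\<rfloor> = \<lfloor>2 ^ M * y + real t\<rfloor> div Q"
   using floor_divide_real_eq_div[of Q "2 ^ M * y + real t"] Q0 by simp
  also have "\<lfloor>2 ^ M * y + real t\<rfloor> = n0 + int t" by (simp add: n0_def)
  finally have rt: "r t = \<lfloor>2 ^ a * x\<rfloor> mod 2 ^ a" by (simp add: r_def)
  have "2 ^ a * x = 2 ^ a * frac x + real_of_int (2 ^ a * \<lfloor>x\<rfloor>)" by (simp add: frac_def algebra_simps)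
  hence "\<lfloor>2 ^ a * x\<rfloor> = \<lfloor>2 ^ a * frac x\<rfloor> + 2 ^ a * \<lfloor>x\<rfloor>" by (metis floor_add_int)
  hence rt2: "r t = \<lfloor>2 ^ a * frac x\<rfloor> mod 2 ^ a" using rt by simp
  have b: "0 <= \<lfloor>2 ^ a * frac x\<rfloor>" "\<lfloor>2 ^ a * frac x\<rfloor> < 2 ^ a"
   using frac_lt_1[of x] by (auto simp: floor_less_iff)
  have "\<lfloor>2 ^ a * frac x\<rfloor> = 0 | \<lfloor>2 ^ a * frac x\<rfloor> = 2 ^ a - 1"
  proof (cases "frac x < 1 / 2 ^ a")
   case True
   hence "2 ^ a * frac x < 1" by (simp add: field_simps)
   thus ?thesis using b(1) by linarith
  next
   case False
   hence "1 - 1 / 2 ^ a <= frac x" using nr by (auto simp: near_def x_def)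
   hence "2 ^ a - 1 <= 2 ^ a * frac x" by (simp add: field_simps)
   hence "2 ^ a - 1 <= \<lfloor>2 ^ a * frac x\<rfloor>" by (simp add: le_floor_iff)
   thus ?thesis using b(2) by linarith
  qed
  hence "r t = 0 | r t = 2 ^ a - 1" using rt2 b by (auto simp: mod_pos_pos_trivial)
  thus "t \<in> Rs 0 \<union> Rs (2 ^ a - 1)" using t by (auto simp: Rs_def)
 qed
 hence "card {t \<in> {..<2 ^ M :: nat}. near a (2 ^ s * (y + real t / 2 ^ M))} <= card (Rs 0 \<union> Rs (2 ^ a - 1))"
  by (intro card_mono) (auto simp: Rs_def)
 also have "... <= card (Rs 0) + card (Rs (2 ^ a - 1))" by (rule card_Un_le)
 also have "... <= 2 * 2 ^ (M - a)" using cRs[of 0] cRs[of "2 ^ a - 1"] by simp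
 finally show ?thesis .
qed

lemma floor_translate_eq:
 fixes F :: "'a => real"
 shows "\<lfloor>F a + c\<rfloor> = \<lfloor>F a' + c\<rfloor> \<longleftrightarrow> \<lfloor>F a + frac c\<rfloor> = \<lfloor>F a' + frac c\<rfloor>"
proof -
 have "\<lfloor>F t + c\<rfloor> = \<lfloor>F t + frac c\<rfloor> + \<lfloor>c\<rfloor>" for t unfolding frac_def by linarith
 thus ?thesis by simp
qed

lemma cent_floor_num_translate:
 fixes F :: "'a => real"
 assumes "finite A"
 shows "cent A (%t. \<lfloor>F t + c\<rfloor>) Y <= cent A (%t. \<lfloor>F t\<rfloor>) Y + 2"
  "cent A (%t. \<lfloor>F t\<rfloor>) Y <= cent A (%t. \<lfloor>F t + c\<rfloor>) Y + 2"
proof -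
 have l: "log 2 (2 * real 1 + 2) = (2::real)" using log_nat_power[of 2 2 2] by simp
 have fr: "\<bar>F t + frac c - F t\<bar> <= real 1" "\<bar>F t - (F t + frac c)\<bar> <= real 1" for t
  using frac_lt_1[of c] frac_ge_0[of c] by linarith+
 have eq: "cent A (%t. \<lfloor>F t + c\<rfloor>) Y = cent A (%t. \<lfloor>F t + frac c\<rfloor>) Y"
  by (rule cent_cong; (rule refl | rule floor_translate_eq))
 show "cent A (%t. \<lfloor>F t + c\<rfloor>) Y <= cent A (%t. \<lfloor>F t\<rfloor>) Y + 2"
  unfolding eq using cent_floor_num_close[of A "%t. F t + frac c" F 1 Y, OF assms fr(1)] l by simp
 show "cent A (%t. \<lfloor>F t\<rfloor>) Y <= cent A (%t. \<lfloor>F t + c\<rfloor>) Y + 2"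
  unfolding eq using cent_floor_num_close[of A F "%t. F t + frac c" 1 Y, OF assms fr(2)] l by simp
qed

lemma cent_floor_cond_translate:
 fixes F :: "'a => real"
 assumes "finite A"
 shows "cent A X (%t. \<lfloor>F t + c\<rfloor>) <= cent A X (%t. \<lfloor>F t\<rfloor>) + 2"
  "cent A X (%t. \<lfloor>F t\<rfloor>) <= cent A X (%t. \<lfloor>F t + c\<rfloor>) + 2"
proof -
 have l: "log 2 (2 * real 1 + 2) = (2::real)" using log_nat_power[of 2 2 2] by simp
 have fr: "\<bar>F t + frac c - F t\<bar> <= real 1" "\<bar>F t - (F t + frac c)\<bar> <= real 1" for t
  using frac_lt_1[of c] frac_ge_0[of c] by linarith+
 have eq: "cent A X (%t. \<lfloor>F t + c\<rfloor>) = cent A X (%t. \<lfloor>F t + frac c\<rfloor>)"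
  by (rule cent_cong; (rule refl | rule floor_translate_eq))
 show "cent A X (%t. \<lfloor>F t + c\<rfloor>) <= cent A X (%t. \<lfloor>F t\<rfloor>) + 2"
  unfolding eq using cent_floor_cond_close[of A "%t. F t + frac c" F 1 X, OF assms fr(1)] l by simp
 show "cent A X (%t. \<lfloor>F t\<rfloor>) <= cent A X (%t. \<lfloor>F t + c\<rfloor>) + 2"
  unfolding eq using cent_floor_cond_close[of A F "%t. F t + frac c" 1 X, OF assms fr(2)] l by simp
qed

text \<open>At a given position of the grid much mass may lie near cell boundaries; averaging over
  translations finds a position at which this fails for all scales together. The constant is 4 and
  not 2 because both widths \<open>a'\<close> and \<open>a''\<close> are treated with one
  translation.\<close>

lemma exists_translate_few_near:
 fixes Y :: "'a => real"
 assumes fin: "finite Om"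
 shows "\<exists>\<tau>. \<forall>a\<in>{a', a''}. (\<Sum>s\<le>n. rcard {p \<in> Om. near a (2 ^ s * (Y p + \<tau>))}) <= 4 * real (n + 1) * rcard Om / 2 ^ a"
proof -
 define M where "M = n + a' + a''"
 define N where "N a t = (\<Sum>s\<le>n. rcard {p \<in> Om. near a (2 ^ s * (Y p + real t / 2 ^ M))})" for a and t :: nat
 have avg: "(\<Sum>t<2 ^ M. 2 ^ a * N a t) <= 2 * 2 ^ M * real (n + 1) * rcard Om" if a: "a \<in> {a', a''}" for a
 proof -
  have "(\<Sum>t<2 ^ M. N a t) = (\<Sum>t<2 ^ M. \<Sum>s\<le>n. \<Sum>p\<in>Om. if near a (2 ^ s * (Y p + real t / 2 ^ M)) then 1 else 0)"
   unfolding N_def using fin by (simp add: sum.inter_filter[symmetric])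
  also have "... = (\<Sum>s\<le>n. \<Sum>t<2 ^ M. \<Sum>p\<in>Om. if near a (2 ^ s * (Y p + real t / 2 ^ M)) then 1 else 0)"
   by (rule sum.swap)
  also have "... = (\<Sum>s\<le>n. \<Sum>p\<in>Om. \<Sum>t<2 ^ M. if near a (2 ^ s * (Y p + real t / 2 ^ M)) then 1 else 0)"
   by (intro sum.cong refl sum.swap)
  also have "... <= (\<Sum>s\<le>n. \<Sum>p\<in>Om. 2 * 2 ^ (M - a))"
  proof (intro sum_mono)
   fix s p assume "s \<in> {..n}"
   have "(\<Sum>t<2 ^ M. if near a (2 ^ s * (Y p + real t / 2 ^ M)) then 1 else 0) =
   rcard {t \<in> {..<2 ^ M :: nat}. near a (2 ^ s * (Y p + real t / 2 ^ M))}"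
   by (simp add: sum.inter_filter[symmetric])
   also have "... <= real (2 * 2 ^ (M - a))"
   using card_near_translates[of s a M "Y p"] a \<open>s \<in> {..n}\<close> unfolding of_nat_le_iff by (auto simp: M_def)
   finally show "(\<Sum>t<2 ^ M. if near a (2 ^ s * (Y p + real t / 2 ^ M)) then 1 else 0) <= (2 * 2 ^ (M - a) :: real)"
   by simp
  qed
  also have "... = 2 * 2 ^ (M - a) * real (n + 1) * rcard Om" by simp
  finally have "2 ^ a * (\<Sum>t<2 ^ M. N a t) <= 2 ^ a * (2 * 2 ^ (M - a) * real (n + 1) * rcard Om)"
   by (intro mult_left_mono) auto
  also have "... = 2 * (2 ^ a * 2 ^ (M - a)) * real (n + 1) * rcard Om" by (simp only: mult_ac)
  also have "(2::real) ^ a * 2 ^ (M - a) = 2 ^ M" using a by (auto simp: power_add[symmetric] M_def)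
  finally show ?thesis by (simp only: sum_distrib_left)
 qed
 have "\<exists>t\<in>{..<2 ^ M}. 2 ^ a' * N a' t + 2 ^ a'' * N a'' t <= 4 * real (n + 1) * rcard Om"
 proof (rule ccontr)
  assume "~ ?thesis"
  hence "(\<Sum>t<2 ^ M :: nat. 4 * real (n + 1) * rcard Om) < (\<Sum>t<2 ^ M. 2 ^ a' * N a' t + 2 ^ a'' * N a'' t)"
   by (intro sum_strict_mono) (auto simp: not_le lessThan_empty_iff)
  also have "... = (\<Sum>t<2 ^ M. 2 ^ a' * N a' t) + (\<Sum>t<2 ^ M. 2 ^ a'' * N a'' t)" by (rule sum.distrib)
  finally show False using avg[of a'] avg[of a''] by (simp add: algebra_simps)
 qed
 then obtain t where t: "2 ^ a' * N a' t + 2 ^ a'' * N a'' t <= 4 * real (n + 1) * rcard Om" by auto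
 have N0: "0 <= 2 ^ a * N a t" for a unfolding N_def by (auto intro!: mult_nonneg_nonneg sum_nonneg)
 have "2 ^ a * N a t <= 4 * real (n + 1) * rcard Om" if "a \<in> {a', a''}" for a
  using t N0[of a'] N0[of a''] that by auto
 hence "\<forall>a\<in>{a', a''}. N a t <= 4 * real (n + 1) * rcard Om / 2 ^ a"
  by (simp add: field_simps)
 thus ?thesis unfolding N_def by blast
qed

text \<open>\<open>D\<close> bounds, up to constants, the information that the word carries about
  the sum: the entropy \<open>E\<close> of the sum less the least entropy \<open>l K\<close> of
  \<open>z\<close>. Moving \<open>f\<close> to a good position costs bounded constants. The chain
  rule then passes from the entropy of \<open>f\<close> given the sum to that of \<open>f\<close>
  itself at the price of another \<open>D\<close>.\<close>

lemma inverse_bound: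
 fixes f z :: "nat => real" and A A' A'' K C :: nat and dl M E c D :: real and l :: "nat => real"
  and Om1 Om2 :: "nat set"
 defines "Y == %p. f (fst p) + z (snd p)"
 defines "Om == Om1 \<times> Om2"
 defines "E == cent Om (%p. dya K (Y p)) (%p. dya 0 (Y p))"
 defines "c == log 2 (2 * real C + 2)"
 defines "D == E - l K + 10 + 2 * c"
 assumes fin: "finite Om1" "finite Om2" and ne: "Om1 ~= {}" "Om2 ~= {}" and A: "A' < A" "A'' <= A" "A <= K"
  and dl: "0 < dl" and C: "!!j. j \<in> Om2 ==> \<bar>z j\<bar> <= real C"
  and fat: "!!s. s <= K ==> fat_at l K Om2 z s"
  and M: "0 <= M" "M = 0 | M + 2 <= l (A - A'')" "M < log 2 (1 / (4 * dl))"
 shows "cent Om1 (%w. dya K (f w)) (%w. dya 0 (f w)) <=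
  real A + 2 * real (K - A + 1) / real (A - A') + 2 ^ (A + 1) * real A * D / dl\<^sup>2 +
  4 * real (K - A + 1) / 2 ^ A' / dl +
  (real A * (E + 4) - real (K - A + 1) * M + M * (4 * real (K - A + 1) / 2 ^ A'')) / (log 2 (1 / (4 * dl)) - M) + D"
proof -
 have finO: "finite Om" unfolding Om_def using fin by auto
 have cO: "0 < rcard Om" unfolding Om_def using fin ne by (auto simp: card_gt_0_iff)
 have c0: "0 <= c" unfolding c_def by simp
 obtain \<tau> where \<tau>: "!!a. a \<in> {A', A''} ==>
   (\<Sum>s\<le>K - A. rcard {p \<in> Om. near a (2 ^ s * (Y p + \<tau>))}) <= 4 * real (K - A + 1) * rcard Om / 2 ^ a"
  using exists_translate_few_near[OF finO, where a'=A' and a''=A'' and n="K - A" and Y=Y] by blast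
 define f' where "f' w = f w + \<tau>" for w
 define Y' where "Y' p = f' (fst p) + z (snd p)" for p
 have Y'Y: "Y' p = Y p + \<tau>" for p by (simp add: Y'_def Y_def f'_def)
 define NB where "NB a = (\<Sum>s\<le>K - A. rcard {p \<in> Om. near a (2 ^ s * Y' p)} / rcard Om)" for a
 have NB: "NB a <= 4 * real (K - A + 1) / 2 ^ a" if "a \<in> {A', A''}" for a
  using \<tau>[OF that] cO unfolding NB_def Y'Y sum_divide_distrib[symmetric] by (simp add: field_simps)
 define E' where "E' = cent Om (%p. dya K (Y' p)) (%p. dya 0 (Y' p))"
 define X' where "X' = cent Om (%p. dya K (Y' p)) (%p. (dya 0 (Y' p), fst p))"
 have E'E: "E' <= E + 4"
 proof -
  have "E' <= cent Om (%p. dya K (Y p)) (%p. dya 0 (Y' p)) + 2"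
   unfolding E'_def using cent_floor_num_translate(1)[OF finO, of "%p. 2 ^ K * Y p" "2 ^ K * \<tau>"]
   by (simp add: dya_def Y'Y distrib_left)
  also have "cent Om (%p. dya K (Y p)) (%p. dya 0 (Y' p)) <= E + 2"
   unfolding E_def using cent_floor_cond_translate(1)[OF finO, of _ Y \<tau>]
   by (simp add: dya_def Y'Y)
  finally show ?thesis by simp
 qed
 have XE: "X' <= E'" unfolding X'_def E'_def by (rule cent_antimono[OF finO]) (simp add: refines_def)
 have lK: "l K - 2 <= cent Om (%p. dya K (Y' p)) fst"
 proof -
  obtain U :: "nat => nat" where U: "\<forall>j\<in>Om2. \<forall>T. 0 + T <= K --> l T <= ent (fib Om2 U j) (%j. dya (0 + T) (z j))"
   using fat[of 0] by blast
  have "l K <= ent Om2 (%j. dya K (z j))"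
  proof -
   have "l K * rcard Om2 = (\<Sum>j\<in>Om2. l K)" by simp
   also have "... <= (\<Sum>j\<in>Om2. ent (fib Om2 U j) (%j. dya K (z j)))"
   using U by (intro sum_mono) auto
   finally have "l K <= (\<Sum>j\<in>Om2. ent (fib Om2 U j) (%j. dya K (z j))) / rcard Om2"
   using fin ne by (simp add: le_divide_eq card_gt_0_iff)
   also have "... = cent Om2 (%j. dya K (z j)) U" by (rule cent_fibers_ent[OF fin(2), symmetric])
   also have "... <= ent Om2 (%j. dya K (z j))"
   unfolding ent_def by (rule cent_antimono[OF fin(2)]) (simp add: refines_def)
   finally show ?thesis .
  qed
  hence "l K - 2 <= ent Om2 (%j. dya K (Y' (w, j)))" for w
   using ent_floor_translate[OF fin(2), of "%j. 2 ^ K * (f' w + z j)" "%j. 2 ^ K * z j" "2 ^ K * f' w"]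
   by (simp add: dya_def Y'_def distrib_left add.commute)
  hence "(\<Sum>w\<in>Om1. l K - 2) <= (\<Sum>w\<in>Om1. ent Om2 (%j. dya K (Y' (w, j))))" by (intro sum_mono)
  thus ?thesis unfolding Om_def cent_Times_fst[OF fin] using fin ne
   by (simp add: le_divide_eq card_gt_0_iff mult.commute)
 qed
 have log1: "log 2 (real (2 * C) + 1) <= c" unfolding c_def by simp
 have d0: "cent Om (%p. dya 0 (Y' p)) fst <= c"
 proof -
  have "cent Om (%p. \<lfloor>Y' p\<rfloor>) fst <= log 2 (real (2 * C) + 1)"
  proof (rule cent_floor_le[OF finO])
   fix p q assume "p \<in> Om" "q \<in> Om" "fst p = fst q"
   thus "Y' p - Y' q <= real (2 * C)"
   using C[of "snd p"] C[of "snd q"] by (auto simp: Y'_def Om_def abs_le_iff)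
  qed
  thus ?thesis using log1 by (simp add: dya_def)
 qed
 have X'l: "l K - 2 - c <= X'"
 proof -
  have "cent Om (%p. dya K (Y' p)) fst <= cent Om (%p. dya K (Y' p)) (%p. (fst p, dya 0 (Y' p))) + cent Om (%p. dya 0 (Y' p)) fst"
   by (rule cent_le_cond_add[OF finO])
  moreover have "cent Om (%p. dya K (Y' p)) (%p. (fst p, dya 0 (Y' p))) = X'"
   unfolding X'_def by (rule cent_cong) auto
  ultimately show ?thesis using lK d0 by linarith
 qed
 have I: "E' - X' <= D" unfolding D_def using E'E X'l c0 by linarith
 define H where "H = log 2 (1 / (4 * dl))"
 have HM: "0 < H - M" using M(3) by (simp add: H_def)
 define Ph where "Ph = cent Om (%p. dya K (f' (fst p))) (%p. (dya 0 (f' (fst p)), dya K (Y' p)))"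
 have "Ph <= real A + 2 * real (K - A + 1) / real (A - A') + 2 ^ (A + 1) * real A * (E' - X') / dl\<^sup>2 +
   NB A' / dl + (real A * X' - real (K - A + 1) * M + M * NB A'') / (H - M)"
  unfolding Ph_def E'_def X'_def NB_def Y'_def H_def Om_def
  by (rule multi_scale[OF fin ne A dl fat M])
 also have "... <= real A + 2 * real (K - A + 1) / real (A - A') + 2 ^ (A + 1) * real A * D / dl\<^sup>2 +
   4 * real (K - A + 1) / 2 ^ A' / dl +
   (real A * (E + 4) - real (K - A + 1) * M + M * (4 * real (K - A + 1) / 2 ^ A'')) / (H - M)"
  using I NB[of A'] NB[of A''] dl HM XE E'E M(1)
  by (intro add_mono mult_left_mono divide_right_mono order_refl diff_right_mono) auto
 finally have PhB: "Ph <= ..." .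
 have "cent Om1 (%w. dya K (f w)) (%w. dya 0 (f w)) = cent Om (%p. dya K (f (fst p))) (%p. dya 0 (f (fst p)))"
  unfolding Om_def by (rule cent_Times_snd_free[OF fin ne(2), symmetric])
 also have "... <= cent Om (%p. dya K (f' (fst p))) (%p. dya 0 (f (fst p))) + 2"
  using cent_floor_num_translate(2)[OF finO, of "%p. 2 ^ K * f (fst p)" _ "2 ^ K * \<tau>"]
  by (simp add: dya_def f'_def distrib_left)
 also have "cent Om (%p. dya K (f' (fst p))) (%p. dya 0 (f (fst p))) <= cent Om (%p. dya K (f' (fst p))) (%p. dya 0 (f' (fst p))) + 2"
  using cent_floor_cond_translate(2)[OF finO, of _ "%p. f (fst p)" \<tau>]
  by (simp add: dya_def f'_def)
 also have "cent Om (%p. dya K (f' (fst p))) (%p. dya 0 (f' (fst p))) =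
   Ph + cent Om (%p. dya K (Y' p)) (%p. dya 0 (f' (fst p))) - cent Om (%p. dya K (Y' p)) (%p. (dya 0 (f' (fst p)), dya K (f' (fst p))))"
 proof -
  have "cent Om (%p. (dya K (f' (fst p)), dya K (Y' p))) (%p. dya 0 (f' (fst p))) =
   cent Om (%p. (dya K (Y' p), dya K (f' (fst p)))) (%p. dya 0 (f' (fst p)))"
   by (rule cent_cong) auto
  thus ?thesis unfolding cent_chain[OF finO] Ph_def by linarith
 qed
 finally have "cent Om1 (%w. dya K (f w)) (%w. dya 0 (f w)) <= Ph +
   cent Om (%p. dya K (Y' p)) (%p. dya 0 (f' (fst p))) -
   cent Om (%p. dya K (Y' p)) (%p. (dya 0 (f' (fst p)), dya K (f' (fst p)))) + 2 + 2" by simp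
 moreover have "cent Om (%p. dya K (Y' p)) fst <= cent Om (%p. dya K (Y' p)) (%p. (dya 0 (f' (fst p)), dya K (f' (fst p))))"
  by (rule cent_antimono[OF finO]) (simp add: refines_def)
 moreover have "cent Om (%p. dya K (Y' p)) (%p. dya 0 (f' (fst p))) <= E' + cent Om (%p. dya 0 (Y' p)) (%p. dya 0 (f' (fst p)))"
  unfolding E'_def by (rule cent_triangle[OF finO])
 moreover have "cent Om (%p. dya 0 (Y' p)) (%p. dya 0 (f' (fst p))) <= c"
 proof -
  have "cent Om (%p. \<lfloor>Y' p\<rfloor>) (%p. \<lfloor>f' (fst p)\<rfloor>) <= log 2 (real (2 * C + 1) + 1)"
  proof (rule cent_floor_le[OF finO])
   fix p q assume pq: "p \<in> Om" "q \<in> Om" "\<lfloor>f' (fst p)\<rfloor> = \<lfloor>f' (fst q)\<rfloor>"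
   have "f' (fst p) - f' (fst q) <= 1" using pq(3) by linarith
   thus "Y' p - Y' q <= real (2 * C + 1)"
   using C[of "snd p"] C[of "snd q"] pq by (auto simp: Y'_def Om_def abs_le_iff)
  qed
  thus ?thesis by (simp add: dya_def c_def add.commute)
 qed
 ultimately have "cent Om1 (%w. dya K (f w)) (%w. dya 0 (f w)) <= Ph + D"
  using lK E'E c0 unfolding D_def by linarith
 thus ?thesis using PhB unfolding H_def by linarith
qed


text \<open>A choice of parameters. The saturation level
  \<open>log 2 (1 / (4 * dl)) = (B + d) * A\<close> lies strictly between the typical cell entropy
  \<open>B * A\<close> and the full entropy \<open>A\<close>. The boundary width \<open>A'\<close>,
  about \<open>(B + 2 * d) * A\<close>, makes the boundary mass \<open>2 ^ - A'\<close> negligible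
  against \<open>dl\<close> and still leaves about \<open>2 * d * A\<close> digits of each window
  under control. \<open>M\<close>, slightly below \<open>B * A\<close>, is the guaranteed cell
  entropy. \<open>A\<close> is fixed before \<open>et\<close>, because the information is multiplied
  by \<open>G\<close>, which is exponential in \<open>A\<close>; \<open>K\<close> comes
  last.\<close>

theorem inverse_theorem:
 fixes B ep :: real and l :: "nat => real" and C :: nat
 assumes B: "0 <= B" "B < 1" and ep: "0 < ep"
  and lim: "!!e. 0 < e ==> \<exists>T0. \<forall>T\<ge>T0. (B - e) * real T <= l T"
 shows "\<exists>et>0. \<exists>K0. \<forall>K\<ge>K0. \<forall>(f :: nat => real) (z :: nat => real) Om1 Om2.
  finite Om1 --> finite Om2 --> Om1 ~= {} --> Om2 ~= {} --> (\<forall>j\<in>Om2. \<bar>z j\<bar> <= real C) -->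
  (\<forall>s\<le>K. fat_at l K Om2 z s) -->
  cent (Om1 \<times> Om2) (%p. dya K (f (fst p) + z (snd p))) (%p. dya 0 (f (fst p) + z (snd p))) <= (B + et) * real K -->
  cent Om1 (%w. dya K (f w)) (%w. dya 0 (f w)) <= ep * real K"
proof -
 define d where "d = (1 - B) / 4"
 have d: "0 < d" "B + 4 * d = 1" using B by (auto simp: d_def field_simps)
 define e where "e = ep * d / 32"
 have e: "0 < e" using d ep by (simp add: e_def)
 \<comment> \<open>\<open>A''\<close> is the width at which a piece of \<open>z\<close> may meet a
   cell boundary. It must make \<open>4 / 2 ^ A''\<close> small against \<open>ep * d\<close> and
   stays fixed while \<open>A\<close> grows.\<close>
 obtain A'' where A'': "64 / (ep * d) < 2 ^ A''" using real_arch_pow[of 2 "64 / (ep * d)"] by auto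
 obtain T0 where T0: "!!T. T >= T0 ==> (B - e / 2) * real T <= l T" using lim[of "e / 2"] e by auto
 obtain A :: nat where A0: "(16 / ep + 2) / (2 * d) + \<bar>log 2 (128 / ep) / d\<bar> + real T0 + real A'' + 2 * (real A'' + 2) / e + 1 < real A"
  using reals_Archimedean2 by blast
 have pos: "0 <= (16 / ep + 2) / (2 * d)" "0 <= \<bar>log 2 (128 / ep) / d\<bar>" "0 <= 2 * (real A'' + 2) / e"
  using ep d e by auto
 have A1: "(16 / ep + 2) / (2 * d) <= real A" and A2: "log 2 (128 / ep) / d <= real A"
  and A3: "real T0 + real A'' <= real A" and A4: "2 * (real A'' + 2) / e <= real A" and A5: "1 <= real A"
  using A0 pos by linarith+
 have A1': "16 / ep + 2 <= 2 * d * real A" using A1 d by (simp add: field_simps)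
 have A2': "log 2 (128 / ep) <= d * real A" using A2 d by (simp add: field_simps)
 have A4': "real A'' + 2 <= (e / 2) * real A" using A4 e by (simp add: field_simps)
 define A' where "A' = nat \<lceil>(B + 2 * d) * real A\<rceil>"
 have A'r: "(B + 2 * d) * real A <= real A'" "real A' < (B + 2 * d) * real A + 1"
 proof -
  have nn: "0 <= (B + 2 * d) * real A" using B d by simp
  hence "real A' = of_int \<lceil>(B + 2 * d) * real A\<rceil>" unfolding A'_def by simp
  thus "(B + 2 * d) * real A <= real A'" "real A' < (B + 2 * d) * real A + 1" by linarith+
 qed
 have "(B + 2 * d) * real A = real A - 2 * d * real A"
 proof -
  have "B + 2 * d = 1 - 2 * d" using d(2) by simp
  thus ?thesis by (simp only: left_diff_distrib mult_1_left)
 qed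
 hence AA': "16 / ep <= real A - real A'" using A'r A1' by linarith
 have A'A: "A' < A" using AA' ep by (smt (verit) divide_pos_pos of_nat_less_iff)
 have A''A: "A'' <= A" using A3 by linarith
 define dl where "dl = 2 powr (- ((B + d) * real A)) / 4"
 have dl: "0 < dl" by (simp add: dl_def)
 have H: "log 2 (1 / (4 * dl)) = (B + d) * real A"
 proof -
  have "1 / (4 * dl) = 2 powr ((B + d) * real A)" by (simp add: dl_def powr_minus_divide)
  thus ?thesis by simp
 qed
 define M where "M = max 0 ((B - e) * real A)"
 have MB: "M <= B * real A" "M <= real A" "(B - e) * real A <= M" "0 <= M"
 proof -
  have "(B - e) * real A <= B * real A" using e by (intro mult_right_mono) auto
  moreover have "0 <= B * real A" using B by simp
  ultimately show "M <= B * real A" by (simp add: M_def)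
  also have "... <= 1 * real A" using B by (intro mult_right_mono) auto
  finally show "M <= real A" by simp
 qed (auto simp: M_def)
 have HM: "d * real A <= log 2 (1 / (4 * dl)) - M" unfolding H using MB(1) by (simp add: algebra_simps)
 have dA: "0 < d * real A" using d A5 by simp
 have Ml: "M = 0 | M + 2 <= l (A - A'')"
 proof (cases "M = 0")
  case False
  hence Me: "M = (B - e) * real A" by (auto simp: M_def max_def split: if_splits)
  have "(B - e / 2) * real (A - A'') <= l (A - A'')" using T0[of "A - A''"] A3 A''A by (simp add: of_nat_diff)
  moreover have "M + 2 <= (B - e / 2) * real (A - A'')"
  proof -
   have "(B - e / 2) * real (A - A'') = B * real A - (e / 2) * real A - B * real A'' + (e / 2) * real A''"
   using A''A by (simp add: of_nat_diff left_diff_distrib right_diff_distrib)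
   moreover have "B * real A'' <= real A''" using B mult_right_mono[of B 1 "real A''"] by simp
   moreover have "0 <= (e / 2) * real A''" using e by simp
   moreover have "M = B * real A - (e / 2) * real A - (e / 2) * real A" by (simp add: Me algebra_simps)
   ultimately show ?thesis using A4' by linarith
  qed
  ultimately show ?thesis by linarith
 qed simp
 define G where "G = 2 ^ (A + 1) * real A / dl\<^sup>2"
 have G: "0 < G" using A5 dl by (simp add: G_def)
 define et where "et = min e (min (ep / 16) (ep / (16 * G)))"
 have et: "0 < et" "et <= e" "et <= ep / 16" using e ep G by (auto simp: et_def)
 have etG: "G * et <= ep / 16"
 proof -
  have "G * et <= G * (ep / (16 * G))" using G by (intro mult_left_mono) (auto simp: et_def)
  thus ?thesis using G by simp
 qed
 obtain T1 where T1: "!!T. T >= T1 ==> (B - et) * real T <= l T" using lim[OF et(1)] by auto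
 define c where "c = log 2 (2 * real C + 2)"
 have c0: "0 <= c" by (simp add: c_def)
 define Z0 where "Z0 = real A + (G + 1) * (10 + 2 * c) + (4 + real A) / d"
 obtain K1 :: nat where K1: "8 * Z0 / ep < real K1" using reals_Archimedean2 by blast
 define K0 where "K0 = max (max A T1) K1"
 have "cent Om1 (%w. dya K (f w)) (%w. dya 0 (f w)) <= ep * real K"
  if K: "K >= K0" and fin: "finite Om1" "finite Om2" and ne: "Om1 ~= {}" "Om2 ~= {}" and C: "\<forall>j\<in>Om2. \<bar>z j\<bar> <= real C"
   and fat: "\<forall>s\<le>K. fat_at l K Om2 z s"
   and EB: "cent (Om1 \<times> Om2) (%p. dya K (f (fst p) + z (snd p))) (%p. dya 0 (f (fst p) + z (snd p))) <= (B + et) * real K"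
  for K and f z :: "nat => real" and Om1 Om2
 proof -
  define E where "E = cent (Om1 \<times> Om2) (%p. dya K (f (fst p) + z (snd p))) (%p. dya 0 (f (fst p) + z (snd p)))"
  define D where "D = E - l K + 10 + 2 * c"
  define k where "k = real K"
  define r where "r = real (K - A + 1)"
  have KA: "A <= K" "T1 <= K" "K1 <= K" using K by (auto simp: K0_def)
  have k0: "0 < k" using KA A5 by (simp add: k_def)
  have r: "r <= k" "0 <= r" "r = k - real A + 1" using KA A5 by (auto simp: r_def k_def of_nat_diff)
  have bnd: "cent Om1 (%w. dya K (f w)) (%w. dya 0 (f w)) <=
   real A + 2 * r / real (A - A') + 2 ^ (A + 1) * real A * D / dl\<^sup>2 + 4 * r / 2 ^ A' / dl +
   (real A * (E + 4) - r * M + M * (4 * r / 2 ^ A'')) / (log 2 (1 / (4 * dl)) - M) + D"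
   unfolding D_def E_def c_def r_def
   by (rule inverse_bound[OF fin ne A'A A''A KA(1) dl])
   (use C fat MB Ml HM dA in auto)
  have E: "E <= (B + et) * k" using EB by (simp add: E_def k_def)
  have lK: "(B - et) * k <= l K" using T1[OF KA(2)] by (simp add: k_def)
  have D: "D <= 2 * et * k + 10 + 2 * c" using E lK unfolding D_def by (simp add: algebra_simps)
  have t1: "2 * r / real (A - A') <= (ep / 8) * k"
  proof -
   have "2 * r / real (A - A') <= 2 * k / (16 / ep)"
   using r AA' A'A ep k0 by (intro frac_le) (auto simp: of_nat_diff)
   thus ?thesis by (simp add: mult.commute)
  qed
  have t2: "2 ^ (A + 1) * real A * D / dl\<^sup>2 <= (ep / 8) * k + G * (10 + 2 * c)"
  proof -
   have "2 ^ (A + 1) * real A * D / dl\<^sup>2 = G * D" by (simp add: G_def)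
   also have "... <= G * (2 * et * k + (10 + 2 * c))" using D G by (intro mult_left_mono) auto
   also have "... = 2 * k * (G * et) + G * (10 + 2 * c)" by (simp add: algebra_simps)
   also have "2 * k * (G * et) <= 2 * k * (ep / 16)" using etG k0 by (intro mult_left_mono) auto
   finally show ?thesis by (simp add: mult.commute)
  qed
  have t3: "4 * r / 2 ^ A' / dl <= (ep / 8) * k"
  proof -
   have "2 ^ A' * dl = 2 powr (real A' - (B + d) * real A) / 4"
   by (simp add: dl_def powr_realpow[symmetric] powr_add[symmetric] left_diff_distrib)
   also have "... >= 2 powr (d * real A) / 4"
   using A'r(1) by (intro divide_right_mono powr_mono) (auto simp: algebra_simps)
   finally have "2 powr (d * real A) / 4 <= 2 ^ A' * dl" .
   moreover have "2 powr (log 2 (128 / ep)) <= 2 powr (d * real A)" using A2' by (intro powr_mono) auto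
   moreover have "2 powr (log 2 (128 / ep)) = 4 * (32 / ep)" using ep by simp
   ultimately have "32 / ep <= 2 ^ A' * dl" by linarith
   hence "4 * r / (2 ^ A' * dl) <= 4 * k / (32 / ep)" using r ep k0 by (intro frac_le) auto
   thus ?thesis by (simp add: mult.commute)
  qed
  have t4: "(real A * (E + 4) - r * M + M * (4 * r / 2 ^ A'')) / (log 2 (1 / (4 * dl)) - M) <=
   (ep / 8) * k + (4 + real A) / d"
  proof -
   define N where "N = real A * ((et + e) * k + 4 + real A + k * (ep * d / 16))"
   have "real A * (E + 4) <= real A * ((B + et) * k + 4)" using E by (intro mult_left_mono) auto
   moreover have "r * M >= k * ((B - e) * real A) - real A * real A"
   proof -
   have "k * ((B - e) * real A) <= k * M" using MB k0 by (intro mult_left_mono) auto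
   moreover have "r * M = k * M - real A * M + M" unfolding r(3) by (simp add: left_diff_distrib distrib_right)
   moreover have "real A * M <= real A * real A" using MB by (intro mult_left_mono) auto
   ultimately show ?thesis using MB by linarith
   qed
   moreover have "M * (4 * r / 2 ^ A'') <= real A * (k * (ep * d / 16))"
   proof (rule mult_mono)
   have "64 <= 2 ^ A'' * (ep * d)" using A'' ep d by (simp add: field_simps)
   hence "4 / 2 ^ A'' <= ep * d / 16" by (simp add: field_simps)
   hence "r * (4 / 2 ^ A'') <= k * (ep * d / 16)" using r k0 by (intro mult_mono) auto
   thus "4 * r / 2 ^ A'' <= k * (ep * d / 16)" by (simp add: mult.commute)
   qed (use MB r in auto)
   ultimately have "real A * (E + 4) - r * M + M * (4 * r / 2 ^ A'') <=
   real A * ((B + et) * k + 4) - (k * ((B - e) * real A) - real A * real A) + real A * (k * (ep * d / 16))"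
   by linarith
   also have "... = N" by (simp add: N_def algebra_simps)
   finally have "(real A * (E + 4) - r * M + M * (4 * r / 2 ^ A'')) / (log 2 (1 / (4 * dl)) - M) <=
   N / (log 2 (1 / (4 * dl)) - M)"
   using HM dA by (intro divide_right_mono) auto
   also have "... <= N / (d * real A)"
   using HM dA et e k0 ep d by (intro divide_left_mono) (auto simp: N_def intro!: mult_nonneg_nonneg add_nonneg_nonneg)
   also have "... = ((et + e) * k + 4 + real A + k * (ep * d / 16)) / d"
   using A5 by (simp add: N_def)
   also have "... = (et + e) / d * k + (4 + real A) / d + k * ep / 16"
   using d(1) by (simp add: field_simps)
   also have "(et + e) / d * k <= (ep / 16) * k"
   proof (rule mult_right_mono)
   have "(et + e) / d <= (2 * e) / d" using et d by (intro divide_right_mono) auto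
   thus "(et + e) / d <= ep / 16" using d(1) by (simp add: e_def)
   qed (use k0 in auto)
   finally show ?thesis by (simp add: algebra_simps)
  qed
  have t5: "D <= (ep / 8) * k + 10 + 2 * c"
  proof -
   have "2 * et * k <= 2 * (ep / 16) * k" using et k0 by (intro mult_right_mono) auto
   thus ?thesis using D by simp
  qed
  have "8 * Z0 / ep <= k" using K1 KA(3) by (simp add: k_def)
  hence Z0: "Z0 <= (ep / 8) * k" using ep by (simp add: field_simps)
  have Z0e: "Z0 = real A + G * (10 + 2 * c) + (10 + 2 * c) + (4 + real A) / d"
   by (simp add: Z0_def algebra_simps)
  have "cent Om1 (%w. dya K (f w)) (%w. dya 0 (f w)) <= 6 * ((ep / 8) * k)"
  proof -
   have "cent Om1 (%w. dya K (f w)) (%w. dya 0 (f w)) <= real A + (ep / 8) * k + ((ep / 8) * k + G * (10 + 2 * c)) +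
   (ep / 8) * k + ((ep / 8) * k + (4 + real A) / d) + ((ep / 8) * k + 10 + 2 * c)"
   by (rule order_trans[OF bnd]) (intro add_mono t1 t2 t3 t4 t5 order_refl)
   also have "... = 5 * ((ep / 8) * k) + Z0" unfolding Z0e by simp
   finally show ?thesis using Z0 by linarith
  qed
  also have "... <= ep * k" using ep k0 by simp
  finally show ?thesis by (simp add: k_def)
 qed
 note main = this
 show ?thesis
  by (intro exI[of _ et] exI[of _ K0] conjI allI impI et(1)) (rule main; assumption)
qed

section \<open>Entropy of the fibre measures\<close>

lemma word_image:
 assumes "0 < b"
 shows "(%p. fst p + b ^ n * snd p) ` ({..<b ^ n} \<times> {..<b ^ m}) = {..<b ^ (n + m) :: nat}"
  "inj_on (%p. fst p + b ^ n * snd p) ({..<b ^ n} \<times> {..<b ^ m :: nat})"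
proof -
 let ?h = "%p. fst p + b ^ n * snd p"
 have bn: "0 < b ^ n" using assms by simp
 show inj: "inj_on ?h ({..<b ^ n} \<times> {..<b ^ m})"
 proof (rule inj_onI)
  fix p q assume p: "p \<in> {..<b ^ n} \<times> {..<b ^ m}" and q: "q \<in> {..<b ^ n} \<times> {..<b ^ m}" and eq: "?h p = ?h q"
  have "?h p mod b ^ n = fst p" "?h q mod b ^ n = fst q" using p q by auto
  moreover have "?h p div b ^ n = snd p" "?h q div b ^ n = snd q" using p q bn by auto
  ultimately show "p = q" using eq by (metis prod_eqI)
 qed
 show "?h ` ({..<b ^ n} \<times> {..<b ^ m}) = {..<b ^ (n + m)}"
 proof (rule card_subset_eq)
  show "?h ` ({..<b ^ n} \<times> {..<b ^ m}) \<subseteq> {..<b ^ (n + m)}"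
  proof clarsimp
   fix w v assume w: "w < b ^ n" and v: "v < b ^ m"
   have "w + b ^ n * v < b ^ n * (v + 1)" using w by simp
   also have "... <= b ^ n * b ^ m" using v by (intro mult_left_mono) auto
   finally show "w + b ^ n * v < b ^ (n + m)" by (simp add: power_add)
  qed
  show "card (?h ` ({..<b ^ n} \<times> {..<b ^ m})) = card {..<b ^ (n + m)}"
   using inj by (simp add: card_image card_cartesian_product power_add)
 qed simp
qed

lemma cent_words:
 assumes "0 < b"
 shows "cent {..<b ^ (n + m) :: nat} X Y =
  cent ({..<b ^ n} \<times> {..<b ^ m}) (%p. X (fst p + b ^ n * snd p)) (%p. Y (fst p + b ^ n * snd p))"
 using cent_image[OF word_image(2)[OF assms, of n m], of X Y] by (simp add: word_image(1)[OF assms])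

section \<open>Lebesgue measure on the unit interval\<close>

definition U01 :: "real measure" where "U01 = restrict_space lborel {0..<1}"

lemma space_U01: "space U01 = {0..<1}" by (simp add: U01_def space_restrict_space)

lemma prob_space_U01: "prob_space U01"
 by (rule prob_spaceI) (simp add: U01_def emeasure_restrict_space space_restrict_space)

interpretation U01: prob_space U01 by (rule prob_space_U01)

lemma measurable_U01: "f \<in> borel_measurable borel ==> f \<in> borel_measurable U01"
 unfolding U01_def by (intro measurable_restrict_space1) simp

lemma integrable_U01_bounded:
 fixes f :: "real => real"
 assumes "f \<in> borel_measurable borel" "!!x. x \<in> {0..<1} ==> \<bar>f x\<bar> <= C"
 shows "integrable U01 f"
 using assms by (intro U01.integrable_const_bound[where B=C] AE_I2 measurable_U01) (auto simp: space_U01)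

lemma integral_U01: "(\<integral>x. f x \<partial>U01) = (\<integral>x. indicator {0..<1} x * f x \<partial>lborel)" for f :: "real => real"
 unfolding U01_def by (subst integral_restrict_space) auto

lemma integral_U01_step:
 fixes c :: "nat => real"
 assumes "0 < N"
 shows "(\<integral>x. c (nat \<lfloor>real N * x\<rfloor>) \<partial>U01) = (\<Sum>w<N. c w) / real N"
proof -
 have eq: "indicator {0..<1} x * c (nat \<lfloor>real N * x\<rfloor>) = (\<Sum>w<N. c w * indicator {real w / real N..<(real w + 1) / real N} x)" for x :: real
 proof (cases "x \<in> {0..<1}")
  case True
  define w0 where "w0 = nat \<lfloor>real N * x\<rfloor>"
  have w0: "real w0 <= real N * x" "real N * x < real w0 + 1" using True assms
   by (auto simp: w0_def)
  have "real N * x < real N" using True assms by simp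
  hence w0N: "w0 < N" using w0 by linarith
  have "x \<in> {real w / real N..<(real w + 1) / real N} \<longleftrightarrow> w = w0" for w
  proof -
   have "x \<in> {real w / real N..<(real w + 1) / real N} \<longleftrightarrow> real w <= real N * x & real N * x < real w + 1"
   using assms by (auto simp: field_simps)
   also have "... \<longleftrightarrow> w = w0" using w0 by linarith
   finally show ?thesis .
  qed
  hence "(\<Sum>w<N. c w * indicator {real w / real N..<(real w + 1) / real N} x) = (\<Sum>w<N. if w = w0 then c w else 0)"
   by (intro sum.cong) (auto simp: indicator_def)
  thus ?thesis using True w0N by (simp add: w0_def)
 next
  case False
  have "x \<notin> {real w / real N..<(real w + 1) / real N}" if "w < N" for w
  proof
   assume h: "x \<in> {real w / real N..<(real w + 1) / real N}"
   have "0 <= real w / real N" by simp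
   moreover have "(real w + 1) / real N <= 1" using that assms by (simp add: field_simps)
   ultimately have "0 <= x" "x < 1" using h by (auto simp del: divide_nonneg_nonneg intro: order_trans less_le_trans)
   thus False using False by simp
  qed
  thus ?thesis using False by (simp add: sum.neutral)
 qed
 have len: "measure lborel {real w / real N..<(real w + 1) / real N} = 1 / real N" for w
  using assms by (simp add: divide_right_mono diff_divide_distrib[symmetric])
 have "(\<integral>x. c (nat \<lfloor>real N * x\<rfloor>) \<partial>U01) = (\<Sum>w<N. c w * measure lborel {real w / real N..<(real w + 1) / real N})"
  unfolding integral_U01 eq by (subst Bochner_Integration.integral_sum) (auto intro!: integrable_mult_right integrable_real_indicator simp: divide_right_mono)
 thus ?thesis unfolding len by (simp add: sum_divide_distrib)
qed

lemma ent_eq_sum: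
 assumes "finite A"
 shows "ent A X = (\<Sum>a\<in>A. log 2 (rcard A / (\<Sum>t\<in>A. if X t = X a then 1 else 0))) / rcard A"
proof -
 have "rcard (fib A (%t. (X t, ())) a) = (\<Sum>t\<in>A. if X t = X a then 1 else 0)" for a
  unfolding fib_def using assms by (simp add: sum.inter_filter[symmetric])
 thus ?thesis by (simp add: ent_def cent_def fib_const)
qed

text \<open>The factor \<open>1 - ga\<close> in the bounds for \<open>\<phi>\<close> and for its
  Lipschitz constant cancels the geometric series, so that the one number \<open>C\<close> bounds
  both \<open>G\<close> and the Lipschitz constant of \<open>G\<close>.\<close>

locale solenoid =
 fixes b :: nat and ga :: real and \<phi> :: "real => real" and C :: nat
 assumes b: "2 <= b" and g0: "0 < ga" and g1: "ga < 1"
  and per: "\<phi> (x + 1) = \<phi> x"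
  and bnd: "\<bar>\<phi> x\<bar> <= real C * (1 - ga)" and lip: "\<bar>\<phi> x - \<phi> y\<bar> <= real C * (1 - ga) * \<bar>x - y\<bar>"
  and C1: "1 <= C"
begin

text \<open>For an integer \<open>w\<close> with base-\<open>b\<close> digits \<open>j\<close>, the
  value \<open>G (x + w)\<close> is S(x, j) with \<open>j\<close> continued by zeros, by periodicity
  of \<open>\<phi>\<close>. One function of a real variable thus holds the points of all
  fibres.\<close>

definition G :: "real => real" where "G u = (\<Sum>k. ga ^ k * \<phi> (u / real b ^ (k + 1)))"
abbreviation Gw :: "real => nat => real" where "Gw x w == G (x + real w)"
abbreviation gcell :: "nat => real => int" where "gcell n y == \<lfloor>y / ga ^ n\<rfloor>"
definition Gn :: "nat => real => real" where "Gn n u = (\<Sum>k<n. ga ^ k * \<phi> (u / real b ^ (k + 1)))"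
text \<open>Words of length \<open>n\<close> suffice at scale \<open>ga ^ n\<close>: later digits
  move a point by at most \<open>2 * C * ga ^ n\<close> (\<open>G_tail\<close>).\<close>

definition a :: "real => nat => real" where "a x n = ent {..<b ^ n} (%w. gcell n (Gw x w))"

lemma b0: "0 < b" "0 < real b" "1 <= real b" using b by auto

lemma per_nat: "\<phi> (x + real n) = \<phi> x"
 by (induction n) (use per in \<open>auto simp: add.assoc[symmetric] add.commute[of 1]\<close>)

lemma geo: "summable (%k. c * ga ^ k)" "(\<Sum>k. c * (1 - ga) * ga ^ k) = c"
 using g0 g1 suminf_geometric[of ga] by (auto simp: suminf_mult suminf_geometric summable_geometric)

lemma summable_G: "summable (%k. ga ^ k * \<phi> (f k))"
proof (rule summable_comparison_test'[OF geo(1)[of "real C * (1 - ga)"]])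
 fix k show "norm (ga ^ k * \<phi> (f k)) <= real C * (1 - ga) * ga ^ k"
  using mult_left_mono[OF bnd[of "f k"], of "ga ^ k"] g0 by (simp add: abs_mult mult_ac)
qed

lemma weighted_sum_bound:
 assumes "!!k. \<bar>c k\<bar> <= real C * (1 - ga) * d" "0 <= d"
 shows "\<bar>\<Sum>k. ga ^ k * c k\<bar> <= real C * d"
proof -
 have le: "norm (ga ^ k * c k) <= (real C * d) * (1 - ga) * ga ^ k" for k
  using mult_left_mono[OF assms(1)[of k], of "ga ^ k"] g0 by (simp add: abs_mult mult_ac)
 have "norm (\<Sum>k. ga ^ k * c k) <= (\<Sum>k. (real C * d) * (1 - ga) * ga ^ k)"
  by (rule norm_suminf_le[OF le]) (rule geo(1))
 thus ?thesis unfolding geo(2) by simp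
qed

lemma G_bound: "\<bar>G u\<bar> <= real C"
 unfolding G_def using weighted_sum_bound[of _ 1] bnd by simp

lemma G_lip: "\<bar>G u - G v\<bar> <= real C * \<bar>u - v\<bar>"
proof -
 have "G u - G v = (\<Sum>k. ga ^ k * (\<phi> (u / real b ^ (k + 1)) - \<phi> (v / real b ^ (k + 1))))"
  unfolding G_def by (simp add: suminf_diff[OF summable_G summable_G] right_diff_distrib)
 also have "\<bar>...\<bar> <= real C * \<bar>u - v\<bar>"
 proof (rule weighted_sum_bound)
  fix k
  have "\<bar>u / real b ^ (k + 1) - v / real b ^ (k + 1)\<bar> = \<bar>u - v\<bar> / real b ^ (k + 1)"
   using b0 by (simp add: diff_divide_distrib[symmetric])
  also have "... <= \<bar>u - v\<bar> / 1" using b0 one_le_power[of "real b" "k + 1"] by (intro divide_left_mono) auto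
  finally have "\<bar>u / real b ^ (k + 1) - v / real b ^ (k + 1)\<bar> <= \<bar>u - v\<bar>" by simp
  thus "\<bar>\<phi> (u / real b ^ (k + 1)) - \<phi> (v / real b ^ (k + 1))\<bar> <= real C * (1 - ga) * \<bar>u - v\<bar>"
   using lip[of "u / real b ^ (k + 1)" "v / real b ^ (k + 1)"] g1
   by (smt (verit) mult_left_mono mult_nonneg_nonneg of_nat_0_le_iff)
 qed simp
 finally show ?thesis .
qed

lemma G_split: "G u = Gn n u + ga ^ n * G (u / real b ^ n)"
proof -
 have "G u = (\<Sum>k. ga ^ (k + n) * \<phi> (u / real b ^ (k + n + 1))) + Gn n u"
  unfolding G_def Gn_def by (rule suminf_split_initial_segment[OF summable_G])
 also have "(\<Sum>k. ga ^ (k + n) * \<phi> (u / real b ^ (k + n + 1))) = (\<Sum>k. ga ^ n * (ga ^ k * \<phi> (u / real b ^ n / real b ^ (k + 1))))"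
  by (simp add: power_add mult_ac)
 also have "... = ga ^ n * G (u / real b ^ n)" unfolding G_def by (rule suminf_mult[OF summable_G])
 finally show ?thesis by simp
qed

lemma Gn_per: "Gn n (u + real (b ^ n * v)) = Gn n u"
 unfolding Gn_def
proof (rule sum.cong[OF refl])
 fix k assume "k \<in> {..<n}"
 hence "b ^ n = b ^ (k + 1) * b ^ (n - k - 1)" by (simp add: power_add[symmetric] del: power_Suc)
 hence "(u + real (b ^ n * v)) / real b ^ (k + 1) = u / real b ^ (k + 1) + real (b ^ (n - k - 1) * v)"
  using b0 by (simp add: field_simps del: power_Suc)
 thus "ga ^ k * \<phi> ((u + real (b ^ n * v)) / real b ^ (k + 1)) = ga ^ k * \<phi> (u / real b ^ (k + 1))"
  by (simp only: per_nat)
qed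

text \<open>Self-affinity of the fibres: the first \<open>n\<close> digits enter through
  \<open>Gn\<close>, which has period \<open>b ^ n\<close>, and the later digits are seen over the
  preimage \<open>u / b ^ n\<close>, contracted by \<open>ga ^ n\<close>.\<close>

lemma G_word: "Gw u (b ^ n * v) = Gn n u + ga ^ n * G (u / real b ^ n + real v)"
proof -
 have "(u + real (b ^ n * v)) / real b ^ n = u / real b ^ n + real v" using b0 by (simp add: field_simps)
 thus ?thesis using G_split[of "u + real (b ^ n * v)" n] Gn_per[of n u v] by simp
qed

lemma G_tail: "\<bar>Gw u (b ^ n * v) - G u\<bar> <= 2 * real C * ga ^ n"
proof -
 have "Gw u (b ^ n * v) - G u = ga ^ n * (G (u / real b ^ n + real v) - G (u / real b ^ n))"
  using G_word[of u n v] G_split[of u n] by (simp add: right_diff_distrib)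
 hence "\<bar>Gw u (b ^ n * v) - G u\<bar> = ga ^ n * \<bar>G (u / real b ^ n + real v) - G (u / real b ^ n)\<bar>"
  using g0 by (simp add: abs_mult)
 also have "... <= ga ^ n * (2 * real C)"
  using G_bound[of "u / real b ^ n + real v"] G_bound[of "u / real b ^ n"] g0 by (intro mult_left_mono) auto
 finally show ?thesis by (simp add: mult_ac)
qed

lemma continuous_G: "continuous_on UNIV G"
proof -
 have "(real C)-lipschitz_on UNIV G"
  using G_lip by (intro lipschitz_onI) (auto simp: dist_real_def)
 thus ?thesis by (rule lipschitz_on_continuous_on)
qed

lemma borel_G [measurable]: "G \<in> borel_measurable borel"
 by (rule borel_measurable_continuous_onI[OF continuous_G])

lemma borel_a [measurable]: "(%x. a x n) \<in> borel_measurable borel"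
 unfolding a_def ent_eq_sum[OF finite_lessThan] by measurable

lemma gp: "0 < ga ^ n" "ga ^ n <= 1" using g0 g1 by (auto simp: power_le_one)

lemma a_nonneg: "0 <= a x n" unfolding a_def ent_def by (rule cent_nonneg) simp

lemma a_le: "a x n <= real n * log 2 (real b)"
proof -
 have "a x n <= log 2 (real (b ^ n))"
  unfolding a_def ent_def
 proof (rule cent_le_log_const)
  fix w
  have "card ((%w. gcell n (Gw x w)) ` fib {..<b ^ n} (%_. ()) w) <= card {..<b ^ n}"
   unfolding fib_const by (rule card_image_le) simp
  thus "rcard ((%w. gcell n (Gw x w)) ` fib {..<b ^ n} (%_. ()) w) <= real (b ^ n)" by simp
 qed (use b0 in \<open>auto simp: one_le_power\<close>)
 thus ?thesis using b0 by (simp add: log_nat_power)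
qed

lemma a_close:
 assumes "\<bar>x - x'\<bar> <= ga ^ m"
 shows "a x m <= a x' m + log 2 (2 * real C + 2)"
 unfolding a_def
proof (rule ent_floor_close)
 fix w
 have "\<bar>Gw x w / ga ^ m - Gw x' w / ga ^ m\<bar> = \<bar>Gw x w - Gw x' w\<bar> / ga ^ m"
  using gp[of m] by (simp add: diff_divide_distrib[symmetric])
 also have "... <= (real C * ga ^ m) / ga ^ m"
  using G_lip[of "x + real w" "x' + real w"] assms gp[of m] mult_left_mono[OF assms, of "real C"]
  by (intro divide_right_mono) auto
 finally show "\<bar>Gw x w / ga ^ m - Gw x' w / ga ^ m\<bar> <= real C" using g0 by simp
qed simp

text \<open>The bounded losses of \<open>a_superadd\<close>: one bit for grids that are not nested,
  two for a translation, and a logarithm for each of two comparisons at scale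
  \<open>ga ^ n\<close>.\<close>

definition \<kappa> :: real where "\<kappa> = 3 + 2 * log 2 (4 * real C + 2)"

lemma \<kappa>0: "0 <= \<kappa>" "log 2 (2 * real C + 2) <= \<kappa>"
proof -
 have "0 <= log 2 (4 * real C + 2)" by simp
 moreover have "log 2 (2 * real C + 2) <= log 2 (4 * real C + 2)" by simp
 ultimately show "0 <= \<kappa>" "log 2 (2 * real C + 2) <= \<kappa>" unfolding \<kappa>_def by linarith+
qed

lemma ent_word_block:
 shows "a x n - log 2 (4 * real C + 2) <=
  ent ({..<b ^ n} \<times> {..<b ^ m}) (%p. gcell n (Gw x (fst p + b ^ n * snd p)))"
proof -
 let ?Om = "{..<b ^ n} \<times> {..<b ^ m}"
 have "a x n = ent ?Om (%p. gcell n (Gw x (fst p)))"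
  using cent_Times_snd_free[of "{..<b ^ n}" "{..<b ^ m}" "%w. gcell n (Gw x w)" "%_. ()"] b0
  by (auto simp: a_def ent_def lessThan_empty_iff)
 also have "... <= ent ?Om (%p. gcell n (Gw x (fst p + b ^ n * snd p))) + log 2 (2 * real (2 * C) + 2)"
 proof (rule ent_floor_close)
  fix p
  have "\<bar>Gw x (fst p) / ga ^ n - Gw x (fst p + b ^ n * snd p) / ga ^ n\<bar> =
   \<bar>G (x + real (fst p) + real (b ^ n * snd p)) - Gw x (fst p)\<bar> / ga ^ n"
   using gp[of n] by (simp add: diff_divide_distrib[symmetric] abs_minus_commute add.assoc)
  also have "... <= 2 * real C * ga ^ n / ga ^ n"
   using gp[of n] by (intro divide_right_mono G_tail) auto
  finally show "\<bar>Gw x (fst p) / ga ^ n - Gw x (fst p + b ^ n * snd p) / ga ^ n\<bar> <= real (2 * C)"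
   using g0 by simp
 qed simp
 finally show ?thesis by simp
qed

lemma cent_coarse:
 assumes "finite A" "i <= j"
 shows "cent A (%t. gcell i (F t)) (%t. gcell j (F t)) <= 1"
proof -
 have "cent A (%t. gcell i (F t)) (%t. gcell j (F t)) <= log 2 (real 1 + 1)"
 proof (rule cent_floor_le[OF assms(1)])
  fix t t' assume "gcell j (F t) = gcell j (F t')"
  hence "F t / ga ^ j - F t' / ga ^ j <= 1" by linarith
  hence "F t - F t' <= ga ^ j" using gp[of j] by (simp add: diff_divide_distrib[symmetric])
  also have "... <= ga ^ i" using g0 g1 assms(2) by (intro power_decreasing) auto
  finally show "F t / ga ^ i - F t' / ga ^ i <= real 1" using gp[of i] by (simp add: diff_divide_distrib[symmetric])
 qed
 thus ?thesis by simp
qed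

lemma ent_fine_ge:
 assumes "finite A" "i <= j"
 shows "ent A (%t. gcell i (F t)) + cent A (%t. gcell j (F t)) (%t. gcell i (F t)) <= ent A (%t. gcell j (F t)) + 1"
proof -
 have "cent A (%t. (gcell j (F t), gcell i (F t))) (%_. ()) = cent A (%t. (gcell i (F t), gcell j (F t))) (%_. ())"
  by (rule cent_cong) auto
 moreover have "cent A X (%t. ((), Z t)) = cent A X Z" for X :: "'a => int" and Z :: "'a => int"
  by (rule cent_cong) auto
 ultimately show ?thesis using cent_coarse[OF assms, of F] unfolding cent_chain[OF assms(1)] ent_def by simp
qed

text \<open>Given the first \<open>n\<close> digits, the next \<open>m\<close> describe the fibre
  over the preimage \<open>(x + w) / b ^ n\<close> at scale \<open>ga ^ m\<close>. The fine entropy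
  is the coarse one plus a conditional entropy, and conditioning also on the prefix \<open>w\<close>
  only lowers the latter, whence this direction of the inequality.\<close>

lemma a_superadd:
 "a x n + (\<Sum>w<b ^ n. a ((x + real w) / real b ^ n) m) / real (b ^ n) - \<kappa> <= a x (n + m)"
proof -
 let ?Om = "{..<b ^ n} \<times> {..<b ^ m}"
 have fin: "finite ?Om" by simp
 define Y where "Y p = Gw x (fst p + b ^ n * snd p)" for p :: "nat \<times> nat"
 have Y: "Y p = Gn n (x + real (fst p)) + ga ^ n * G ((x + real (fst p)) / real b ^ n + real (snd p))" for p
  unfolding Y_def using G_word[of "x + real (fst p)" n "snd p"] by (simp add: add.assoc)
 have "a x (n + m) = ent ?Om (%p. gcell (n + m) (Y p))"
  unfolding a_def ent_def Y_def by (rule cent_words) (rule b0)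
 moreover have "ent ?Om (%p. gcell n (Y p)) + cent ?Om (%p. gcell (n + m) (Y p)) (%p. gcell n (Y p)) <=
   ent ?Om (%p. gcell (n + m) (Y p)) + 1"
  by (rule ent_fine_ge[OF fin]) simp
 moreover have "cent ?Om (%p. gcell (n + m) (Y p)) (%p. (fst p, gcell n (Y p))) <=
   cent ?Om (%p. gcell (n + m) (Y p)) (%p. gcell n (Y p))"
  by (rule cent_antimono[OF fin]) (simp add: refines_def)
 moreover have "cent ?Om (%p. gcell (n + m) (Y p)) fst <=
   cent ?Om (%p. gcell (n + m) (Y p)) (%p. (fst p, gcell n (Y p))) + cent ?Om (%p. gcell n (Y p)) fst"
  by (rule cent_le_cond_add[OF fin])
 moreover have "cent ?Om (%p. gcell n (Y p)) fst <= log 2 (real (2 * C) + 1)"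
 proof (rule cent_floor_le[OF fin])
  fix p q :: "nat \<times> nat" assume "fst p = fst q"
  hence "Y p - Y q = ga ^ n * (G ((x + real (fst p)) / real b ^ n + real (snd p)) - G ((x + real (fst p)) / real b ^ n + real (snd q)))"
   unfolding Y by (simp add: right_diff_distrib)
  hence "Y p / ga ^ n - Y q / ga ^ n = G ((x + real (fst p)) / real b ^ n + real (snd p)) - G ((x + real (fst p)) / real b ^ n + real (snd q))"
   using g0 by (simp add: diff_divide_distrib[symmetric])
  also have "... <= real (2 * C)"
   using G_bound[of "(x + real (fst p)) / real b ^ n + real (snd p)"] G_bound[of "(x + real (fst p)) / real b ^ n + real (snd q)"]
   by simp
  finally show "Y p / ga ^ n - Y q / ga ^ n <= real (2 * C)" .
 qed
 moreover have "log 2 (real (2 * C) + 1) <= log 2 (4 * real C + 2)" by simp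
 moreover have "(\<Sum>w<b ^ n. a ((x + real w) / real b ^ n) m) / real (b ^ n) - 2 <= cent ?Om (%p. gcell (n + m) (Y p)) fst"
 proof -
  have "a ((x + real w) / real b ^ n) m <= ent {..<b ^ m} (%v. gcell (n + m) (Y (w, v))) + 2" for w
   unfolding a_def
  proof (rule ent_floor_translate[where c="Gn n (x + real w) / ga ^ (n + m)"])
   fix v
   show "Y (w, v) / ga ^ (n + m) = G ((x + real w) / real b ^ n + real v) / ga ^ m + Gn n (x + real w) / ga ^ (n + m)"
   unfolding Y using g0 by (simp add: power_add add_divide_distrib)
  qed simp
  hence "(\<Sum>w<b ^ n. a ((x + real w) / real b ^ n) m) <= (\<Sum>w<b ^ n. ent {..<b ^ m} (%v. gcell (n + m) (Y (w, v))) + 2)"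
   by (intro sum_mono)
  also have "... = (\<Sum>w<b ^ n. ent {..<b ^ m} (%v. gcell (n + m) (Y (w, v)))) + 2 * real (b ^ n)"
   by (simp add: sum.distrib)
  finally have "(\<Sum>w<b ^ n. a ((x + real w) / real b ^ n) m) / real (b ^ n) <=
   ((\<Sum>w<b ^ n. ent {..<b ^ m} (%v. gcell (n + m) (Y (w, v)))) + 2 * real (b ^ n)) / real (b ^ n)"
   by (rule divide_right_mono) simp
  also have "... = (\<Sum>w<b ^ n. ent {..<b ^ m} (%v. gcell (n + m) (Y (w, v)))) / real (b ^ n) + 2"
   using b0 by (simp add: add_divide_distrib)
  also have "(\<Sum>w<b ^ n. ent {..<b ^ m} (%v. gcell (n + m) (Y (w, v)))) / real (b ^ n) = cent ?Om (%p. gcell (n + m) (Y p)) fst"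
   by (subst cent_Times_fst) auto
  finally show ?thesis by simp
 qed
 moreover have "a x n - log 2 (4 * real C + 2) <= ent ?Om (%p. gcell n (Y p))"
  unfolding Y_def by (rule ent_word_block)
 ultimately show ?thesis unfolding \<kappa>_def by linarith
qed

definition Av :: "nat => real" where "Av m = (\<integral>x. a x m \<partial>U01)"

lemma integrable_a: "integrable U01 (%x. a x m)"
 using a_nonneg a_le by (intro integrable_U01_bounded[where C="real m * log 2 (real b)"]) (auto simp: abs_of_nonneg)

lemma Av_bounds: "0 <= Av m" "Av m <= real m * log 2 (real b)"
proof -
 show "0 <= Av m" unfolding Av_def by (intro integral_nonneg_AE AE_I2 a_nonneg)
 have "Av m <= (\<integral>x. real m * log 2 (real b) \<partial>U01)"
  unfolding Av_def by (rule integral_mono[OF integrable_a]) (auto intro: a_le)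
 thus "Av m <= real m * log 2 (real b)" by (simp add: U01.prob_space)
qed

text \<open>The preimages of one point are evenly spaced at distance \<open>1 / b ^ n\<close>, and
  \<open>a\<close> changes by at most a constant when \<open>x\<close> moves by
  \<open>ga ^ m\<close>. So the mean over the preimages of any single \<open>x\<close> is comparable
  with the mean over the interval.\<close>

lemma avg_preimages_ge:
 assumes x: "0 <= x" "x <= 1" and n: "1 / real b ^ n <= ga ^ m"
 shows "Av m - log 2 (2 * real C + 2) <= (\<Sum>w<b ^ n. a ((x + real w) / real b ^ n) m) / real (b ^ n)"
proof -
 define c where "c w = a ((x + real w) / real b ^ n) m + log 2 (2 * real C + 2)" for w :: nat
 have bn: "0 < b ^ n" using b0 by simp
 have "Av m <= (\<integral>y. c (nat \<lfloor>real (b ^ n) * y\<rfloor>) \<partial>U01)"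
  unfolding Av_def
 proof (rule integral_mono[OF integrable_a])
  show "integrable U01 (%y. c (nat \<lfloor>real (b ^ n) * y\<rfloor>))"
  proof (rule integrable_U01_bounded)
   fix y show "\<bar>c (nat \<lfloor>real (b ^ n) * y\<rfloor>)\<bar> <= real m * log 2 (real b) + log 2 (2 * real C + 2)"
   unfolding c_def using a_nonneg a_le by (simp add: abs_of_nonneg add_nonneg_nonneg)
  qed measurable
  fix y assume "y \<in> space U01"
  hence y: "0 <= y" "y < 1" by (auto simp: space_U01)
  define w where "w = nat \<lfloor>real (b ^ n) * y\<rfloor>"
  have w: "real w <= real (b ^ n) * y" "real (b ^ n) * y < real w + 1" using y bn by (auto simp: w_def)
  have "y - (x + real w) / real b ^ n = (real (b ^ n) * y - (x + real w)) / real b ^ n"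
   using b0 by (simp add: diff_divide_distrib)
  hence "\<bar>y - (x + real w) / real b ^ n\<bar> = \<bar>real (b ^ n) * y - (x + real w)\<bar> / real b ^ n"
   by (simp add: abs_divide)
  also have "... <= 1 / real b ^ n" using w x by (intro divide_right_mono) auto
  also have "... <= ga ^ m" by (rule n)
  finally show "a y m <= c (nat \<lfloor>real (b ^ n) * y\<rfloor>)" unfolding w_def[symmetric] c_def by (rule a_close)
 qed
 also have "... = (\<Sum>w<b ^ n. c w) / real (b ^ n)" by (rule integral_U01_step[OF bn])
 also have "... = (\<Sum>w<b ^ n. a ((x + real w) / real b ^ n) m) / real (b ^ n) + log 2 (2 * real C + 2)"
  using bn by (simp add: c_def sum.distrib add_divide_distrib)
 finally show ?thesis by simp
qed

text \<open>The growth rate of \<open>Av\<close>, as Fekete's lemma gives it for a sequence that is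
  superadditive up to a constant. It counts bits per factor \<open>ga\<close>, so the corresponding
  fibre dimension is \<open>\<beta> / lam\<close>.\<close>

definition \<beta> :: real where "\<beta> = (SUP m. (Av (Suc m) - 2 * \<kappa>) / real (Suc m))"

lemma \<beta>_bdd: "bdd_above (range (%m. (Av (Suc m) - 2 * \<kappa>) / real (Suc m)))"
proof (rule bdd_aboveI2)
 fix m
 have "Av (Suc m) - 2 * \<kappa> <= real (Suc m) * log 2 (real b)" using Av_bounds(2)[of "Suc m"] \<kappa>0 by linarith
 thus "(Av (Suc m) - 2 * \<kappa>) / real (Suc m) <= log 2 (real b)" by (simp add: divide_le_eq mult.commute)
qed

lemma Av_le_\<beta>: "1 <= m ==> Av m <= \<beta> * real m + 2 * \<kappa>"
 using cSUP_upper[OF UNIV_I \<beta>_bdd, of "m - 1"] unfolding \<beta>_def[symmetric]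
 by (cases m) (auto simp: divide_le_eq)

text \<open>The bound holds over every \<open>x\<close>, since \<open>avg_preimages_ge\<close>
  replaces the mean over preimages by \<open>Av m\<close> at each application of
  \<open>a_superadd\<close>. This requires a prefix with \<open>1 / b ^ n <= ga ^ m\<close>, so the
  induction starts from length \<open>n0\<close>. Together with \<open>Av_le_\<beta>\<close> it
  shows that \<open>a x n\<close> is close to \<open>\<beta> * n\<close> for most
  \<open>x\<close>.\<close>

lemma a_uniform_lower:
 assumes "0 < ep"
 shows "\<exists>n1. \<forall>n\<ge>n1. \<forall>x. 0 <= x --> x <= 1 --> (\<beta> - ep) * real n <= a x n"
proof -
 obtain m' where "\<beta> - ep / 2 < (Av (Suc m') - 2 * \<kappa>) / real (Suc m')"
  using less_cSUP_iff[OF _ \<beta>_bdd, of "\<beta> - ep / 2"] assms unfolding \<beta>_def by auto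
 then obtain m where m: "1 <= m" "\<beta> - ep / 2 < (Av m - 2 * \<kappa>) / real m"
  by (metis le_add1 plus_1_eq_Suc)
 define D where "D = Av m - 2 * \<kappa>"
 have Dm: "(\<beta> - ep / 2) * real m <= D" using m by (simp add: D_def less_divide_eq)
 obtain n0 where n0: "(1 / real b) ^ n0 < ga ^ m"
  using real_arch_pow_inv[of "ga ^ m" "1 / real b"] gp[of m] b by auto
 have n0': "1 / real b ^ n <= ga ^ m" if "n0 <= n" for n
 proof -
  have "1 / real b ^ n = (1 / real b) ^ n" by (simp add: power_one_over)
  also have "... <= (1 / real b) ^ n0" using b0 that by (intro power_decreasing) auto
  finally show ?thesis using n0 by simp
 qed
 have step: "real l * D <= a x (n0 + l * m)" if x: "0 <= x" "x <= 1" for x l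
 proof (induction l)
  case 0 thus ?case using a_nonneg by simp
 next
  case (Suc l)
  have "a x (n0 + l * m) + (Av m - \<kappa>) - \<kappa> <= a x (n0 + l * m + m)"
   using a_superadd[of x "n0 + l * m" m] avg_preimages_ge[OF x n0', of "n0 + l * m"] \<kappa>0 by simp
  thus ?case using Suc by (simp add: D_def algebra_simps)
 qed
 define n1 where "n1 = nat \<lceil>2 * (\<bar>\<beta>\<bar> + ep) * (real n0 + real m) / ep + 2 * \<kappa> / ep\<rceil> + n0"
 have "(\<beta> - ep) * real n <= a x n" if n: "n1 <= n" and x: "0 <= x" "x <= 1" for n x
 proof -
  define l where "l = (n - n0) div m"
  define r where "r = (n - n0) mod m"
  have nn: "n = n0 + l * m + r" "r < m" using n m by (auto simp: l_def r_def n1_def)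
  have "a x (n0 + l * m) - \<kappa> <= a x n"
  proof -
   have "0 <= (\<Sum>w<b ^ (n0 + l * m). a ((x + real w) / real b ^ (n0 + l * m)) r) / real (b ^ (n0 + l * m))"
   by (intro divide_nonneg_nonneg sum_nonneg a_nonneg) auto
   thus ?thesis using a_superadd[of x "n0 + l * m" r] nn(1) by simp
  qed
  hence "real l * D - \<kappa> <= a x n" using step[OF x, of l] by linarith
  moreover have "real l * ((\<beta> - ep / 2) * real m) <= real l * D" using Dm by (intro mult_left_mono) auto
  moreover have "real l * ((\<beta> - ep / 2) * real m) = (\<beta> - ep / 2) * real n - (\<beta> - ep / 2) * (real n0 + real r)"
   using nn(1) by (simp add: algebra_simps)
  moreover have "(\<beta> - ep / 2) * (real n0 + real r) <= (\<bar>\<beta>\<bar> + ep) * (real n0 + real m)"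
   using assms nn(2) by (intro mult_mono) auto
  moreover have "(\<bar>\<beta>\<bar> + ep) * (real n0 + real m) + \<kappa> <= (ep / 2) * real n"
  proof -
   have "2 * (\<bar>\<beta>\<bar> + ep) * (real n0 + real m) / ep + 2 * \<kappa> / ep <= real n"
   using n unfolding n1_def by linarith
   thus ?thesis using assms by (simp add: field_simps)
  qed
  ultimately show ?thesis by (simp add: algebra_simps)
 qed
 thus ?thesis by blast
qed

end

section \<open>Derivatives of real analytic periodic functions\<close>

lemma diffs_funpow: "(diffs ^^ m) c n = (fact (n + m) / fact n) * (c (n + m) :: real)"
proof (induction m arbitrary: n)
 case (Suc m)
 have "(diffs ^^ Suc m) c n = real (Suc n) * (fact (Suc n + m) / fact (Suc n) * c (Suc n + m))"
  by (simp add: diffs_def Suc)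
 also have "real (Suc n) * (fact (Suc n + m) / fact (Suc n) * c (Suc n + m)) = fact (n + Suc m) / fact n * c (n + Suc m)"
  by (simp add: fact_Suc[of n] del: of_nat_Suc fact_Suc)
 finally show ?case .
qed simp

lemma fact_ratio_le: "fact (n + m) / fact n <= fact m * (2::real) ^ (n + m)"
proof -
 have "fact (n + m) / fact n = fact m * real ((n + m) choose m)"
  by (simp add: binomial_fact)
 also have "... <= fact m * real (2 ^ (n + m))"
  by (intro mult_left_mono) (auto simp: binomial_le_pow2 simp del: of_nat_power)
 finally show ?thesis by simp
qed

text \<open>Cauchy estimates from the power series. The coefficients are at most
  \<open>M / rh ^ n\<close> with \<open>rh = r / 2\<close>, and the binomial bound
  \<open>fact_ratio_le\<close> costs a factor 2 per degree; within \<open>r / 8\<close> of the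
  centre the series is then dominated by powers of 1/2.\<close>

lemma local_derivatives:
 fixes f :: "real => real"
 assumes "0 < r" and f: "!!y. \<bar>y - x0\<bar> < r ==> (%n. c n * (y - x0) ^ n) sums f y"
 shows "!!y m. \<bar>y - x0\<bar> < r ==> ((deriv ^^ m) f has_real_derivative (deriv ^^ Suc m) f y) (at y)"
  and "\<exists>M>0. \<exists>R>0. \<forall>y m. \<bar>y - x0\<bar> < r / 8 --> \<bar>(deriv ^^ m) f y\<bar> <= M * R ^ m * fact m"
proof -
 have sumc: "summable (%n. c n * z ^ n)" if "norm z < r" for z :: real
  using f[of "x0 + z"] that by (auto simp: sums_iff)
 have sumd: "summable (%n. (diffs ^^ m) c n * z ^ n)" if "norm z < r" for z :: real and m
  using that
 proof (induction m arbitrary: z)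
  case (Suc m)
  thus ?case using termdiff_converges[of z r "(diffs ^^ m) c"] by simp
 qed (use sumc in simp)
 have der: "((%y. \<Sum>n. (diffs ^^ m) c n * (y - x0) ^ n) has_real_derivative (\<Sum>n. (diffs ^^ Suc m) c n * (y - x0) ^ n)) (at y)"
  if "\<bar>y - x0\<bar> < r" for y m
 proof -
  have "((%z. \<Sum>n. (diffs ^^ m) c n * z ^ n) has_real_derivative (\<Sum>n. diffs ((diffs ^^ m) c) n * (y - x0) ^ n)) (at (y - x0))"
   using that by (intro termdiffs_strong'[of r]) (auto intro: sumd)
  thus ?thesis using DERIV_shift[of "%z. \<Sum>n. (diffs ^^ m) c n * z ^ n" _ y "- x0"] by simp
 qed
 have eq: "(deriv ^^ m) f y = (\<Sum>n. (diffs ^^ m) c n * (y - x0) ^ n)" if "\<bar>y - x0\<bar> < r" for y m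
  using that
 proof (induction m arbitrary: y)
  case 0 thus ?case using f[of y] by (simp add: sums_iff)
 next
  case (Suc m)
  have "((deriv ^^ m) f has_real_derivative (\<Sum>n. (diffs ^^ Suc m) c n * (y - x0) ^ n)) (at y)"
  proof (rule has_field_derivative_transform_within_open[OF der[OF Suc.prems, of m], of "{y. \<bar>y - x0\<bar> < r}"])
   show "open {y. \<bar>y - x0\<bar> < r}" by (intro open_Collect_less continuous_intros)
  qed (use Suc in auto)
  thus ?case by (simp add: DERIV_imp_deriv)
 qed
 show d: "((deriv ^^ m) f has_real_derivative (deriv ^^ Suc m) f y) (at y)" if "\<bar>y - x0\<bar> < r" for y m
 proof -
  have "((deriv ^^ m) f has_real_derivative (\<Sum>n. (diffs ^^ Suc m) c n * (y - x0) ^ n)) (at y)"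
  proof (rule has_field_derivative_transform_within_open[OF der[OF that, of m], of "{y. \<bar>y - x0\<bar> < r}"])
   show "open {y. \<bar>y - x0\<bar> < r}" by (intro open_Collect_less continuous_intros)
  qed (use that eq in auto)
  thus ?thesis using eq[OF that, of "Suc m"] by simp
 qed
 define rh where "rh = r / 2"
 have rh: "0 < rh" "rh < r" using assms(1) by (auto simp: rh_def)
 have "Bseq (%n. c n * rh ^ n)"
  using summable_LIMSEQ_zero[OF sumc[of rh]] rh by (intro convergent_imp_Bseq convergentI) auto
 then obtain M where M: "0 < M" "!!n. \<bar>c n * rh ^ n\<bar> <= M" by (auto elim: BseqE)
 have cb: "\<bar>c n\<bar> <= M / rh ^ n" for n
  using M(2)[of n] rh by (simp add: abs_mult field_simps)
 have "\<bar>(deriv ^^ m) f y\<bar> <= (2 * M) * (2 / rh) ^ m * fact m" if y: "\<bar>y - x0\<bar> < r / 8" for y m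
 proof -
  have y4: "\<bar>y - x0\<bar> <= rh / 4" using y by (simp add: rh_def)
  have le: "norm ((diffs ^^ m) c n * (y - x0) ^ n) <= (M * (2 / rh) ^ m * fact m) * (1 / 2) ^ n" for n
  proof -
   have "norm ((diffs ^^ m) c n * (y - x0) ^ n) = (fact (n + m) / fact n) * \<bar>c (n + m)\<bar> * \<bar>y - x0\<bar> ^ n"
   unfolding diffs_funpow by (simp add: abs_mult power_abs)
   also have "... <= (fact m * 2 ^ (n + m)) * (M / rh ^ (n + m)) * (rh / 4) ^ n"
   using y4 by (intro mult_mono fact_ratio_le cb power_mono) (auto simp: M(1) less_imp_le rh)
   also have "... = (M * (2 / rh) ^ m * fact m) * (1 / 2) ^ n"
   proof -
   have "(2::real) ^ (n + m) * (rh / 4) ^ n / rh ^ (n + m) = (2 / rh) ^ m * (1 / 2) ^ n"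
   proof -
   have "(4::real) ^ n = 2 ^ n * 2 ^ n" by (simp add: power_mult_distrib[symmetric])
   thus ?thesis using rh(1) by (simp add: power_add power_divide field_simps)
   qed
   hence "M * fact m * (2 ^ (n + m) * (rh / 4) ^ n / rh ^ (n + m)) = M * fact m * ((2 / rh) ^ m * (1 / 2) ^ n)"
   by (simp only:)
   thus ?thesis by (simp only: times_divide_eq_right times_divide_eq_left mult_ac)
   qed
   finally show ?thesis .
  qed
  have "\<bar>(deriv ^^ m) f y\<bar> = norm (\<Sum>n. (diffs ^^ m) c n * (y - x0) ^ n)"
   using eq[of y m] y assms(1) by simp
  also have "... <= (\<Sum>n. (M * (2 / rh) ^ m * fact m) * (1 / 2) ^ n)"
   by (rule norm_suminf_le[OF le]) (intro summable_mult summable_geometric, simp)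
  also have "... = (M * (2 / rh) ^ m * fact m) * 2"
   by (subst suminf_mult) (auto simp: suminf_geometric summable_geometric)
  finally show ?thesis by (simp add: mult_ac)
 qed
 thus "\<exists>M>0. \<exists>R>0. \<forall>y m. \<bar>y - x0\<bar> < r / 8 --> \<bar>(deriv ^^ m) f y\<bar> <= M * R ^ m * fact m"
  using M(1) rh(1) by (intro exI[of _ "2 * M"] exI[of _ "2 / rh"] conjI allI impI) auto
qed

lemma deriv_shift: "deriv f (x + a) = deriv (%x. f (x + a)) (x::real)" for f :: "real => real"
 unfolding deriv_def DERIV_shift ..

text \<open>A finite cover of the unit interval makes the local constants uniform, and periodicity
  carries them to the line. The common \<open>R\<close> is what later lets the vanishing of all
  derivatives at one point spread in steps of fixed length.\<close>

lemma analytic_periodic_derivatives: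
 assumes an: "real_analytic \<phi>" and per: "int_periodic \<phi>"
 shows "\<exists>M>0. \<exists>R\<ge>1. \<forall>m x. ((deriv ^^ m) \<phi> has_real_derivative (deriv ^^ Suc m) \<phi> x) (at x) &
  \<bar>(deriv ^^ m) \<phi> x\<bar> <= M * R ^ m * fact m"
proof -
 have "\<forall>x0. \<exists>r>0. (\<forall>y m. \<bar>y - x0\<bar> < r --> ((deriv ^^ m) \<phi> has_real_derivative (deriv ^^ Suc m) \<phi> y) (at y)) &
   (\<exists>M>0. \<exists>R>0. \<forall>y m. \<bar>y - x0\<bar> < r --> \<bar>(deriv ^^ m) \<phi> y\<bar> <= M * R ^ m * fact m)"
 proof
  fix x0
  obtain r c where r: "r > 0" and f: "!!y. \<bar>y - x0\<bar> < r ==> (%n. c n * (y - x0) ^ n) sums \<phi> y"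
   using an unfolding real_analytic_def by blast
  show "\<exists>r>0. (\<forall>y m. \<bar>y - x0\<bar> < r --> ((deriv ^^ m) \<phi> has_real_derivative (deriv ^^ Suc m) \<phi> y) (at y)) &
   (\<exists>M>0. \<exists>R>0. \<forall>y m. \<bar>y - x0\<bar> < r --> \<bar>(deriv ^^ m) \<phi> y\<bar> <= M * R ^ m * fact m)"
  proof (rule exI[of _ "r / 8"], intro conjI allI impI)
   show "0 < r / 8" using r by simp
   show "((deriv ^^ m) \<phi> has_real_derivative (deriv ^^ Suc m) \<phi> y) (at y)" if "\<bar>y - x0\<bar> < r / 8" for y m
   using that r by (intro local_derivatives(1)[OF r f]) auto
   show "\<exists>M>0. \<exists>R>0. \<forall>y m. \<bar>y - x0\<bar> < r / 8 --> \<bar>(deriv ^^ m) \<phi> y\<bar> <= M * R ^ m * fact m"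
   by (rule local_derivatives(2)[OF r f])
  qed
 qed
 then obtain r where r: "!!x0. r x0 > 0"
  and der: "!!x0 y m. \<bar>y - x0\<bar> < r x0 ==> ((deriv ^^ m) \<phi> has_real_derivative (deriv ^^ Suc m) \<phi> y) (at y)"
  and bd: "!!x0. \<exists>M>0. \<exists>R>0. \<forall>y m. \<bar>y - x0\<bar> < r x0 --> \<bar>(deriv ^^ m) \<phi> y\<bar> <= M * R ^ m * fact m"
  by metis
 obtain M R where M: "!!x0. M x0 > 0" and R: "!!x0. R x0 > 0"
  and MR: "!!x0 y m. \<bar>y - x0\<bar> < r x0 ==> \<bar>(deriv ^^ m) \<phi> y\<bar> <= M x0 * R x0 ^ m * fact m"
  using bd by metis
 obtain D where D: "D \<subseteq> {0..1}" "finite D" "{0..1::real} \<subseteq> (\<Union>x0\<in>D. ball x0 (r x0))"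
 proof (rule compactE_image[OF compact_Icc[of 0 "1::real"], of "{0..1}" "%x0. ball x0 (r x0)"])
  show "{0..1} \<subseteq> (\<Union>c\<in>{0..1}. ball c (r c))" using r by force
 qed auto
 define M' where "M' = 1 + (\<Sum>x0\<in>D. M x0)"
 define R' where "R' = 1 + (\<Sum>x0\<in>D. R x0)"
 have bound01: "\<bar>(deriv ^^ m) \<phi> y\<bar> <= M' * R' ^ m * fact m" if "y \<in> {0..1}" for y m
 proof -
  have "y \<in> (\<Union>x0\<in>D. ball x0 (r x0))" using D(3) that by blast
  then obtain x0 where x0: "x0 \<in> D" "\<bar>y - x0\<bar> < r x0"
   by (auto simp: dist_real_def abs_minus_commute)
  have "M x0 <= (\<Sum>x0\<in>D. M x0)" "R x0 <= (\<Sum>x0\<in>D. R x0)"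
   using x0(1) D(2) by (auto intro!: member_le_sum simp: less_imp_le[OF M] less_imp_le[OF R])
  hence "M x0 * R x0 ^ m * fact m <= M' * R' ^ m * fact m"
   unfolding M'_def R'_def using M[of x0] R[of x0]
   by (intro mult_right_mono mult_mono power_mono) auto
  thus ?thesis using MR[OF x0(2), of m] by linarith
 qed
 have per1: "(deriv ^^ m) \<phi> (x + 1) = (deriv ^^ m) \<phi> x" for m x
 proof (induction m arbitrary: x)
  case 0 thus ?case using per by (simp add: int_periodic_def)
 next
  case (Suc m)
  have "(%x. (deriv ^^ m) \<phi> (x + 1)) = (deriv ^^ m) \<phi>" using Suc by auto
  thus ?case by (simp add: deriv_shift)
 qed
 have pern: "(deriv ^^ m) \<phi> (x + real n) = (deriv ^^ m) \<phi> x" for m n x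
 proof (induction n)
  case (Suc n)
  have "(deriv ^^ m) \<phi> (x + real (Suc n)) = (deriv ^^ m) \<phi> ((x + real n) + 1)" by (simp add: add_ac)
  also have "... = (deriv ^^ m) \<phi> (x + real n)" by (rule per1)
  finally show ?case using Suc by simp
 qed simp
 have perz: "(deriv ^^ m) \<phi> x = (deriv ^^ m) \<phi> (frac x)" for m x
 proof (cases "0 <= \<lfloor>x\<rfloor>")
  case True
  thus ?thesis using pern[of m "frac x" "nat \<lfloor>x\<rfloor>"] by (simp add: frac_def)
 next
  case False
  thus ?thesis using pern[of m x "nat (- \<lfloor>x\<rfloor>)"] by (simp add: frac_def)
 qed
 have "\<bar>(deriv ^^ m) \<phi> x\<bar> <= M' * R' ^ m * fact m" for m x
  unfolding perz[of m x] by (rule bound01) (simp add: less_imp_le frac_lt_1)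
 moreover have "0 < M'" unfolding M'_def using M by (intro add_pos_nonneg sum_nonneg) (auto intro: less_imp_le)
 moreover have "1 <= R'" unfolding R'_def using R by (simp add: sum_nonneg less_imp_le)
 moreover have "((deriv ^^ m) \<phi> has_real_derivative (deriv ^^ Suc m) \<phi> x) (at x)" for m x
  using der[of x x m] r by simp
 ultimately show ?thesis by (intro exI[of _ M'] conjI exI[of _ R'] allI) auto
qed

section \<open>Sublevel sets of functions of finite type\<close>

lemma measure_le_of_diameter:
 fixes S :: "real set"
 assumes "S \<in> sets lborel" "!!x y. x \<in> S ==> y \<in> S ==> x <= y ==> y - x <= d" "0 <= d"
 shows "emeasure lborel S <= ennreal d"
proof (cases "S = {}")
 case False
 then obtain s where s: "s \<in> S" by auto
 have bdd: "bdd_below S"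
 proof (rule bdd_belowI)
  fix x assume "x \<in> S" thus "s - d <= x" using assms(2)[of x s] s assms(3) by (cases "x <= s") auto
 qed
 have "S \<subseteq> {Inf S..Inf S + d}"
 proof
  fix y assume y: "y \<in> S"
  have "y - d <= Inf S"
  proof (rule cInf_greatest[OF False])
   fix x assume "x \<in> S" thus "y - d <= x" using assms(2)[of x y] y assms(3) by (cases "x <= y") auto
  qed
  thus "y \<in> {Inf S..Inf S + d}" using cInf_lower[OF y bdd] by auto
 qed
 hence "emeasure lborel S <= emeasure lborel {Inf S..Inf S + d}" by (rule emeasure_mono) simp
 thus ?thesis using assms(3) by simp
qed simp

text \<open>Induction on the order of the derivative that is bounded away from 0. If
  \<open>f (Suc k)\<close> is, then \<open>f k\<close> is monotone; it is smaller than
  \<open>\<sigma>\<close> in modulus only on a set of measure at most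
  \<open>2 * \<sigma> / c\<close>, and the rest consists of two intervals on which the induction
  hypothesis applies with \<open>\<sigma>\<close> in place of \<open>c\<close>.\<close>

lemma sublevel_estimate:
 fixes f :: "nat => real => real"
 assumes "!!m x. (f m has_real_derivative f (Suc m) x) (at x)"
  and "p <= q" "q - p <= 1" "!!x. x \<in> {p..q} ==> c <= \<bar>f k x\<bar>" "0 < c" "c <= 1" "0 < rh" "rh <= 1"
 shows "emeasure lborel {x \<in> {p..q}. \<bar>f 0 x\<bar> <= rh} <= ennreal (4 ^ (k + 1) * rh powr ((1 / 2) ^ k) / c)"
 using assms(2-)
proof (induction k arbitrary: p q c)
 case 0
 have cont: "continuous_on UNIV (f m)" for m
  using assms(1) by (meson DERIV_isCont continuous_at_imp_continuous_on)
 show ?case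
 proof (cases "rh < c")
  case True
  have "{x \<in> {p..q}. \<bar>f 0 x\<bar> <= rh} = {}" using 0 True by force
  thus ?thesis by (simp only: emeasure_empty) simp
 next
  case False
  have "emeasure lborel {x \<in> {p..q}. \<bar>f 0 x\<bar> <= rh} <= emeasure lborel {p..q}"
   by (rule emeasure_mono) auto
  also have "... <= ennreal 1" using 0 by simp
  also have "... <= ennreal (4 ^ (0 + 1) * rh powr ((1 / 2) ^ 0) / c)"
   using False 0 by (intro ennreal_leI) (simp add: field_simps)
  finally show ?thesis .
 qed
next
 case (Suc k)
 have cont: "continuous_on UNIV (f m)" for m
  using assms(1) by (meson DERIV_isCont continuous_at_imp_continuous_on)
 have bor: "f m \<in> borel_measurable borel" for m by (rule borel_measurable_continuous_onI[OF cont])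
 note [measurable] = bor
 define \<theta> where "\<theta> = (1 / 2 :: real) ^ k"
 have \<theta>: "0 < \<theta>" "\<theta> <= 1" by (auto simp: \<theta>_def power_le_one)
 \<comment> \<open>This balances the two contributions, as
   \<open>rh powr \<theta> / \<sigma> = \<sigma>\<close>, and halves the exponent at each step of
   the induction.\<close>
 define \<sigma> where "\<sigma> = rh powr (\<theta> / 2)"
 have \<sigma>: "0 < \<sigma>" "\<sigma> <= 1" using Suc.prems \<theta> powr_mono2[of "\<theta> / 2" rh 1] by (auto simp: \<sigma>_def)
 have mvt: "c * (y - x) <= \<bar>f k y - f k x\<bar>" if xy: "x \<in> {p..q}" "y \<in> {p..q}" "x <= y" for x y
 proof (cases "x = y")
  case False
  hence "x < y" using xy by simp
  then obtain t where t: "x < t" "t < y" "f k y - f k x = (y - x) * f (Suc k) t"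
   using MVT2[of x y "f k" "f (Suc k)"] assms(1) by blast
  have "c <= \<bar>f (Suc k) t\<bar>" using Suc.prems(3)[of t] t xy by auto
  hence "(y - x) * c <= (y - x) * \<bar>f (Suc k) t\<bar>" using xy by (intro mult_left_mono) auto
  thus ?thesis using t xy by (simp add: abs_mult mult.commute)
 qed simp
 have le: "y <= x" if "x \<in> {p..q}" "y \<in> {p..q}" "x <= y" "\<bar>f k y - f k x\<bar> = 0" for x y
 proof -
  have "c * (y - x) <= 0" using mvt[OF that(1-3)] that(4) by linarith
  thus ?thesis using Suc.prems(4) by (simp add: mult_le_0_iff)
 qed
 have inj: "inj_on (f k) {p..q}"
 proof (rule inj_onI)
  fix x y assume h: "x \<in> {p..q}" "y \<in> {p..q}" "f k x = f k y"
  have "\<bar>f k y - f k x\<bar> = 0" "\<bar>f k x - f k y\<bar> = 0" using h(3) by simp_all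
  thus "x = y" using le[of x y] le[of y x] h(1,2) by linarith
 qed
 define P where "P = {x \<in> {p..q}. \<sigma> <= f k x}"
 define N where "N = {x \<in> {p..q}. f k x <= - \<sigma>}"
 define Z where "Z = {x \<in> {p..q}. \<bar>f k x\<bar> < \<sigma>}"
 have piece: "emeasure lborel {x \<in> S. \<bar>f 0 x\<bar> <= rh} <= ennreal (4 ^ (k + 1) * rh powr \<theta> / \<sigma>)"
  if S: "S = P | S = N" for S
 proof (cases "S = {}")
  case False
  have closed: "closed S"
  proof -
   have "P = {p..q} \<inter> {x. \<sigma> <= f k x}" "N = {p..q} \<inter> {x. f k x <= - \<sigma>}" by (auto simp: P_def N_def)
   moreover have "closed {x. \<sigma> <= f k x}" "closed {x. f k x <= - \<sigma>}"
   using cont[of k] by (auto intro!: closed_Collect_le continuous_on_const)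
   ultimately show ?thesis using S by auto
  qed
  have sub: "S \<subseteq> {p..q}" using S by (auto simp: P_def N_def)
  have "compact S" using closed sub by (meson bounded_closed_interval bounded_subset compact_eq_bounded_closed)
  moreover have "connected S"
  proof -
   have "is_interval S"
   unfolding is_interval_1
   proof (intro ballI allI impI)
   fix x y t assume h: "x \<in> S" "y \<in> S" "x <= t & t <= y"
   hence xy: "x \<in> {p..q}" "y \<in> {p..q}" "t \<in> {p..q}" using sub by auto
   have "f k x <= f k t & f k t <= f k y | f k y <= f k t & f k t <= f k x"
   proof (cases "x < t & t < y")
   case True
   have "inj_on (f k) {x..y}" by (rule inj_on_subset[OF inj]) (use xy in auto)
   thus ?thesis
   using continuous_inj_imp_mono[of x t y "f k"] True continuous_on_subset[OF cont, of "{x..y}" k] by force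
   next
   case False
   hence "t = x | t = y" using h(3) by auto
   thus ?thesis by auto
   qed
   thus "t \<in> S" using S h xy by (auto simp: P_def N_def)
   qed
   thus ?thesis by (simp add: is_interval_connected_1)
  qed
  ultimately obtain a b where ab: "S = {a..b}" using connected_compact_interval_1[of S] by auto
  have "a <= b" using ab False by auto
  have "emeasure lborel {x \<in> {a..b}. \<bar>f 0 x\<bar> <= rh} <= ennreal (4 ^ (k + 1) * rh powr ((1 / 2) ^ k) / \<sigma>)"
  proof (rule Suc.IH)
   show "a <= b" by fact
   have "a \<in> {p..q}" "b \<in> {p..q}" using sub ab \<open>a <= b\<close> by auto
   thus "b - a <= 1" using Suc.prems by auto
   fix x assume "x \<in> {a..b}"
   hence "x \<in> S" using ab by simp
   thus "\<sigma> <= \<bar>f k x\<bar>" using S by (auto simp: P_def N_def)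
  qed (use \<sigma> Suc.prems in auto)
  thus ?thesis using ab by (simp add: \<theta>_def)
 qed simp
 have Zm: "emeasure lborel Z <= ennreal (2 * \<sigma> / c)"
 proof (rule measure_le_of_diameter)
  show "Z \<in> sets lborel" unfolding Z_def by measurable
  fix x y assume "x \<in> Z" "y \<in> Z" "x <= y"
  hence "c * (y - x) <= \<bar>f k y - f k x\<bar>" by (intro mvt) (auto simp: Z_def)
  also have "... <= 2 * \<sigma>" using \<open>x \<in> Z\<close> \<open>y \<in> Z\<close> by (auto simp: Z_def)
  finally show "y - x <= 2 * \<sigma> / c" using Suc.prems by (simp add: field_simps)
 qed (use \<sigma> Suc.prems in auto)
 have "emeasure lborel {x \<in> {p..q}. \<bar>f 0 x\<bar> <= rh} <=
   emeasure lborel ({x \<in> P. \<bar>f 0 x\<bar> <= rh} \<union> {x \<in> N. \<bar>f 0 x\<bar> <= rh} \<union> Z)"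
  by (rule emeasure_mono) (auto simp: P_def N_def Z_def)
 also have "... <= emeasure lborel ({x \<in> P. \<bar>f 0 x\<bar> <= rh} \<union> {x \<in> N. \<bar>f 0 x\<bar> <= rh}) + emeasure lborel Z"
  by (rule emeasure_subadditive) (auto simp: P_def N_def Z_def)
 also have "... <= (emeasure lborel {x \<in> P. \<bar>f 0 x\<bar> <= rh} + emeasure lborel {x \<in> N. \<bar>f 0 x\<bar> <= rh}) + emeasure lborel Z"
  by (intro add_right_mono emeasure_subadditive) (auto simp: P_def N_def)
 also have "... <= (ennreal (4 ^ (k + 1) * rh powr \<theta> / \<sigma>) + ennreal (4 ^ (k + 1) * rh powr \<theta> / \<sigma>)) + ennreal (2 * \<sigma> / c)"
  by (intro add_mono piece Zm) auto
 also have "... = ennreal (2 * (4 ^ (k + 1) * rh powr \<theta> / \<sigma>) + 2 * \<sigma> / c)"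
  using \<sigma> Suc.prems by (subst ennreal_plus[symmetric]; simp)+
 also have "... <= ennreal (4 ^ (Suc k + 1) * rh powr ((1 / 2) ^ Suc k) / c)"
 proof (rule ennreal_leI)
  have "rh powr \<theta> = \<sigma> * \<sigma>" unfolding \<sigma>_def by (simp add: powr_add[symmetric])
  hence 1: "rh powr \<theta> / \<sigma> = \<sigma>" using \<sigma> by simp
  have 2: "rh powr ((1 / 2) ^ Suc k) = \<sigma>" by (simp add: \<sigma>_def \<theta>_def)
  define F :: real where "F = 4 ^ (k + 1)"
  have "(1::real) <= F" unfolding F_def by (rule one_le_power) simp
  moreover have "\<sigma> <= \<sigma> / c" using \<sigma> Suc.prems by (simp add: field_simps)
  ultimately have "2 * (F * \<sigma>) + 2 * (\<sigma> / c) <= 2 * (F * (\<sigma> / c)) + 2 * (F * (\<sigma> / c))"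
   using \<sigma> Suc.prems mult_right_mono[of 1 F "\<sigma> / c"] by (intro add_mono mult_left_mono) auto
  also have "... = 4 ^ (Suc k + 1) * \<sigma> / c" by (simp add: F_def)
  finally show "2 * (4 ^ (k + 1) * rh powr \<theta> / \<sigma>) + 2 * \<sigma> / c <= 4 ^ (Suc k + 1) * rh powr ((1 / 2) ^ Suc k) / c"
   using 1 unfolding 2 F_def by (simp add: times_divide_eq_right[symmetric] del: times_divide_eq_right)
 qed
 finally show ?case .
qed

section \<open>Transversality of finite order\<close>

lemma compact_words: "compact (words b)"
proof -
 have "compactin (product_topology (%i::nat. euclidean :: nat topology) UNIV) (PiE UNIV (%_. {..<b}))"
  unfolding compactin_PiE by (auto simp: finite_imp_compact)
 moreover have "PiE UNIV (%_::nat. {..<b}) = words b" by (auto simp: words_def PiE_def)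
 ultimately have "compactin euclidean (words b)" by (metis euclidean_product_topology)
 thus ?thesis by simp
qed

locale analytic_family =
 fixes b :: nat and ga :: real and \<phi> :: "real => real" and M R :: real
 assumes b2: "2 <= b" and g0: "0 < ga" and g1: "ga < 1" and M0: "0 < M" and R1: "1 <= R"
  and der: "!!m x. ((deriv ^^ m) \<phi> has_real_derivative (deriv ^^ Suc m) \<phi> x) (at x)"
  and bd: "!!m x. \<bar>(deriv ^^ m) \<phi> x\<bar> <= M * R ^ m * fact m"
  and H: "condition_H b ga \<phi>"
begin

definition arg :: "nat => real => (nat => nat) => real" where
 "arg n x i = (x + (\<Sum>k\<le>n. real (i k) * real b ^ k)) / real b ^ (Suc n)"
text \<open>Term \<open>n\<close> of the series \<open>S_fun\<close>, differentiated
  \<open>m\<close> times in \<open>x\<close>.\<close>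

definition t :: "nat => nat => real => (nat => nat) => real" where
 "t m n x i = ga ^ n * (1 / real b ^ Suc n) ^ m * (deriv ^^ m) \<phi> (arg n x i)"
definition T :: "nat => real => (nat => nat) => real" where "T m x i = (\<Sum>n. t m n x i)"
definition W :: "nat => real" where "W m = M * R ^ m * fact m / (1 - ga)"

lemma T0: "T 0 x i = S_fun b ga \<phi> x i"
 by (simp add: T_def t_def S_fun_def arg_def)

lemma t_bound: "norm (t m n x i) <= W m * (1 - ga) * ga ^ n"
proof -
 have "norm (t m n x i) = ga ^ n * (1 / real b ^ Suc n) ^ m * \<bar>(deriv ^^ m) \<phi> (arg n x i)\<bar>"
  using g0 by (simp add: t_def abs_mult)
 also have "... <= ga ^ n * 1 * (M * R ^ m * fact m)"
 proof (intro mult_mono bd order_refl power_le_one)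
  have "1 <= real b ^ Suc n" using b2 by (intro one_le_power) auto
  thus "1 / real b ^ Suc n <= 1" by simp
 qed (use g0 in auto)
 also have "... = W m * (1 - ga) * ga ^ n" using g1 by (simp add: W_def)
 finally show ?thesis .
qed

lemma geo: "summable (%n. c * ga ^ n)" "(\<Sum>n. c * (1 - ga) * ga ^ n) = c"
 using g0 g1 suminf_geometric[of ga] by (auto simp: suminf_mult summable_geometric)

lemma t_summable: "summable (%n. t m n x i)"
 by (rule summable_comparison_test'[OF geo(1) t_bound])

lemma T_bound: "\<bar>T m x i\<bar> <= W m"
 using norm_suminf_le[OF t_bound geo(1)] unfolding T_def geo(2) by simp

lemma W0: "0 < W m" using M0 R1 g1 by (simp add: W_def)

lemma T_deriv: "((%x. T m x i) has_real_derivative T (Suc m) x i) (at x)"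
proof -
 have "((%x. \<Sum>n. t m n x i) has_real_derivative (\<Sum>n. t (Suc m) n x i)) (at x)"
 proof (rule has_field_derivative_series'(2)[where S=UNIV])
  fix n x
  have 1: "((%x. arg n x i) has_real_derivative 1 / real b ^ Suc n) (at x)"
   unfolding arg_def using b2 by (auto intro!: derivative_eq_intros)
  have "((%x. (deriv ^^ m) \<phi> (arg n x i)) has_real_derivative (deriv ^^ Suc m) \<phi> (arg n x i) * (1 / real b ^ Suc n)) (at x)"
   by (rule DERIV_chain2[OF der 1])
  from DERIV_cmult[OF this, of "ga ^ n * (1 / real b ^ Suc n) ^ m"]
  show "((%x. t m n x i) has_real_derivative t (Suc m) n x i) (at x within UNIV)"
   unfolding t_def by (simp add: mult_ac)
 next
  show "uniformly_convergent_on UNIV (%n x. \<Sum>k<n. t (Suc m) k x i)"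
   by (rule Weierstrass_m_test'[OF t_bound geo(1)])
 qed (auto intro: t_summable)
 thus ?thesis by (simp add: T_def)
qed

lemma T_lip: "\<bar>T m x i - T m x' i\<bar> <= W (Suc m) * \<bar>x - x'\<bar>"
proof -
 have *: "\<bar>T m y i - T m x i\<bar> <= W (Suc m) * (y - x)" if xy: "x < y" for x y
 proof -
  obtain z where "T m y i - T m x i = (y - x) * T (Suc m) z i"
   using MVT2[OF xy, of "%x. T m x i" "%x. T (Suc m) x i"] T_deriv by blast
  thus ?thesis using T_bound[of "Suc m" z i] xy by (simp add: abs_mult mult.commute mult_left_mono)
 qed
 show ?thesis
  using *[of x x'] *[of x' x] by (cases x x' rule: linorder_cases) (auto simp: abs_minus_commute)
qed

lemma T_words: assumes "!!k. k < n ==> i k = i' k" shows "\<bar>T m x i - T m x i'\<bar> <= 2 * W m * ga ^ n"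
proof -
 have eq: "t m k x i = t m k x i'" if "k < n" for k
 proof -
  have "arg k x i = arg k x i'" unfolding arg_def using assms that by simp
  thus ?thesis by (simp add: t_def)
 qed
 have tail: "\<bar>\<Sum>k. t m (k + n) x j\<bar> <= W m * ga ^ n" for j
 proof -
  have "norm (\<Sum>k. t m (k + n) x j) <= (\<Sum>k. (W m * ga ^ n) * (1 - ga) * ga ^ k)"
  proof (rule norm_suminf_le)
   fix k show "norm (t m (k + n) x j) <= (W m * ga ^ n) * (1 - ga) * ga ^ k"
   using t_bound[of m "k + n" x j] by (simp add: power_add mult_ac)
  qed (rule geo(1))
  thus ?thesis unfolding geo(2) by simp
 qed
 have "T m x i - T m x i' = (\<Sum>k. t m (k + n) x i) - (\<Sum>k. t m (k + n) x i')"
  unfolding T_def suminf_split_initial_segment[OF t_summable, of m x i n]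
   suminf_split_initial_segment[OF t_summable, of m x i' n] using eq by simp
 thus ?thesis using tail[of i] tail[of i'] by linarith
qed

text \<open>Taylor's formula with the bounds \<open>W\<close> makes the difference vanish, with all
  its derivatives, within \<open>1 / (4 * R)\<close> of a point where all derivatives vanish. This
  radius is the same at every point, so repetition reaches the whole line and contradicts condition
  (H).\<close>

lemma not_all_derivatives_zero:
 assumes ij: "i \<in> words b" "j \<in> words b" "i ~= j"
 shows "\<exists>m. T m x0 i - T m x0 j ~= 0"
proof (rule ccontr)
 define D where "D m x = T m x i - T m x j" for m x
 assume "~ ?thesis"
 hence z0: "D m x0 = 0" for m by (simp add: D_def)
 have Dd: "(D m has_real_derivative D (Suc m) x) (at x)" for m x
  unfolding D_def by (intro DERIV_diff T_deriv)
 have Db: "\<bar>D m x\<bar> <= 2 * W m" for m x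
  unfolding D_def using T_bound[of m x i] T_bound[of m x j] by linarith
 have local: "D m x = 0" if z: "!!m. D m y = 0" and xy: "\<bar>x - y\<bar> <= 1 / (4 * R)" for x y m
 proof (cases "x = y")
  case False
  have "\<bar>D m x\<bar> <= (2 * M / (1 - ga) * (2 * R) ^ m * fact m) * (1 / 2) ^ n" if n0: "0 < n" for n
  proof -
   obtain s where "D m x = (\<Sum>k<n. D (m + k) y / fact k * (x - y) ^ k) + D (m + n) s / fact n * (x - y) ^ n"
   using Taylor[of n "%k. D (m + k)" "D m" "min x y" "max x y" y x] n0 False Dd by auto
   hence "\<bar>D m x\<bar> = \<bar>D (m + n) s\<bar> / fact n * \<bar>x - y\<bar> ^ n" using z by (simp add: abs_mult power_abs)
   also have "... <= (2 * W (m + n)) / fact n * (1 / (4 * R)) ^ n"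
   using xy by (intro mult_mono divide_right_mono Db power_mono) (auto simp: less_imp_le[OF W0])
   also have "... = 2 * M / (1 - ga) * (R ^ (m + n) * (1 / (4 * R)) ^ n) * (fact (n + m) / fact n)"
   by (simp add: W_def add.commute mult_ac)
   also have "... <= 2 * M / (1 - ga) * (R ^ (m + n) * (1 / (4 * R)) ^ n) * (fact m * 2 ^ (n + m))"
   using M0 g1 R1 by (intro mult_left_mono fact_ratio_le) auto
   also have "... = (2 * M / (1 - ga) * (2 * R) ^ m * fact m) * (R * (1 / (4 * R)) * 2) ^ n"
   by (simp only: power_add power_mult_distrib mult_ac)
   also have "R * (1 / (4 * R)) * 2 = 1 / 2" using R1 by simp
   finally show ?thesis .
  qed
  hence ev: "\<forall>\<^sub>F n in sequentially. \<bar>D m x\<bar> <= (2 * M / (1 - ga) * (2 * R) ^ m * fact m) * (1 / 2) ^ n"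
   by (auto intro!: eventually_sequentiallyI[of 1])
  have "(%n. (2 * M / (1 - ga) * (2 * R) ^ m * fact m) * (1 / 2) ^ n) \<longlonglongrightarrow> (2 * M / (1 - ga) * (2 * R) ^ m * fact m) * 0"
   by (intro tendsto_mult tendsto_const LIMSEQ_realpow_zero) auto
  from tendsto_lowerbound[OF this ev] show ?thesis by simp
 qed (use z in simp)
 have "\<forall>m x. \<bar>x - x0\<bar> <= real n / (4 * R) --> D m x = 0" for n
 proof (induction n)
  case 0 thus ?case using z0 by simp
 next
  case (Suc n)
  show ?case
  proof (intro allI impI)
   fix m x assume x: "\<bar>x - x0\<bar> <= real (Suc n) / (4 * R)"
   \<comment> \<open>The point on the segment from \<open>x0\<close> to \<open>x\<close> that is one
     admissible step short of \<open>x\<close>.\<close>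
   define y where "y = x0 + (x - x0) * (real n / real (Suc n))"
   have "\<bar>y - x0\<bar> = \<bar>x - x0\<bar> * (real n / real (Suc n))" by (simp add: y_def abs_mult)
   also have "... <= real (Suc n) / (4 * R) * (real n / real (Suc n))" using x by (intro mult_right_mono) auto
   also have "... = real n / (4 * R)" by (simp del: of_nat_Suc)
   finally have hy: "D m y = 0" for m using Suc by blast
   have "x - y = (x - x0) * (1 / real (Suc n))"
   by (simp add: y_def field_simps)
   hence "\<bar>x - y\<bar> = \<bar>x - x0\<bar> * (1 / real (Suc n))" by (simp add: abs_mult)
   hence "\<bar>x - y\<bar> <= real (Suc n) / (4 * R) * (1 / real (Suc n))"
   using x mult_right_mono[OF x, of "1 / real (Suc n)"] by simp
   hence hxy: "\<bar>x - y\<bar> <= 1 / (4 * R)" by (simp del: of_nat_Suc)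
   show "D m x = 0" by (rule local[OF hy hxy])
  qed
 qed
 moreover have "\<exists>n::nat. \<bar>x - x0\<bar> <= real n / (4 * R)" for x
 proof -
  obtain n :: nat where "\<bar>x - x0\<bar> * (4 * R) <= real n" using real_arch_simple by blast
  thus ?thesis using R1 by (intro exI[of _ n]) (simp add: field_simps)
 qed
 ultimately have "D 0 x = 0" for x by blast
 hence eq: "\<forall>x\<in>{0..1}. S_fun b ga \<phi> x i - S_fun b ga \<phi> x j = 0" by (simp add: D_def T0)
 have "j ~= i --> ~ (\<forall>x\<in>{0..1}. S_fun b ga \<phi> x i - S_fun b ga \<phi> x j = 0)"
  by (rule bspec[OF bspec[OF H[unfolded condition_H_def] ij(2)] ij(1)])
 from mp[OF this ij(3)[symmetric]] show False using eq by (rule notE)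
qed

text \<open>Compactness: a sequence of counterexamples accumulates at some \<open>(i, j, x)\<close>
  where every derivative of the difference vanishes. Distinct first digits, unlike mere distinctness
  of words, survive the limit, so \<open>not_all_derivatives_zero\<close> applies there. One number
  \<open>k\<close> serves as the order and, through \<open>1 / (k + 1)\<close>, as the lower
  bound.\<close>

lemma uniform_finite_order:
 "\<exists>k. \<forall>i\<in>words b. \<forall>j\<in>words b. i 0 ~= j 0 --> (\<forall>x\<in>{0..1}. \<exists>m\<le>k. 1 / real (k + 1) <= \<bar>T m x i - T m x j\<bar>)"
proof (rule ccontr)
 assume "~ ?thesis"
 hence neg: "~ (\<forall>i\<in>words b. \<forall>j\<in>words b. i 0 ~= j 0 -->
   (\<forall>x\<in>{0..1}. \<exists>m\<le>k. 1 / real (k + 1) <= \<bar>T m x i - T m x j\<bar>))" for k by blast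
 have "\<exists>p. fst p \<in> words b & fst (snd p) \<in> words b & fst p 0 ~= fst (snd p) 0 & snd (snd p) \<in> {0..1} &
   ~ (\<exists>m\<le>k. 1 / real (k + 1) <= \<bar>T m (snd (snd p)) (fst p) - T m (snd (snd p)) (fst (snd p))\<bar>)" for k
  using neg[of k] by (simp only: split_paired_Ex fst_conv snd_conv) blast
 then obtain p where p: "!!k. fst (p k) \<in> words b & fst (snd (p k)) \<in> words b &
   fst (p k) 0 ~= fst (snd (p k)) 0 & snd (snd (p k)) \<in> {0..1} &
   ~ (\<exists>m\<le>k. 1 / real (k + 1) <= \<bar>T m (snd (snd (p k))) (fst (p k)) - T m (snd (snd (p k))) (fst (snd (p k)))\<bar>)"
  by metis
 define I where "I k = fst (p k)" for k
 define J where "J k = fst (snd (p k))" for k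
 define X where "X k = snd (snd (p k))" for k
 have I: "I k \<in> words b" and J: "J k \<in> words b" and IJ: "I k 0 ~= J k 0" and X: "X k \<in> {0..1}" for k
  using p[of k] unfolding I_def J_def X_def by blast+
 have small: "\<bar>T m (X k) (I k) - T m (X k) (J k)\<bar> < 1 / real (k + 1)" if "m <= k" for k m
  using p[of k] that unfolding I_def J_def X_def not_le[symmetric] by blast
 have sc: "seq_compact (words b \<times> words b \<times> {0..1::real})"
  by (simp add: seq_compact_eq_compact compact_Times compact_words)
 have mem: "\<forall>k. (I k, J k, X k) \<in> words b \<times> words b \<times> {0..1}" using I J X by auto
 obtain l r where l: "l \<in> words b \<times> words b \<times> {0..1::real}" and r: "strict_mono (r :: nat => nat)"
  and lim: "((%k. (I k, J k, X k)) \<circ> r) \<longlonglongrightarrow> l"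
  by (rule seq_compactE[OF sc mem]) (rule that)
 obtain i j x where ijx: "l = (i, j, x)" by (cases l) auto
 have limI: "(%k. I (r k)) \<longlonglongrightarrow> i" and limJ: "(%k. J (r k)) \<longlonglongrightarrow> j" and limX: "(%k. X (r k)) \<longlonglongrightarrow> x"
  using tendsto_fst[OF lim] tendsto_fst[OF tendsto_snd[OF lim]] tendsto_snd[OF tendsto_snd[OF lim]]
  by (auto simp: ijx o_def)
 have digit: "\<forall>\<^sub>F k in sequentially. F k n = f n" if "F \<longlonglongrightarrow> f" for F :: "nat => nat => nat" and f n
 proof -
  have "continuous_on UNIV (%f :: nat => nat. f n)" by (rule continuous_on_product_coordinates)
  from continuous_on_tendsto_compose[OF this that] show ?thesis by (simp add: tendsto_discrete)
 qed
 have digits: "\<forall>\<^sub>F k in sequentially. \<forall>q<n. F k q = f q" if "F \<longlonglongrightarrow> f" for F :: "nat => nat => nat" and f n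
 proof -
  have "\<forall>\<^sub>F k in sequentially. \<forall>q\<in>{..<n}. F k q = f q"
   by (rule eventually_ball_finite) (auto intro: digit[OF that])
  thus ?thesis by (rule eventually_mono) auto
 qed
 have conv: "(%k. T m (X (r k)) (F k)) \<longlonglongrightarrow> T m x f" if "F \<longlonglongrightarrow> f" for F f m
 proof (rule metric_LIMSEQ_I)
  fix e :: real assume e: "0 < e"
  obtain n where n: "ga ^ n < e / 2 / (2 * W m)"
   using real_arch_pow_inv[of "e / 2 / (2 * W m)" ga] g1 e W0[of m] by auto
  have "\<forall>\<^sub>F k in sequentially. dist (X (r k)) x < e / 2 / W (Suc m)"
   using tendstoD[OF limX, of "e / 2 / W (Suc m)"] e W0[of "Suc m"] by simp
  with digits[OF that, of n] have "\<forall>\<^sub>F k in sequentially. dist (T m (X (r k)) (F k)) (T m x f) < e"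
  proof eventually_elim
   case (elim k)
   have "\<bar>T m (X (r k)) (F k) - T m (X (r k)) f\<bar> <= 2 * W m * ga ^ n" using elim by (intro T_words) auto
   also have "... < e / 2" using n W0[of m] by (simp add: field_simps)
   finally have 1: "\<bar>T m (X (r k)) (F k) - T m (X (r k)) f\<bar> < e / 2" .
   have "\<bar>T m (X (r k)) f - T m x f\<bar> <= W (Suc m) * \<bar>X (r k) - x\<bar>" by (rule T_lip)
   also have "... < e / 2" using elim W0[of "Suc m"] by (simp add: dist_real_def field_simps)
   finally show ?case using 1 unfolding dist_real_def by linarith
  qed
  thus "\<exists>no. \<forall>k\<ge>no. dist (T m (X (r k)) (F k)) (T m x f) < e" by (simp add: eventually_sequentially)
 qed
 have "T m x i - T m x j = 0" for m
 proof -
  have "(%k. T m (X (r k)) (I (r k)) - T m (X (r k)) (J (r k))) \<longlonglongrightarrow> T m x i - T m x j"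
   by (intro tendsto_diff conv limI limJ)
  moreover have "(%k. T m (X (r k)) (I (r k)) - T m (X (r k)) (J (r k))) \<longlonglongrightarrow> 0"
  proof (rule Lim_null_comparison)
   show "\<forall>\<^sub>F k in sequentially. norm (T m (X (r k)) (I (r k)) - T m (X (r k)) (J (r k))) <= inverse (real (Suc k))"
   proof (rule eventually_sequentiallyI[of m])
   fix k assume "m <= k"
   hence "k <= r k" "m <= r k" using seq_suble[OF r, of k] by auto
   hence "norm (T m (X (r k)) (I (r k)) - T m (X (r k)) (J (r k))) <= 1 / real (r k + 1)" using small[of m "r k"] by simp
   also have "... <= inverse (real (Suc k))" using \<open>k <= r k\<close> by (simp add: field_simps)
   finally show "norm (T m (X (r k)) (I (r k)) - T m (X (r k)) (J (r k))) <= inverse (real (Suc k))" .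
   qed
  qed (rule LIMSEQ_inverse_real_of_nat)
  ultimately show ?thesis by (rule LIMSEQ_unique)
 qed
 moreover have "i ~= j"
 proof
  assume "i = j"
  have "\<forall>\<^sub>F k in sequentially. False"
   using digit[OF limI, of 0] digit[OF limJ, of 0]
  proof eventually_elim
   case (elim k) thus ?case using IJ[of "r k"] \<open>i = j\<close> by simp
  qed
  thus False by simp
 qed
 ultimately show False using not_all_derivatives_zero[of i j x] l ijx by auto
qed

text \<open>On a short interval one derivative of order at most \<open>k\<close> is bounded away
  from 0 throughout, so \<open>sublevel_estimate\<close> gives the exponent
  \<open>(1 / 2) ^ k\<close> there; the number of intervals enters the constant.\<close>

lemma transversality:
 "\<exists>K>0. \<exists>\<theta>>0. \<forall>i\<in>words b. \<forall>j\<in>words b. i 0 ~= j 0 --> (\<forall>rh. 0 < rh --> rh <= 1 -->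
  emeasure lborel {x \<in> {0..1}. \<bar>S_fun b ga \<phi> x i - S_fun b ga \<phi> x j\<bar> <= rh} <= ennreal (K * rh powr \<theta>))"
proof -
 obtain k where k: "!!i j x. i \<in> words b ==> j \<in> words b ==> i 0 ~= j 0 ==> x \<in> {0..1} ==>
   \<exists>m\<le>k. 1 / real (k + 1) <= \<bar>T m x i - T m x j\<bar>"
  using uniform_finite_order by blast
 define c where "c = 1 / real (k + 1)"
 have c: "0 < c" "c <= 1" by (auto simp: c_def)
 define B where "B = (\<Sum>m\<le>Suc k. 2 * W m)"
 have B: "2 * W m <= B" if "m <= Suc k" for m
  unfolding B_def using that W0 by (intro member_le_sum) (auto simp: less_imp_le)
 have B0: "0 < B" using B[of 0] W0[of 0] by simp
 \<comment> \<open>The intervals are so short that, by the Lipschitz bound \<open>B\<close>, a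
   derivative of modulus at least \<open>c\<close> at the left end point keeps modulus at least
   \<open>c / 2\<close>.\<close>
 obtain Q :: nat where Q: "2 * B / c < real Q" using reals_Archimedean2 by blast
 have Q0: "0 < real Q" using Q B0 c by (smt (verit) divide_pos_pos)
 define K where "K = real Q * (4 ^ (k + 1) / (c / 2))"
 define \<theta> where "\<theta> = (1 / 2 :: real) ^ k"
 have "emeasure lborel {x \<in> {0..1}. \<bar>S_fun b ga \<phi> x i - S_fun b ga \<phi> x j\<bar> <= rh} <= ennreal (K * rh powr \<theta>)"
  if ij: "i \<in> words b" "j \<in> words b" "i 0 ~= j 0" and rh: "0 < rh" "rh <= 1" for i j rh
 proof -
  define D where "D m x = T m x i - T m x j" for m x
  have Dd: "(D m has_real_derivative D (Suc m) x) (at x)" for m x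
   unfolding D_def by (intro DERIV_diff T_deriv)
  have cont: "continuous_on UNIV (D 0)" using Dd by (meson DERIV_isCont continuous_at_imp_continuous_on)
  have bor[measurable]: "D 0 \<in> borel_measurable borel" by (rule borel_measurable_continuous_onI[OF cont])
  let ?I = "%s::nat. {real s / real Q..(real s + 1) / real Q}"
  have piece: "emeasure lborel {x \<in> ?I s. \<bar>D 0 x\<bar> <= rh} <= ennreal (4 ^ (k + 1) / (c / 2) * rh powr \<theta>)" if s: "s < Q" for s
  proof -
   have "real s / real Q \<in> {0..1}" using s by (auto simp: field_simps)
   from k[OF ij this] obtain m where m: "m <= k" "c <= \<bar>D m (real s / real Q)\<bar>"
   by (auto simp: c_def D_def)
   have "emeasure lborel {x \<in> ?I s. \<bar>D 0 x\<bar> <= rh} <= ennreal (4 ^ (m + 1) * rh powr ((1 / 2) ^ m) / (c / 2))"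
   proof (rule sublevel_estimate[where f=D, OF Dd])
   show "real s / real Q <= (real s + 1) / real Q" using Q0 by (simp add: divide_right_mono)
   show "(real s + 1) / real Q - real s / real Q <= 1" using s by (simp add: diff_divide_distrib[symmetric] field_simps)
   fix x assume x: "x \<in> ?I s"
   have xs: "\<bar>x - real s / real Q\<bar> <= 1 / real Q" using x by (auto simp: add_divide_distrib)
   have "\<bar>D m x - D m (real s / real Q)\<bar> <= 2 * W (Suc m) * \<bar>x - real s / real Q\<bar>"
   unfolding D_def using T_lip[of m x i "real s / real Q"] T_lip[of m x j "real s / real Q"] by linarith
   also have "... <= B * (1 / real Q)"
   using B[of "Suc m"] m xs B0 by (intro mult_mono) auto
   also have "... <= c / 2" using Q Q0 c by (simp add: field_simps)
   finally show "c / 2 <= \<bar>D m x\<bar>" using m(2) by linarith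
   qed (use c rh in auto)
   also have "... <= ennreal (4 ^ (k + 1) / (c / 2) * rh powr \<theta>)"
   proof (rule ennreal_leI)
   have "(1 / 2 :: real) ^ k <= (1 / 2) ^ m" using m by (intro power_decreasing) auto
   hence "rh powr ((1 / 2) ^ m) <= rh powr \<theta>" unfolding \<theta>_def using rh by (intro powr_mono') auto
   moreover have "(4::real) ^ (m + 1) <= 4 ^ (k + 1)" using m by (intro power_increasing) auto
   ultimately have "4 ^ (m + 1) * rh powr ((1 / 2) ^ m) <= 4 ^ (k + 1) * rh powr \<theta>" by (intro mult_mono) auto
   hence "4 ^ (m + 1) * rh powr ((1 / 2) ^ m) / (c / 2) <= 4 ^ (k + 1) * rh powr \<theta> / (c / 2)"
   using c by (intro divide_right_mono) auto
   thus "4 ^ (m + 1) * rh powr ((1 / 2) ^ m) / (c / 2) <= 4 ^ (k + 1) / (c / 2) * rh powr \<theta>" by simp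
   qed
   finally show ?thesis .
  qed
  have "{x \<in> {0..1}. \<bar>D 0 x\<bar> <= rh} \<subseteq> (\<Union>s\<in>{..<Q}. {x \<in> ?I s. \<bar>D 0 x\<bar> <= rh})"
  proof
   fix x assume x: "x \<in> {x \<in> {0..1}. \<bar>D 0 x\<bar> <= rh}"
   define s where "s = min (nat \<lfloor>real Q * x\<rfloor>) (Q - 1)"
   have xs: "0 <= real Q * x" "real Q * x <= real Q" using x Q0 by (auto simp: mult_le_cancel_left1)
   have "s < Q" using Q0 by (auto simp: s_def)
   have fl: "real (nat \<lfloor>real Q * x\<rfloor>) <= real Q * x" "real Q * x < real (nat \<lfloor>real Q * x\<rfloor>) + 1"
   using xs(1) by auto
   have "s <= nat \<lfloor>real Q * x\<rfloor>" by (simp add: s_def)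
   hence "real s <= real Q * x" using fl(1) by linarith
   moreover have "real Q * x <= real s + 1"
   proof (cases "nat \<lfloor>real Q * x\<rfloor> <= Q - 1")
   case True thus ?thesis using fl(2) by (simp add: s_def)
   next
   case False
   hence "s = Q - 1" by (simp add: s_def)
   hence "real s + 1 = real Q" using Q0 by (simp add: of_nat_diff)
   thus ?thesis using xs(2) by simp
   qed
   ultimately have "x \<in> ?I s" using Q0 by (simp add: field_simps)
   thus "x \<in> (\<Union>s\<in>{..<Q}. {x \<in> ?I s. \<bar>D 0 x\<bar> <= rh})" using x \<open>s < Q\<close> by auto
  qed
  hence "emeasure lborel {x \<in> {0..1}. \<bar>D 0 x\<bar> <= rh} <= emeasure lborel (\<Union>s\<in>{..<Q}. {x \<in> ?I s. \<bar>D 0 x\<bar> <= rh})"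
   by (rule emeasure_mono) measurable
  also have "... <= (\<Sum>s\<in>{..<Q}. emeasure lborel {x \<in> ?I s. \<bar>D 0 x\<bar> <= rh})"
   by (rule emeasure_subadditive_finite) auto
  also have "... <= (\<Sum>s\<in>{..<Q}. ennreal (4 ^ (k + 1) / (c / 2) * rh powr \<theta>))"
   by (intro sum_mono piece) auto
  also have "... = ennreal (K * rh powr \<theta>)"
   using c by (simp add: K_def ennreal_of_nat_eq_real_of_nat ennreal_mult[symmetric] mult.assoc)
  finally show ?thesis by (simp add: D_def T0)
 qed
 moreover have "0 < K" using Q0 c by (simp add: K_def)
 moreover have "0 < \<theta>" by (simp add: \<theta>_def)
 ultimately show ?thesis by blast
qed

end

section \<open>Fibre measures seen through windows of scales\<close>

context solenoid
begin

definition lam :: real where "lam = log 2 (1 / ga)"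
definition am :: "nat => real" where "am t = (INF x\<in>{0..1}. a x t)"
text \<open>The number of factors \<open>ga\<close> that fit into \<open>T\<close> binary digits,
  after the losses from the factor \<open>4 * C\<close> in the diameter of a piece and from rounding
  up the length of its prefix. For small \<open>T\<close> it is 0, and then \<open>lo T\<close> is
  at most 0.\<close>

definition tt :: "nat => nat" where "tt T = nat \<lfloor>(real T - log 2 (4 * real C) - lam) / lam\<rfloor>"
definition lo :: "nat => real" where "lo T = am (tt T) - \<kappa>"

lemma lam0: "0 < lam" unfolding lam_def using g0 g1 by simp

lemma gamma_powr: "ga ^ n = 2 powr (- (real n * lam))"
proof -
 have "lam = - log 2 ga" unfolding lam_def using g0 by (simp add: log_divide)
 hence "2 powr (- (real n * lam)) = 2 powr (log 2 ga * real n)" by (simp add: mult.commute)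
 also have "... = ga powr real n" using g0 by (simp add: powr_powr[symmetric])
 finally show ?thesis using g0 by (simp add: powr_realpow)
qed

lemma am_le: "0 <= x ==> x <= 1 ==> am t <= a x t"
 unfolding am_def by (rule cINF_lower) (auto intro!: bdd_belowI2[where m=0] a_nonneg)

lemma am_ge: "(!!x. 0 <= x ==> x <= 1 ==> c <= a x t) ==> c <= am t"
 unfolding am_def by (rule cINF_greatest) auto

lemma am_0: "am 0 <= 0"
proof -
 have "a 0 0 <= 0" using a_le[of 0 0] by simp
 thus ?thesis using am_le[of 0 0] by simp
qed

lemma beta_nonneg: "0 <= \<beta>"
proof (rule field_le_epsilon)
 fix e :: real assume e: "0 < e"
 obtain m :: nat where m: "2 * \<kappa> / e < real m" using reals_Archimedean2 by blast
 have "- e <= (Av (Suc m) - 2 * \<kappa>) / real (Suc m)"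
 proof -
  have "2 * \<kappa> <= e * real (Suc m)" using m e by (simp add: field_simps)
  thus ?thesis using Av_bounds(1)[of "Suc m"] by (simp add: le_divide_eq del: of_nat_Suc)
 qed
 also have "... <= \<beta>" unfolding \<beta>_def by (rule cSUP_upper[OF UNIV_I \<beta>_bdd])
 finally show "0 <= \<beta> + e" by simp
qed

text \<open>Translates the rate \<open>\<beta>\<close> per factor \<open>ga\<close> into the rate
  \<open>\<beta> / lam\<close> per binary digit, the unit of \<open>inverse_theorem\<close>.\<close>

lemma lo_limit:
 assumes e: "0 < e"
 shows "\<exists>T0. \<forall>T\<ge>T0. (\<beta> / lam - e) * real T <= lo T"
proof -
 define e' where "e' = e * lam / 2"
 have e': "0 < e'" using e lam0 by (simp add: e'_def)
 obtain n1 where n1: "!!n x. n1 <= n ==> 0 <= x ==> x <= 1 ==> (\<beta> - e') * real n <= a x n"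
  using a_uniform_lower[OF e'] by blast
 define c where "c = (log 2 (4 * real C) + lam) / lam"
 have c0: "0 <= c" unfolding c_def using lam0 C1 by simp
 obtain T0 :: nat where T0: "lam * (real n1 + 1 + c) + 2 * (\<bar>\<beta> - e'\<bar> * (c + 1) + \<kappa>) / e < real T0"
  using reals_Archimedean2 by blast
 have "(\<beta> / lam - e) * real T <= lo T" if T: "T0 <= T" for T
 proof -
  have p: "0 <= 2 * (\<bar>\<beta> - e'\<bar> * (c + 1) + \<kappa>) / e" "0 <= lam * (real n1 + 1 + c)"
   using e c0 \<kappa>0 lam0 by auto
  have T1: "lam * (real n1 + 1 + c) < real T" "2 * (\<bar>\<beta> - e'\<bar> * (c + 1) + \<kappa>) / e < real T"
   using T0 T p by linarith+
  define u where "u = (real T - log 2 (4 * real C) - lam) / lam"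
  have u: "u = real T / lam - c" using lam0 by (simp add: u_def c_def field_simps)
  have u1: "real n1 + 1 < u" using T1(1) lam0 unfolding u by (simp add: field_simps)
  have tu: "real (tt T) <= u" "u < real (tt T) + 1" using u1 unfolding tt_def u_def[symmetric] by linarith+
  have "n1 <= tt T" using tu u1 by linarith
  hence "(\<beta> - e') * real (tt T) <= am (tt T)" by (intro am_ge n1) auto
  moreover have "(\<beta> - e') * real (tt T) >= (\<beta> - e') * (real T / lam) - \<bar>\<beta> - e'\<bar> * (c + 1)"
  proof -
   have "\<bar>real T / lam - real (tt T)\<bar> <= c + 1" using tu u c0 by linarith
   hence "\<bar>(\<beta> - e') * (real T / lam - real (tt T))\<bar> <= \<bar>\<beta> - e'\<bar> * (c + 1)"
   unfolding abs_mult by (intro mult_left_mono) auto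
   thus ?thesis by (simp add: right_diff_distrib abs_le_iff)
  qed
  moreover have "(\<beta> - e') * (real T / lam) = (\<beta> / lam - e / 2) * real T"
   using lam0 by (simp add: e'_def field_simps)
  moreover have "\<bar>\<beta> - e'\<bar> * (c + 1) + \<kappa> <= e / 2 * real T" using T1(2) e by (simp add: field_simps)
  moreover have "(\<beta> / lam - e) * real T = (\<beta> / lam - e / 2) * real T - e / 2 * real T" by (simp add: left_diff_distrib)
  ultimately show ?thesis unfolding lo_def by linarith
 qed
 thus ?thesis by blast
qed

lemma ent_tail_words:
 assumes t: "t <= r"
 shows "a x t - log 2 (4 * real C + 2) <= ent {..<b ^ r} (%v. gcell t (Gw x v))"
proof -
 have "ent {..<b ^ r} (%v. gcell t (Gw x v)) =
   ent ({..<b ^ t} \<times> {..<b ^ (r - t)}) (%p. gcell t (Gw x (fst p + b ^ t * snd p)))"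
  using cent_words[OF b0(1), of t "r - t" "%v. gcell t (Gw x v)" "%_. ()"] t by (simp add: ent_def)
 thus ?thesis using ent_word_block[of x t "r - t"] by simp
qed

text \<open>A piece consists of the words with a common prefix of length \<open>m\<close>, where
  \<open>m\<close> is just large enough for \<open>4 * C * ga ^ m <= 1 / 2 ^ s\<close>. By
  \<open>G_word\<close> it is a scaled and translated copy of the fibre over a point of the unit
  interval, whose entropy is at least \<open>am\<close>. The hypothesis \<open>k <= q\<close> makes
  the words long enough for all digits up to \<open>K\<close>.\<close>

lemma fat_fibre_measure:
 assumes y: "0 <= y" "y <= 1" and k: "k <= q" and K: "real K <= real k * lam" and s: "s <= K"
 defines "z == %j. Gw y j - G y"
 shows "\<exists>U :: nat => nat. (\<forall>j\<in>{..<b ^ q}. \<forall>j'\<in>{..<b ^ q}. U j = U j' --> \<bar>z j - z j'\<bar> <= 1 / 2 ^ s) &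
   (\<forall>j\<in>{..<b ^ q}. \<forall>T. s + T <= K --> lo T <= ent (fib {..<b ^ q} U j) (%j. dya (s + T) (z j)))"
proof -
 define c where "c = log 2 (4 * real C)"
 have c0: "0 <= c" unfolding c_def using C1 by simp
 define m where "m = nat \<lceil>(real s + c) / lam\<rceil>"
 have mr: "(real s + c) / lam <= real m" "real m < (real s + c) / lam + 1"
  unfolding m_def using c0 lam0 by (simp_all add: of_nat_nat) linarith+
 have m1: "real s + c <= real m * lam" "real m * lam < real s + c + lam"
  using mr lam0 by (simp_all add: field_simps)
 have gm: "4 * real C * ga ^ m <= 1 / 2 ^ s"
 proof -
  have "4 * real C = 2 powr c" unfolding c_def using C1 by simp
  hence "4 * real C * ga ^ m = 2 powr (c - real m * lam)" unfolding gamma_powr by (simp add: powr_add[symmetric])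
  also have "... <= 2 powr (- real s)" using m1(1) by (intro powr_mono) auto
  also have "... = 1 / 2 ^ s" by (simp add: powr_minus_divide powr_realpow)
  finally show ?thesis .
 qed
 have dec: "real j = real (j mod b ^ m) + real (b ^ m * (j div b ^ m))" for j
  unfolding of_nat_add[symmetric] by simp
 have near: "\<bar>Gw y j - Gw y (j mod b ^ m)\<bar> <= 2 * real C * ga ^ m" for j
  using G_tail[of "y + real (j mod b ^ m)" m "j div b ^ m"] by (subst dec) (simp only: add.assoc)
 have diam: "\<bar>z j - z j'\<bar> <= 1 / 2 ^ s" if "j mod b ^ m = j' mod b ^ m" for j j'
  using near[of j] near[of j'] that gm unfolding z_def by (simp add: abs_le_iff)
 have ent: "lo T <= ent (fib {..<b ^ q} (%j. j mod b ^ m) j) (%j. dya (s + T) (z j))"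
  if j: "j < b ^ q" and T: "s + T <= K" for j T
 proof (cases "real T - c - lam < 0")
  case True
  hence "(real T - c - lam) / lam < 0" using lam0 by (simp add: divide_neg_pos)
  hence "tt T = 0" unfolding tt_def c_def by simp
  hence "lo T <= 0" unfolding lo_def using am_0 \<kappa>0 by simp
  moreover have "0 <= ent (fib {..<b ^ q} (%j. j mod b ^ m) j) (%j. dya (s + T) (z j))"
   unfolding ent_def by (rule cent_nonneg) (simp add: finite_fib)
  ultimately show ?thesis by linarith
 next
  case False
  define t where "t = tt T"
  have "real t <= (real T - c - lam) / lam"
   unfolding t_def tt_def c_def[symmetric] using False lam0 by (simp add: of_nat_nat)
  hence tl: "real t * lam <= real T - c - lam" using lam0 by (simp add: field_simps)
  hence mt: "(real m + real t) * lam <= real s + real T" using m1(2) by (simp add: distrib_right)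
  also have "... <= real k * lam" using T K by linarith
  finally have "real (m + t) <= real k" using lam0 by simp
  hence mtq: "m + t <= q" using k by linarith
  define r where "r = j mod b ^ m"
  have rb: "r < b ^ m" using b0 by (simp add: r_def)
  have fb: "fib {..<b ^ q} (%j. j mod b ^ m) j = (%v. r + b ^ m * v) ` {..<b ^ (q - m)}"
  proof (intro equalityI subsetI)
   fix i assume "i \<in> fib {..<b ^ q} (%j. j mod b ^ m) j"
   hence i: "i < b ^ q" "i mod b ^ m = r" by (auto simp: fib_def r_def)
   have "i div b ^ m < b ^ (q - m)"
   proof (rule ccontr)
   assume "~ i div b ^ m < b ^ (q - m)"
   hence "b ^ m * b ^ (q - m) <= b ^ m * (i div b ^ m)" by simp
   also have "... <= i" by simp
   finally show False using i(1) mtq by (simp add: power_add[symmetric])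
   qed
   moreover have "i = r + b ^ m * (i div b ^ m)" using i(2) by (metis mod_mult_div_eq)
   ultimately show "i \<in> (%v. r + b ^ m * v) ` {..<b ^ (q - m)}" by blast
  next
   fix i assume "i \<in> (%v. r + b ^ m * v) ` {..<b ^ (q - m)}"
   then obtain v where v: "v < b ^ (q - m)" "i = r + b ^ m * v" by auto
   have "i < b ^ m * (v + 1)" using v rb by simp
   also have "... <= b ^ m * b ^ (q - m)" using v by (intro mult_left_mono) auto
   also have "... = b ^ q" using mtq by (simp add: power_add[symmetric])
   finally show "i \<in> fib {..<b ^ q} (%j. j mod b ^ m) j" using v rb by (simp add: fib_def r_def)
  qed
  have inj: "inj_on (%v. r + b ^ m * v) {..<b ^ (q - m)}" using b0 by (auto simp: inj_on_def)
  define x where "x = (y + real r) / real b ^ m"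
  have x: "0 <= x" "x <= 1"
  proof -
   have "Suc r <= b ^ m" using rb by simp
   hence "real (Suc r) <= real (b ^ m)" by (simp only: of_nat_le_iff)
   hence "y + real r <= real b ^ m" using y by simp
   thus "x <= 1" unfolding x_def using b0 by simp
  qed (use y b0 in \<open>simp add: x_def\<close>)
  have zr: "z (r + b ^ m * v) = ga ^ m * Gw x v + (Gn m (y + real r) - G y)" for v
   unfolding z_def x_def using G_word[of "y + real r" m v] by (simp add: add.assoc)
  have "am t <= a x t" using x by (rule am_le)
  also have "... <= ent {..<b ^ (q - m)} (%v. gcell t (Gw x v)) + log 2 (4 * real C + 2)"
  proof -
   have "t <= q - m" using mtq by linarith
   from ent_tail_words[OF this, of x] show ?thesis by linarith
  qed
  also have "ent {..<b ^ (q - m)} (%v. gcell t (Gw x v)) <=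
   ent {..<b ^ (q - m)} (%v. dya (s + T) (z (r + b ^ m * v))) + 1"
  proof -
   have sc: "1 <= 2 ^ (s + T) * ga ^ (m + t)"
   proof -
   have "2 ^ (s + T) * ga ^ (m + t) = 2 powr (real (s + T) - real (m + t) * lam)"
   unfolding gamma_powr by (simp add: powr_realpow[symmetric] powr_add[symmetric])
   also have "... >= 2 powr 0" using mt by (intro powr_mono) auto
   finally show ?thesis by simp
   qed
   have "cent {..<b ^ (q - m)} (%v. gcell t (Gw x v)) (%v. dya (s + T) (z (r + b ^ m * v))) <= log 2 (real 1 + 1)"
   unfolding dya_def
   proof (rule cent_floor_le)
   fix v v' assume "\<lfloor>2 ^ (s + T) * z (r + b ^ m * v)\<rfloor> = \<lfloor>2 ^ (s + T) * z (r + b ^ m * v')\<rfloor>"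
   hence d: "2 ^ (s + T) * z (r + b ^ m * v) - 2 ^ (s + T) * z (r + b ^ m * v') <= 1" by linarith
   define A where "A = (Gw x v - Gw x v') / ga ^ t"
   have "2 ^ (s + T) * z (r + b ^ m * v) - 2 ^ (s + T) * z (r + b ^ m * v') = (2 ^ (s + T) * ga ^ (m + t)) * A"
   proof -
   have At: "ga ^ t * A = Gw x v - Gw x v'" using g0 by (simp add: A_def)
   have "(2 ^ (s + T) * ga ^ (m + t)) * A = 2 ^ (s + T) * ga ^ m * (ga ^ t * A)"
   by (simp add: power_add)
   thus ?thesis unfolding zr At by (simp add: algebra_simps)
   qed
   hence "(2 ^ (s + T) * ga ^ (m + t)) * A <= 1" using d by simp
   have "A <= 1"
   proof (rule ccontr)
   assume "~ A <= 1"
   hence "1 * A <= (2 ^ (s + T) * ga ^ (m + t)) * A" using sc by (intro mult_right_mono) auto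
   thus False using \<open>~ A <= 1\<close> \<open>(2 ^ (s + T) * ga ^ (m + t)) * A <= 1\<close> by linarith
   qed
   thus "Gw x v / ga ^ t - Gw x v' / ga ^ t <= real 1" by (simp add: A_def diff_divide_distrib)
   qed simp
   thus ?thesis using cent_triangle[of "{..<b ^ (q - m)}" "%v. gcell t (Gw x v)" "%_. ()" "%v. dya (s + T) (z (r + b ^ m * v))"]
   by (simp add: ent_def)
  qed
  also have "ent {..<b ^ (q - m)} (%v. dya (s + T) (z (r + b ^ m * v))) = ent (fib {..<b ^ q} (%j. j mod b ^ m) j) (%j. dya (s + T) (z j))"
   unfolding fb by (rule ent_image[OF inj, symmetric])
  finally have "am t <= ent (fib {..<b ^ q} (%j. j mod b ^ m) j) (%j. dya (s + T) (z j)) + 1 + log 2 (4 * real C + 2)" by simp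
  moreover have "0 <= log 2 (4 * real C + 2)" by simp
  ultimately show ?thesis unfolding lo_def t_def \<kappa>_def by linarith
 qed
 show ?thesis using diam ent by (intro exI[of _ "%j. j mod b ^ m"]) auto
qed

end

text \<open>Given the word, the sum is a translate of \<open>z\<close>, so convolution cannot lower
  the entropy of \<open>z\<close> by more than a constant.\<close>

lemma window_entropy_ge:
 fixes f z :: "nat => real" and C' :: nat
 assumes fin: "finite Om1" "finite Om2" and ne: "Om1 ~= {}"
  and C: "!!j. j \<in> Om2 ==> \<bar>z j\<bar> <= real C'" and l: "l0 <= ent Om2 (%j. dya K (z j))"
 shows "l0 - 2 - log 2 (2 * real C' + 1) <=
  cent (Om1 \<times> Om2) (%p. dya K (f (fst p) + z (snd p))) (%p. dya 0 (f (fst p) + z (snd p)))"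
proof -
 let ?Om = "Om1 \<times> Om2" and ?Y = "%p. f (fst p) + z (snd p)"
 have finO: "finite ?Om" using fin by auto
 have "l0 - 2 <= ent Om2 (%j. dya K (f w + z j))" for w
  using l ent_floor_translate[OF fin(2), of "%j. 2 ^ K * (f w + z j)" "%j. 2 ^ K * z j" "2 ^ K * f w"]
  by (simp add: dya_def distrib_left add.commute)
 hence "(\<Sum>w\<in>Om1. l0 - 2) <= (\<Sum>w\<in>Om1. ent Om2 (%j. dya K (f w + z j)))" by (intro sum_mono)
 hence 1: "l0 - 2 <= cent ?Om (%p. dya K (?Y p)) fst" unfolding cent_Times_fst[OF fin] using fin ne
  by (simp add: le_divide_eq card_gt_0_iff mult.commute)
 have "cent ?Om (%p. \<lfloor>?Y p\<rfloor>) fst <= log 2 (real (2 * C') + 1)"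
 proof (rule cent_floor_le[OF finO])
  fix p q assume "p \<in> ?Om" "q \<in> ?Om" "fst p = fst q"
  thus "?Y p - ?Y q <= real (2 * C')" using C[of "snd p"] C[of "snd q"] by (auto simp: abs_le_iff)
 qed
 hence 2: "cent ?Om (%p. dya 0 (?Y p)) fst <= log 2 (2 * real C' + 1)" by (simp add: dya_def)
 have 3: "cent ?Om (%p. dya K (?Y p)) fst <= cent ?Om (%p. dya K (?Y p)) (%p. (fst p, dya 0 (?Y p))) + cent ?Om (%p. dya 0 (?Y p)) fst"
  by (rule cent_le_cond_add[OF finO])
 have 4: "cent ?Om (%p. dya K (?Y p)) (%p. (fst p, dya 0 (?Y p))) <= cent ?Om (%p. dya K (?Y p)) (%p. dya 0 (?Y p))"
  by (rule cent_antimono[OF finO]; unfold refines_def prod.inject; blast)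
 show ?thesis using 1 2 3 4 by linarith
qed

text \<open>A word of length \<open>N + d + r\<close> is read as a prefix, a middle block and a
  tail. The product lists the middle block first, so that conditioning on it is conditioning on
  \<open>fst\<close>.\<close>

lemma triple_word_image:
 fixes b N d r :: nat
 assumes "0 < b"
 defines "H == %p. fst (snd p) + b ^ N * (fst p + b ^ d * snd (snd p))"
 shows "H ` ({..<b ^ d} \<times> {..<b ^ N} \<times> {..<b ^ r}) = {..<b ^ (N + d + r) :: nat}"
  "inj_on H ({..<b ^ d} \<times> {..<b ^ N} \<times> {..<b ^ r :: nat})"
proof -
 let ?S = "{..<b ^ d} \<times> {..<b ^ N} \<times> {..<b ^ r}"
 let ?g = "%p. (fst (snd p), fst p + b ^ d * snd (snd p))"
 have H: "H p = fst (?g p) + b ^ N * snd (?g p)" for p by (simp add: H_def)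
 have g1: "?g ` ?S = {..<b ^ N} \<times> {..<b ^ (d + r)}"
 proof (intro equalityI subsetI)
  fix q assume "q \<in> ?g ` ?S"
  then obtain v w j where vwj: "v < b ^ d" "w < b ^ N" "j < b ^ r" "q = (w, v + b ^ d * j)" by auto
  have "(%p. fst p + b ^ d * snd p) (v, j) \<in> {..<b ^ (d + r)}"
   unfolding word_image(1)[OF assms(1), symmetric] using vwj by (intro imageI) auto
  thus "q \<in> {..<b ^ N} \<times> {..<b ^ (d + r)}" using vwj by simp
 next
  fix q assume "q \<in> {..<b ^ N} \<times> {..<b ^ (d + r)}"
  hence "fst q < b ^ N" "snd q \<in> (%p. fst p + b ^ d * snd p) ` ({..<b ^ d} \<times> {..<b ^ r})"
   unfolding word_image(1)[OF assms(1)] by auto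
  then obtain v j where "v < b ^ d" "j < b ^ r" "snd q = v + b ^ d * j" "fst q < b ^ N" by auto
  thus "q \<in> ?g ` ?S" by (intro image_eqI[of _ _ "(v, fst q, j)"]) (auto simp: prod_eq_iff)
 qed
 show "H ` ?S = {..<b ^ (N + d + r)}"
 proof -
  have "H ` ?S = (%p. fst p + b ^ N * snd p) ` (?g ` ?S)" unfolding image_image H ..
  thus ?thesis unfolding g1 word_image(1)[OF assms(1)] by (simp add: add.assoc)
 qed
 hence "card (H ` ?S) = card ?S" by (simp add: card_cartesian_product power_add mult_ac)
 thus "inj_on H ?S" by (intro eq_card_imp_inj_on) auto
qed

context solenoid
begin

text \<open>The tail \<open>j\<close> is seen over the base point \<open>xi\<close>, which lies
  within \<open>1 / b ^ d\<close> of \<open>v / b ^ d\<close> whatever the prefix \<open>w\<close>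
  is. Once \<open>v\<close> is fixed, the point of the word is up to this error a function of
  \<open>w\<close> plus a function of \<open>j\<close>: this is where the convolutions come
  from.\<close>

lemma split_error:
 assumes x: "0 <= x" "x <= 1" and w: "w < b ^ N"
 shows "\<bar>Gw x (w + b ^ N * (v + b ^ d * j)) / ga ^ (N + d) -
  (Gw x (w + b ^ N * v) / ga ^ (N + d) + (G (real v / real b ^ d + real j) - G (real v / real b ^ d)))\<bar> <= 2 * real C / real b ^ d"
proof -
 define u where "u = x + real (w + b ^ N * v)"
 define xi where "xi = u / real b ^ (N + d)"
 define y where "y = real v / real b ^ d"
 have "x + real (w + b ^ N * (v + b ^ d * j)) = u + real (b ^ (N + d) * j)"
  by (simp add: u_def power_add distrib_left)
 hence "Gw x (w + b ^ N * (v + b ^ d * j)) = Gn (N + d) u + ga ^ (N + d) * Gw xi j"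
  using G_word[of u "N + d" j] by (simp add: xi_def)
 moreover have "G u = Gn (N + d) u + ga ^ (N + d) * G xi" unfolding xi_def by (rule G_split)
 ultimately have "Gw x (w + b ^ N * (v + b ^ d * j)) / ga ^ (N + d) - G u / ga ^ (N + d) = Gw xi j - G xi"
  using g0 by (simp add: diff_divide_distrib[symmetric] right_diff_distrib[symmetric])
 moreover have "\<bar>xi - y\<bar> <= 1 / real b ^ d"
 proof -
  have "Suc w <= b ^ N" using w by simp
  hence "real (Suc w) <= real (b ^ N)" by (simp only: of_nat_le_iff)
  hence xw: "x + real w <= real b ^ N" using x by simp
  have "xi - y = (x + real w) / real b ^ (N + d)"
   unfolding xi_def y_def u_def using b0 by (simp add: power_add field_simps)
  moreover have "(x + real w) / real b ^ (N + d) <= real b ^ N / real b ^ (N + d)"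
   using xw b0 by (intro divide_right_mono) auto
  moreover have "real b ^ N / real b ^ (N + d) = 1 / real b ^ d" using b0 by (simp add: power_add)
  moreover have "0 <= (x + real w) / real b ^ (N + d)" using x b0 by simp
  ultimately show ?thesis by simp
 qed
 hence "real C * \<bar>xi - y\<bar> <= real C * (1 / real b ^ d)" by (intro mult_left_mono) auto
 moreover have "\<bar>Gw xi j - Gw y j\<bar> <= real C * \<bar>xi - y\<bar>" "\<bar>G xi - G y\<bar> <= real C * \<bar>xi - y\<bar>"
  using G_lip[of "xi + real j" "y + real j"] G_lip[of xi y] by auto
 ultimately show ?thesis unfolding u_def[symmetric] y_def[symmetric] by (simp add: abs_le_iff)
qed

definition c2 :: real where "c2 = 10 + 2 * log 2 (4 * real C + 2)"

lemma scale_K: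
 assumes "real K <= real k * lam"
 shows "2 ^ K * ga ^ k <= 1"
proof -
 have "2 ^ K * ga ^ k = 2 powr (real K - real k * lam)"
  unfolding gamma_powr by (simp add: powr_realpow[symmetric] powr_add[symmetric])
 also have "... <= 2 powr 0" using assms by (intro powr_mono) auto
 finally show ?thesis by simp
qed

lemma scale_K_lower:
 assumes "real k * lam <= real K + 1"
 shows "1 <= 2 * (2 ^ K * ga ^ k)"
proof -
 have "2 * (2 ^ K * ga ^ k) = 2 ^ Suc K * ga ^ k" by simp
 also have "... = 2 powr (real (Suc K) - real k * lam)"
  unfolding gamma_powr by (simp add: powr_realpow[symmetric] powr_add[symmetric] del: power_Suc of_nat_Suc)
 finally have "2 * (2 ^ K * ga ^ k) = 2 powr (real K + 1 - real k * lam)" by (simp add: add.commute)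
 moreover have "2 powr 0 <= 2 powr (real K + 1 - real k * lam)" using assms by (intro powr_mono) auto
 ultimately show ?thesis by simp
qed

text \<open>For each \<open>v\<close> the entropy of the sum in the window is that of the word
  points up to \<open>c2\<close>. The mean over \<open>v\<close> is a conditional entropy given the
  middle block, hence at most the entropy for all words.\<close>

lemma window_step:
 fixes x :: real and N d r k K :: nat
 assumes x: "0 <= x" "x <= 1" and d: "1 / real b ^ d <= ga ^ k" and K: "real K <= real k * lam"
 defines "Y == %v p. Gw x (fst p + b ^ N * v) / ga ^ (N + d) + (G (real v / real b ^ d + real (snd p)) - G (real v / real b ^ d))"
 shows "(\<Sum>v<b ^ d. cent ({..<b ^ N} \<times> {..<b ^ r}) (%p. dya K (Y v p)) (%p. dya 0 (Y v p))) / real (b ^ d) <=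
  cent {..<b ^ (N + d + r)} (%u. gcell (N + d + k) (Gw x u)) (%u. gcell (N + d) (Gw x u)) + c2"
proof -
 define H where "H p = fst (snd p) + b ^ N * (fst p + b ^ d * snd (snd p))" for p :: "nat \<times> nat \<times> nat"
 let ?V = "{..<b ^ d}" and ?WJ = "{..<b ^ N} \<times> {..<b ^ r}"
 define X where "X u = gcell (N + d + k) (Gw x u)" for u :: nat
 define Z where "Z u = gcell (N + d) (Gw x u)" for u :: nat
 have img: "H ` (?V \<times> ?WJ) = {..<b ^ (N + d + r)}" "inj_on H (?V \<times> ?WJ)"
  unfolding H_def using triple_word_image[OF b0(1)] by auto
 have fin: "finite ?WJ" "finite ?V" "finite (?V \<times> ?WJ)" by auto
 have "(\<Sum>v\<in>?V. cent ?WJ (%p. X (H (v, p))) (%p. Z (H (v, p)))) / rcard ?V = cent (?V \<times> ?WJ) (%q. X (H q)) (%q. (fst q, Z (H q)))"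
  by (rule cent_Times_fst_cond[symmetric]) auto
 also have "... <= cent (?V \<times> ?WJ) (%q. X (H q)) (%q. Z (H q))"
  by (rule cent_antimono[OF fin(3)]) (simp add: refines_def)
 also have "... = cent {..<b ^ (N + d + r)} X Z" unfolding img(1)[symmetric] by (rule cent_image[OF img(2), symmetric])
 finally have avg: "(\<Sum>v<b ^ d. cent ?WJ (%p. X (H (v, p))) (%p. Z (H (v, p)))) / real (b ^ d) <= cent {..<b ^ (N + d + r)} X Z"
  by simp
 have one: "cent ?WJ (%p. dya K (Y v p)) (%p. dya 0 (Y v p)) <= cent ?WJ (%p. X (H (v, p))) (%p. Z (H (v, p))) + c2" for v
 proof -
  define R where "R p = Gw x (H (v, p)) / ga ^ (N + d)" for p
  have err: "\<bar>R p - Y v p\<bar> <= 2 * real C * ga ^ k" if "p \<in> ?WJ" for p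
  proof -
   have "\<bar>R p - Y v p\<bar> <= 2 * real C / real b ^ d"
   unfolding R_def Y_def H_def using split_error[OF x, of "fst p" N v d "snd p"] that by auto
   also have "... = 2 * real C * (1 / real b ^ d)" by simp
   also have "... <= 2 * real C * ga ^ k" using d by (intro mult_left_mono) auto
   finally show ?thesis .
  qed
  have e0: "\<bar>Y v p - R p\<bar> <= real (2 * C)" if "p \<in> ?WJ" for p
   using err[OF that] mult_left_mono[OF gp(2)[of k], of "2 * real C"] by (simp add: abs_minus_commute)
  have eK: "\<bar>2 ^ K * Y v p - 2 ^ K * R p\<bar> <= real (2 * C)" if "p \<in> ?WJ" for p
  proof -
   have "\<bar>2 ^ K * Y v p - 2 ^ K * R p\<bar> = 2 ^ K * \<bar>R p - Y v p\<bar>"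
   by (simp add: right_diff_distrib[symmetric] abs_mult abs_minus_commute)
   also have "... <= 2 ^ K * (2 * real C * ga ^ k)" using err[OF that] by (intro mult_left_mono) auto
   also have "... = 2 * real C * (2 ^ K * ga ^ k)" by simp
   also have "... <= 2 * real C * 1" using scale_K[OF K] by (intro mult_left_mono) auto
   finally show ?thesis by simp
  qed
  have "cent ?WJ (%p. \<lfloor>2 ^ K * Y v p\<rfloor>) (%p. \<lfloor>Y v p\<rfloor>) <= cent ?WJ (%p. \<lfloor>2 ^ K * R p\<rfloor>) (%p. \<lfloor>Y v p\<rfloor>) + log 2 (2 * real (2 * C) + 2)"
   using eK by (intro cent_floor_num_close[OF fin(1)]) auto
  also have "cent ?WJ (%p. \<lfloor>2 ^ K * R p\<rfloor>) (%p. \<lfloor>Y v p\<rfloor>) <= cent ?WJ (%p. \<lfloor>2 ^ K * R p\<rfloor>) (%p. \<lfloor>R p\<rfloor>) + log 2 (2 * real (2 * C) + 2)"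
   using e0 by (intro cent_floor_cond_close[OF fin(1)]) auto
  also have "cent ?WJ (%p. \<lfloor>2 ^ K * R p\<rfloor>) (%p. \<lfloor>R p\<rfloor>) <= cent ?WJ (%p. \<lfloor>2 ^ K * R p\<rfloor>) (%p. gcell k (R p)) + cent ?WJ (%p. gcell k (R p)) (%p. \<lfloor>R p\<rfloor>)"
   by (rule cent_triangle[OF fin(1)])
  also have "cent ?WJ (%p. \<lfloor>2 ^ K * R p\<rfloor>) (%p. gcell k (R p)) <= log 2 (real 1 + 1)"
  proof (rule cent_floor_le[OF fin(1)])
   fix p q assume "gcell k (R p) = gcell k (R q)"
   hence "R p / ga ^ k - R q / ga ^ k <= 1" by linarith
   hence "R p - R q <= ga ^ k" using gp[of k] by (simp add: diff_divide_distrib[symmetric])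
   hence "2 ^ K * (R p - R q) <= 2 ^ K * ga ^ k" by (intro mult_left_mono) auto
   thus "2 ^ K * R p - 2 ^ K * R q <= real 1" using scale_K[OF K] by (simp add: right_diff_distrib)
  qed
  also have "cent ?WJ (%p. gcell k (R p)) (%p. \<lfloor>R p\<rfloor>) = cent ?WJ (%p. X (H (v, p))) (%p. Z (H (v, p)))"
   unfolding X_def Z_def R_def by (simp add: power_add mult.commute)
  finally show ?thesis unfolding c2_def dya_def by simp
 qed
 have "(\<Sum>v<b ^ d. cent ?WJ (%p. dya K (Y v p)) (%p. dya 0 (Y v p))) <= (\<Sum>v<b ^ d. cent ?WJ (%p. X (H (v, p))) (%p. Z (H (v, p))) + c2)"
  by (intro sum_mono one)
 also have "... = (\<Sum>v<b ^ d. cent ?WJ (%p. X (H (v, p))) (%p. Z (H (v, p)))) + real (b ^ d) * c2" by (simp add: sum.distrib)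
 finally have "(\<Sum>v<b ^ d. cent ?WJ (%p. dya K (Y v p)) (%p. dya 0 (Y v p))) / real (b ^ d) <=
   ((\<Sum>v<b ^ d. cent ?WJ (%p. X (H (v, p))) (%p. Z (H (v, p)))) + real (b ^ d) * c2) / real (b ^ d)"
  by (rule divide_right_mono) simp
 also have "... = (\<Sum>v<b ^ d. cent ?WJ (%p. X (H (v, p))) (%p. Z (H (v, p)))) / real (b ^ d) + c2"
  using b0 by (simp add: add_divide_distrib)
 also have "... <= cent {..<b ^ (N + d + r)} X Z + c2" using avg by simp
 finally show ?thesis unfolding X_def Z_def .
qed

text \<open>With middle block and tail fixed, the word points differ from \<open>f\<close> by a
  constant, up to the resolution of the window; a bound on the entropy of \<open>f\<close> thus
  passes to the prefixes. Here \<open>ga ^ k\<close> must also not be much finer than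
  \<open>1 / 2 ^ K\<close>, whence the second half of the hypothesis on \<open>K\<close>.\<close>

lemma prefix_window:
 fixes x :: real and N d k K v j :: nat
 assumes x: "0 <= x" "x <= 1" and d: "1 / real b ^ d <= ga ^ k" and K: "real K <= real k * lam" "real k * lam <= real K + 1"
 defines "P == %w. Gw x (w + b ^ N * (v + b ^ d * j))"
 defines "f == %w. Gw x (w + b ^ N * v) / ga ^ (N + d)"
 shows "cent {..<b ^ N} (%w. gcell (N + d + k) (P w)) (%w. gcell (N + d) (P w)) <=
  cent {..<b ^ N} (%w. dya K (f w)) (%w. dya 0 (f w)) + c2"
proof -
 let ?W = "{..<b ^ N}"
 define c where "c = G (real v / real b ^ d + real j) - G (real v / real b ^ d)"
 define R where "R w = P w / ga ^ (N + d)" for w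
 have fin: "finite ?W" by simp
 have err: "\<bar>R w - (f w + c)\<bar> <= 2 * real C * ga ^ k" if "w \<in> ?W" for w
 proof -
  have "\<bar>R w - (f w + c)\<bar> <= 2 * real C / real b ^ d"
   unfolding R_def P_def f_def c_def using split_error[OF x, of w N v d j] that by auto
  also have "... = 2 * real C * (1 / real b ^ d)" by simp
  also have "... <= 2 * real C * ga ^ k" using d by (intro mult_left_mono) auto
  finally show ?thesis .
 qed
 have e0: "\<bar>R w - (f w + c)\<bar> <= real (2 * C)" if "w \<in> ?W" for w
  using err[OF that] mult_left_mono[OF gp(2)[of k], of "2 * real C"] by simp
 have eK: "\<bar>2 ^ K * R w - (2 ^ K * f w + 2 ^ K * c)\<bar> <= real (2 * C)" if "w \<in> ?W" for w
 proof -
  have "\<bar>2 ^ K * R w - (2 ^ K * f w + 2 ^ K * c)\<bar> = 2 ^ K * \<bar>R w - (f w + c)\<bar>"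
   by (simp only: right_diff_distrib[symmetric] distrib_left[symmetric] abs_mult) simp
  also have "... <= 2 ^ K * (2 * real C * ga ^ k)" using err[OF that] by (intro mult_left_mono) auto
  also have "... = 2 * real C * (2 ^ K * ga ^ k)" by simp
  also have "... <= 2 * real C * 1" using scale_K[OF K(1)] by (intro mult_left_mono) auto
  finally show ?thesis by simp
 qed
 have "cent ?W (%w. gcell k (R w)) (%w. \<lfloor>R w\<rfloor>) <= cent ?W (%w. gcell k (R w)) (%w. \<lfloor>2 ^ K * R w\<rfloor>) + cent ?W (%w. \<lfloor>2 ^ K * R w\<rfloor>) (%w. \<lfloor>R w\<rfloor>)"
  by (rule cent_triangle[OF fin])
 also have "cent ?W (%w. gcell k (R w)) (%w. \<lfloor>2 ^ K * R w\<rfloor>) <= log 2 (real 3 + 1)"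
 proof (rule cent_floor_le[OF fin])
  fix p q assume "\<lfloor>2 ^ K * R p\<rfloor> = \<lfloor>2 ^ K * R q\<rfloor>"
  hence d: "2 ^ K * R p - 2 ^ K * R q <= 1" by linarith
  define D where "D = (R p - R q) / ga ^ k"
  have eq: "2 ^ K * R p - 2 ^ K * R q = (2 ^ K * ga ^ k) * D"
  proof -
   have "ga ^ k * D = R p - R q" using g0 by (simp add: D_def)
   thus ?thesis by (simp only: mult.assoc right_diff_distrib)
  qed
  have "D <= 3"
  proof (rule ccontr)
   assume "~ D <= 3"
   hence "1 * D <= 2 * (2 ^ K * ga ^ k) * D" using scale_K_lower[OF K(2)] by (intro mult_right_mono) auto
   thus False using d eq \<open>~ D <= 3\<close> by linarith
  qed
  thus "R p / ga ^ k - R q / ga ^ k <= real 3" by (simp add: D_def diff_divide_distrib)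
 qed
 also have "cent ?W (%w. \<lfloor>2 ^ K * R w\<rfloor>) (%w. \<lfloor>R w\<rfloor>) <= cent ?W (%w. \<lfloor>2 ^ K * f w + 2 ^ K * c\<rfloor>) (%w. \<lfloor>R w\<rfloor>) + log 2 (2 * real (2 * C) + 2)"
  using eK by (intro cent_floor_num_close[OF fin]) auto
 also have "cent ?W (%w. \<lfloor>2 ^ K * f w + 2 ^ K * c\<rfloor>) (%w. \<lfloor>R w\<rfloor>) <= cent ?W (%w. \<lfloor>2 ^ K * f w\<rfloor>) (%w. \<lfloor>R w\<rfloor>) + 2"
  by (rule cent_floor_num_translate(1)[OF fin])
 also have "cent ?W (%w. \<lfloor>2 ^ K * f w\<rfloor>) (%w. \<lfloor>R w\<rfloor>) <= cent ?W (%w. \<lfloor>2 ^ K * f w\<rfloor>) (%w. \<lfloor>f w + c\<rfloor>) + log 2 (2 * real (2 * C) + 2)"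
  using e0 by (intro cent_floor_cond_close[OF fin]) auto
 also have "cent ?W (%w. \<lfloor>2 ^ K * f w\<rfloor>) (%w. \<lfloor>f w + c\<rfloor>) <= cent ?W (%w. \<lfloor>2 ^ K * f w\<rfloor>) (%w. \<lfloor>f w\<rfloor>) + 2"
  by (rule cent_floor_cond_translate(1)[OF fin])
 also have "log 2 (real 3 + 1) = 2" using log_nat_power[of 2 2 2] by simp
 finally have "cent ?W (%w. gcell k (R w)) (%w. \<lfloor>R w\<rfloor>) <= cent ?W (%w. dya K (f w)) (%w. dya 0 (f w)) + c2"
  unfolding dya_def c2_def by simp
 thus ?thesis unfolding R_def by (simp add: power_add mult.commute)
qed

text \<open>Telescoping over consecutive windows. Each costs one bit because the grids of mesh
  \<open>ga ^ n\<close> are not nested.\<close>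

lemma windows_total:
 fixes x :: real and N k k' lm :: nat
 assumes k: "0 < k"
 defines "n == %l. N + k' + l * k"
 defines "L == n lm"
 shows "(\<Sum>l<lm. cent {..<b ^ L} (%u. gcell (n l + k) (Gw x u)) (%u. \<lfloor>Gw x u / ga ^ n l\<rfloor>)) <=
  a x L - a x (N + k') + log 2 (4 * real C + 2) + real lm"
proof -
 define e where "e l = ent {..<b ^ L} (%u. \<lfloor>Gw x u / ga ^ n l\<rfloor>)" for l
 have "cent {..<b ^ L} (%u. gcell (n l + k) (Gw x u)) (%u. \<lfloor>Gw x u / ga ^ n l\<rfloor>) <= (e (Suc l) - e l) + 1" for l
  using ent_fine_ge[of "{..<b ^ L}" "n l" "n l + k" "%u. Gw x u"] unfolding e_def n_def
  by (simp add: add_ac)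
 hence "(\<Sum>l<lm. cent {..<b ^ L} (%u. gcell (n l + k) (Gw x u)) (%u. \<lfloor>Gw x u / ga ^ n l\<rfloor>)) <=
   (\<Sum>l<lm. (e (Suc l) - e l) + 1)" by (intro sum_mono)
 also have "... = e lm - e 0 + real lm" by (simp add: sum.distrib sum_lessThan_telescope)
 also have "e lm = a x L" by (simp add: e_def a_def L_def)
 finally have "(\<Sum>l<lm. cent {..<b ^ L} (%u. gcell (n l + k) (Gw x u)) (%u. \<lfloor>Gw x u / ga ^ n l\<rfloor>)) <=
   a x L - e 0 + real lm" .
 moreover have "a x (N + k') - log 2 (4 * real C + 2) <= e 0"
  unfolding e_def using ent_tail_words[of "N + k'" L x] by (simp add: n_def L_def)
 ultimately show ?thesis by linarith
qed

text \<open>Separation at scale \<open>ga ^ L\<close> raises the entropy of the prefixes to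
  \<open>N * log 2 b\<close>, while at scale \<open>ga ^ N\<close> it is about \<open>a x N\<close>.
  The difference must arise in the windows in between, except for what fits into the initial gap
  from \<open>N\<close> to \<open>N + k'\<close>, at most \<open>k' * lam + 2\<close>.\<close>

lemma prefix_total:
 fixes x :: real and N k k' lm v :: nat
 assumes x: "0 <= x" "x <= 1"
 defines "n == %l. N + k' + l * k"
 defines "L == n lm"
 defines "P == %w. Gw x (w + b ^ N * v)"
 assumes sep: "!!w w'. w < b ^ N ==> w' < b ^ N ==> w ~= w' ==> ga ^ L < \<bar>P w - P w'\<bar>"
 shows "real N * log 2 (real b) - a x N - log 2 (4 * real C + 2) - real k' * lam - 2 <=
  (\<Sum>l<lm. cent {..<b ^ N} (%w. gcell (n l + k) (P w)) (%w. \<lfloor>P w / ga ^ n l\<rfloor>))"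
proof -
 let ?W = "{..<b ^ N}"
 have fin: "finite ?W" by simp
 define e where "e l = ent ?W (%w. \<lfloor>P w / ga ^ n l\<rfloor>)" for l
 have st: "e (Suc l) - e l <= cent ?W (%w. gcell (n l + k) (P w)) (%w. \<lfloor>P w / ga ^ n l\<rfloor>)" for l
  using cent_triangle[OF fin, of "%w. gcell (n l + k) (P w)" "%_. ()" "%w. \<lfloor>P w / ga ^ n l\<rfloor>"]
  unfolding e_def n_def ent_def by (simp add: add_ac)
 have "(\<Sum>l<lm. e (Suc l) - e l) <= (\<Sum>l<lm. cent ?W (%w. gcell (n l + k) (P w)) (%w. \<lfloor>P w / ga ^ n l\<rfloor>))"
  by (intro sum_mono st)
 hence tel: "e lm - e 0 <= (\<Sum>l<lm. cent ?W (%w. gcell (n l + k) (P w)) (%w. \<lfloor>P w / ga ^ n l\<rfloor>))"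
  by (simp add: sum_lessThan_telescope)
 have "log 2 (1 / (1 / real (b ^ N))) <= e lm"
  unfolding e_def
 proof (rule ent_ge_min_entropy[OF fin])
  show "?W ~= {}" using b0 by (auto simp: lessThan_empty_iff)
  show "0 < 1 / real (b ^ N)" using b0 by simp
  fix w assume w: "w \<in> ?W"
  have "fib ?W (%w. \<lfloor>P w / ga ^ n lm\<rfloor>) w = {w}"
  proof (intro equalityI subsetI)
   fix w' assume "w' \<in> fib ?W (%w. \<lfloor>P w / ga ^ n lm\<rfloor>) w"
   hence w': "w' < b ^ N" "\<lfloor>P w' / ga ^ n lm\<rfloor> = \<lfloor>P w / ga ^ n lm\<rfloor>" by (auto simp: fib_def)
   hence "\<bar>P w' / ga ^ n lm - P w / ga ^ n lm\<bar> <= 1" by linarith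
   hence "\<bar>P w' - P w\<bar> / ga ^ L <= 1" using gp[of L] by (simp add: L_def diff_divide_distrib[symmetric])
   hence "\<bar>P w' - P w\<bar> <= ga ^ L" using gp[of L] by (simp add: divide_le_eq)
   thus "w' \<in> {w}" using sep[of w' w] w w' by force
  qed (use w in \<open>auto simp: fib_def\<close>)
  thus "rcard (fib ?W (%w. \<lfloor>P w / ga ^ n lm\<rfloor>) w) <= 1 / real (b ^ N) * rcard ?W" using b0 by simp
 qed
 hence e1: "real N * log 2 (real b) <= e lm" using b0 by (simp add: log_nat_power)
 have "e 0 <= cent ?W (%w. gcell (N + k') (P w)) (%w. gcell N (P w)) + ent ?W (%w. gcell N (P w))"
  unfolding e_def ent_def n_def using cent_triangle[OF fin] by simp
 also have "ent ?W (%w. gcell N (P w)) <= a x N + log 2 (2 * real (2 * C) + 2)"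
  unfolding a_def
 proof (rule ent_floor_close[OF fin])
  fix w
  have "\<bar>P w / ga ^ N - Gw x w / ga ^ N\<bar> = \<bar>G (x + real w + real (b ^ N * v)) - Gw x w\<bar> / ga ^ N"
   using gp[of N] by (simp add: diff_divide_distrib[symmetric] P_def add.assoc)
  also have "... <= 2 * real C * ga ^ N / ga ^ N" using gp[of N] by (intro divide_right_mono G_tail) auto
  finally show "\<bar>P w / ga ^ N - Gw x w / ga ^ N\<bar> <= real (2 * C)" using g0 by simp
 qed
 also have "cent ?W (%w. gcell (N + k') (P w)) (%w. gcell N (P w)) <= real k' * lam + 2"
 proof -
  define M where "M = nat \<lceil>1 / ga ^ k'\<rceil>"
  have ge1: "1 <= 1 / ga ^ k'" using gp[of k'] by simp
  have M: "1 / ga ^ k' <= real M" "real M < 1 / ga ^ k' + 1" unfolding M_def using ge1 by linarith+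
  have "cent ?W (%w. gcell (N + k') (P w)) (%w. gcell N (P w)) <= log 2 (real M + 1)"
  proof (rule cent_floor_le[OF fin])
   fix w w' assume "gcell N (P w) = gcell N (P w')"
   hence "P w / ga ^ N - P w' / ga ^ N <= 1" by linarith
   hence "(P w / ga ^ N - P w' / ga ^ N) / ga ^ k' <= 1 / ga ^ k'" using gp[of k'] by (intro divide_right_mono) auto
   thus "P w / ga ^ (N + k') - P w' / ga ^ (N + k') <= real M" using M by (simp add: power_add diff_divide_distrib)
  qed
  also have "... <= log 2 (4 * (1 / ga ^ k'))" using M ge1 by (intro log_mono) auto
  also have "... = 2 + log 2 (1 / ga ^ k')"
  proof -
   have "log 2 (4::real) = 2" using log_nat_power[of 2 2 2] by simp
   thus ?thesis using g0 by (subst log_mult) auto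
  qed
  also have "log 2 (1 / ga ^ k') = real k' * lam"
   unfolding lam_def using g0 log_nat_power[of "1 / ga" 2 k'] by (simp add: power_one_over)
  finally show ?thesis by simp
 qed
 finally show ?thesis using tel e1 by simp
qed

end

section \<open>Collisions between words\<close>

lemma emeasure_affine_vimage:
 fixes A :: "real set"
 assumes "A \<in> sets borel" "0 < c"
 shows "ennreal c * emeasure lborel ((%x. t + c * x) -` A) = emeasure lborel A"
proof -
 have "emeasure lborel A = emeasure (density (distr lborel borel (%x. t + c * x)) (%_. ennreal \<bar>c\<bar>)) A"
  using lborel_real_affine[of c t] assms by simp
 also have "... = ennreal c * emeasure (distr lborel borel (%x. t + c * x)) A"
  using assms by (subst emeasure_density_const) auto
 also have "emeasure (distr lborel borel (%x. t + c * x)) A = emeasure lborel ((%x. t + c * x) -` A)"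
  using assms by (subst emeasure_distr) auto
 finally show ?thesis by simp
qed

lemma sum_mod_words:
 fixes g :: "nat => real"
 assumes "0 < b"
 shows "(\<Sum>v<b ^ (d + r). g (v mod b ^ d)) = real (b ^ r) * (\<Sum>v<b ^ d. g v)"
proof -
 have "(\<Sum>v<b ^ (d + r). g (v mod b ^ d)) = (\<Sum>p\<in>{..<b ^ d} \<times> {..<b ^ r}. g ((fst p + b ^ d * snd p) mod b ^ d))"
  unfolding word_image(1)[OF assms, symmetric] by (subst sum.reindex[OF word_image(2)[OF assms]]) simp
 also have "... = (\<Sum>p\<in>{..<b ^ d} \<times> {..<b ^ r}. g (fst p))" by (intro sum.cong) auto
 also have "... = (\<Sum>v<b ^ d. \<Sum>j<b ^ r. g v)" unfolding sum.cartesian_product by (simp add: split_def)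
 finally show ?thesis by (simp add: sum_distrib_left)
qed

lemma U01_exists_less:
 assumes "integrable U01 g" "(\<integral>x. g x \<partial>U01) < (c::real)"
 shows "\<exists>x\<in>{0..<1}. g x < c"
proof (rule ccontr)
 assume "~ ?thesis"
 hence "c <= g x" if "x \<in> space U01" for x using that by (force simp: space_U01)
 hence "(\<integral>x. c \<partial>U01) <= (\<integral>x. g x \<partial>U01)" using assms(1) by (intro integral_mono) auto
 thus False using assms(2) by (simp add: U01.prob_space)
qed

locale transversal_solenoid = solenoid +
 fixes Kt \<theta> :: real
 assumes Kt: "0 < Kt" and th: "0 < \<theta>"
  and tr: "!!U U' rh. U mod b ~= U' mod b ==> 0 < rh ==> rh <= 1 ==>
   emeasure lborel {x \<in> {0..1}. \<bar>Gw x U - Gw x U'\<bar> <= rh} <= ennreal (Kt * rh powr \<theta>)"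
begin

text \<open>A common prefix of length \<open>l\<close> is removed by the substitution
  \<open>y = (x + r) / b ^ l\<close>, which divides vertical distances by \<open>ga ^ l\<close> and
  lengths by \<open>b ^ l\<close>. Then the first digits differ and \<open>tr\<close> applies. As
  \<open>l <= N\<close>, undoing the substitution costs at most the factor
  \<open>b ^ N\<close>.\<close>

lemma collision_measure:
 fixes w w' v N L :: nat
 assumes w: "w < b ^ N" "w' < b ^ N" "w ~= w'" and L: "N <= L"
 defines "U == w + b ^ N * v" and "U' == w' + b ^ N * v"
 shows "emeasure lborel {x \<in> {0..<1}. \<bar>Gw x U - Gw x U'\<bar> <= ga ^ L} <=
  ennreal (real (b ^ N) * (Kt * (ga ^ (L - N)) powr \<theta>))"
proof -
 have ex: "U mod b ^ N ~= U' mod b ^ N" using w by (simp add: U_def U'_def)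
 define m where "m = (LEAST m. U mod b ^ m ~= U' mod b ^ m)"
 have m: "U mod b ^ m ~= U' mod b ^ m" unfolding m_def by (rule LeastI[of _ N]) (rule ex)
 have mN: "m <= N" unfolding m_def by (rule Least_le) (rule ex)
 have "m ~= 0" using m by (intro notI) simp
 then obtain l where l: "m = Suc l" by (cases m) auto
 have eq: "U mod b ^ l = U' mod b ^ l" using not_less_Least[of l "%m. U mod b ^ m ~= U' mod b ^ m"] l by (simp add: m_def)
 define r where "r = U mod b ^ l"
 define V where "V = U div b ^ l"
 define V' where "V' = U' div b ^ l"
 have UV: "U = r + b ^ l * V" "U' = r + b ^ l * V'"
  unfolding r_def V_def V'_def using eq mod_mult_div_eq[of U "b ^ l"] mod_mult_div_eq[of U' "b ^ l"] by auto
 have rb: "r < b ^ l" using b0 by (simp add: r_def)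
 have VV: "V mod b ~= V' mod b"
 proof
  assume "V mod b = V' mod b"
  moreover have "U mod (b ^ l * b) = b ^ l * (U div b ^ l mod b) + U mod b ^ l"
   "U' mod (b ^ l * b) = b ^ l * (U' div b ^ l mod b) + U' mod b ^ l" by (rule mod_mult2_eq)+
  ultimately show False using m eq l by (simp add: V_def V'_def mult.commute)
 qed
 have lN: "l <= N" using l mN by simp
 let ?A = "{y \<in> {0..1}. \<bar>Gw y V - Gw y V'\<bar> <= ga ^ (L - l)}"
 define c where "c = 1 / real b ^ l"
 have c: "0 < c" using b0 by (simp add: c_def)
 have sub: "{x \<in> {0..<1}. \<bar>Gw x U - Gw x U'\<bar> <= ga ^ L} \<subseteq> (%x. real r / real b ^ l + c * x) -` ?A"
 proof
  fix x assume "x \<in> {x \<in> {0..<1}. \<bar>Gw x U - Gw x U'\<bar> <= ga ^ L}"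
  hence x: "0 <= x" "x < 1" "\<bar>Gw x U - Gw x U'\<bar> <= ga ^ L" by auto
  define y where "y = (x + real r) / real b ^ l"
  have yeq: "real r / real b ^ l + c * x = y" by (simp add: y_def c_def add_divide_distrib)
  have "Gw x U - Gw x U' = ga ^ l * (Gw y V - Gw y V')"
   using G_word[of "x + real r" l V] G_word[of "x + real r" l V'] unfolding UV y_def
   by (simp add: add.assoc right_diff_distrib)
  hence "ga ^ l * \<bar>Gw y V - Gw y V'\<bar> <= ga ^ l * ga ^ (L - l)"
   using x(3) g0 lN L by (simp add: abs_mult power_add[symmetric])
  hence "\<bar>Gw y V - Gw y V'\<bar> <= ga ^ (L - l)" using g0 by simp
  moreover have "0 <= y" using x b0 by (simp add: y_def)
  moreover have "y <= 1"
  proof -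
   have "Suc r <= b ^ l" using rb by simp
   hence "real (Suc r) <= real (b ^ l)" by (simp only: of_nat_le_iff)
   thus ?thesis using x b0 by (simp add: y_def)
  qed
  ultimately show "x \<in> (%x. real r / real b ^ l + c * x) -` ?A" using yeq by simp
 qed
 have Am: "?A \<in> sets borel" by measurable
 have "ennreal c * emeasure lborel {x \<in> {0..<1}. \<bar>Gw x U - Gw x U'\<bar> <= ga ^ L} <=
   ennreal c * emeasure lborel ((%x. real r / real b ^ l + c * x) -` ?A)"
 proof (rule mult_left_mono[OF emeasure_mono[OF sub]])
  show "(%x. real r / real b ^ l + c * x) -` ?A \<in> sets lborel"
   using measurable_sets[of "%x. real r / real b ^ l + c * x" borel borel ?A] Am by simp
 qed simp
 also have "... = emeasure lborel ?A" by (rule emeasure_affine_vimage[OF Am c])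
 also have "... <= ennreal (Kt * (ga ^ (L - l)) powr \<theta>)" using gp[of "L - l"] by (intro tr VV) auto
 also have "... <= ennreal (Kt * (ga ^ (L - N)) powr \<theta>)"
 proof (intro ennreal_leI mult_left_mono powr_mono2)
  show "ga ^ (L - l) <= ga ^ (L - N)" using g0 g1 lN by (intro power_decreasing) auto
 qed (use th Kt g0 in auto)
 finally have *: "ennreal c * emeasure lborel {x \<in> {0..<1}. \<bar>Gw x U - Gw x U'\<bar> <= ga ^ L} <=
   ennreal (Kt * (ga ^ (L - N)) powr \<theta>)" .
 have "emeasure lborel {x \<in> {0..<1}. \<bar>Gw x U - Gw x U'\<bar> <= ga ^ L} =
   ennreal (real b ^ l) * (ennreal c * emeasure lborel {x \<in> {0..<1}. \<bar>Gw x U - Gw x U'\<bar> <= ga ^ L})"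
  using b0 by (simp add: mult.assoc[symmetric] ennreal_mult[symmetric] c_def)
 also have "... <= ennreal (real b ^ l) * ennreal (Kt * (ga ^ (L - N)) powr \<theta>)" by (rule mult_left_mono[OF *]) simp
 also have "... = ennreal (real b ^ l * (Kt * (ga ^ (L - N)) powr \<theta>))" using b0 by (simp add: ennreal_mult[symmetric] Kt less_imp_le)
 also have "... <= ennreal (real (b ^ N) * (Kt * (ga ^ (L - N)) powr \<theta>))"
  using b0 lN Kt by (intro ennreal_leI mult_right_mono) (auto intro!: power_increasing)
 finally show ?thesis .
qed

text \<open>The number of ordered pairs of colliding prefixes, averaged over the continuation
  \<open>v\<close>.\<close>

definition coll :: "nat => nat => nat => real => real" where
 "coll N M L x = (\<Sum>v<b ^ M. \<Sum>w<b ^ N. \<Sum>w'<b ^ N.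
  if w ~= w' & \<bar>Gw x (w + b ^ N * v) - Gw x (w' + b ^ N * v)\<bar> <= ga ^ L then 1 else 0) / real (b ^ M)"

text \<open>The cube is \<open>b ^ (2 * N)\<close> pairs times the factor \<open>b ^ N\<close> of
  \<open>collision_measure\<close>; a power of \<open>ga ^ (L - N)\<close> has to beat it.\<close>

lemma coll_integral:
 assumes L: "N <= L"
 shows "integrable U01 (coll N M L)"
  "(\<integral>x. coll N M L x \<partial>U01) <= real (b ^ N) ^ 3 * (Kt * (ga ^ (L - N)) powr \<theta>)"
proof -
 define B where "B = real (b ^ N) * (Kt * (ga ^ (L - N)) powr \<theta>)"
 have B0: "0 <= B" unfolding B_def using Kt by (intro mult_nonneg_nonneg) auto
 define T where "T v w w' x = (if w ~= w' & \<bar>Gw x (w + b ^ N * v) - Gw x (w' + b ^ N * v)\<bar> <= ga ^ L then 1 else 0 :: real)" for v w w' x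
 have Tint: "integrable U01 (T v w w')" for v w w'
  unfolding T_def by (intro integrable_U01_bounded[where C=1]) auto
 have TB: "(\<integral>x. T v w w' x \<partial>U01) <= B" if "w < b ^ N" "w' < b ^ N" for v w w'
 proof (cases "w = w'")
  case True thus ?thesis using B0 by (simp add: T_def)
 next
  case False
  let ?S = "{x \<in> {0..<1}. \<bar>Gw x (w + b ^ N * v) - Gw x (w' + b ^ N * v)\<bar> <= ga ^ L}"
  have S: "?S \<in> sets lborel" by measurable
  have "(\<integral>x. T v w w' x \<partial>U01) = (\<integral>x. indicator ?S x \<partial>lborel)"
   unfolding integral_U01 using False by (intro Bochner_Integration.integral_cong) (auto simp: T_def indicator_def)
  also have "... = measure lborel ?S" by simp
  also have "... <= B"
   using collision_measure[OF that False L, of v] B0 unfolding B_def measure_def by (intro enn2real_leI) auto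
  finally show ?thesis .
 qed
 have cT: "coll N M L x = (\<Sum>v<b ^ M. \<Sum>w<b ^ N. \<Sum>w'<b ^ N. T v w w' x) / real (b ^ M)" for x
  by (simp add: coll_def T_def)
 show "integrable U01 (coll N M L)" unfolding cT[abs_def] by (intro integrable_divide Bochner_Integration.integrable_sum Tint)
 have "(\<integral>x. coll N M L x \<partial>U01) = (\<Sum>v<b ^ M. \<Sum>w<b ^ N. \<Sum>w'<b ^ N. (\<integral>x. T v w w' x \<partial>U01)) / real (b ^ M)"
  unfolding cT by (simp add: Bochner_Integration.integral_sum Tint)
 also have "... <= (\<Sum>v<b ^ M. \<Sum>w<b ^ N. \<Sum>w'<b ^ N. B) / real (b ^ M)"
  by (intro divide_right_mono sum_mono TB) auto
 also have "... = real (b ^ N) ^ 2 * B" using b0 by (simp add: power2_eq_square)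
 also have "... = real (b ^ N) ^ 3 * (Kt * (ga ^ (L - N)) powr \<theta>)"
  by (simp add: B_def power2_eq_square power3_eq_cube)
 finally show "(\<integral>x. coll N M L x \<partial>U01) <= real (b ^ N) ^ 3 * (Kt * (ga ^ (L - N)) powr \<theta>)" .
qed

lemma nonseparated_fraction:
 "rcard {v \<in> {..<b ^ M}. \<exists>w<b ^ N. \<exists>w'<b ^ N. w ~= w' &
  \<bar>Gw x (w + b ^ N * v) - Gw x (w' + b ^ N * v)\<bar> <= ga ^ L} <= coll N M L x * real (b ^ M)"
proof -
 let ?P = "%v w w'. w ~= w' & \<bar>Gw x (w + b ^ N * v) - Gw x (w' + b ^ N * v)\<bar> <= ga ^ L"
 let ?T = "%v w w'. if ?P v w w' then 1 else 0 :: real"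
 let ?X = "{v \<in> {..<b ^ M}. \<exists>w<b ^ N. \<exists>w'<b ^ N. ?P v w w'}"
 have "rcard ?X = (\<Sum>v\<in>?X. 1)" by simp
 also have "... <= (\<Sum>v\<in>?X. \<Sum>w<b ^ N. \<Sum>w'<b ^ N. ?T v w w')"
 proof (rule sum_mono)
  fix v assume "v \<in> ?X"
  then obtain w w' where w: "w < b ^ N" "w' < b ^ N" "?P v w w'" by auto
  have "(1::real) = ?T v w w'" using w by simp
  also have "... <= (\<Sum>w'<b ^ N. ?T v w w')" using w by (intro member_le_sum[where f="?T v w"]) auto
  also have "... <= (\<Sum>w<b ^ N. \<Sum>w'<b ^ N. ?T v w w')"
   using w by (intro member_le_sum[where f="%w. \<Sum>w'<b ^ N. ?T v w w'"]) (auto intro!: sum_nonneg)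
  finally show "1 <= (\<Sum>w<b ^ N. \<Sum>w'<b ^ N. ?T v w w')" .
 qed
 also have "... <= (\<Sum>v<b ^ M. \<Sum>w<b ^ N. \<Sum>w'<b ^ N. ?T v w w')" by (intro sum_mono2) (auto intro!: sum_nonneg)
 finally show ?thesis unfolding coll_def using b0 by simp
qed

end

section \<open>Lower bound for the entropy rate\<close>

context solenoid
begin

lemma fat_total:
 assumes y: "0 <= y" "y <= 1" and k: "k <= q" and K: "real K <= real k * lam"
 shows "lo K <= ent {..<b ^ q} (%j. dya K (Gw y j - G y))"
proof -
 let ?Om = "{..<b ^ q}" and ?z = "%j::nat. Gw y j - G y"
 have fin: "finite ?Om" by simp
 obtain U :: "nat => nat" where U: "\<forall>j\<in>?Om. \<forall>T. 0 + T <= K --> lo T <= ent (fib ?Om U j) (%j. dya (0 + T) (?z j))"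
  using fat_fibre_measure[OF y k K, of 0] by blast
 have "lo K * rcard ?Om = (\<Sum>j\<in>?Om. lo K)" by simp
 also have "... <= (\<Sum>j\<in>?Om. ent (fib ?Om U j) (%j. dya K (?z j)))" using U by (intro sum_mono) auto
 finally have "lo K <= (\<Sum>j\<in>?Om. ent (fib ?Om U j) (%j. dya K (?z j))) / rcard ?Om"
  using b0 by (simp add: le_divide_eq)
 also have "... = cent ?Om (%j. dya K (?z j)) U" by (rule cent_fibers_ent[OF fin, symmetric])
 also have "... <= ent ?Om (%j. dya K (?z j))"
  unfolding ent_def by (rule cent_antimono[OF fin]) (simp add: refines_def)
 finally show ?thesis .
qed

text \<open>Along the windows from scale \<open>N + k'\<close> to scale \<open>L\<close>, the sum over most words \<open>v\<close> of the entropies of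
 the convolutions exceeds its minimum by little, whereas the entropies of the prefixes add up to almost
 \<open>N * (log b - \<beta>)\<close>. The inverse theorem makes this impossible.\<close>
lemma window_contradiction:
 fixes N k k' lm K :: nat and x B et \<mu> ep1 A0 :: real
 defines "L == N + k' + lm * k"
 assumes x: "0 <= x" "x <= 1" and k: "0 < k" "0 < lm"
  and K: "real K <= real k * lam" "real k * lam <= real K + 1" "1 <= K"
  and k': "1 / real b ^ k' <= ga ^ k"
  and IT: "!!(f :: nat => real) (z :: nat => real) Om1 Om2. finite Om1 ==> finite Om2 ==> Om1 ~= {} ==> Om2 ~= {} ==> (\<forall>j\<in>Om2. \<bar>z j\<bar> <= real (2 * C)) ==>
   (\<forall>s\<le>K. fat_at lo K Om2 z s) ==>
   cent (Om1 \<times> Om2) (%p. dya K (f (fst p) + z (snd p))) (%p. dya 0 (f (fst p) + z (snd p))) <= (B + et) * real K ==>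
   cent Om1 (%w. dya K (f w)) (%w. dya 0 (f w)) <= ep1 * real K"
  and et: "0 < et" and ep1: "0 <= ep1" and \<mu>: "0 <= \<mu>"
  and loK: "(B - \<mu>) * real K <= lo K - 2 - log 2 (4 * real C + 1)"
  and sep: "rcard {v \<in> {..<b ^ (k' + lm * k)}. \<exists>w<b ^ N. \<exists>w'<b ^ N. w ~= w' &
   \<bar>Gw x (w + b ^ N * v) - Gw x (w' + b ^ N * v)\<bar> <= ga ^ L} <= real (b ^ (k' + lm * k)) / 4"
  and A0: "0 < A0" "a x L - a x (N + k') + log 2 (4 * real C + 2) + real lm + real lm * c2 - real lm * ((B - \<mu>) * real K) <= A0"
 shows "real N * log 2 (real b) - a x N - log 2 (4 * real C + 2) - real k' * lam - 2 - real lm * c2 <=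
  real lm * ep1 * real K + 8 * A0 / et"
proof -
 define M where "M = k' + lm * k"
 define d where "d l = k' + l * k" for l
 define r where "r l = (lm - l) * k" for l
 have dr: "d l + r l = M" "N + d l + r l = L" if "l < lm" for l
 proof -
  have "l * k + (lm - l) * k = lm * k" using that by (simp add: distrib_right[symmetric])
  thus "d l + r l = M" "N + d l + r l = L" by (simp_all add: d_def r_def M_def L_def)
 qed
 have dk: "1 / real b ^ d l <= ga ^ k" for l
 proof -
  have "1 / real b ^ d l <= 1 / real b ^ k'"
   using b0 by (intro divide_left_mono power_increasing) (auto simp: d_def)
  thus ?thesis using k' by linarith
 qed
 have kr: "k <= r l" if "l < lm" for l
 proof -
  have "1 * k <= (lm - l) * k" using that by (intro mult_right_mono) auto
  thus ?thesis by (simp add: r_def)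
 qed
 define f where "f l v w = Gw x (w + b ^ N * v) / ga ^ (N + d l)" for l v w
 define z where "z l v j = G (real v / real b ^ d l + real j) - G (real v / real b ^ d l)" for l v j :: nat
 define E where "E l v = cent ({..<b ^ N} \<times> {..<b ^ r l}) (%p. dya K (f l v (fst p) + z l v (snd p))) (%p. dya 0 (f l v (fst p) + z l v (snd p)))" for l v
 define F where "F l v = cent {..<b ^ N} (%w. dya K (f l v w)) (%w. dya 0 (f l v w))" for l v
 have zC: "\<bar>z l v j\<bar> <= real (2 * C)" for l v j
  unfolding z_def using G_bound[of "real v / real b ^ d l + real j"] G_bound[of "real v / real b ^ d l"] by simp
 have yv: "0 <= real v / real b ^ d l" "real v / real b ^ d l <= 1" if "v < b ^ d l" for v l
  using that b0 by (auto simp: divide_le_eq)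
 have ne: "{..<b ^ n} ~= {}" for n using b0 by (auto simp: lessThan_empty_iff)
 have Elow: "(B - \<mu>) * real K <= E l v" if l: "l < lm" and v: "v < b ^ d l" for l v
 proof -
  have "lo K <= ent {..<b ^ r l} (%j. dya K (z l v j))"
   unfolding z_def by (rule fat_total[OF yv[OF v] kr[OF l] K(1)])
  hence "lo K - 2 - log 2 (2 * real (2 * C) + 1) <= E l v"
   unfolding E_def using zC ne by (intro window_entropy_ge) auto
  thus ?thesis using loK by simp
 qed
 have FE: "F l v <= ep1 * real K" if l: "l < lm" and v: "v < b ^ d l" and E: "E l v <= (B + et) * real K" for l v
  unfolding F_def
 proof (rule IT[where z="z l v" and ?Om2.0="{..<b ^ r l}"])
  show "\<forall>s\<le>K. \<exists>U :: nat => nat. (\<forall>j\<in>{..<b ^ r l}. \<forall>j'\<in>{..<b ^ r l}. U j = U j' --> \<bar>z l v j - z l v j'\<bar> <= 1 / 2 ^ s) &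
   (\<forall>j\<in>{..<b ^ r l}. \<forall>T. s + T <= K --> lo T <= ent (fib {..<b ^ r l} U j) (%j. dya (s + T) (z l v j)))"
   unfolding z_def using fat_fibre_measure[OF yv[OF v] kr[OF l] K(1)] by blast
 qed (use zC ne E in \<open>auto simp: E_def\<close>)
 have Fup: "F l v <= 2 * real K" for l v
 proof -
  have "F l v <= log 2 (real (2 ^ K) + 1)"
   unfolding F_def dya_def
  proof (rule cent_floor_le)
   fix w w' assume "\<lfloor>2 ^ 0 * f l v w\<rfloor> = \<lfloor>2 ^ 0 * f l v w'\<rfloor>"
   hence "f l v w - f l v w' <= 1" by simp linarith
   hence "2 ^ K * (f l v w - f l v w') <= 2 ^ K * 1" by (intro mult_left_mono) auto
   thus "2 ^ K * f l v w - 2 ^ K * f l v w' <= real (2 ^ K)" by (simp add: right_diff_distrib)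
  qed simp
  also have "... <= log 2 (2 ^ (K + 1))" by (intro log_mono) (auto simp: one_le_power add_pos_pos)
  also have "... = real K + 1" by (simp add: log_nat_power del: power_Suc power_add)
  finally show ?thesis using K(3) by simp
 qed
 \<comment> \<open>The excess of the convolutions over their least entropy, added over the windows;
   each summand is nonnegative by \<open>Elow\<close>. Window \<open>l\<close> sees only the first
   \<open>d l\<close> digits of \<open>v\<close> as its middle block.\<close>
 define S where "S v = (\<Sum>l<lm. E l (v mod b ^ d l) - (B - \<mu>) * real K)" for v
 have bd: "0 < b ^ n" for n using b0 by simp
 have S0: "0 <= E l (v mod b ^ d l) - (B - \<mu>) * real K" if "l < lm" for l v
  using Elow[OF that, of "v mod b ^ d l"] bd by simp
 have avgS: "(\<Sum>v<b ^ M. S v) <= real (b ^ M) * A0"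
 proof -
  have avgE: "(\<Sum>v<b ^ M. E l (v mod b ^ d l)) <= real (b ^ M) * (cent {..<b ^ L} (%u. gcell (N + k' + l * k + k) (Gw x u))
   (%u. gcell (N + k' + l * k) (Gw x u)) + c2)" if l: "l < lm" for l
  proof -
   have "(\<Sum>v<b ^ d l. E l v) / real (b ^ d l) <= cent {..<b ^ (N + d l + r l)} (%u. gcell (N + d l + k) (Gw x u))
   (%u. gcell (N + d l) (Gw x u)) + c2"
   unfolding E_def f_def z_def by (rule window_step[OF x dk K(1)])
   also have "N + d l = N + k' + l * k" by (simp add: d_def)
   also have "N + k' + l * k + r l = L" using dr[OF l] by (simp add: d_def)
   finally have 1: "(\<Sum>v<b ^ d l. E l v) / real (b ^ d l) <= cent {..<b ^ L} (%u. gcell (N + k' + l * k + k) (Gw x u))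
   (%u. gcell (N + k' + l * k) (Gw x u)) + c2" .
   have "(\<Sum>v<b ^ M. E l (v mod b ^ d l)) = real (b ^ r l) * (\<Sum>v<b ^ d l. E l v)"
   using sum_mod_words[OF b0(1), of "E l" "d l" "r l"] dr[OF l] by simp
   also have "... = real (b ^ M) * ((\<Sum>v<b ^ d l. E l v) / real (b ^ d l))"
   unfolding dr(1)[OF l, symmetric] using b0 by (simp add: power_add)
   also have "... <= real (b ^ M) * (cent {..<b ^ L} (%u. gcell (N + k' + l * k + k) (Gw x u))
   (%u. gcell (N + k' + l * k) (Gw x u)) + c2)" using 1 by (intro mult_left_mono) auto
   finally show ?thesis .
  qed
  have "(\<Sum>v<b ^ M. S v) = (\<Sum>l<lm. \<Sum>v<b ^ M. E l (v mod b ^ d l) - (B - \<mu>) * real K)"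
   unfolding S_def by (rule sum.swap)
  also have "... = (\<Sum>l<lm. (\<Sum>v<b ^ M. E l (v mod b ^ d l)) - real (b ^ M) * ((B - \<mu>) * real K))"
   by (simp add: sum_subtractf)
  also have "... <= (\<Sum>l<lm. real (b ^ M) * (cent {..<b ^ L} (%u. gcell (N + k' + l * k + k) (Gw x u))
   (%u. gcell (N + k' + l * k) (Gw x u)) + c2) - real (b ^ M) * ((B - \<mu>) * real K))"
   by (intro sum_mono diff_right_mono avgE) auto
  also have "... = real (b ^ M) * ((\<Sum>l<lm. cent {..<b ^ L} (%u. gcell (N + k' + l * k + k) (Gw x u))
   (%u. gcell (N + k' + l * k) (Gw x u))) + real lm * c2 - real lm * ((B - \<mu>) * real K))"
   by (simp add: sum_distrib_left sum.distrib sum_subtractf right_diff_distrib distrib_left)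
  also have "... <= real (b ^ M) * A0"
   using windows_total[OF k(1), where N=N and k'=k' and lm=lm and x=x] A0(2) unfolding L_def[symmetric]
   by (intro mult_left_mono) auto
  finally show ?thesis .
 qed
 define NS where "NS = {v \<in> {..<b ^ M}. \<exists>w<b ^ N. \<exists>w'<b ^ N. w ~= w' &
   \<bar>Gw x (w + b ^ N * v) - Gw x (w' + b ^ N * v)\<bar> <= ga ^ L}"
 \<comment> \<open>The mean of the nonnegative \<open>S\<close> is at most \<open>A0\<close>, and at
   most a quarter of all \<open>v\<close> fail to separate, so not all the others can exceed
   \<open>4 * A0\<close>.\<close>
 have "\<exists>v\<in>{..<b ^ M} - NS. S v <= 4 * A0"
 proof (rule ccontr)
  assume "~ ?thesis"
  hence big: "4 * A0 <= S v" if "v \<in> {..<b ^ M} - NS" for v using that by force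
  have cNS: "rcard NS <= real (b ^ M) / 4" using sep by (simp add: NS_def M_def)
  have sub: "NS \<subseteq> {..<b ^ M}" by (auto simp: NS_def)
  have "card ({..<b ^ M} - NS) = b ^ M - card NS" using sub by (subst card_Diff_subset) (auto intro: finite_subset)
  moreover have "card NS <= b ^ M" using card_mono[OF _ sub] by simp
  ultimately have "rcard ({..<b ^ M} - NS) = real (b ^ M) - rcard NS" by (simp only: of_nat_diff)
  hence "rcard ({..<b ^ M} - NS) >= 3 / 4 * real (b ^ M)" using cNS by linarith
  hence "3 / 4 * real (b ^ M) * (4 * A0) <= rcard ({..<b ^ M} - NS) * (4 * A0)" using A0 by (intro mult_right_mono) auto
  also have "... = (\<Sum>v\<in>{..<b ^ M} - NS. 4 * A0)" by simp
  also have "... <= (\<Sum>v\<in>{..<b ^ M} - NS. S v)" by (intro sum_mono big)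
  also have "... <= (\<Sum>v<b ^ M. S v)" by (intro sum_mono2) (auto simp: S_def intro!: sum_nonneg S0)
  also have "... <= real (b ^ M) * A0" by (rule avgS)
  finally have "3 * (real (b ^ M) * A0) <= real (b ^ M) * A0" by simp
  moreover have "0 < real (b ^ M) * A0" using b0 A0 by simp
  ultimately show False by linarith
 qed
 then obtain v where v: "v < b ^ M" "v \<notin> NS" "S v <= 4 * A0" by auto
 \<comment> \<open>The windows that escape the inverse theorem. Each has excess above
   \<open>et * K\<close>, so they are few, and the trivial bound \<open>Fup\<close> is good enough
   for them.\<close>
 define bad where "bad = {l \<in> {..<lm}. (B + et) * real K < E l (v mod b ^ d l)}"
 have cbad: "rcard bad * (et * real K) <= 4 * A0"
 proof -
  have "rcard bad * (et * real K) = (\<Sum>l\<in>bad. et * real K)" by simp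
  also have "... <= (\<Sum>l\<in>bad. E l (v mod b ^ d l) - (B - \<mu>) * real K)"
  proof (rule sum_mono)
   fix l assume "l \<in> bad"
   hence "(B + et) * real K < E l (v mod b ^ d l)" by (simp add: bad_def)
   moreover have "0 <= \<mu> * real K" using \<mu> by simp
   ultimately show "et * real K <= E l (v mod b ^ d l) - (B - \<mu>) * real K" by (simp add: algebra_simps)
  qed
  also have "... <= S v" unfolding S_def by (intro sum_mono2) (auto simp: bad_def intro!: Elow mod_less_divisor bd)
  finally show ?thesis using v(3) by simp
 qed
 have "(\<Sum>l<lm. F l (v mod b ^ d l)) <= (\<Sum>l<lm. ep1 * real K + (if l \<in> bad then 2 * real K else 0))"
 proof (rule sum_mono)
  fix l assume l: "l \<in> {..<lm}"
  show "F l (v mod b ^ d l) <= ep1 * real K + (if l \<in> bad then 2 * real K else 0)"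
  proof (cases "l \<in> bad")
   case True
   have "0 <= ep1 * real K" using ep1 by simp
   thus ?thesis using True Fup[of l "v mod b ^ d l"] by simp
  next
   case False
   thus ?thesis using FE[of l "v mod b ^ d l"] l bd by (simp add: bad_def not_less)
  qed
 qed
 also have "... = real lm * (ep1 * real K) + 2 * (rcard bad * real K)"
 proof -
  have "(\<Sum>l<lm. if l \<in> bad then 2 * real K else 0) = (\<Sum>l\<in>{l \<in> {..<lm}. l \<in> bad}. 2 * real K)"
   by (rule sum.inter_filter[symmetric]) simp
  also have "{l \<in> {..<lm}. l \<in> bad} = bad" by (auto simp: bad_def)
  finally show ?thesis by (simp add: sum.distrib)
 qed
 also have "2 * (rcard bad * real K) <= 8 * A0 / et" using cbad et by (simp add: field_simps)
 finally have up: "(\<Sum>l<lm. F l (v mod b ^ d l)) <= real lm * ep1 * real K + 8 * A0 / et" by (simp add: mult.assoc)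
 \<comment> \<open>In window \<open>l\<close> the word \<open>v\<close> is cut into the middle block
   \<open>v mod b ^ d l\<close> and the tail \<open>v div b ^ d l\<close>; the prefix points
   themselves are the same in all windows.\<close>
 have low: "cent {..<b ^ N} (%w. gcell (N + k' + l * k + k) (Gw x (w + b ^ N * v)))
   (%w. gcell (N + k' + l * k) (Gw x (w + b ^ N * v))) <= F l (v mod b ^ d l) + c2" for l
 proof -
  have vd: "v mod b ^ d l + b ^ d l * (v div b ^ d l) = v" by simp
  show ?thesis using prefix_window[OF x dk K(1,2), of N "v mod b ^ d l" l "v div b ^ d l"]
   unfolding vd F_def f_def by (simp only: d_def add.assoc)
 qed
 have "real N * log 2 (real b) - a x N - log 2 (4 * real C + 2) - real k' * lam - 2 <=
  (\<Sum>l<lm. cent {..<b ^ N} (%w. gcell (N + k' + l * k + k) (Gw x (w + b ^ N * v)))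
   (%w. gcell (N + k' + l * k) (Gw x (w + b ^ N * v))))"
 proof (rule prefix_total[OF x])
  fix w w' assume "w < b ^ N" "w' < b ^ N" "w ~= w'"
  thus "ga ^ (N + k' + lm * k) < \<bar>Gw x (w + b ^ N * v) - Gw x (w' + b ^ N * v)\<bar>"
   using v(1,2) unfolding NS_def L_def by (force simp: not_le)
 qed
 also have "... <= (\<Sum>l<lm. F l (v mod b ^ d l) + c2)" by (intro sum_mono low)
 also have "... = (\<Sum>l<lm. F l (v mod b ^ d l)) + real lm * c2" by (simp add: sum.distrib)
 finally show ?thesis using up by linarith
qed

end

context transversal_solenoid
begin

text \<open>The order of the constants matters. \<open>Qs\<close> fixes the ratio between the depth
  of separation and the prefix length; the deficit \<open>Dl\<close> then amounts to
  \<open>8 * D8\<close> per unit of \<open>t = N * Qs\<close>. The inverse theorem with tolerance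
  \<open>ep1\<close> supplies \<open>et\<close>; \<open>\<mu>\<close> is chosen small against
  \<open>et\<close>, next the window length \<open>k\<close>, and last \<open>N1\<close>, which
  makes the bounded terms negligible. All losses together are at most \<open>6 * D8 * t\<close>,
  less than the \<open>8 * D8 * t\<close> to be accounted for.\<close>

theorem beta_ge: "min (log 2 (real b)) lam <= \<beta>"
proof (rule ccontr)
 assume "~ ?thesis"
 hence bb: "\<beta> < log 2 (real b)" and bl: "\<beta> < lam" by auto
 define B where "B = \<beta> / lam"
 have B: "0 <= B" "B < 1" "B * lam = \<beta>" using beta_nonneg lam0 bl by (auto simp: B_def)
 define Dl where "Dl = log 2 (real b) - \<beta>"
 have gth: "0 < ga powr \<theta>" "ga powr \<theta> < 1" using g0 g1 th powr_less_mono2[of \<theta> ga 1] by auto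
 have b3: "1 <= real b ^ 3" using b0 by (intro one_le_power) auto
 \<comment> \<open>A factor below \<open>1 / b ^ 3\<close> per digit of the prefix beats the cube of
   \<open>b ^ N\<close> in \<open>coll_integral\<close>; the extra 2 makes the collision integral
   decay in \<open>N\<close>.\<close>
 obtain Qs where Qs: "(ga powr \<theta>) ^ Qs < 1 / (2 * real b ^ 3)"
  using real_arch_pow_inv[of "1 / (2 * real b ^ 3)" "ga powr \<theta>"] gth b0 by auto
 have Qs1: "1 <= Qs"
 proof (rule ccontr)
  assume "~ 1 <= Qs"
  hence "Qs = 0" by simp
  hence "1 < 1 / (2 * real b ^ 3)" using Qs by simp
  moreover have "1 / (2 * real b ^ 3) <= 1 / 2" using b3 b0 by (intro divide_left_mono) auto
  ultimately show False by linarith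
 qed
 define D8 where "D8 = Dl / (8 * real Qs)"
 have D8: "0 < D8" "Dl = 8 * D8 * real Qs" using bb Qs1 by (auto simp: D8_def Dl_def)
 define ep1 where "ep1 = D8 / lam"
 have e1: "0 < ep1" "ep1 * lam = D8" using D8 lam0 by (auto simp: ep1_def)
 obtain et K0 where et: "0 < et" and IT0: "\<forall>K\<ge>K0. \<forall>(f :: nat => real) (z :: nat => real) Om1 Om2.
  finite Om1 --> finite Om2 --> Om1 ~= {} --> Om2 ~= {} --> (\<forall>j\<in>Om2. \<bar>z j\<bar> <= real (2 * C)) -->
  (\<forall>s\<le>K. fat_at lo K Om2 z s) -->
  cent (Om1 \<times> Om2) (%p. dya K (f (fst p) + z (snd p))) (%p. dya 0 (f (fst p) + z (snd p))) <= (B + et) * real K -->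
  cent Om1 (%w. dya K (f w)) (%w. dya 0 (f w)) <= ep1 * real K"
  using inverse_theorem[OF B(1,2) e1(1), of lo "2 * C", OF lo_limit[folded B_def]] by blast
 define \<mu> where "\<mu> = min (D8 / 5) (D8 * et / (8 * (5 + lam)))"
 have \<mu>: "0 < \<mu>" "5 * \<mu> <= D8" using D8 et lam0 by (auto simp: \<mu>_def)
 have \<mu>2: "8 * (\<mu> * (5 + lam)) / et <= D8"
 proof -
  have "\<mu> * (8 * (5 + lam)) <= D8 * et / (8 * (5 + lam)) * (8 * (5 + lam))"
   using lam0 by (intro mult_right_mono) (auto simp: \<mu>_def)
  also have "D8 * et / (8 * (5 + lam)) * (8 * (5 + lam)) = D8 * et" using lam0 by simp
  finally have "8 * (\<mu> * (5 + lam)) <= D8 * et" by (simp only: mult_ac)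
  thus ?thesis using et by (simp add: divide_le_eq)
 qed
 obtain T0 where T0: "!!T. T0 <= T ==> (B - \<mu> / 2) * real T <= lo T"
  using lo_limit[of "\<mu> / 2"] \<mu> unfolding B_def by auto
 define c7 where "c7 = 2 + log 2 (4 * real C + 1)"
 have c70: "0 <= c7" by (simp add: c7_def)
 have c20: "0 <= c2" by (simp add: c2_def)
 obtain k :: nat where k0: "(real K0 + real T0 + 2 * c7 / \<mu> + 2) / lam + (2 + 2 * c2) * 8 / (et * D8) + c2 / D8 + 1 < real k"
  using reals_Archimedean2 by blast
 have pp: "0 <= (real K0 + real T0 + 2 * c7 / \<mu> + 2) / lam" "0 <= (2 + 2 * c2) * 8 / (et * D8)" "0 <= c2 / D8"
  using lam0 \<mu> et D8 c70 c20 by auto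
 have k1: "(real K0 + real T0 + 2 * c7 / \<mu> + 2) / lam <= real k" "(2 + 2 * c2) * 8 / (et * D8) <= real k" "c2 / D8 <= real k" "1 <= real k"
  using k0 pp by linarith+
 have kl: "real K0 + real T0 + 2 * c7 / \<mu> + 2 <= real k * lam" using k1(1) lam0 by (simp add: field_simps)
 have k2: "8 * ((2 + 2 * c2) / real k) / et <= D8"
 proof -
  have "(2 + 2 * c2) * 8 <= real k * (et * D8)" using k1(2) et D8 by (simp add: divide_le_eq)
  thus ?thesis using k1(4) et by (simp add: field_simps)
 qed
 have k3: "c2 <= D8 * real k" using k1(3) D8 by (simp add: field_simps)
 define K where "K = nat \<lfloor>real k * lam\<rfloor>"
 have K: "real K <= real k * lam" "real k * lam < real K + 1" unfolding K_def using kl lam0 k1 by auto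
 have c7m: "0 <= 2 * c7 / \<mu>" using c70 \<mu> by simp
 have K2: "K0 <= K" "T0 <= K" "1 <= K" "2 * c7 / \<mu> <= real K" using K kl c7m by linarith+
 have loK: "(B - \<mu>) * real K <= lo K - 2 - log 2 (4 * real C + 1)"
 proof -
  have "c7 <= \<mu> / 2 * real K" using K2(4) \<mu> by (simp add: field_simps)
  moreover have "(B - \<mu>) * real K = (B - \<mu> / 2) * real K - \<mu> / 2 * real K" by (simp add: left_diff_distrib)
  ultimately show ?thesis using T0[OF K2(2)] by (simp add: c7_def)
 qed
 \<comment> \<open>A block of \<open>r0\<close> base-\<open>b\<close> digits resolves the base point
   to within one factor \<open>ga\<close>, so the middle block of length \<open>k * r0\<close>
   resolves it to within \<open>ga ^ k\<close>.\<close>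
 obtain r0 where r0: "(1 / real b) ^ r0 < ga" using real_arch_pow_inv[of ga "1 / real b"] g0 b by auto
 define k' where "k' = k * r0"
 have k': "1 / real b ^ k' <= ga ^ k"
 proof -
  have "1 / real b ^ k' = ((1 / real b) ^ r0) ^ k"
   by (simp add: k'_def power_one_over power_mult[symmetric] mult.commute)
  also have "... <= ga ^ k" using r0 b0 by (intro power_mono) auto
  finally show ?thesis .
 qed
 obtain n1 where n1: "!!n x. n1 <= n ==> 0 <= x ==> x <= 1 ==> (\<beta> - \<mu> / 8) * real n <= a x n"
  using a_uniform_lower[of "\<mu> / 8"] \<mu> by auto
 obtain p where p: "(1 / 2 :: real) ^ p < 1 / (16 * Kt)" using real_arch_pow_inv[of "1 / (16 * Kt)" "1 / 2"] Kt by auto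
 define Z where "Z = \<kappa> + log 2 (4 * real C + 2) + real k' * lam + 2"
 have Z0: "0 <= Z" using \<kappa>0 lam0 by (simp add: Z_def)
 obtain N1 :: nat where N10: "real r0 + real n1 + real p + 16 * \<kappa> / \<mu> + Z / D8 + 1 < real N1" using reals_Archimedean2 by blast
 have qq: "0 <= 16 * \<kappa> / \<mu>" "0 <= Z / D8" using \<kappa>0 \<mu> Z0 D8 by auto
 have N1: "r0 <= N1" "n1 <= N1" "p <= N1" "16 * \<kappa> / \<mu> <= real N1" "Z / D8 <= real N1" "1 <= N1" using N10 qq by linarith+
 define N where "N = k * N1"
 define lm where "lm = Qs * N1"
 define M where "M = k' + lm * k"
 define L where "L = N + k' + lm * k"
 have kpos: "0 < k" "0 < lm" using k1(4) Qs1 N1(6) by (auto simp: lm_def)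
 have LM: "L = N + M" by (simp add: L_def M_def)
 define t where "t = real (lm * k)"
 have tN: "t = real N * real Qs" by (simp add: t_def lm_def N_def)
 have NN1: "N1 <= N" using kpos by (simp add: N_def)
 have Nt: "N <= lm * k"
 proof -
  have "N * 1 <= N * Qs" using Qs1 by (intro mult_left_mono) auto
  thus ?thesis by (simp add: lm_def N_def mult_ac)
 qed
 have k'N: "k' <= N" using N1(1) by (simp add: k'_def N_def)
 have Ntr: "real N <= t" "real k' <= t" using Nt k'N unfolding t_def by linarith+
 have t0: "0 < t" using kpos by (simp add: t_def)
 have n1L: "n1 <= L" "n1 <= M" "n1 <= N + k'" using N1(2) NN1 Nt by (auto simp: L_def M_def)
 have N1L: "N1 <= L" using NN1 by (simp add: L_def)
 have L0: "0 < real L" using N1L N1(6) by linarith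
 have collI: "(\<integral>x. coll N M L x \<partial>U01) <= 1 / 16"
 proof -
  have "(\<integral>x. coll N M L x \<partial>U01) <= real (b ^ N) ^ 3 * (Kt * (ga ^ (L - N)) powr \<theta>)"
   by (rule coll_integral(2)) (simp add: LM)
  also have "L - N = M" by (simp add: LM)
  also have "real (b ^ N) ^ 3 * (Kt * (ga ^ M) powr \<theta>) <= real (b ^ N) ^ 3 * (Kt * (1 / (2 * real b ^ 3)) ^ N)"
  proof -
   have "ga ^ M <= ga ^ (Qs * N)" using g0 g1 by (intro power_decreasing) (auto simp: M_def lm_def N_def mult_ac)
   hence "(ga ^ M) powr \<theta> <= (ga ^ (Qs * N)) powr \<theta>" using g0 th by (intro powr_mono2) auto
   also have "... = ((ga powr \<theta>) ^ Qs) ^ N"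
   using g0 by (simp add: powr_realpow[symmetric] powr_powr mult_ac)
   also have "... <= (1 / (2 * real b ^ 3)) ^ N" using Qs gth by (intro power_mono) auto
   finally show ?thesis using Kt by (intro mult_left_mono) auto
  qed
  also have "real (b ^ N) ^ 3 * (Kt * (1 / (2 * real b ^ 3)) ^ N) = Kt * (1 / 2) ^ N"
  proof -
   have "real (b ^ N) ^ 3 = (real b ^ 3) ^ N" by (simp add: power_mult[symmetric] mult.commute)
   moreover have "(real b ^ 3) ^ N * (1 / (2 * real b ^ 3)) ^ N = (1 / 2) ^ N"
   using b0 by (simp add: power_mult_distrib[symmetric])
   ultimately show ?thesis by (metis mult.left_commute)
  qed
  also have "Kt * (1 / 2) ^ N <= Kt * (1 / 2) ^ p" using N1(3) NN1 Kt by (intro mult_left_mono power_decreasing) auto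
  also have "... <= 1 / 16" using p Kt by (simp add: field_simps)
  finally show ?thesis .
 qed
 \<comment> \<open>One function for two requirements on \<open>x\<close>. Both summands are
   nonnegative, the first by the uniform lower bound on \<open>a\<close>, so \<open>g x < 1\<close>
   gives at once an almost minimal entropy at length \<open>L\<close> and
   \<open>coll N M L x <= 1 / 4\<close>.\<close>
 define g where "g x = (a x L - (\<beta> - \<mu> / 8) * real L) / (\<mu> * real L) + 4 * coll N M L x" for x
 have ci: "integrable U01 (coll N M L)" by (rule coll_integral(1)) (simp add: LM)
 have gi: "integrable U01 g"
  unfolding g_def by (intro Bochner_Integration.integrable_add integrable_divide Bochner_Integration.integrable_diff
   integrable_a integrable_mult_right ci) auto
 have "(\<integral>x. g x \<partial>U01) = (Av L - (\<beta> - \<mu> / 8) * real L) / (\<mu> * real L) + 4 * (\<integral>x. coll N M L x \<partial>U01)"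
  unfolding g_def Av_def using integrable_a ci by (simp add: U01.prob_space)
 also have "... <= (\<beta> * real L + 2 * \<kappa> - (\<beta> - \<mu> / 8) * real L) / (\<mu> * real L) + 4 * (1 / 16)"
 proof (intro add_mono mult_left_mono collI divide_right_mono diff_right_mono)
  show "Av L <= \<beta> * real L + 2 * \<kappa>" using L0 by (intro Av_le_\<beta>) simp
 qed (use \<mu> in auto)
 also have "(\<beta> * real L + 2 * \<kappa> - (\<beta> - \<mu> / 8) * real L) / (\<mu> * real L) <= 1 / 4"
 proof -
  have "real N1 <= real L" using N1L by simp
  hence "16 * \<kappa> / \<mu> <= real L" using N1(4) by linarith
  hence "2 * \<kappa> <= \<mu> / 8 * real L" using \<mu> by (simp add: field_simps)
  hence "\<beta> * real L + 2 * \<kappa> - (\<beta> - \<mu> / 8) * real L <= 1 / 4 * (\<mu> * real L)" by (simp add: algebra_simps)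
  thus ?thesis using \<mu> L0 by (simp add: divide_le_eq)
 qed
 finally have "(\<integral>x. g x \<partial>U01) < 1" by simp
 from U01_exists_less[OF gi this] obtain x where x01: "x \<in> {0..<1}" and gx: "g x < 1" by auto
 have x: "0 <= x" "x <= 1" using x01 by auto
 have coll0: "0 <= coll N M L x" unfolding coll_def by (intro divide_nonneg_nonneg sum_nonneg) auto
 have aL0: "0 <= (a x L - (\<beta> - \<mu> / 8) * real L) / (\<mu> * real L)"
  using n1[OF n1L(1) x] \<mu> L0 by (intro divide_nonneg_nonneg) auto
 have c14: "coll N M L x <= 1 / 4" using gx aL0 unfolding g_def by linarith
 have aL: "a x L <= (\<beta> + \<mu>) * real L"
 proof -
  have "(a x L - (\<beta> - \<mu> / 8) * real L) / (\<mu> * real L) < 1" using gx coll0 unfolding g_def by linarith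
  hence "a x L - (\<beta> - \<mu> / 8) * real L < \<mu> * real L" using \<mu> L0 by (simp add: divide_less_eq)
  moreover have "0 <= \<mu> / 8 * real L" using \<mu> by simp
  ultimately show ?thesis by (simp add: algebra_simps)
 qed
 have alow: "(\<beta> - \<mu>) * real n <= a y n" if "n1 <= n" "0 <= y" "y <= 1" for n y
 proof -
  have "(\<beta> - \<mu>) * real n <= (\<beta> - \<mu> / 8) * real n" using \<mu> by (intro mult_right_mono) auto
  thus ?thesis using n1[OF that] by linarith
 qed
 define A0 where "A0 = t * (\<mu> * (5 + lam) + (2 + 2 * c2) / real k)"
 have A00: "0 < A0" unfolding A0_def using t0 \<mu> lam0 c20 k1(4) by (intro mult_pos_pos add_pos_nonneg) auto
 have A0: "a x L - a x (N + k') + log 2 (4 * real C + 2) + real lm + real lm * c2 - real lm * ((B - \<mu>) * real K) <= A0"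
 proof -
  have 1: "a x L - a x (N + k') <= \<beta> * t + \<mu> * (5 * t)"
  proof -
   have "a x L - a x (N + k') <= (\<beta> + \<mu>) * real L - (\<beta> - \<mu>) * real (N + k')"
   using aL alow[OF n1L(3) x] by linarith
   also have "... = \<beta> * t + \<mu> * (2 * real N + 2 * real k' + t)"
   by (simp add: L_def t_def algebra_simps)
   also have "... <= \<beta> * t + \<mu> * (5 * t)" using Ntr \<mu> by (intro add_left_mono mult_left_mono) auto
   finally show ?thesis .
  qed
  have 2: "real lm * ((B - \<mu>) * real K) >= \<beta> * t - real lm - \<mu> * lam * t"
  proof -
   have "B * (real k * lam - 1) <= B * real K" using K(2) B by (intro mult_left_mono) auto
   moreover have "B * (real k * lam - 1) = \<beta> * real k - B" using B(3) by (metis mult.commute mult.left_commute right_diff_distrib mult.right_neutral)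
   moreover have "\<mu> * real K <= \<mu> * (real k * lam)" using K(1) \<mu> by (intro mult_left_mono) auto
   ultimately have "\<beta> * real k - 1 - \<mu> * (real k * lam) <= (B - \<mu>) * real K" using B(2) by (simp add: left_diff_distrib)
   hence "real lm * (\<beta> * real k - 1 - \<mu> * (real k * lam)) <= real lm * ((B - \<mu>) * real K)" by (intro mult_left_mono) auto
   thus ?thesis by (simp add: t_def algebra_simps)
  qed
  have 3: "log 2 (4 * real C + 2) <= real lm * c2"
  proof -
   have "log 2 (4 * real C + 2) <= 1 * c2" unfolding c2_def by simp
   also have "... <= real lm * c2" using kpos c20 by (intro mult_right_mono) auto
   finally show ?thesis .
  qed
  have "A0 = \<mu> * (5 * t) + \<mu> * lam * t + real lm * (2 + 2 * c2)"
   unfolding A0_def using k1(4) by (simp add: t_def field_simps)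
  thus ?thesis using 1 2 3 by (simp add: algebra_simps)
 qed
 have sep: "rcard {v \<in> {..<b ^ (k' + lm * k)}. \<exists>w<b ^ N. \<exists>w'<b ^ N. w ~= w' &
   \<bar>Gw x (w + b ^ N * v) - Gw x (w' + b ^ N * v)\<bar> <= ga ^ (N + k' + lm * k)} <= real (b ^ (k' + lm * k)) / 4"
 proof -
  have "coll N M L x * real (b ^ M) <= 1 / 4 * real (b ^ M)" using c14 by (intro mult_right_mono) auto
  thus ?thesis using nonseparated_fraction[of M N x L] unfolding M_def L_def by linarith
 qed
 have main: "real N * log 2 (real b) - a x N - log 2 (4 * real C + 2) - real k' * lam - 2 - real lm * c2 <=
  real lm * ep1 * real K + 8 * A0 / et"
  by (rule window_contradiction[where B=B and \<mu>=\<mu>, OF x kpos K(1) less_imp_le[OF K(2)] K2(3) k' _ et _ _ loK sep A00 A0[unfolded L_def]])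
   (use IT0 K2(1) e1 \<mu> in auto)
 \<comment> \<open>Superadditivity read backwards: the entropy at length \<open>L\<close> is almost
   minimal and the preimages contribute at least the minimal rate, so the prefixes over the same
   \<open>x\<close> cannot carry much more than \<open>\<beta> * N\<close>.\<close>
 have aN: "a x N <= \<beta> * real N + \<mu> * (5 * t) + \<kappa>"
 proof -
  have "(\<beta> - \<mu>) * real M <= (\<Sum>w<b ^ N. a ((x + real w) / real b ^ N) M) / real (b ^ N)"
  proof -
   have "(\<Sum>w<b ^ N. (\<beta> - \<mu>) * real M) <= (\<Sum>w<b ^ N. a ((x + real w) / real b ^ N) M)"
   proof (rule sum_mono)
   fix w assume "w \<in> {..<b ^ N}"
   hence "Suc w <= b ^ N" by simp
   hence "real (Suc w) <= real (b ^ N)" by (simp only: of_nat_le_iff)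
   hence "(x + real w) / real b ^ N <= 1" using x b0 by simp
   thus "(\<beta> - \<mu>) * real M <= a ((x + real w) / real b ^ N) M" using x b0 by (intro alow n1L) auto
   qed
   thus ?thesis using b0 by (simp add: le_divide_eq mult.commute)
  qed
  hence "a x N + (\<beta> - \<mu>) * real M - \<kappa> <= (\<beta> + \<mu>) * real L" using a_superadd[of x N M] aL unfolding LM by linarith
  hence "a x N <= \<beta> * real N + \<mu> * (real N + 2 * real k' + 2 * t) + \<kappa>"
   by (simp add: LM M_def t_def algebra_simps)
  also have "\<mu> * (real N + 2 * real k' + 2 * t) <= \<mu> * (5 * t)" using Ntr \<mu> by (intro mult_left_mono) auto
  finally show ?thesis by simp
 qed
 have f1: "real N * log 2 (real b) - \<beta> * real N = 8 * (D8 * t)"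
 proof -
  have "real N * log 2 (real b) - \<beta> * real N = real N * Dl" by (simp add: Dl_def algebra_simps)
  thus ?thesis by (simp add: D8(2) tN)
 qed
 have f2: "\<mu> * (5 * t) <= D8 * t" using mult_right_mono[OF \<mu>(2), of t] t0 by simp
 have f3: "Z <= D8 * t"
 proof -
  have "Z <= D8 * real N1" using N1(5) D8 by (simp add: divide_le_eq mult.commute)
  also have "real N1 <= t" using NN1 Ntr(1) by linarith
  finally show ?thesis using D8 by (simp add: mult_left_mono)
 qed
 have f4: "real lm * c2 <= D8 * t" using mult_left_mono[OF k3, of "real lm"] by (simp add: t_def mult_ac)
 have f5: "real lm * ep1 * real K <= D8 * t"
 proof -
  have "real lm * ep1 * real K <= real lm * ep1 * (real k * lam)" using K(1) e1 by (intro mult_left_mono) auto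
  also have "... = (ep1 * lam) * t" by (simp add: t_def)
  finally show ?thesis using e1 by simp
 qed
 have f6: "8 * A0 / et <= 2 * (D8 * t)"
 proof -
  have "8 * A0 / et = t * (8 * (\<mu> * (5 + lam)) / et + 8 * ((2 + 2 * c2) / real k) / et)"
   by (simp add: A0_def add_divide_distrib distrib_left mult_ac)
  also have "... <= t * (D8 + D8)" using \<mu>2 k2 t0 by (intro mult_left_mono add_mono) auto
  finally show ?thesis by (simp add: mult_ac)
 qed
 have "0 < D8 * t" using D8 t0 by simp
 thus False using main aN f1 f2 f3 f4 f5 f6 unfolding Z_def by linarith
qed

end

section \<open>Moments of the fibre measures\<close>

text \<open>For the law of \<open>X\<close> this is the sum of the cell masses to the power
  \<open>1 + s\<close>, that is, the partition sum of the \<open>L^q\<close> spectrum at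
  \<open>q = 1 + s\<close>.\<close>

definition mom :: "real => 'a set => ('a => 'b) => real" where
 "mom s A X = (\<Sum>a\<in>A. (rcard (fib A X a) / rcard A) powr s) / rcard A"

lemma powr_bernoulli:
 fixes u s :: real
 assumes "0 < u" "0 <= s"
 shows "1 - s * (u - 1) <= u powr (- s)"
proof -
 have "1 - s * (u - 1) <= 1 + (- s) * ln u" using mult_left_mono[OF ln_le_minus_one[OF assms(1)] assms(2)] by simp
 also have "... <= exp ((- s) * ln u)" by (rule exp_ge_add_one_self)
 also have "... = u powr (- s)" using assms by (simp add: powr_def)
 finally show ?thesis .
qed

text \<open>A fibre of \<open>X\<close> that splits into at most \<open>k\<close> fibres of
  \<open>(Z, X)\<close> is compared with \<open>k\<close> times its parts.
  \<open>powr_bernoulli\<close> linearises the power at \<open>u = F / (k * H)\<close>, and the mean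
  of \<open>u\<close> over the fibre is at most 1, so the linear term has the right sign.\<close>

lemma sum_fib_powr_le:
 assumes fin: "finite A" and s: "0 <= s"
  and k: "!!a. a \<in> A ==> rcard (Z ` fib A X a) <= k a"
  and kc: "!!a a'. a \<in> A ==> a' \<in> A ==> X a = X a' ==> k a = k a'"
 shows "(\<Sum>a\<in>A. rcard (fib A X a) powr s) <= (\<Sum>a\<in>A. (k a * rcard (fib A (%t. (Z t, X t)) a)) powr s)"
proof -
 define F where "F a = rcard (fib A X a)" for a
 define H where "H a = rcard (fib A (%t. (Z t, X t)) a)" for a
 have pos: "0 < F a" "0 < H a" if "a \<in> A" for a unfolding F_def H_def using card_fib_pos[OF fin that] by auto
 have kpos: "1 <= k a" if a: "a \<in> A" for a
 proof -
  have "0 < card (Z ` fib A X a)" using finite_fib[OF fin, of X a] self_in_fib[OF a, of X] by (auto simp: card_gt_0_iff)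
  thus ?thesis using k[OF a] by linarith
 qed
 have inv: "(\<Sum>t\<in>fib A X a. 1 / H t) <= k a" if a: "a \<in> A" for a
 proof -
  have "(\<Sum>t\<in>fib A X a. 1 / H t) = (\<Sum>x\<in>Z ` fib A X a. \<Sum>t\<in>{t\<in>fib A X a. Z t = x}. 1 / H t)"
   by (rule sum.group[symmetric]) (auto simp: finite_fib[OF fin])
  also have "... = (\<Sum>x\<in>Z ` fib A X a. 1)"
  proof (rule sum.cong[OF refl])
   fix x assume "x \<in> Z ` fib A X a"
   then obtain t0 where t0: "t0 \<in> fib A X a" "x = Z t0" by auto
   have S: "{t\<in>fib A X a. Z t = x} = fib A (%t. (Z t, X t)) t0" using t0 by (auto simp: fib_def)
   have "(\<Sum>t\<in>{t\<in>fib A X a. Z t = x}. 1 / H t) = (\<Sum>t\<in>{t\<in>fib A X a. Z t = x}. 1 / H t0)"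
   unfolding S by (rule sum.cong) (auto simp: H_def fib_eq)
   also have "... = 1" unfolding S using pos(2)[of t0] t0 fib_subset[of A X a] by (auto simp: H_def)
   finally show "(\<Sum>t\<in>{t\<in>fib A X a. Z t = x}. 1 / H t) = 1" .
  qed
  finally show ?thesis using k[OF a] by simp
 qed
 have one: "F a powr s <= (\<Sum>t\<in>fib A X a. (k t * H t) powr s) / rcard (fib A X a)" if a: "a \<in> A" for a
 proof -
  have tA: "t \<in> A" "k t = k a" if "t \<in> fib A X a" for t using that a kc[of t a] by (auto simp: fib_def)
  have "F a powr s = F a powr s * (\<Sum>t\<in>fib A X a. 1) / F a" using pos[OF a] by (simp add: F_def)
  also have "... <= F a powr s * (\<Sum>t\<in>fib A X a. 1 - s * (F a / (k a * H t) - 1)) / F a"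
  proof (intro divide_right_mono mult_left_mono)
   have "(\<Sum>t\<in>fib A X a. 1 - s * (F a / (k a * H t) - 1)) = F a - s * (F a / k a * (\<Sum>t\<in>fib A X a. 1 / H t) - F a)"
   by (simp add: sum_subtractf sum_distrib_left F_def right_diff_distrib mult.assoc)
   moreover have "F a / k a * (\<Sum>t\<in>fib A X a. 1 / H t) <= F a / k a * k a"
   using inv[OF a] pos[OF a] kpos[OF a] by (intro mult_left_mono) auto
   hence "F a / k a * (\<Sum>t\<in>fib A X a. 1 / H t) <= F a" using kpos[OF a] by simp
   hence "0 <= s * (F a - F a / k a * (\<Sum>t\<in>fib A X a. 1 / H t))" using s by simp
   ultimately show "(\<Sum>t\<in>fib A X a. 1) <= (\<Sum>t\<in>fib A X a. 1 - s * (F a / (k a * H t) - 1))"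
   by (simp add: F_def right_diff_distrib)
  qed (use pos[OF a] in auto)
  also have "... <= F a powr s * (\<Sum>t\<in>fib A X a. (F a / (k a * H t)) powr (- s)) / F a"
   using pos tA kpos[OF a] s pos(1)[OF a]
   by (intro divide_right_mono mult_left_mono sum_mono powr_bernoulli) (auto intro!: divide_pos_pos mult_pos_pos)
  also have "... = (\<Sum>t\<in>fib A X a. F a powr s * (F a / (k a * H t)) powr (- s)) / F a"
   by (simp add: sum_distrib_left)
  also have "(\<Sum>t\<in>fib A X a. F a powr s * (F a / (k a * H t)) powr (- s)) = (\<Sum>t\<in>fib A X a. (k t * H t) powr s)"
  proof (rule sum.cong[OF refl])
   fix t assume t: "t \<in> fib A X a"
   have "F a powr s * (F a / (k a * H t)) powr (- s) = F a powr s * ((k a * H t) / F a) powr s"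
   using pos(1)[OF a] pos(2)[OF tA(1)[OF t]] kpos[OF a] by (simp add: powr_minus_divide powr_divide)
   also have "... = (F a * ((k a * H t) / F a)) powr s"
   by (rule powr_mult[symmetric])
   finally show "F a powr s * (F a / (k a * H t)) powr (- s) = (k t * H t) powr s"
   using pos(1)[OF a] tA(2)[OF t] by simp
  qed
  finally show ?thesis by (simp add: F_def)
 qed
 have "(\<Sum>a\<in>A. F a powr s) <= (\<Sum>a\<in>A. (\<Sum>t\<in>fib A X a. (k t * H t) powr s) / rcard (fib A X a))"
  by (intro sum_mono one)
 also have "... = (\<Sum>a\<in>A. (k a * H a) powr s)" by (rule sum_fib_average[OF fin])
 finally show ?thesis unfolding F_def H_def .
qed

lemma mom_le_values:
 assumes fin: "finite A" and s: "0 <= s" and k: "!!a. a \<in> A ==> rcard (Z ` fib A X a) <= k" "0 <= k"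
 shows "mom s A X <= k powr s * mom s A Z"
proof (cases "A = {}")
 case False
 define n where "n = rcard A"
 have n: "0 < n" using False fin by (simp add: n_def card_gt_0_iff)
 have "(\<Sum>a\<in>A. rcard (fib A X a) powr s) <= (\<Sum>a\<in>A. (k * rcard (fib A (%t. (Z t, X t)) a)) powr s)"
  by (rule sum_fib_powr_le[OF fin s]) (auto intro: k)
 also have "... <= (\<Sum>a\<in>A. (k * rcard (fib A Z a)) powr s)"
 proof (intro sum_mono powr_mono2 mult_left_mono s k)
  fix a
  have "card (fib A (%t. (Z t, X t)) a) <= card (fib A Z a)" by (rule card_mono) (auto simp: fib_def fin)
  thus "rcard (fib A (%t. (Z t, X t)) a) <= rcard (fib A Z a)" by simp
 qed (use k(2) in auto)
 finally have "(\<Sum>a\<in>A. rcard (fib A X a) powr s) / n powr s <= (\<Sum>a\<in>A. (k * rcard (fib A Z a)) powr s) / n powr s"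
  by (intro divide_right_mono) auto
 also have "(\<Sum>a\<in>A. rcard (fib A X a) powr s) / n powr s = (\<Sum>a\<in>A. (rcard (fib A X a) / n) powr s)"
  unfolding sum_divide_distrib using n by (intro sum.cong) (auto simp: powr_divide)
 also have "(\<Sum>a\<in>A. (k * rcard (fib A Z a)) powr s) / n powr s = k powr s * (\<Sum>a\<in>A. (rcard (fib A Z a) / n) powr s)"
  unfolding sum_divide_distrib sum_distrib_left using n k(2) by (intro sum.cong) (auto simp: powr_divide powr_mult)
 finally show ?thesis unfolding mom_def n_def[symmetric] using n by (simp add: divide_right_mono)
qed (simp add: mom_def)

text \<open>A fibre of the pair is split by the word \<open>w\<close> into at most as many parts as
  the \<open>e\<close>-fibre of \<open>w\<close> has elements; within one \<open>w\<close> the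
  moment is at most \<open>q\<close>. This is the source of submultiplicativity.\<close>

lemma mom_Times_le:
 fixes e :: "'a => 'e" and y :: "'a \<times> 'b => 'c"
 assumes fin: "finite W" "finite V" and ne: "W ~= {}" "V ~= {}" and s: "0 <= s"
  and q: "!!w. w \<in> W ==> mom s V (%v. y (w, v)) <= q" "0 <= q"
 shows "mom s (W \<times> V) (%p. (y p, e (fst p))) <= mom s W e * q"
proof -
 let ?A = "W \<times> V"
 let ?X = "%p. (y p, e (fst p))"
 have finA: "finite ?A" using fin by auto
 define nW where "nW = rcard W"
 define nV where "nV = rcard V"
 have n: "0 < nW" "0 < nV" using fin ne by (auto simp: nW_def nV_def card_gt_0_iff)
 define k where "k p = rcard (fib W e (fst p))" for p :: "'a \<times> 'b"
 have "(\<Sum>p\<in>?A. rcard (fib ?A ?X p) powr s) <= (\<Sum>p\<in>?A. (k p * rcard (fib ?A (%t. (fst t, ?X t)) p)) powr s)"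
 proof (rule sum_fib_powr_le[OF finA s])
  fix p assume p: "p \<in> ?A"
  have "card (fst ` fib ?A ?X p) <= card (fib W e (fst p))"
   by (rule card_mono) (auto simp: fib_def fin)
  thus "rcard (fst ` fib ?A ?X p) <= k p" by (simp add: k_def)
 next
  fix p p' assume "?X p = ?X p'"
  thus "k p = k p'" by (simp add: k_def fib_def)
 qed
 also have "... = (\<Sum>p\<in>?A. (k p * rcard (fib V (%v. y (fst p, v)) (snd p))) powr s)"
 proof (rule sum.cong[OF refl])
  fix p assume p: "p \<in> ?A"
  have "fib ?A (%t. (fst t, ?X t)) p = Pair (fst p) ` fib V (%v. y (fst p, v)) (snd p)"
   using p by (auto simp: fib_def)
  hence "card (fib ?A (%t. (fst t, ?X t)) p) = card (fib V (%v. y (fst p, v)) (snd p))"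
   by (simp add: card_image inj_on_def)
  thus "(k p * rcard (fib ?A (%t. (fst t, ?X t)) p)) powr s = (k p * rcard (fib V (%v. y (fst p, v)) (snd p))) powr s"
   by simp
 qed
 also have "... = (\<Sum>w\<in>W. \<Sum>v\<in>V. (rcard (fib W e w) * rcard (fib V (%v. y (w, v)) v)) powr s)"
  unfolding sum.cartesian_product k_def by (simp add: split_def)
 also have "... = (\<Sum>w\<in>W. rcard (fib W e w) powr s * (\<Sum>v\<in>V. rcard (fib V (%v. y (w, v)) v) powr s))"
  by (simp add: powr_mult sum_distrib_left)
 also have "... = (\<Sum>w\<in>W. rcard (fib W e w) powr s * (nV powr s * nV * mom s V (%v. y (w, v))))"
 proof (intro sum.cong refl arg_cong2[where f="(*)"])
  fix w
  have "(\<Sum>v\<in>V. (rcard (fib V (%v. y (w, v)) v) / nV) powr s) = (\<Sum>v\<in>V. rcard (fib V (%v. y (w, v)) v) powr s) / nV powr s"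
   unfolding sum_divide_distrib using n by (intro sum.cong) (auto simp: powr_divide)
  thus "(\<Sum>v\<in>V. rcard (fib V (%v. y (w, v)) v) powr s) = nV powr s * nV * mom s V (%v. y (w, v))"
   unfolding mom_def nV_def[symmetric] using n by (simp add: field_simps)
 qed
 also have "... <= (\<Sum>w\<in>W. rcard (fib W e w) powr s * (nV powr s * nV * q))"
  using n by (intro sum_mono mult_left_mono q) auto
 also have "... = (\<Sum>w\<in>W. rcard (fib W e w) powr s) * (nV powr s * nV * q)" by (simp add: sum_distrib_right)
 also have "(\<Sum>w\<in>W. rcard (fib W e w) powr s) = nW powr s * nW * mom s W e"
 proof -
  have "(\<Sum>w\<in>W. (rcard (fib W e w) / nW) powr s) = (\<Sum>w\<in>W. rcard (fib W e w) powr s) / nW powr s"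
   unfolding sum_divide_distrib using n by (intro sum.cong) (auto simp: powr_divide)
  thus ?thesis unfolding mom_def nW_def[symmetric] using n by (simp add: field_simps)
 qed
 finally have le: "(\<Sum>p\<in>?A. rcard (fib ?A ?X p) powr s) <= nW powr s * nW * mom s W e * (nV powr s * nV * q)" .
 have cA: "rcard ?A = nW * nV" by (simp add: nW_def nV_def card_cartesian_product)
 have "(\<Sum>p\<in>?A. (rcard (fib ?A ?X p) / (nW * nV)) powr s) = (\<Sum>p\<in>?A. rcard (fib ?A ?X p) powr s) / (nW * nV) powr s"
  unfolding sum_divide_distrib using n by (intro sum.cong) (auto simp: powr_divide)
 also have "... <= nW powr s * nW * mom s W e * (nV powr s * nV * q) / (nW * nV) powr s"
  using le by (intro divide_right_mono) auto
 also have "... = nW * nV * (mom s W e * q)" using n by (simp add: powr_mult)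
 finally have "(\<Sum>p\<in>?A. (rcard (fib ?A ?X p) / (nW * nV)) powr s) / (nW * nV) <= nW * nV * (mom s W e * q) / (nW * nV)"
  using n by (intro divide_right_mono) auto
 thus ?thesis unfolding mom_def[of s ?A] cA using n by simp
qed

lemma mom_image: "inj_on g A ==> mom s (g ` A) X = mom s A (%t. X (g t))"
 unfolding mom_def by (simp add: sum.reindex card_image card_fib_image)

text \<open>The moment is the mean of \<open>exp (- s * i)\<close> for the information function
  \<open>i\<close>, whose mean is the entropy in nats. The expansion to second order is controlled
  by the maximum \<open>ln (rcard A)\<close> of \<open>i\<close>.\<close>

lemma mom_le_entropy:
 assumes fin: "finite A" and ne: "A ~= {}" and s: "0 <= s"
 shows "mom s A X <= exp (- (s * ln 2 * ent A X) + (s * ln (rcard A))\<^sup>2)"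
proof -
 define n where "n = rcard A"
 have n: "1 <= n" using fin ne by (simp add: n_def card_gt_0_iff Suc_le_eq)
 define i where "i a = ln (n / rcard (fib A X a))" for a
 have fb: "1 <= rcard (fib A X a)" "rcard (fib A X a) <= n" if "a \<in> A" for a
  using card_fib_pos[OF fin that, of X] card_mono[OF fin fib_subset[of A X a]] by (auto simp: n_def)
 have i: "0 <= i a" "i a <= ln n" if "a \<in> A" for a
 proof -
  show "0 <= i a" unfolding i_def using fb[OF that] n by (intro ln_ge_zero) (simp add: le_divide_eq)
  have "n / rcard (fib A X a) <= n / 1" using fb[OF that] n by (intro divide_left_mono) auto
  thus "i a <= ln n" unfolding i_def using fb[OF that] n by (intro ln_mono) auto
 qed
 have ent: "ln 2 * ent A X = (\<Sum>a\<in>A. i a) / n"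
 proof -
  have "fib A (%t. (X t, ())) a = fib A X a" for a by (auto simp: fib_def)
  hence "ent A X = (\<Sum>a\<in>A. i a / ln 2) / n" by (simp add: ent_def cent_def fib_const i_def n_def log_def)
  thus ?thesis by (simp add: sum_divide_distrib[symmetric])
 qed
 have "(rcard (fib A X a) / n) powr s <= 1 - s * i a + (s * ln n)\<^sup>2" if a: "a \<in> A" for a
 proof -
  define y where "y = s * i a"
  have y: "0 <= y" "y <= s * ln n" unfolding y_def using s i[OF a] by (auto intro: mult_left_mono)
  have "(rcard (fib A X a) / n) powr s = exp (- y)"
  proof -
   have "ln (rcard (fib A X a) / n) = - i a" unfolding i_def using fb[OF a] n by (simp add: ln_div)
   thus ?thesis unfolding powr_def y_def using fb[OF a] n by simp
  qed
  also have "... <= 1 / (1 + y)"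
   unfolding exp_minus using exp_ge_add_one_self[of y] y by (simp add: inverse_eq_divide frac_le)
  also have "... <= 1 - y + y\<^sup>2"
  proof -
   have "(1 - y + y\<^sup>2) * (1 + y) = 1 + y ^ 3" by (simp add: power2_eq_square power3_eq_cube algebra_simps)
   thus ?thesis using y by (simp add: divide_le_eq)
  qed
  also have "y\<^sup>2 <= (s * ln n)\<^sup>2" using y by (intro power_mono) auto
  finally show ?thesis by (simp add: y_def)
 qed
 hence "(\<Sum>a\<in>A. (rcard (fib A X a) / n) powr s) <= (\<Sum>a\<in>A. 1 - s * i a + (s * ln n)\<^sup>2)" by (intro sum_mono)
 also have "... = n - s * (\<Sum>a\<in>A. i a) + n * (s * ln n)\<^sup>2"
  by (simp add: sum.distrib sum_subtractf sum_distrib_left n_def)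
 finally have "mom s A X <= (n - s * (\<Sum>a\<in>A. i a) + n * (s * ln n)\<^sup>2) / n"
  unfolding mom_def n_def[symmetric] using n by (intro divide_right_mono) auto
 also have "... = 1 + (- (s * ((\<Sum>a\<in>A. i a) / n)) + (s * ln n)\<^sup>2)" using n by (simp add: field_simps)
 also have "... <= exp (- (s * ((\<Sum>a\<in>A. i a) / n)) + (s * ln n)\<^sup>2)" by (rule exp_ge_add_one_self)
 finally have "mom s A X <= exp (- (s * ((\<Sum>a\<in>A. i a) / n)) + (s * ln n)\<^sup>2)" .
 moreover have "s * ln 2 * ent A X = s * ((\<Sum>a\<in>A. i a) / n)" using ent by (simp add: mult.assoc)
 ultimately show ?thesis by (simp only: n_def)
qed

context solenoid
begin

definition Ph :: "real => real => nat => real" where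
 "Ph s x n = mom s {..<b ^ n} (%w. gcell n (Gw x w))"

text \<open>The words are split as in \<open>a_superadd\<close>. Moments multiply as soon as the
  bound \<open>q\<close> holds over every base point, and this is where the uniformity in
  \<open>x\<close> of the entropy bound is used.\<close>

lemma Ph_submult:
 assumes s: "0 <= s" and q: "0 <= q" "!!x'. 0 <= x' ==> x' <= 1 ==> Ph s x' m <= q" and x: "0 <= x" "x <= 1"
 shows "Ph s x (n + m) <= (8 * real C + 4) powr s * q * Ph s x n"
proof -
 let ?W = "{..<b ^ n}" and ?V = "{..<b ^ m}"
 let ?Om = "?W \<times> ?V"
 define Y where "Y p = Gw x (fst p + b ^ n * snd p)" for p :: "nat \<times> nat"
 define X where "X p = gcell (n + m) (Y p)" for p
 define e where "e w = gcell n (Gw x w)" for w :: nat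
 have fin: "finite ?Om" "finite ?W" "finite ?V" by auto
 have ne: "?W ~= {}" "?V ~= {}" using b0 by (auto simp: lessThan_empty_iff)
 have Y: "Y p = Gn n (x + real (fst p)) + ga ^ n * G ((x + real (fst p)) / real b ^ n + real (snd p))" for p
  unfolding Y_def using G_word[of "x + real (fst p)" n "snd p"] by (simp add: add.assoc)
 have "Ph s x (n + m) = mom s ?Om X"
  unfolding Ph_def X_def Y_def word_image(1)[OF b0(1), symmetric] by (rule mom_image[OF word_image(2)[OF b0(1)]])
 also have "... <= (4 * real C + 2) powr s * mom s ?Om (%p. (X p, e (fst p)))"
 proof (rule mom_le_values[OF fin(1) s])
  fix p assume p: "p \<in> ?Om"
  have "card ((%p. gcell n (Gw x (fst p))) ` fib ?Om X p) <= (4 * C + 1) + 1"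
  proof (rule card_floor_image_le)
   fix t t' assume "t \<in> fib ?Om X p" "t' \<in> fib ?Om X p"
   hence "gcell (n + m) (Y t) = gcell (n + m) (Y t')" by (simp add: fib_def X_def)
   hence "Y t / ga ^ (n + m) - Y t' / ga ^ (n + m) <= 1" by linarith
   hence "Y t - Y t' <= ga ^ (n + m)" using gp[of "n + m"] by (simp add: diff_divide_distrib[symmetric])
   also have "... <= ga ^ n" using g0 g1 by (intro power_decreasing) auto
   finally have d: "Y t - Y t' <= ga ^ n" .
   have G2: "\<bar>Y u - Gw x (fst u)\<bar> <= 2 * real C * ga ^ n" for u
   unfolding Y_def using G_tail[of "x + real (fst u)" n "snd u"] by (simp add: add.assoc)
   have "Gw x (fst t) - Gw x (fst t') <= (4 * real C + 1) * ga ^ n"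
   using d G2[of t] G2[of t'] by (simp add: abs_le_iff algebra_simps)
   thus "Gw x (fst t) / ga ^ n - Gw x (fst t') / ga ^ n <= real (4 * C + 1)"
   using gp[of n] by (simp add: diff_divide_distrib[symmetric] divide_le_eq add.commute)
  qed (rule finite_fib[OF fin(1)])
  moreover have "(%p. (X p, e (fst p))) ` fib ?Om X p \<subseteq> Pair (X p) ` ((%p. e (fst p)) ` fib ?Om X p)"
   by (auto simp: fib_def)
  hence "card ((%p. (X p, e (fst p))) ` fib ?Om X p) <= card (Pair (X p) ` ((%p. e (fst p)) ` fib ?Om X p))"
   by (intro card_mono finite_imageI finite_fib fin)
  hence "card ((%p. (X p, e (fst p))) ` fib ?Om X p) <= card ((%p. e (fst p)) ` fib ?Om X p)"
   by (simp add: card_image inj_on_def)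
  ultimately have "card ((%p. (X p, e (fst p))) ` fib ?Om X p) <= 4 * C + 2" unfolding e_def by linarith
  from of_nat_mono[OF this, where 'a=real] show "rcard ((%p. (X p, e (fst p))) ` fib ?Om X p) <= 4 * real C + 2" by simp
 qed simp
 also have "mom s ?Om (%p. (X p, e (fst p))) <= mom s ?W e * (2 powr s * q)"
 proof (rule mom_Times_le[OF fin(2,3) ne s])
  fix w assume "w \<in> ?W"
  define x' where "x' = (x + real w) / real b ^ n"
  have x': "0 <= x'" "x' <= 1"
  proof -
   have "Suc w <= b ^ n" using \<open>w \<in> ?W\<close> by simp
   hence "real (Suc w) <= real (b ^ n)" by (simp only: of_nat_le_iff)
   thus "x' <= 1" using x b0 by (simp add: x'_def)
  qed (use x b0 in \<open>simp add: x'_def\<close>)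
  define c where "c = Gn n (x + real w) / ga ^ (n + m)"
  have Xv: "X (w, v) = \<lfloor>Gw x' v / ga ^ m + c\<rfloor>" for v
   unfolding X_def Y x'_def c_def using g0 by (simp add: power_add add_divide_distrib add.commute)
  have "mom s ?V (%v. X (w, v)) <= 2 powr s * mom s ?V (%v. gcell m (Gw x' v))"
  proof (rule mom_le_values[OF fin(3) s])
   fix v assume "v \<in> ?V"
   have "card ((%v. gcell m (Gw x' v)) ` fib ?V (%v. X (w, v)) v) <= 1 + 1"
   proof (rule card_floor_image_le)
   fix t t' assume "t \<in> fib ?V (%v. X (w, v)) v" "t' \<in> fib ?V (%v. X (w, v)) v"
   hence "\<lfloor>Gw x' t / ga ^ m + c\<rfloor> = \<lfloor>Gw x' t' / ga ^ m + c\<rfloor>" by (simp add: fib_def Xv)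
   thus "Gw x' t / ga ^ m - Gw x' t' / ga ^ m <= real 1" by linarith
   qed (rule finite_fib[OF fin(3)])
   thus "rcard ((%v. gcell m (Gw x' v)) ` fib ?V (%v. X (w, v)) v) <= 2" by simp
  qed simp
  also have "... <= 2 powr s * q" using q(2)[OF x'] by (intro mult_left_mono) (auto simp: Ph_def)
  finally show "mom s ?V (%v. X (w, v)) <= 2 powr s * q" .
 qed (use q in simp)
 also have "mom s ?W e = Ph s x n" by (simp add: Ph_def e_def[abs_def])
 finally have "Ph s x (n + m) <= (4 * real C + 2) powr s * (Ph s x n * (2 powr s * q))" by (simp add: mult_left_mono)
 also have "... = ((4 * real C + 2) powr s * 2 powr s) * q * Ph s x n" by simp
 also have "(4 * real C + 2) powr s * 2 powr s = (8 * real C + 4) powr s" by (simp add: powr_mult[symmetric])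
 finally show ?thesis .
qed

lemma Ph_power:
 assumes s: "0 <= s" and q: "0 <= q" "!!x'. 0 <= x' ==> x' <= 1 ==> Ph s x' m <= q" and x: "0 <= x" "x <= 1"
 shows "Ph s x (l * m) <= ((8 * real C + 4) powr s * q) ^ l"
proof (induction l)
 case 0
 have "fib {..<1::nat} (%w. \<lfloor>Gw x w / 1\<rfloor>) 0 = {0}" by (auto simp: fib_def)
 thus ?case by (simp add: Ph_def mom_def)
next
 case (Suc l)
 have "Ph s x (Suc l * m) = Ph s x (l * m + m)" by (simp add: add.commute)
 also have "... <= (8 * real C + 4) powr s * q * Ph s x (l * m)" by (rule Ph_submult[OF s q x])
 also have "... <= (8 * real C + 4) powr s * q * ((8 * real C + 4) powr s * q) ^ l"
  using Suc q by (intro mult_left_mono) auto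
 finally show ?case by simp
qed

text \<open>The block length \<open>m\<close> makes the constant \<open>8 * C + 4\<close>
  negligible, and then \<open>s\<close> is so small that the quadratic term of
  \<open>mom_le_entropy\<close> at length \<open>m\<close> is negligible too. Iterating over blocks
  keeps this \<open>s\<close>, whereas \<open>mom_le_entropy\<close> used directly at length
  \<open>l * m\<close> would force \<open>s\<close> to tend to 0.\<close>

lemma Ph_decay:
 assumes ep: "0 < ep"
 shows "\<exists>m\<ge>1. \<exists>s>0. s <= 1 & (\<forall>x l. 0 <= x --> x <= 1 --> Ph s x (l * m) <= 2 powr (- (s * (\<beta> - ep) * real (l * m))))"
proof -
 define e where "e = ep / 3"
 have e: "0 < e" using ep by (simp add: e_def)
 obtain n1 where n1: "!!n x. n1 <= n ==> 0 <= x ==> x <= 1 ==> (\<beta> - e) * real n <= a x n"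
  using a_uniform_lower[OF e] by blast
 define c0 where "c0 = 8 * real C + 4"
 obtain m' :: nat where m': "ln c0 / (e * ln 2) < real m'" using reals_Archimedean2 by blast
 define m where "m = m' + n1 + 1"
 have m: "n1 <= m" "1 <= m" by (auto simp: m_def)
 have "ln c0 / (e * ln 2) <= real m" using m' by (simp add: m_def)
 hence mc: "ln c0 <= e * ln 2 * real m" using e by (simp add: divide_le_eq mult.commute)
 define h where "h = real m * ln (real b)"
 have h: "0 < h" using m b by (simp add: h_def)
 define s where "s = min 1 (e * ln 2 * real m / h\<^sup>2)"
 have s: "0 < s" "s <= 1" using e m h by (auto simp: s_def)
 have sh: "s * h\<^sup>2 <= e * ln 2 * real m"
 proof -
  have "s * h\<^sup>2 <= e * ln 2 * real m / h\<^sup>2 * h\<^sup>2" by (intro mult_right_mono) (auto simp: s_def)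
  thus ?thesis using h by simp
 qed
 define q where "q = exp (- (s * ln 2 * ((\<beta> - e) * real m)) + (s * h)\<^sup>2)"
 have qb: "Ph s x m <= q" if x: "0 <= x" "x <= 1" for x
 proof -
  have "Ph s x m <= exp (- (s * ln 2 * a x m) + (s * ln (rcard {..<b ^ m}))\<^sup>2)"
   unfolding Ph_def a_def using s b0 by (intro mom_le_entropy) (auto simp: lessThan_empty_iff)
  also have "ln (rcard {..<b ^ m}) = h" using b0 by (simp add: h_def ln_realpow)
  also have "exp (- (s * ln 2 * a x m) + (s * h)\<^sup>2) <= q"
   unfolding q_def using n1[OF m(1) x] s by (simp add: mult_left_mono)
  finally show ?thesis .
 qed
 have base: "c0 powr s * q <= 2 powr (- (s * (\<beta> - ep) * real m))"
 proof -
  have "c0 powr s = exp (s * ln c0)" by (simp add: powr_def c0_def)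
  hence "c0 powr s * q = exp (s * ln c0 - s * ln 2 * ((\<beta> - e) * real m) + (s * h)\<^sup>2)"
   by (simp add: q_def exp_add[symmetric])
  also have "... <= exp (s * (e * ln 2 * real m) - s * ln 2 * ((\<beta> - e) * real m) + s * (e * ln 2 * real m))"
  proof -
   have "s * ln c0 <= s * (e * ln 2 * real m)" using mc s by (intro mult_left_mono) auto
   moreover have "(s * h)\<^sup>2 = s * (s * h\<^sup>2)" by (simp add: power2_eq_square mult_ac)
   moreover have "s * (s * h\<^sup>2) <= s * (e * ln 2 * real m)" using sh s by (intro mult_left_mono) auto
   ultimately show ?thesis unfolding exp_le_cancel_iff by linarith
  qed
  also have "s * (e * ln 2 * real m) - s * ln 2 * ((\<beta> - e) * real m) + s * (e * ln 2 * real m) = - (s * (\<beta> - ep) * real m) * ln 2"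
   by (simp add: e_def algebra_simps)
  finally show ?thesis by (simp add: powr_def mult_ac)
 qed
 have "Ph s x (l * m) <= 2 powr (- (s * (\<beta> - ep) * real (l * m)))" if x: "0 <= x" "x <= 1" for x l
 proof -
  have "Ph s x (l * m) <= (c0 powr s * q) ^ l"
   unfolding c0_def using s qb x by (intro Ph_power) (auto simp: q_def)
  also have "... <= (2 powr (- (s * (\<beta> - ep) * real m))) ^ l" using base by (intro power_mono) (auto simp: q_def)
  also have "... = 2 powr (- (s * (\<beta> - ep) * real (l * m)))" by (simp add: powr_realpow[symmetric] powr_powr mult_ac)
  finally show ?thesis .
 qed
 thus ?thesis using m s by blast
qed

text \<open>Masses of centred intervals instead of grid cells; these are the ones that compare with
  balls.\<close>

definition Nb :: "nat => real => nat => nat => real" where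
 "Nb c x n w = rcard {w' \<in> {..<b ^ n}. \<bar>Gw x w' - Gw x w\<bar> <= real c * ga ^ n} / real (b ^ n)"

text \<open>With mesh \<open>4 * c * ga ^ n\<close> an interval of radius a quarter of the mesh lies
  inside one cell either of the grid or of its shift by half a mesh, according to the position of
  its centre. So two grid moments dominate.\<close>

lemma Nb_moment:
 assumes s: "0 <= s" and c: "1 <= c"
 shows "(\<Sum>w<b ^ n. Nb c x n w powr s) / real (b ^ n) <= 2 * (4 * real c + 1) powr s * Ph s x n"
proof -
 let ?W = "{..<b ^ n}"
 have fin: "finite ?W" by simp
 define u where "u w = Gw x w / (4 * real c * ga ^ n)" for w :: nat
 define X where "X i w = \<lfloor>u w + i\<rfloor>" for i :: real and w
 have pos: "0 < 4 * real c * ga ^ n" using c gp[of n] by simp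
 have du: "\<bar>u w' - u w\<bar> <= 1 / 4" if "\<bar>Gw x w' - Gw x w\<bar> <= real c * ga ^ n" for w w'
 proof -
  have "\<bar>u w' - u w\<bar> = \<bar>Gw x w' - Gw x w\<bar> / (4 * real c * ga ^ n)"
   unfolding u_def diff_divide_distrib[symmetric] abs_divide using pos by linarith
  also have "... <= (real c * ga ^ n) / (4 * real c * ga ^ n)" using that pos by (intro divide_right_mono) auto
  also have "... = 1 / 4" using c g0 by simp
  finally show ?thesis .
 qed
 have cov: "Nb c x n w <= rcard (fib ?W (X 0) w) / real (b ^ n) | Nb c x n w <= rcard (fib ?W (X (1 / 2)) w) / real (b ^ n)" for w
 proof -
  let ?S = "{w' \<in> ?W. \<bar>Gw x w' - Gw x w\<bar> <= real c * ga ^ n}"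
  have dS: "u w' <= u w + 1 / 4" "u w <= u w' + 1 / 4" if "w' \<in> ?S" for w'
   using du[of w' w] that unfolding mem_Collect_eq abs_le_iff by linarith+
  have "?S \<subseteq> fib ?W (X 0) w | ?S \<subseteq> fib ?W (X (1 / 2)) w"
  proof (cases "1 / 4 <= frac (u w) & frac (u w) < 3 / 4")
   case True
   have "X 0 w' = X 0 w" if "w' \<in> ?S" for w'
   using dS[OF that] True unfolding X_def frac_def floor_eq_iff add_0_right by linarith
   thus ?thesis by (auto simp: fib_def)
  next
   case False
   have "X (1 / 2) w' = X (1 / 2) w" if "w' \<in> ?S" for w'
   proof (cases "frac (u w) < 1 / 4")
   case True
   have "\<lfloor>u w + 1 / 2\<rfloor> = \<lfloor>u w\<rfloor>" using True unfolding frac_def floor_eq_iff by linarith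
   moreover have "\<lfloor>u w' + 1 / 2\<rfloor> = \<lfloor>u w\<rfloor>"
   using dS[OF that] True unfolding frac_def floor_eq_iff by linarith
   ultimately show ?thesis by (simp add: X_def)
   next
   case F2: False
   hence h: "3 / 4 <= frac (u w)" using False by auto
   have "\<lfloor>u w + 1 / 2\<rfloor> = \<lfloor>u w\<rfloor> + 1" using h frac_lt_1[of "u w"] unfolding frac_def by (simp add: floor_eq_iff)
   moreover have "\<lfloor>u w' + 1 / 2\<rfloor> = \<lfloor>u w\<rfloor> + 1"
   using dS[OF that] h frac_lt_1[of "u w"] unfolding frac_def floor_eq_iff by linarith
   ultimately show ?thesis by (simp add: X_def)
   qed
   thus ?thesis by (auto simp: fib_def)
  qed
  hence "card ?S <= card (fib ?W (X 0) w) | card ?S <= card (fib ?W (X (1 / 2)) w)"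
   using card_mono[OF finite_fib[OF fin]] by blast
  thus ?thesis unfolding Nb_def by (auto intro!: divide_right_mono)
 qed
 have "Nb c x n w powr s <= (rcard (fib ?W (X 0) w) / rcard ?W) powr s + (rcard (fib ?W (X (1 / 2)) w) / rcard ?W) powr s" for w
 proof -
  have n0: "0 <= Nb c x n w" by (simp add: Nb_def)
  have "Nb c x n w powr s <= (rcard (fib ?W (X 0) w) / real (b ^ n)) powr s |
   Nb c x n w powr s <= (rcard (fib ?W (X (1 / 2)) w) / real (b ^ n)) powr s"
   using cov[of w] powr_mono2[OF s n0] by blast
  thus ?thesis by (auto intro: add_increasing add_increasing2)
 qed
 hence "(\<Sum>w<b ^ n. Nb c x n w powr s) / real (b ^ n) <= (\<Sum>w<b ^ n. (rcard (fib ?W (X 0) w) / rcard ?W) powr s + (rcard (fib ?W (X (1 / 2)) w) / rcard ?W) powr s) / real (b ^ n)"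
  by (intro divide_right_mono sum_mono) auto
 also have "... = mom s ?W (X 0) + mom s ?W (X (1 / 2))" by (simp add: mom_def sum.distrib add_divide_distrib)
 also have "... <= (4 * real c + 1) powr s * Ph s x n + (4 * real c + 1) powr s * Ph s x n"
 proof -
  have "mom s ?W (X i) <= (4 * real c + 1) powr s * Ph s x n" for i
   unfolding Ph_def
  proof (rule mom_le_values[OF fin s])
   fix w assume "w \<in> ?W"
   have "card ((%w. gcell n (Gw x w)) ` fib ?W (X i) w) <= 4 * c + 1"
   proof (rule card_floor_image_le)
   fix t t' assume "t \<in> fib ?W (X i) w" "t' \<in> fib ?W (X i) w"
   hence "\<lfloor>u t + i\<rfloor> = \<lfloor>u t' + i\<rfloor>" by (simp add: fib_def X_def)
   hence "u t - u t' <= 1" by linarith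
   hence "(Gw x t - Gw x t') / (4 * real c * ga ^ n) <= 1" by (simp add: u_def diff_divide_distrib)
   hence "Gw x t - Gw x t' <= 4 * real c * ga ^ n" using pos by (simp add: divide_le_eq)
   thus "Gw x t / ga ^ n - Gw x t' / ga ^ n <= real (4 * c)"
   using gp[of n] by (simp add: diff_divide_distrib[symmetric] divide_le_eq)
   qed (rule finite_fib[OF fin])
   from of_nat_mono[OF this, where 'a=real] show "rcard ((%w. gcell n (Gw x w)) ` fib ?W (X i) w) <= 4 * real c + 1" by simp
  qed simp
  thus ?thesis by (intro add_mono)
 qed
 finally show ?thesis by (simp add: mult_ac)
qed

end

section \<open>Borel probability measures\<close>

text \<open>For uniform \<open>x\<close> the integer part and the fractional part of
  \<open>N * x\<close> are independent and uniform.\<close>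

lemma integral_U01_blocks:
 fixes f :: "nat => real => real"
 assumes N: "0 < N" and f [measurable]: "!!w. f w \<in> borel_measurable borel" and B: "!!w x. \<bar>f w x\<bar> <= B"
 shows "(\<integral>x. f (nat \<lfloor>real N * x\<rfloor>) (frac (real N * x)) \<partial>U01) = (\<Sum>w<N. \<integral>x. f w x \<partial>U01) / real N"
proof -
 have eq: "indicator {0..<1} x * f (nat \<lfloor>real N * x\<rfloor>) (frac (real N * x)) =
   (\<Sum>w<N. indicator {0..<1} (- real w + real N * x) * f w (- real w + real N * x))" for x :: real
 proof (cases "x \<in> {0..<1}")
  case True
  define w0 where "w0 = nat \<lfloor>real N * x\<rfloor>"
  have w0: "real w0 <= real N * x" "real N * x < real w0 + 1" using True N by (auto simp: w0_def)
  have "real N * x < real N" using True N by simp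
  hence w0N: "w0 < N" using w0 by linarith
  have fr: "frac (real N * x) = - real w0 + real N * x" using True N by (simp add: w0_def frac_def)
  have "indicator {0..<1} (- real w + real N * x) * f w (- real w + real N * x) =
   (if w = w0 then f w (- real w + real N * x) else 0)" for w
  proof -
   have "- real w + real N * x \<in> {0..<1} \<longleftrightarrow> w = w0" using w0 by auto
   thus ?thesis by (auto simp: indicator_def)
  qed
  thus ?thesis using True w0N fr by (simp add: w0_def)
 next
  case False
  have "- real w + real N * x \<notin> {0..<1}" if "w < N" for w
  proof
   assume h: "- real w + real N * x \<in> {0..<1}"
   have "real w + 1 <= real N" using that by linarith
   hence "0 <= real N * x" "real N * x < real N * 1" using h unfolding atLeastLessThan_iff by linarith+
   hence "0 <= x" "x < 1" using N unfolding mult_less_cancel_left by (auto simp: zero_le_mult_iff)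
   thus False using False by simp
  qed
  thus ?thesis using False by (simp add: sum.neutral)
 qed
 have int: "integrable lborel (%x. indicator {0..<1} x * f w x)" for w
 proof (rule Bochner_Integration.integrable_bound)
  show "integrable lborel (%x. B * indicator {0..<1::real} x)" by simp
  show "AE x in lborel. norm (indicator {0..<1} x * f w x) <= norm (B * indicator {0..<1} x :: real)"
   using B[of w] by (auto simp: indicator_def abs_mult intro!: AE_I2 order_trans[OF B])
 qed measurable
 have Nr: "real N ~= 0" using N by simp
 have "(\<integral>x. f (nat \<lfloor>real N * x\<rfloor>) (frac (real N * x)) \<partial>U01) =
   (\<Sum>w<N. \<integral>x. indicator {0..<1} (- real w + real N * x) * f w (- real w + real N * x) \<partial>lborel)"
  unfolding integral_U01 eq
  by (rule Bochner_Integration.integral_sum) (rule lborel_integrable_real_affine[OF int Nr])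
 also have "... = (\<Sum>w<N. (\<integral>x. f w x \<partial>U01) / real N)"
  unfolding integral_U01
  by (intro sum.cong refl, subst (2) lborel_integral_real_affine[OF Nr, of _ "- real w" for w]) (use N in auto)
 finally show ?thesis by (simp add: sum_divide_distrib)
qed

text \<open>Borel-Cantelli through Tonelli: the sum of the \<open>V n\<close> has finite integral,
  so it converges almost everywhere.\<close>

lemma AE_tendsto_zero_of_summable:
 fixes V :: "nat => 'a => real"
 assumes [measurable]: "!!n. V n \<in> borel_measurable M" and V0: "!!n x. 0 <= V n x"
  and int: "!!n. integrable M (V n)" and le: "!!n. (\<integral>x. V n x \<partial>M) <= c n" and sm: "summable c"
 shows "AE x in M. (%n. V n x) \<longlonglongrightarrow> 0"
proof -
 have c0: "0 <= c n" for n using le[of n] integral_nonneg_AE[of "V n" M] V0 by (meson AE_I2 order_trans)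
 have "(\<integral>\<^sup>+x. (\<Sum>n. ennreal (V n x)) \<partial>M) = (\<Sum>n. \<integral>\<^sup>+x. ennreal (V n x) \<partial>M)"
  by (rule nn_integral_suminf) measurable
 also have "... = (\<Sum>n. ennreal (\<integral>x. V n x \<partial>M))"
  using V0 int by (simp add: nn_integral_eq_integral)
 also have "... <= (\<Sum>n. ennreal (c n))" by (intro suminf_le ennreal_leI le) auto
 also have "... = ennreal (\<Sum>n. c n)" using sm c0 by (simp add: suminf_ennreal2)
 also have "... < \<infinity>" by simp
 finally have "AE x in M. (\<Sum>n. ennreal (V n x)) ~= \<infinity>"
  by (intro nn_integral_noteq_infinite) auto
 thus ?thesis
 proof (eventually_elim)
  case (elim x)
  hence "summable (%n. V n x)" using V0 by (intro summable_suminf_not_top) (auto simp: top_unique)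
  thus ?case by (rule summable_LIMSEQ_zero)
 qed
qed

text \<open>The gap between consecutive squares is of order \<open>m\<close>, negligible against
  \<open>m\<^sup>2\<close>, so the terms in between do not affect averages of a bounded
  sequence.\<close>

lemma tendsto_averages_of_squares:
 fixes Y :: "nat => real"
 assumes Y: "!!k. \<bar>Y k\<bar> <= 1" and lim: "(%m. (\<Sum>k<m\<^sup>2. Y k) / real (m\<^sup>2)) \<longlonglongrightarrow> 0"
 shows "(%N. (\<Sum>k<N. Y k) / real N) \<longlonglongrightarrow> 0"
proof -
 define m where "m N = nat \<lfloor>sqrt (real N)\<rfloor>" for N
 have mN: "(m N)\<^sup>2 <= N" "N < (m N + 1)\<^sup>2" for N
 proof -
  have "real (m N) <= sqrt (real N)" "sqrt (real N) < real (m N) + 1" unfolding m_def by auto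
  hence "(real (m N))\<^sup>2 <= (sqrt (real N))\<^sup>2" "(sqrt (real N))\<^sup>2 < (real (m N) + 1)\<^sup>2"
   by (intro power_mono power_strict_mono; simp)+
  hence "real ((m N)\<^sup>2) <= real N" "real N < real ((m N + 1)\<^sup>2)" by (auto simp: add.commute)
  thus "(m N)\<^sup>2 <= N" "N < (m N + 1)\<^sup>2" by (simp_all only: of_nat_le_iff of_nat_less_iff)
 qed
 have mlim: "filterlim m at_top sequentially"
 proof -
  have "filterlim (%N. sqrt (real N)) at_top sequentially"
   by (rule filterlim_compose[OF sqrt_at_top filterlim_real_sequentially])
  hence "filterlim (%N. nat \<lfloor>sqrt (real N)\<rfloor>) at_top sequentially"
   by (intro filterlim_compose[OF filterlim_nat_sequentially] filterlim_compose[OF filterlim_floor_sequentially])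
  thus ?thesis unfolding m_def .
 qed
 have "(%m. \<bar>(\<Sum>k<m\<^sup>2. Y k) / real (m\<^sup>2)\<bar> + 3 / real m) \<longlonglongrightarrow> \<bar>0\<bar> + 0"
  by (intro tendsto_add tendsto_rabs lim lim_const_over_n)
 hence "(%m. \<bar>(\<Sum>k<m\<^sup>2. Y k) / real (m\<^sup>2)\<bar> + 3 / real m) \<longlonglongrightarrow> 0" by simp
 from filterlim_compose[OF this mlim]
 have L: "(%N. \<bar>(\<Sum>k<(m N)\<^sup>2. Y k) / real ((m N)\<^sup>2)\<bar> + 3 / real (m N)) \<longlonglongrightarrow> 0" .
 show ?thesis
 proof (rule Lim_null_comparison[OF _ L], rule eventually_sequentiallyI[of 1])
  fix N :: nat assume N: "1 <= N"
  define p where "p = m N"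
  have p: "p\<^sup>2 <= N" "N < (p + 1)\<^sup>2" using mN[of N] by (auto simp: p_def)
  have p1: "1 <= p" using p N by (cases p) auto
  have "(\<Sum>k<N. Y k) = (\<Sum>k<p\<^sup>2. Y k) + (\<Sum>k\<in>{p\<^sup>2..<N}. Y k)"
   using p by (simp add: sum.union_disjoint[symmetric] ivl_disj_int lessThan_atLeast0 ivl_disj_un)
  moreover have "\<bar>\<Sum>k\<in>{p\<^sup>2..<N}. Y k\<bar> <= (\<Sum>k\<in>{p\<^sup>2..<N}. 1)"
   by (rule order_trans[OF sum_abs]) (intro sum_mono Y)
  moreover have "(\<Sum>k\<in>{p\<^sup>2..<N}. 1 :: real) <= 3 * real p"
  proof -
   have "N - p\<^sup>2 <= 3 * p" using p p1 by (simp add: power2_eq_square)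
   thus ?thesis by simp
  qed
  ultimately have le: "\<bar>\<Sum>k<N. Y k\<bar> <= \<bar>\<Sum>k<p\<^sup>2. Y k\<bar> + 3 * real p" by linarith
  have pos: "0 < real (p\<^sup>2)" "real (p\<^sup>2) <= real N" using p1 p by (auto simp del: of_nat_power)
  have "norm ((\<Sum>k<N. Y k) / real N) = \<bar>\<Sum>k<N. Y k\<bar> / real N" by simp
  also have "... <= (\<bar>\<Sum>k<p\<^sup>2. Y k\<bar> + 3 * real p) / real (p\<^sup>2)"
   using le pos by (intro frac_le) auto
  also have "... = \<bar>(\<Sum>k<p\<^sup>2. Y k) / real (p\<^sup>2)\<bar> + 3 / real p"
   using p1 by (simp add: add_divide_distrib power2_eq_square)
  finally show "norm ((\<Sum>k<N. Y k) / real N) <= \<bar>(\<Sum>k<(m N)\<^sup>2. Y k) / real ((m N)\<^sup>2)\<bar> + 3 / real (m N)"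
   unfolding p_def .
 qed
qed

text \<open>Closed sets form an intersection-stable generator, and the indicator of a nonempty
  closed set is the limit of the bounded continuous functions
  \<open>max 0 (1 - n * infdist z X)\<close>.\<close>

lemma measure_eqI_continuous:
 fixes M N :: "'a :: metric_space measure"
 assumes M: "finite_measure M" "sets M = sets borel" and N: "finite_measure N" "sets N = sets borel"
  and eq: "!!f :: 'a => real. continuous_on UNIV f ==> bounded (range f) ==> integral\<^sup>L M f = integral\<^sup>L N f"
 shows "M = N"
proof (rule measure_eqI_generator_eq[where E="Collect closed" and \<Omega>=UNIV and A="%_. UNIV"])
 interpret M: finite_measure M by fact
 interpret N: finite_measure N by fact
 have lim: "(%n. \<integral>z. max 0 (1 - real n * infdist z X) \<partial>K) \<longlonglongrightarrow> measure K X"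
  if K: "finite_measure K" "sets K = sets borel" and X: "closed X" "X ~= {}" for K :: "'a measure" and X
 proof -
  interpret K: finite_measure K by fact
  have [measurable_cong]: "sets K = sets borel" by fact
  have XK: "X \<in> sets K" using K X by simp
  have "(%n. \<integral>z. max 0 (1 - real n * infdist z X) \<partial>K) \<longlonglongrightarrow> (\<integral>z. indicator X z \<partial>K)"
  proof (rule integral_dominated_convergence[where w="%_. 1"])
   show "(%z. max 0 (1 - real n * infdist z X)) \<in> borel_measurable K" for n
   unfolding measurable_cong_sets[OF K(2) refl]
   by (intro borel_measurable_continuous_onI continuous_intros)
   show "AE z in K. (%n. max 0 (1 - real n * infdist z X)) \<longlonglongrightarrow> indicator X z"
   proof (rule AE_I2)
   fix z
   show "(%n. max 0 (1 - real n * infdist z X)) \<longlonglongrightarrow> indicator X z"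
   proof (cases "z \<in> X")
   case False
   hence d: "0 < infdist z X" using X by (simp add: infdist_pos_not_in_closed)
   obtain n0 where n0: "1 / infdist z X < real n0" using reals_Archimedean2 by blast
   have "max 0 (1 - real n * infdist z X) = 0" if "n0 <= n" for n
   proof -
   have "1 / infdist z X < real n" using n0 that by linarith
   thus ?thesis using d by (simp add: divide_less_eq)
   qed
   thus ?thesis using False
   by (intro tendsto_eventually eventually_sequentiallyI[of n0]) auto
   qed simp
   qed
   show "AE z in K. norm (max 0 (1 - real n * infdist z X)) <= 1" for n
   by (intro AE_I2) (simp add: infdist_nonneg)
  qed (use XK in auto)
  thus ?thesis using XK by (simp add: Int_absorb2 sets.sets_into_space)
 qed
 show "emeasure M X = emeasure N X" if "X \<in> Collect closed" for X
 proof (cases "X = {}")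
  case False
  have "(\<integral>z. max 0 (1 - real n * infdist z X) \<partial>M) = (\<integral>z. max 0 (1 - real n * infdist z X) \<partial>N)" for n
  proof (rule eq)
   show "continuous_on UNIV (%z. max 0 (1 - real n * infdist z X))" by (intro continuous_intros)
   show "bounded (range (%z. max 0 (1 - real n * infdist z X)))"
   by (rule boundedI[of _ 1]) (auto simp: infdist_nonneg)
  qed
  hence "measure M X = measure N X"
   using lim[OF M, of X] lim[OF N, of X] that False by (auto intro: LIMSEQ_unique)
  thus ?thesis by (simp add: M.emeasure_eq_measure N.emeasure_eq_measure)
 qed simp
 show "sets M = sigma_sets UNIV (Collect closed)" "sets N = sigma_sets UNIV (Collect closed)"
  unfolding M N borel_eq_closed by (auto intro: sets_measure_of)
 show "emeasure M UNIV ~= \<infinity>" for i :: nat by simp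
qed (auto simp: Int_stable_def)

text \<open>Monotonicity reduces the limit to geometric sequences of radii, and constant factors
  disappear after division by \<open>ln r\<close>. The ratio \<open>rh\<close> may depend on the
  exponent \<open>e\<close>, since the upper bounds for balls come with their own block
  length.\<close>

lemma local_dimension_limit:
 fixes f :: "real => real"
 assumes mono: "!!r r'. r <= r' ==> f r <= f r'" and d: "1 <= d"
  and up: "!!e. 0 < e ==> e < d ==> \<exists>rh K. 0 < rh & rh < 1 & 0 < K & (\<forall>\<^sub>F l in sequentially. f (rh ^ l) <= K * (rh ^ l) powr e)"
  and low: "!!e. d < e ==> \<exists>rh K L. 0 < rh & rh < 1 & 0 < K & 0 < L & (\<forall>\<^sub>F l in sequentially. K * (rh ^ l) powr e <= f (L * rh ^ l))"
 shows "((%r. ln (f r) / ln r) \<longlongrightarrow> d) (at_right 0)"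
proof -
 have scale: "\<exists>l\<ge>l0. rh ^ Suc l < r & r <= rh ^ l" if h: "0 < rh" "rh < 1" "0 < r" "r <= rh ^ l0" for rh r :: real and l0
 proof -
  define l where "l = (LEAST l. rh ^ l < r)"
  obtain n where "rh ^ n < r" using real_arch_pow_inv[OF h(3,2)] by blast
  hence l: "rh ^ l < r" unfolding l_def by (rule LeastI)
  have "l0 < l"
  proof (rule ccontr)
   assume "~ l0 < l"
   hence "rh ^ l0 <= rh ^ l" using h by (intro power_decreasing) auto
   thus False using l h by linarith
  qed
  moreover have "r <= rh ^ (l - 1)" using not_less_Least[of "l - 1" "%l. rh ^ l < r"] \<open>l0 < l\<close> unfolding l_def[symmetric] by simp
  ultimately show ?thesis using l by (intro exI[of _ "l - 1"]) auto
 qed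
 have U: "\<exists>K>0. \<forall>\<^sub>F r in at_right 0. f r <= K * r powr e" if ed: "0 < e" "e < d" for e
 proof -
  obtain rh K l0 where r: "0 < rh" "rh < 1" "0 < K" and le: "!!l. l0 <= l ==> f (rh ^ l) <= K * (rh ^ l) powr e"
   using up[OF ed] unfolding eventually_sequentially by blast
  have "f r <= K / rh powr e * r powr e" if h: "0 < r" "r < rh ^ l0" for r
  proof -
   obtain l where l: "l0 <= l" "rh ^ Suc l < r" "r <= rh ^ l" using scale[OF r(1,2) h(1), of l0] h by auto
   have "f r <= f (rh ^ l)" by (rule mono) fact
   also have "... <= K * (rh ^ l) powr e" by (rule le) fact
   also have "... <= K * (r / rh) powr e"
   using l r h ed by (intro mult_left_mono powr_mono2) (auto simp: field_simps)
   also have "... = K / rh powr e * r powr e" using r h by (simp add: powr_divide)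
   finally show ?thesis .
  qed
  moreover have "\<forall>\<^sub>F r in at_right 0. r \<in> {0<..<rh ^ l0}" using r by (intro eventually_at_right_real) simp
  ultimately show ?thesis using r by (intro exI[of _ "K / rh powr e"] conjI) (auto elim!: eventually_mono)
 qed
 have D: "\<exists>K>0. \<forall>\<^sub>F r in at_right 0. K * r powr e <= f r" if ed: "d < e" for e
 proof -
  obtain rh K L l0 where r: "0 < rh" "rh < 1" "0 < K" "0 < L" and le: "!!l. l0 <= l ==> K * (rh ^ l) powr e <= f (L * rh ^ l)"
   using low[OF ed] unfolding eventually_sequentially by blast
  have e0: "0 < e" using ed d by linarith
  have "K * (rh / L) powr e * r powr e <= f r" if h: "0 < r" "r < L * rh ^ l0" for r
  proof -
   have "0 < r / L" "r / L <= rh ^ l0" using r h by (auto simp: field_simps)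
   then obtain l where l: "l0 <= l" "rh ^ Suc l < r / L" "r / L <= rh ^ l" using scale[OF r(1,2)] by blast
   have "K * (rh / L) powr e * r powr e = K * (rh * (r / L)) powr e" using r h by (simp add: powr_mult powr_divide)
   also have "... <= K * (rh ^ Suc l) powr e"
   proof (intro mult_left_mono powr_mono2)
   show "rh * (r / L) <= rh ^ Suc l" using mult_left_mono[OF l(3), of rh] r by simp
   qed (use r h e0 in auto)
   also have "... <= f (L * rh ^ Suc l)" using l by (intro le) simp
   also have "... <= f r" using l r by (intro mono) (simp add: field_simps)
   finally show ?thesis .
  qed
  moreover have "\<forall>\<^sub>F r in at_right 0. r \<in> {0<..<L * rh ^ l0}" using r by (intro eventually_at_right_real) simp
  ultimately show ?thesis using r by (intro exI[of _ "K * (rh / L) powr e"] conjI) (auto elim!: eventually_mono)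
 qed
 have logs: "((%r::real. ln K / ln r) \<longlongrightarrow> 0) (at_right 0)" for K :: real
  by (rule tendsto_divide_0[OF tendsto_const filterlim_mono[OF ln_at_0 at_bot_le_at_infinity order_refl]])
 have pos: "\<forall>\<^sub>F r in at_right 0. 0 < f r & r \<in> {0<..<1::real}"
 proof -
  obtain K where K: "K > 0" "\<forall>\<^sub>F r in at_right 0. K * r powr (d + 1) <= f r" using D[of "d + 1"] by auto
  have "\<forall>\<^sub>F r in at_right 0. r \<in> {0<..<1::real}" by (intro eventually_at_right_real) simp
  with K(2) show ?thesis
  proof eventually_elim
   case (elim r)
   have "0 < K * r powr (d + 1)" using K elim by simp
   thus ?case using elim by auto
  qed
 qed
 show ?thesis
 proof (rule order_tendstoI)
  fix q assume q: "q < d"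
  define e where "e = max (1/2) ((q + d) / 2)"
  have e: "0 < e" "e < d" "q < e" using q d by (auto simp: e_def max_def)
  obtain K where K: "K > 0" "\<forall>\<^sub>F r in at_right 0. f r <= K * r powr e" using U[OF e(1,2)] by auto
  have "\<forall>\<^sub>F r in at_right 0. q - e < ln K / ln r" using logs[of K] e by (intro order_tendstoD(1)) auto
  thus "\<forall>\<^sub>F r in at_right 0. q < ln (f r) / ln r"
   using K(2) pos
  proof eventually_elim
   case (elim r)
   hence r: "0 < r" "ln r < 0" by auto
   have "ln (f r) <= ln (K * r powr e)" using elim r K by (subst ln_le_cancel_iff) auto
   also have "... = ln K + e * ln r" using r K by (simp add: ln_mult ln_powr)
   finally have "(ln K + e * ln r) / ln r <= ln (f r) / ln r" using r by (intro divide_right_mono_neg) auto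
   moreover have "(ln K + e * ln r) / ln r = ln K / ln r + e" using r by (simp add: add_divide_distrib)
   ultimately show ?case using elim by linarith
  qed
 next
  fix q assume q: "d < q"
  define e where "e = (q + d) / 2"
  have e: "d < e" "e < q" using q by (auto simp: e_def)
  obtain K where K: "K > 0" "\<forall>\<^sub>F r in at_right 0. K * r powr e <= f r" using D[OF e(1)] by auto
  have "\<forall>\<^sub>F r in at_right 0. ln K / ln r < q - e" using logs[of K] e by (intro order_tendstoD(2)) auto
  thus "\<forall>\<^sub>F r in at_right 0. ln (f r) / ln r < q"
   using K(2) pos
  proof eventually_elim
   case (elim r)
   hence r: "0 < r" "ln r < 0" by auto
   have "ln (K * r powr e) <= ln (f r)" using elim r K by (subst ln_le_cancel_iff) auto
   moreover have "ln (K * r powr e) = ln K + e * ln r" using r K by (simp add: ln_mult ln_powr)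
   ultimately have "ln (f r) / ln r <= (ln K + e * ln r) / ln r" using r by (intro divide_right_mono_neg) auto
   moreover have "(ln K + e * ln r) / ln r = ln K / ln r + e" using r by (simp add: add_divide_distrib)
   ultimately show ?case using elim by linarith
  qed
 qed
qed

section \<open>Normality of base expansions\<close>

lemma borel_frac [measurable]: "(frac :: real => real) \<in> borel_measurable borel"
 unfolding frac_def by measurable

text \<open>The digits at places \<open>k + 1\<close> to \<open>k + n\<close> can be read from the
  integer formed by the first \<open>l\<close> digits. A digit block is thus a function of what
  precedes place \<open>l\<close>, hence independent of what follows.\<close>

lemma floor_digit_block:
 assumes b: "0 < b" and x: "0 <= x" and l: "k + n <= l"
 shows "nat \<lfloor>real (b ^ n) * frac (real (b ^ k) * x)\<rfloor> = (nat \<lfloor>real (b ^ l) * x\<rfloor> div b ^ (l - k - n)) mod b ^ n"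
proof -
 define d where "d = l - k - n"
 define v where "v = real (b ^ k) * x"
 have "l = d + (k + n)" using l by (simp add: d_def)
 hence u: "real (b ^ l) * x / real (b ^ d) = real (b ^ n) * v" using b by (simp add: v_def power_add)
 have "\<lfloor>real (b ^ l) * x / real_of_int (int (b ^ d))\<rfloor> = \<lfloor>real (b ^ l) * x\<rfloor> div int (b ^ d)"
  by (rule floor_divide_real_eq_div) simp
 hence e1: "\<lfloor>real (b ^ n) * v\<rfloor> = \<lfloor>real (b ^ l) * x\<rfloor> div int (b ^ d)" using u by simp
 define q where "q = \<lfloor>real (b ^ n) * frac v\<rfloor>"
 have "real (b ^ n) * frac v = real (b ^ n) * v - real_of_int (int (b ^ n) * \<lfloor>v\<rfloor>)"
  by (simp add: frac_def right_diff_distrib)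
 hence "q = \<lfloor>real (b ^ n) * v\<rfloor> - int (b ^ n) * \<lfloor>v\<rfloor>" unfolding q_def by (simp only: floor_diff_of_int)
 moreover have "0 <= q" unfolding q_def by (simp add: frac_ge_0)
 moreover have "q < int (b ^ n)"
 proof -
  have "real (b ^ n) * frac v < real (b ^ n) * 1" using b frac_lt_1[of v] by (intro mult_strict_left_mono) auto
  thus ?thesis unfolding q_def by (simp add: floor_less_iff)
 qed
 ultimately have "q = \<lfloor>real (b ^ n) * v\<rfloor> mod int (b ^ n)"
  by (metis add_diff_cancel_right' diff_add_cancel mod_mult_self2 mod_pos_pos_trivial mult.commute)
 hence "nat q = nat (\<lfloor>real (b ^ l) * x\<rfloor> div int (b ^ d)) mod b ^ n"
  unfolding e1 using x by (simp add: nat_mod_distrib pos_imp_zdiv_nonneg_iff b del: of_nat_power)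
 thus ?thesis using x by (simp add: q_def v_def d_def nat_div_distrib del: of_nat_power)
qed

text \<open>Normality in base \<open>b\<close>, stated for arbitrary functions of a digit block
  instead of block frequencies, as \<open>birkhoff_continuous\<close> uses it.\<close>

definition normal_base :: "nat => real => bool" where
 "normal_base b x \<longleftrightarrow> (\<forall>n (c :: nat => real).
  (%N. (\<Sum>k<N. c (nat \<lfloor>real (b ^ n) * frac (real (b ^ k) * x)\<rfloor>)) / real N) \<longlonglongrightarrow> (\<Sum>w<b ^ n. c w) / real (b ^ n))"

text \<open>The second-moment proof of the strong law. Centred indicators of blocks that do not
  overlap are orthogonal, so the average of \<open>N\<close> of them has second moment of order
  \<open>1 / N\<close>; this is summable along squares, and
  \<open>tendsto_averages_of_squares\<close> fills the gaps.\<close>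

theorem base_expansion_normal:
 assumes b: "0 < b"
 shows "AE x in U01. normal_base b x"
proof -
 define g where "g n w0 x = (if nat \<lfloor>real (b ^ n) * frac x\<rfloor> = w0 then 1 else 0) - 1 / real (b ^ n)" for n w0 :: nat and x :: real
 have bn: "0 < b ^ n" "0 < real (b ^ n)" "1 <= real (b ^ n)" for n using b by (auto simp: one_le_power Suc_leI)
 have [measurable]: "g n w0 \<in> borel_measurable borel" for n w0 unfolding g_def by measurable
 have inv1: "1 / real (b ^ n) <= 1" "0 <= 1 / real (b ^ n)" for n using bn[of n] by (auto simp: divide_le_eq_1)
 have g1: "\<bar>g n w0 x\<bar> <= 1" for n w0 x using inv1[of n] unfolding g_def by auto
 have one: "AE x in U01. (%N. (\<Sum>k<N. g n w0 (real (b ^ k) * x)) / real N) \<longlonglongrightarrow> 0" if w0: "w0 < b ^ n" for n w0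
 proof -
  define Y where "Y k x = g n w0 (real (b ^ k) * x)" for k x
  have Ym [measurable]: "Y k \<in> borel_measurable borel" for k unfolding Y_def by measurable
  have Y1: "\<bar>Y k x\<bar> <= 1" for k x unfolding Y_def by (rule g1)
  have mean: "(\<integral>x. g n w0 x \<partial>U01) = 0"
  proof -
   have "(\<integral>x. g n w0 x \<partial>U01) = (\<integral>x. (%w. (if w = w0 then 1 else 0) - 1 / real (b ^ n)) (nat \<lfloor>real (b ^ n) * x\<rfloor>) \<partial>U01)"
   by (rule Bochner_Integration.integral_cong) (auto simp: g_def space_U01 frac_eq[THEN iffD2])
   also have "... = (\<Sum>w<b ^ n. (if w = w0 then 1 else 0) - 1 / real (b ^ n)) / real (b ^ n)"
   by (rule integral_U01_step[OF bn(1)])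
   also have "(\<Sum>w<b ^ n. (if w = w0 then 1 else 0) - 1 / real (b ^ n)) = 0"
   using w0 bn[of n] by (simp add: sum_subtractf del: of_nat_power)
   finally show ?thesis by simp
  qed
  have orth: "(\<integral>x. Y k x * Y l x \<partial>U01) = 0" if kl: "k + n <= l" for k l
  proof -
   define h where "h w = (if (w div b ^ (l - k - n)) mod b ^ n = w0 then 1 else 0) - 1 / real (b ^ n)" for w
   have h1: "\<bar>h w\<bar> <= 1" for w using inv1[of n] unfolding h_def by auto
   have "(\<integral>x. Y k x * Y l x \<partial>U01) = (\<integral>x. h (nat \<lfloor>real (b ^ l) * x\<rfloor>) * g n w0 (frac (real (b ^ l) * x)) \<partial>U01)"
   proof (rule Bochner_Integration.integral_cong[OF refl])
   fix x assume "x \<in> space U01"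
   hence x: "0 <= x" by (simp add: space_U01)
   show "Y k x * Y l x = h (nat \<lfloor>real (b ^ l) * x\<rfloor>) * g n w0 (frac (real (b ^ l) * x))"
   unfolding Y_def h_def floor_digit_block[OF b x kl, symmetric] by (simp add: g_def)
   qed
   also have "... = (\<Sum>w<b ^ l. \<integral>x. h w * g n w0 x \<partial>U01) / real (b ^ l)"
   by (rule integral_U01_blocks[where f="%w x. h w * g n w0 x" and B=1])
   (use bn h1 g1 in \<open>auto simp: abs_mult intro!: mult_le_one\<close>)
   finally show ?thesis using mean by simp
  qed
  have intY: "integrable U01 (%x. Y k x * Y l x)" for k l
   using Y1 by (intro integrable_U01_bounded[where C=1]) (auto simp: abs_mult intro!: mult_le_one)
  have second: "(\<integral>x. (\<Sum>k<N. Y k x)\<^sup>2 \<partial>U01) <= real N * (2 * real n)" for N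
  proof -
   have "(\<integral>x. (\<Sum>k<N. Y k x)\<^sup>2 \<partial>U01) = (\<Sum>k<N. \<Sum>l<N. \<integral>x. Y k x * Y l x \<partial>U01)"
   unfolding power2_eq_square sum_product
   by (subst Bochner_Integration.integral_sum, intro Bochner_Integration.integrable_sum intY, intro sum.cong refl Bochner_Integration.integral_sum intY)
   also have "... <= (\<Sum>k<N. \<Sum>l<N. if k < l + n & l < k + n then 1 else 0)"
   proof (intro sum_mono)
   fix k l
   have le1: "Y k x * Y l x <= 1" for x
   by (rule order_trans[OF abs_ge_self]) (simp add: abs_mult mult_le_one Y1)
   have "(\<integral>x. Y k x * Y l x \<partial>U01) <= (\<integral>x. 1 \<partial>U01)"
   by (intro integral_mono intY le1) simp
   hence i1: "(\<integral>x. Y k x * Y l x \<partial>U01) <= 1" by (simp add: U01.prob_space)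
   have sw: "(\<integral>x. Y l x * Y k x \<partial>U01) = (\<integral>x. Y k x * Y l x \<partial>U01)"
   by (intro Bochner_Integration.integral_cong refl mult.commute)
   consider "k + n <= l" | "l + n <= k" | "k < l + n & l < k + n" by linarith
   thus "(\<integral>x. Y k x * Y l x \<partial>U01) <= (if k < l + n & l < k + n then 1 else 0)"
   proof cases
   case 1
   thus ?thesis unfolding orth[OF 1] by simp
   next
   case 2
   thus ?thesis unfolding sw[symmetric] orth[OF 2] by simp
   next
   case 3
   thus ?thesis using i1 by simp
   qed
   qed
   also have "... <= (\<Sum>k<N. 2 * real n)"
   proof (intro sum_mono)
   fix k
   have "card {l \<in> {..<N}. k < l + n & l < k + n} <= card {k - n..<k + n}" by (intro card_mono) auto
   also have "... <= 2 * n" by simp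
   finally have "rcard {l \<in> {..<N}. k < l + n & l < k + n} <= 2 * real n" by linarith
   thus "(\<Sum>l<N. if k < l + n & l < k + n then 1 else 0) <= 2 * real n"
   by (simp add: sum.inter_filter[symmetric])
   qed
   finally show ?thesis by simp
  qed
  have "AE x in U01. (%m. ((\<Sum>k<m\<^sup>2. Y k x) / real (m\<^sup>2))\<^sup>2) \<longlonglongrightarrow> 0"
  proof (rule AE_tendsto_zero_of_summable)
   show "(%x. ((\<Sum>k<m\<^sup>2. Y k x) / real (m\<^sup>2))\<^sup>2) \<in> borel_measurable U01" for m
   by (rule measurable_U01) measurable
   show "integrable U01 (%x. ((\<Sum>k<m\<^sup>2. Y k x) / real (m\<^sup>2))\<^sup>2)" for m
   proof -
   have "((\<Sum>k<m\<^sup>2. Y k x) / real (m\<^sup>2))\<^sup>2 = (\<Sum>k<m\<^sup>2. \<Sum>l<m\<^sup>2. Y k x * Y l x) / (real (m\<^sup>2))\<^sup>2" for x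
   unfolding power_divide power2_eq_square[of "sum (%k. Y k x) _"] sum_product ..
   note e = this
   show ?thesis unfolding e by (intro integrable_divide Bochner_Integration.integrable_sum intY)
   qed
   show "(\<integral>x. ((\<Sum>k<m\<^sup>2. Y k x) / real (m\<^sup>2))\<^sup>2 \<partial>U01) <= 2 * real n * inverse (real m ^ 2)" for m
   proof -
   have "(\<integral>x. ((\<Sum>k<m\<^sup>2. Y k x) / real (m\<^sup>2))\<^sup>2 \<partial>U01) = (\<integral>x. (\<Sum>k<m\<^sup>2. Y k x)\<^sup>2 \<partial>U01) / (real (m\<^sup>2))\<^sup>2"
   unfolding power_divide by (rule integral_divide_zero)
   also have "... <= real (m\<^sup>2) * (2 * real n) / (real (m\<^sup>2))\<^sup>2" by (intro divide_right_mono second) simp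
   also have "... = 2 * real n * inverse (real m ^ 2)" by (cases "m = 0") (simp_all add: power2_eq_square field_simps)
   finally show ?thesis .
   qed
   show "summable (%m. 2 * real n * inverse (real m ^ 2))" by (intro summable_mult inverse_power_summable) simp
  qed simp
  thus ?thesis
  proof eventually_elim
   case (elim x)
   have "(%m. (\<Sum>k<m\<^sup>2. Y k x) / real (m\<^sup>2)) \<longlonglongrightarrow> 0"
   using tendsto_real_sqrt[OF elim] unfolding real_sqrt_abs real_sqrt_zero by (rule tendsto_rabs_zero_cancel)
   from tendsto_averages_of_squares[of "%k. Y k x", OF Y1 this] show ?case unfolding Y_def .
  qed
 qed
 have "AE x in U01. \<forall>n w0. w0 < b ^ n --> (%N. (\<Sum>k<N. g n w0 (real (b ^ k) * x)) / real N) \<longlonglongrightarrow> 0"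
  unfolding AE_all_countable using one by auto
 thus ?thesis
  unfolding normal_base_def
 proof (eventually_elim, intro allI)
  fix x n and c :: "nat => real"
  assume h: "\<forall>n w0. w0 < b ^ n --> (%N. (\<Sum>k<N. g n w0 (real (b ^ k) * x)) / real N) \<longlonglongrightarrow> 0"
  define D where "D k = nat \<lfloor>real (b ^ n) * frac (real (b ^ k) * x)\<rfloor>" for k
  have D: "D k < b ^ n" for k
  proof -
   have "real (b ^ n) * frac (real (b ^ k) * x) < real (b ^ n) * 1"
   using bn(2)[of n] frac_lt_1 by (intro mult_strict_left_mono) auto
   thus ?thesis using bn(1)[of n] unfolding D_def by (simp add: nat_less_iff floor_less_iff del: of_nat_power)
  qed
  have cD: "c (D k) = (\<Sum>w<b ^ n. c w * g n w (real (b ^ k) * x)) + (\<Sum>w<b ^ n. c w) / real (b ^ n)" for k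
  proof -
   have "c w * g n w (real (b ^ k) * x) = (if w = D k then c w else 0) - c w / real (b ^ n)" for w
   by (auto simp: g_def D_def right_diff_distrib)
   hence "(\<Sum>w<b ^ n. c w * g n w (real (b ^ k) * x)) = (\<Sum>w<b ^ n. if w = D k then c w else 0) - (\<Sum>w<b ^ n. c w) / real (b ^ n)"
   by (simp only: sum_subtractf sum_divide_distrib)
   thus ?thesis using D[of k] by simp
  qed
  have "(%N. (\<Sum>w<b ^ n. c w * ((\<Sum>k<N. g n w (real (b ^ k) * x)) / real N)) + (\<Sum>w<b ^ n. c w) / real (b ^ n))
   \<longlonglongrightarrow> (\<Sum>w<b ^ n. c w * 0) + (\<Sum>w<b ^ n. c w) / real (b ^ n)"
   using h by (intro tendsto_intros) auto
  moreover have "\<forall>\<^sub>F N in sequentially. (\<Sum>w<b ^ n. c w * ((\<Sum>k<N. g n w (real (b ^ k) * x)) / real N)) + (\<Sum>w<b ^ n. c w) / real (b ^ n)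
   = (\<Sum>k<N. c (D k)) / real N"
  proof (rule eventually_sequentiallyI[of 1])
   fix N :: nat assume N: "1 <= N"
   have "(\<Sum>k<N. c (D k)) = (\<Sum>k<N. \<Sum>w<b ^ n. c w * g n w (real (b ^ k) * x)) + real N * ((\<Sum>w<b ^ n. c w) / real (b ^ n))"
   unfolding cD sum.distrib by simp
   also have "(\<Sum>k<N. \<Sum>w<b ^ n. c w * g n w (real (b ^ k) * x)) = (\<Sum>w<b ^ n. c w * (\<Sum>k<N. g n w (real (b ^ k) * x)))"
   unfolding sum_distrib_left by (rule sum.swap)
   finally have e: "(\<Sum>k<N. c (D k)) = (\<Sum>w<b ^ n. c w * (\<Sum>k<N. g n w (real (b ^ k) * x))) + real N * ((\<Sum>w<b ^ n. c w) / real (b ^ n))" .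
   have "(\<Sum>w<b ^ n. c w * (s w / real N)) = (\<Sum>w<b ^ n. c w * s w) / real N" for s by (simp add: sum_divide_distrib)
   thus "(\<Sum>w<b ^ n. c w * ((\<Sum>k<N. g n w (real (b ^ k) * x)) / real N)) + (\<Sum>w<b ^ n. c w) / real (b ^ n)
   = (\<Sum>k<N. c (D k)) / real N"
   unfolding e add_divide_distrib using N by simp
  qed
  ultimately show "(%N. (\<Sum>k<N. c (nat \<lfloor>real (b ^ n) * frac (real (b ^ k) * x)\<rfloor>)) / real N) \<longlonglongrightarrow> (\<Sum>w<b ^ n. c w) / real (b ^ n)"
   unfolding D_def[symmetric] by (simp add: Lim_transform_eventually)
 qed
qed

section \<open>An invariant measure\<close>

lemma borel_measurable_U01_pair:
 assumes "h \<in> borel_measurable (borel :: (real \<times> real) measure)"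
 shows "h \<in> borel_measurable (U01 \<Otimes>\<^sub>M U01)"
proof -
 have id: "(%x. x) \<in> U01 \<rightarrow>\<^sub>M borel" by (rule measurable_U01) simp
 have "(%z. (fst z, snd z)) \<in> U01 \<Otimes>\<^sub>M U01 \<rightarrow>\<^sub>M borel \<Otimes>\<^sub>M borel"
  by (intro measurable_Pair measurable_compose[OF measurable_fst id] measurable_compose[OF measurable_snd id])
 hence "(%z. z) \<in> U01 \<Otimes>\<^sub>M U01 \<rightarrow>\<^sub>M borel" by (simp add: borel_prod)
 from measurable_compose[OF this assms] show ?thesis by simp
qed

interpretation U2: pair_prob_space U01 U01 ..

lemma U01_pair_Fubini:
 fixes h :: "real \<times> real => real"
 assumes h: "h \<in> borel_measurable borel" and B: "!!z. \<bar>h z\<bar> <= B"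
 shows "integral\<^sup>L (U01 \<Otimes>\<^sub>M U01) h = (\<integral>x. \<integral>u. h (x, u) \<partial>U01 \<partial>U01)"
  "integral\<^sup>L (U01 \<Otimes>\<^sub>M U01) h = (\<integral>u. \<integral>x. h (x, u) \<partial>U01 \<partial>U01)"
  "integrable (U01 \<Otimes>\<^sub>M U01) h"
proof -
 show int: "integrable (U01 \<Otimes>\<^sub>M U01) h"
  using B by (intro U2.P.integrable_const_bound[where B=B] AE_I2 borel_measurable_U01_pair h) auto
 thus "integral\<^sup>L (U01 \<Otimes>\<^sub>M U01) h = (\<integral>x. \<integral>u. h (x, u) \<partial>U01 \<partial>U01)" by (rule U2.integral_fst'[symmetric])
 have "(\<integral>u. \<integral>x. (%x u. h (x, u)) x u \<partial>U01 \<partial>U01) = integral\<^sup>L (U01 \<Otimes>\<^sub>M U01) (%(x, u). h (x, u))"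
  using int by (intro U2.integral_snd) simp
 thus "integral\<^sup>L (U01 \<Otimes>\<^sub>M U01) h = (\<integral>u. \<integral>x. h (x, u) \<partial>U01 \<partial>U01)" by simp
qed

text \<open>The baker map preserves area: integrating over the \<open>b\<close> vertical strips
  before the map or over the \<open>b\<close> horizontal strips after it gives the same sum over
  \<open>s\<close> of integrals of \<open>g s\<close>.\<close>

lemma integral_baker:
 fixes h :: "real \<times> real => real"
 assumes b: "0 < b" and h [measurable]: "h \<in> borel_measurable borel" and B: "!!z. \<bar>h z\<bar> <= B"
 shows "(\<integral>z. h (frac (real b * fst z), (snd z + real_of_int \<lfloor>real b * fst z\<rfloor>) / real b) \<partial>(U01 \<Otimes>\<^sub>M U01)) = integral\<^sup>L (U01 \<Otimes>\<^sub>M U01) h"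
proof -
 define g where "g s z = h (fst z, (snd z + real s) / real b)" for s :: nat and z
 have g [measurable]: "g s \<in> borel_measurable borel" for s unfolding g_def borel_prod[symmetric] by measurable
 have gB: "\<bar>g s z\<bar> <= B" for s z unfolding g_def by (rule B)
 have gm [measurable]: "(%x. g s (x, u)) \<in> borel_measurable borel" "(%u. g s (x, u)) \<in> borel_measurable borel" for s x u
  by (rule measurable_compose[OF _ g], intro borel_measurable_continuous_onI continuous_intros)+
 have m2: "(%z. h (frac (real b * fst z), (snd z + real_of_int \<lfloor>real b * fst z\<rfloor>) / real b)) \<in> borel_measurable borel"
  unfolding borel_prod[symmetric] by measurable
 have fl: "x \<in> space U01 ==> real_of_int \<lfloor>real b * x\<rfloor> = real (nat \<lfloor>real b * x\<rfloor>)" for x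
  by (simp add: space_U01)
 have "(\<integral>z. h (frac (real b * fst z), (snd z + real_of_int \<lfloor>real b * fst z\<rfloor>) / real b) \<partial>(U01 \<Otimes>\<^sub>M U01))
   = (\<integral>u. \<integral>x. h (frac (real b * x), (u + real_of_int \<lfloor>real b * x\<rfloor>) / real b) \<partial>U01 \<partial>U01)"
  by (subst U01_pair_Fubini(2)[OF m2 B]) simp
 also have "... = (\<integral>u. (\<integral>x. g (nat \<lfloor>real b * x\<rfloor>) (frac (real b * x), u) \<partial>U01) \<partial>U01)"
  by (intro Bochner_Integration.integral_cong refl) (simp only: g_def fst_conv snd_conv fl)
 also have "... = (\<integral>u. (\<Sum>s<b. \<integral>x. g s (x, u) \<partial>U01) / real b \<partial>U01)"
  by (intro Bochner_Integration.integral_cong refl integral_U01_blocks[where f="%s x. g s (x, u)" and B=B for u] b gm gB)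
 also have "... = (\<Sum>s<b. \<integral>u. \<integral>x. g s (x, u) \<partial>U01 \<partial>U01) / real b"
 proof -
  have "integrable U01 (%u. \<integral>x. g s (x, u) \<partial>U01)" for s
   by (rule U2.integrable_snd) (use U01_pair_Fubini(3)[OF g gB] in simp)
  thus ?thesis by simp
 qed
 also have "... = (\<Sum>s<b. \<integral>x. \<integral>u. g s (x, u) \<partial>U01 \<partial>U01) / real b"
  using U01_pair_Fubini(1,2)[OF g gB] by simp
 also have "... = (\<integral>x. (\<Sum>s<b. \<integral>u. g s (x, u) \<partial>U01) / real b \<partial>U01)"
 proof -
  have "integrable U01 (%x. \<integral>u. g s (x, u) \<partial>U01)" for s
   by (rule U2.integrable_fst) (use U01_pair_Fubini(3)[OF g gB] in simp)
  thus ?thesis by simp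
 qed
 also have "... = (\<integral>x. (\<integral>u. g (nat \<lfloor>real b * u\<rfloor>) (x, frac (real b * u)) \<partial>U01) \<partial>U01)"
  by (intro Bochner_Integration.integral_cong refl integral_U01_blocks[where f="%s u. g s (x, u)" and B=B for x, symmetric] b gm gB)
 also have "... = (\<integral>x. (\<integral>u. h (x, u) \<partial>U01) \<partial>U01)"
 proof (intro Bochner_Integration.integral_cong refl)
  fix x u assume "u \<in> space U01"
  hence "(frac (real b * u) + real (nat \<lfloor>real b * u\<rfloor>)) / real b = u"
   using b by (simp add: fl[symmetric] frac_def)
  thus "g (nat \<lfloor>real b * u\<rfloor>) (x, frac (real b * u)) = h (x, u)" by (simp add: g_def)
 qed
 also have "... = integral\<^sup>L (U01 \<Otimes>\<^sub>M U01) h" by (rule U01_pair_Fubini(1)[OF h B, symmetric])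
 finally show ?thesis .
qed

context solenoid
begin

abbreviation "T == T_map b ga \<phi>"

lemma borel_\<phi> [measurable]: "\<phi> \<in> borel_measurable borel"
proof -
 have "(real C * (1 - ga))-lipschitz_on UNIV \<phi>"
  using lip g1 by (intro lipschitz_onI) (auto simp: dist_real_def)
 thus ?thesis by (intro borel_measurable_continuous_onI lipschitz_on_continuous_on)
qed

lemma borel_T [measurable]: "T \<in> borel_measurable borel"
 unfolding T_map_def borel_prod[symmetric] by measurable

text \<open>The second coordinate of the unit square carries the past of the orbit as a base-b expansion,
 so the inverse baker map recovers the preimages of x along that past.\<close>

lemma invariant_measure_exists:
 "\<exists>om. sets om = sets borel & prob_space om & (AE z in om. fst z \<in> {0..<1} & \<bar>snd z\<bar> <= real C) & distr om om T = om &
  (\<forall>(h :: real => real) B. h \<in> borel_measurable borel --> (\<forall>x. \<bar>h x\<bar> <= B) --> (\<integral>z. h (fst z) \<partial>om) = (\<integral>x. h x \<partial>U01))"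
proof -
 define D where "D z = ((fst z + real_of_int \<lfloor>real b * snd z\<rfloor>) / real b, frac (real b * snd z))" for z :: "real \<times> real"
 define E where "E z = (frac (real b * fst z), (snd z + real_of_int \<lfloor>real b * fst z\<rfloor>) / real b)" for z :: "real \<times> real"
 \<comment> \<open>This is S over \<open>fst z\<close> along the base-\<open>b\<close> digits of
   \<open>snd z\<close>, with the successive preimages written as first coordinates of the orbit
   under \<open>D\<close>. In this form \<open>T (Q z) = Q (E z)\<close> is a shift of the series by
   one term.\<close>
 define Y where "Y z = (\<Sum>k. ga ^ k * \<phi> (fst ((D ^^ (k + 1)) z)))" for z
 define Q where "Q z = (fst z, Y z)" for z
 have D [measurable]: "D \<in> borel_measurable borel" unfolding D_def borel_prod[symmetric] by measurable
 have E [measurable]: "E \<in> borel_measurable borel" unfolding E_def borel_prod[symmetric] by measurable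
 have Dk [measurable]: "(D ^^ k) \<in> borel_measurable borel" for k
  by (induction k) (auto simp: id_def comp_def intro: measurable_compose[OF _ D])
 have fst_m [measurable]: "fst \<in> borel_measurable (borel :: (real \<times> real) measure)"
  unfolding borel_prod[symmetric] by measurable
 have "(%z. fst ((D ^^ k) z)) \<in> borel_measurable borel" for k by (rule measurable_compose[OF Dk fst_m])
 hence Ym [measurable]: "Y \<in> borel_measurable borel" unfolding Y_def by measurable
 have Pm [measurable]: "Q \<in> borel_measurable borel" unfolding Q_def by (intro borel_measurable_Pair fst_m Ym)
 have YC: "\<bar>Y z\<bar> <= real C" for z unfolding Y_def using weighted_sum_bound[of _ 1] bnd by simp
 have DE: "D (E z) = z" if "snd z \<in> {0..<1}" for z
 proof -
  have "\<lfloor>snd z + real_of_int \<lfloor>real b * fst z\<rfloor>\<rfloor> = \<lfloor>real b * fst z\<rfloor>" using that by (simp add: floor_eq_iff)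
  moreover have "frac (snd z + real_of_int \<lfloor>real b * fst z\<rfloor>) = snd z" using that by (simp add: frac_def floor_eq_iff)
  ultimately show ?thesis unfolding D_def E_def using b0 by (simp add: frac_def prod_eq_iff)
 qed
 have equi: "T (Q z) = Q (E z)" if z: "snd z \<in> {0..<1}" for z
 proof -
  have "Y (E z) = (\<Sum>k. ga ^ k * \<phi> (fst ((D ^^ k) z)))"
   unfolding Y_def using DE[OF z] by (simp add: funpow_swap1 del: funpow.simps(2) add: funpow_Suc_right)
  also have "... = \<phi> (fst z) + (\<Sum>k. ga ^ Suc k * \<phi> (fst ((D ^^ Suc k) z)))"
   using suminf_split_head[OF summable_G[of "%k. fst ((D ^^ k) z)"]] by simp
  also have "(\<Sum>k. ga ^ Suc k * \<phi> (fst ((D ^^ Suc k) z))) = ga * Y z"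
   unfolding Y_def using suminf_mult[OF summable_G[of "%k. fst ((D ^^ (k + 1)) z)"], of ga] by (simp add: mult.assoc)
  finally show ?thesis by (simp add: T_map_def Q_def E_def)
 qed
 define om where "om = distr (U01 \<Otimes>\<^sub>M U01) borel Q"
 have P2: "Q \<in> U01 \<Otimes>\<^sub>M U01 \<rightarrow>\<^sub>M borel"
 proof -
  have id: "(%x. x) \<in> U01 \<rightarrow>\<^sub>M borel" by (rule measurable_U01) simp
  have "(%z. (fst z, snd z)) \<in> U01 \<Otimes>\<^sub>M U01 \<rightarrow>\<^sub>M borel \<Otimes>\<^sub>M borel"
   by (intro measurable_Pair measurable_compose[OF measurable_fst id] measurable_compose[OF measurable_snd id])
  hence "(%z. z) \<in> U01 \<Otimes>\<^sub>M U01 \<rightarrow>\<^sub>M borel" by (simp add: borel_prod)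
  from measurable_compose[OF this Pm] show ?thesis by simp
 qed
 have sets: "sets om = sets borel" by (simp add: om_def)
 have ps: "prob_space om" unfolding om_def by (rule U2.P.prob_space_distr[OF P2])
 interpret om: prob_space om by (rule ps)
 have int: "(\<integral>z. f z \<partial>om) = (\<integral>z. f (Q z) \<partial>(U01 \<Otimes>\<^sub>M U01))" if "f \<in> borel_measurable borel" for f :: "real \<times> real => real"
  unfolding om_def by (rule integral_distr[OF P2 that])
 have "AE z in om. fst z \<in> {0..<1} & \<bar>snd z\<bar> <= real C"
  unfolding om_def
 proof (subst AE_distr_iff[OF P2])
  have "{z \<in> space (borel :: (real \<times> real) measure). fst z \<in> {0..<1} & \<bar>snd z\<bar> <= real C} = {0..<1} \<times> {- real C..real C}" by auto
  also have "... \<in> sets borel" by (rule borel_Times) auto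
  finally show "{z \<in> space borel. fst z \<in> {0..<1} & \<bar>snd z\<bar> <= real C} \<in> sets (borel :: (real \<times> real) measure)" .
 qed (use YC in \<open>auto simp: Q_def space_pair_measure space_U01\<close>)
 moreover have "distr om om T = om"
 proof (rule measure_eqI)
  fix A assume "A \<in> sets (distr om om T)"
  hence A [measurable]: "A \<in> sets borel" by (simp add: sets)
  have TA: "T -` A \<in> sets borel" using measurable_sets[OF borel_T A] by simp
  have Tom: "T \<in> om \<rightarrow>\<^sub>M om" using borel_T unfolding measurable_cong_sets[OF sets sets] .
  have ind: "(\<integral>z. indicator X z \<partial>om) = measure om X" if "X \<in> sets borel" for X
   using that sets.sets_into_space[of X om] by (simp add: sets Int_absorb2)
  have "measure om (T -` A) = (\<integral>z. indicator (T -` A) (Q z) \<partial>(U01 \<Otimes>\<^sub>M U01))"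
   unfolding ind[OF TA, symmetric] by (rule int) (use TA in simp)
  also have "... = (\<integral>z. (%z. indicator A (Q z)) (E z) \<partial>(U01 \<Otimes>\<^sub>M U01))"
   by (rule Bochner_Integration.integral_cong[OF refl])
   (use equi in \<open>auto simp: indicator_def space_pair_measure space_U01\<close>)
  also have "... = (\<integral>z. indicator A (Q z) \<partial>(U01 \<Otimes>\<^sub>M U01))"
   unfolding E_def by (rule integral_baker[where B=1]) (auto simp: b0 indicator_def)
  also have "... = measure om A" unfolding ind[OF A, symmetric] by (rule int[symmetric]) simp
  finally show "emeasure (distr om om T) A = emeasure om A"
   using Tom A sets by (simp add: emeasure_distr om.emeasure_eq_measure sets_eq_imp_space_eq[OF sets])
 qed simp
 moreover have "(\<integral>z. h (fst z) \<partial>om) = (\<integral>x. h x \<partial>U01)" if h: "h \<in> borel_measurable borel" "!!x. \<bar>h x\<bar> <= B" for h :: "real => real" and B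
 proof -
  have hf: "(%z. h (fst z)) \<in> borel_measurable (borel :: (real \<times> real) measure)" by (rule measurable_compose[OF fst_m h(1)])
  have "(\<integral>z. h (fst z) \<partial>om) = (\<integral>z. h (fst z) \<partial>(U01 \<Otimes>\<^sub>M U01))" using int[OF hf] by (simp add: Q_def)
  also have "... = (\<integral>x. h x \<partial>U01)" by (subst U01_pair_Fubini(1)[OF hf h(2)]) (simp add: U01.prob_space)
  finally show ?thesis .
 qed
 ultimately show ?thesis using sets ps by (intro exI[of _ om] conjI allI impI) auto
qed

end

section \<open>Birkhoff averages, ergodicity and uniqueness\<close>

lemma averages_shift_close:
 fixes u v :: "nat => real"
 assumes u: "!!k. \<bar>u k\<bar> <= F" and v: "!!k. \<bar>v k\<bar> <= F" and uv: "!!k. k0 <= k ==> \<bar>u (m + k) - v k\<bar> <= ep"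
  and e: "0 <= ep" "ep < ep'" and L: "(%N. (\<Sum>k<N. v k) / real N) \<longlonglongrightarrow> L"
 shows "\<forall>\<^sub>F N in sequentially. \<bar>(\<Sum>k<N. u k) / real N - L\<bar> < ep'"
proof -
 have F0: "0 <= F" using u[of 0] by linarith
 have sh: "\<bar>(\<Sum>k<N. u (m + k)) - (\<Sum>k<N. u k)\<bar> <= real m * (2 * F)" for m N
 proof (induction m)
  case (Suc m)
  have "(\<Sum>k<N. u (Suc m + k)) - (\<Sum>k<N. u (m + k)) = u (m + N) - u (m + 0)"
   using sum_lessThan_telescope[of "%k. u (m + k)" N] by (simp add: sum_subtractf)
  hence "\<bar>(\<Sum>k<N. u (Suc m + k)) - (\<Sum>k<N. u (m + k))\<bar> <= 2 * F" using u[of "m + N"] u[of "m + 0"] by linarith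
  moreover have "real (Suc m) * (2 * F) = real m * (2 * F) + 2 * F" by (simp add: algebra_simps)
  ultimately show ?case using Suc by linarith
 qed simp
 define K where "K = real m * (2 * F) + real k0 * (2 * F)"
 have diff: "\<bar>(\<Sum>k<N. u k) - (\<Sum>k<N. v k)\<bar> <= real N * ep + K" for N
 proof -
  have "\<bar>(\<Sum>k<N. u (m + k)) - (\<Sum>k<N. v k)\<bar> <= (\<Sum>k<N. \<bar>u (m + k) - v k\<bar>)"
   unfolding sum_subtractf[symmetric] by (rule sum_abs)
  also have "... <= (\<Sum>k<N. ep + (if k < k0 then 2 * F else 0))"
  proof (rule sum_mono)
   fix k
   show "\<bar>u (m + k) - v k\<bar> <= ep + (if k < k0 then 2 * F else 0)"
   using uv[of k] u[of "m + k"] v[of k] e(1) by (cases "k < k0") auto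
  qed
  also have "... = real N * ep + (\<Sum>k\<in>{..<N} \<inter> {..<k0}. 2 * F)"
   unfolding sum.distrib sum.inter_restrict[OF finite_lessThan] by simp
  also have "(\<Sum>k\<in>{..<N} \<inter> {..<k0}. 2 * F) <= (\<Sum>k<k0. 2 * F)" using F0 by (intro sum_mono2) auto
  finally show ?thesis using sh[of m N] unfolding K_def by (simp add: abs_le_iff)
 qed
 have "(%N. \<bar>(\<Sum>k<N. v k) / real N - L\<bar> + K / real N) \<longlonglongrightarrow> \<bar>L - L\<bar> + 0"
  by (intro tendsto_intros L lim_const_over_n)
 hence "\<forall>\<^sub>F N in sequentially. \<bar>(\<Sum>k<N. v k) / real N - L\<bar> + K / real N < ep' - ep"
  using e by (intro order_tendstoD) auto
 moreover have "\<forall>\<^sub>F N in sequentially. 0 < N" by (rule eventually_gt_at_top)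
 ultimately show ?thesis
 proof eventually_elim
  case (elim N)
  have "\<bar>(\<Sum>k<N. u k) / real N - (\<Sum>k<N. v k) / real N\<bar> = \<bar>(\<Sum>k<N. u k) - (\<Sum>k<N. v k)\<bar> / real N"
   by (simp add: diff_divide_distrib[symmetric])
  also have "... <= (real N * ep + K) / real N" by (intro divide_right_mono diff) simp
  also have "... = ep + K / real N" using elim by (simp add: add_divide_distrib)
  finally show ?case using elim by linarith
 qed
qed

locale solenoid_measure = solenoid +
 fixes om :: "(real \<times> real) measure"
 assumes sets_om: "sets om = sets borel" and prob_om: "prob_space om"
  and supp: "AE z in om. fst z \<in> {0..<1} & \<bar>snd z\<bar> <= real C"
  and inv: "distr om om T = om"
  and marg: "!!(h :: real => real) B. h \<in> borel_measurable borel ==> (!!x. \<bar>h x\<bar> <= B) ==> (\<integral>z. h (fst z) \<partial>om) = (\<integral>x. h x \<partial>U01)"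
begin

sublocale om: prob_space om by (rule prob_om)

lemma measurable_om: "measurable om N = measurable borel N" "measurable N om = measurable N borel"
 by (rule measurable_cong_sets[OF sets_om refl], rule measurable_cong_sets[OF refl sets_om])

lemma space_om: "space om = UNIV" using sets_eq_imp_space_eq[OF sets_om] by simp

lemma measurable_Tn [measurable]: "(T ^^ n) \<in> borel_measurable borel"
 by (induction n) (auto simp: id_def comp_def intro: measurable_compose[OF _ borel_T])

lemma distr_Tn: "distr om om (T ^^ n) = om"
proof (induction n)
 case (Suc n)
 have "distr om om (T ^^ Suc n) = distr (distr om om (T ^^ n)) om T"
  unfolding funpow.simps by (rule distr_distr[symmetric]) (auto simp: measurable_om)
 thus ?case unfolding Suc inv .
qed (simp add: id_def distr_id)

lemma integral_Tn:
 fixes f :: "real \<times> real => real"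
 assumes "f \<in> borel_measurable borel"
 shows "(\<integral>z. f ((T ^^ n) z) \<partial>om) = integral\<^sup>L om f"
 using integral_distr[of "T ^^ n" om om f] assms unfolding distr_Tn by (simp add: measurable_om)

lemma AE_Tn: "Measurable.pred borel P ==> (AE z in om. P z) \<longleftrightarrow> (AE z in om. P ((T ^^ n) z))"
 using AE_distr_iff[of "T ^^ n" om om P] unfolding distr_Tn by (auto simp: measurable_om space_om pred_def sets_om)

lemma integrable_om_bounded:
 fixes f :: "real \<times> real => real"
 assumes "f \<in> borel_measurable borel" "!!z. \<bar>f z\<bar> <= B"
 shows "integrable om f"
 using assms by (intro om.integrable_const_bound[where B=B] AE_I2) (auto simp: measurable_om)

lemma G_times_b: "G (real b * u) = \<phi> u + ga * G u"
 using G_split[of "real b * u" 1] b0 by (simp add: Gn_def)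

lemma per_frac: "\<phi> (frac u) = \<phi> u"
proof (cases "0 <= \<lfloor>u\<rfloor>")
 case True
 thus ?thesis using per_nat[of "frac u" "nat \<lfloor>u\<rfloor>"] by (simp add: frac_def)
next
 case False
 thus ?thesis using per_nat[of u "nat (- \<lfloor>u\<rfloor>)"] by (simp add: frac_def)
qed

text \<open>The equation \<open>G (b * u) = \<phi> u + ga * G u\<close> makes the graph of
  \<open>G\<close>, wound around the strip by \<open>frac\<close>, invariant under \<open>T\<close>,
  while the vertical distance to it contracts by \<open>ga\<close> at each step.\<close>

lemma T_pow:
 assumes "fst z \<in> {0..<1}"
 shows "(T ^^ n) z = (frac (real (b ^ n) * fst z), G (real (b ^ n) * fst z) + ga ^ n * (snd z - G (fst z)))"
proof (induction n)
 case 0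
 thus ?case using assms by (simp add: prod_eq_iff frac_eq)
next
 case (Suc n)
 define u where "u = real (b ^ n) * fst z"
 have "real b * frac u = real b * u - real_of_int (int b * \<lfloor>u\<rfloor>)" by (simp add: frac_def right_diff_distrib)
 hence fr: "frac (real b * frac u) = frac (real b * u)" unfolding frac_def by (simp only: floor_diff_of_int)
 have IH: "(T ^^ n) z = (frac u, G u + ga ^ n * (snd z - G (fst z)))" using Suc unfolding u_def .
 have e: "real (b ^ Suc n) * fst z = real b * u" by (simp add: u_def)
 show ?case unfolding funpow.simps comp_apply IH e
  by (simp add: T_map_def fr per_frac G_times_b distrib_left mult.assoc)
qed

text \<open>Up to an error of order \<open>ga ^ n\<close> in the second coordinate, \<open>T ^^ n\<close> forgets the second coordinate of its argument.\<close>

lemma tn_error: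
 assumes "\<bar>y\<bar> <= real C"
 shows "\<bar>ga ^ n * (y - G x)\<bar> <= 2 * real C * ga ^ n"
proof -
 have "\<bar>y - G x\<bar> <= 2 * real C" using G_bound[of x] assms by linarith
 from mult_left_mono[OF this, of "ga ^ n"] show ?thesis using gp[of n] by (simp add: abs_mult mult_ac)
qed

lemma frac_word_close:
 fixes x :: real and m :: nat
 assumes x: "0 <= x" "x < 1"
 defines "w == nat \<lfloor>real (b ^ (2 * m)) * x\<rfloor>"
 shows "\<bar>frac (real (b ^ m) * x) - frac (real w / real (b ^ m))\<bar> <= 1 / real (b ^ m)"
  "\<bar>real (b ^ m) * x - real w / real (b ^ m)\<bar> <= 1 / real (b ^ m)"
proof -
 define N where "N = b ^ m"
 have N: "0 < real N" using b0 by (simp add: N_def)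
 have NN: "real (b ^ (2 * m)) * x = real N * (real N * x)" by (simp add: N_def mult_2 power_add)
 have w: "real w <= real N * (real N * x)" "real N * (real N * x) < real w + 1"
  unfolding w_def NN using x N by auto
 have le: "real w / real N <= real N * x" using w N by (simp add: divide_le_eq mult_ac)
 have lt: "real N * x < real w / real N + 1 / real N" using w N by (simp add: field_simps)
 show 2: "\<bar>real (b ^ m) * x - real w / real (b ^ m)\<bar> <= 1 / real (b ^ m)"
  using le lt unfolding N_def[symmetric] by linarith
 have "\<lfloor>real w / real N\<rfloor> = \<lfloor>real N * x\<rfloor>"
 proof (rule antisym)
  show "\<lfloor>real w / real N\<rfloor> <= \<lfloor>real N * x\<rfloor>" using le by (rule floor_mono)
  have "real_of_int (int N * \<lfloor>real N * x\<rfloor>) <= real N * (real N * x)" using N by simp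
  hence "int N * \<lfloor>real N * x\<rfloor> <= \<lfloor>real N * (real N * x)\<rfloor>" by (simp only: le_floor_iff)
  also have "... = int w" unfolding w_def NN using x N by simp
  finally have "real_of_int (int N * \<lfloor>real N * x\<rfloor>) <= real w" by linarith
  thus "\<lfloor>real N * x\<rfloor> <= \<lfloor>real w / real N\<rfloor>" using N by (simp add: le_floor_iff le_divide_eq mult.commute)
 qed
 thus "\<bar>frac (real (b ^ m) * x) - frac (real w / real (b ^ m))\<bar> <= 1 / real (b ^ m)"
  using 2 unfolding frac_def N_def by simp
qed

text \<open>After \<open>m\<close> steps \<open>f\<close> is, up to a small error, a function
  \<open>c\<close> of \<open>2 * m\<close> digits of the first coordinate: \<open>m\<close> of them
  have become the past, which nearly determines the height, and \<open>m\<close> more locate the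
  fractional part. Normality gives the limit of the averages of \<open>c\<close>; invariance and the
  known marginal identify this limit with the integral of \<open>f\<close>.\<close>

lemma birkhoff_continuous:
 fixes f :: "real \<times> real => real"
 assumes z: "fst z \<in> {0..<1}" and f: "continuous_on UNIV f" "bounded (range f)"
  and normal: "normal_base b (fst z)"
 shows "(%n. (\<Sum>k<n. f ((T ^^ k) z)) / real n) \<longlonglongrightarrow> integral\<^sup>L om f"
proof (rule LIMSEQ_I)
 fix e :: real assume e: "0 < e"
 obtain F where F: "!!p. \<bar>f p\<bar> <= F" using f(2) unfolding bounded_iff by auto
 have F0: "0 <= F" using F[of "(0,0)"] by linarith
 define c1 where "c1 = real C + 1"
 let ?K = "{0..1 :: real} \<times> {-c1..c1}"
 have "compact ?K" by (intro compact_Times compact_Icc)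
 hence "uniformly_continuous_on ?K f" using f(1) by (intro compact_uniformly_continuous continuous_on_subset[OF f(1)]) auto
 then obtain d where d: "0 < d" and ud: "!!p q. p \<in> ?K ==> q \<in> ?K ==> dist p q < d ==> \<bar>f p - f q\<bar> < e / 4"
  unfolding uniformly_continuous_on_def using e by (auto simp: dist_real_def dest!: spec[of _ "e / 4"])
 have close: "\<bar>f (x, y) - f (x', y')\<bar> < e / 4"
  if "x \<in> {0..1}" "x' \<in> {0..1}" "\<bar>y\<bar> <= c1" "\<bar>y'\<bar> <= c1" "\<bar>x - x'\<bar> < d / 2" "\<bar>y - y'\<bar> < d / 2" for x x' y y'
 proof (rule ud)
  have "dist (x, y) (x', y') <= \<bar>x - x'\<bar> + \<bar>y - y'\<bar>"
   using sqrt_sum_squares_le_sum_abs[of "x - x'" "y - y'"] by (simp add: dist_Pair_Pair dist_real_def)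
  thus "dist (x, y) (x', y') < d" using that by linarith
 qed (use that in \<open>auto simp: abs_le_iff\<close>)
 have "(%m. 2 * real C * ga ^ m + (real C + 1) * (1 / real b) ^ m) \<longlonglongrightarrow> 2 * real C * 0 + (real C + 1) * 0"
  using g0 g1 b by (intro tendsto_intros LIMSEQ_realpow_zero) auto
 hence "\<forall>\<^sub>F m in sequentially. 2 * real C * ga ^ m + (real C + 1) * (1 / real b) ^ m < min (d / 4) 1"
  using d by (intro order_tendstoD) auto
 then obtain m where m0: "2 * real C * ga ^ m + (real C + 1) * (1 / real b) ^ m < min (d / 4) 1"
  by (auto simp: eventually_sequentially)
 define i where "i = 1 / real (b ^ m)"
 have i: "0 < i" "i = (1 / real b) ^ m" using b0 by (auto simp: i_def power_divide)
 have m: "2 * real C * ga ^ m + real C * i + i < d / 4" "2 * real C * ga ^ m + real C * i < 1"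
  using m0 i unfolding i(2)[symmetric] by (auto simp: algebra_simps)
 have Ci: "0 <= real C * i" "0 <= 2 * real C * ga ^ m" using i gp[of m] by auto
 define c where "c w = f (frac (real w / real (b ^ m)), G (real w / real (b ^ m)))" for w :: nat
 have approx: "\<bar>f (frac (real (b ^ m) * x), G (real (b ^ m) * x) + et) - c (nat \<lfloor>real (b ^ (2 * m)) * x\<rfloor>)\<bar> < e / 4"
  if x: "0 <= x" "x < 1" and et: "\<bar>et\<bar> < d / 4" "\<bar>et\<bar> <= 1" for x et
  unfolding c_def
 proof (rule close)
  let ?w = "nat \<lfloor>real (b ^ (2 * m)) * x\<rfloor>"
  note fw = frac_word_close[OF x, of m, folded i_def]
  show "\<bar>frac (real (b ^ m) * x) - frac (real ?w / real (b ^ m))\<bar> < d / 2" using fw m Ci d by linarith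
  have "\<bar>G (real (b ^ m) * x) - G (real ?w / real (b ^ m))\<bar> <= real C * i"
   using G_lip[of "real (b ^ m) * x" "real ?w / real (b ^ m)"] mult_left_mono[OF fw(2), of "real C"] by linarith
  thus "\<bar>G (real (b ^ m) * x) + et - G (real ?w / real (b ^ m))\<bar> < d / 2" using m Ci i et by linarith
  show "\<bar>G (real (b ^ m) * x) + et\<bar> <= c1" using G_bound[of "real (b ^ m) * x"] et unfolding c1_def by linarith
  show "\<bar>G (real ?w / real (b ^ m))\<bar> <= c1" using G_bound[of "real ?w / real (b ^ m)"] unfolding c1_def by linarith
 qed (auto simp: frac_ge_0 less_imp_le[OF frac_lt_1])
 define avg where "avg = (\<Sum>w<b ^ (2 * m). c w) / real (b ^ (2 * m))"
 have fm [measurable]: "f \<in> borel_measurable borel" by (rule borel_measurable_continuous_onI[OF f(1)])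
 have mean: "\<bar>integral\<^sup>L om f - avg\<bar> <= e / 4"
 proof -
  have cF: "\<bar>c w\<bar> <= F" for w unfolding c_def by (rule F)
  have avg: "avg = (\<integral>z. c (nat \<lfloor>real (b ^ (2 * m)) * fst z\<rfloor>) \<partial>om)"
  proof -
   have "(\<integral>z. c (nat \<lfloor>real (b ^ (2 * m)) * fst z\<rfloor>) \<partial>om) = (\<integral>x. c (nat \<lfloor>real (b ^ (2 * m)) * x\<rfloor>) \<partial>U01)"
   by (rule marg[OF _ cF]) measurable
   also have "... = avg" unfolding avg_def using b0 by (intro integral_U01_step) simp
   finally show ?thesis by simp
  qed
  have cm: "(%z :: real \<times> real. c (nat \<lfloor>real (b ^ (2 * m)) * fst z\<rfloor>)) \<in> borel_measurable borel"
   unfolding borel_prod[symmetric] by measurable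
  have ci: "integrable om (%z. c (nat \<lfloor>real (b ^ (2 * m)) * fst z\<rfloor>))"
   by (rule integrable_om_bounded[OF cm cF])
  have fi: "integrable om (%z. f ((T ^^ m) z))" by (rule integrable_om_bounded[OF _ F]) measurable
  have "\<bar>integral\<^sup>L om f - avg\<bar> = \<bar>\<integral>z. f ((T ^^ m) z) - c (nat \<lfloor>real (b ^ (2 * m)) * fst z\<rfloor>) \<partial>om\<bar>"
   unfolding avg integral_Tn[OF fm, of m, symmetric] using ci fi by simp
  also have "... <= (\<integral>z. \<bar>f ((T ^^ m) z) - c (nat \<lfloor>real (b ^ (2 * m)) * fst z\<rfloor>)\<bar> \<partial>om)" by (rule integral_abs_bound)
  also have "... <= (\<integral>z. e / 4 \<partial>om)"
  proof (rule integral_mono_AE)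
   show "AE z in om. \<bar>f ((T ^^ m) z) - c (nat \<lfloor>real (b ^ (2 * m)) * fst z\<rfloor>)\<bar> <= e / 4"
   using supp
   proof eventually_elim
   case (elim z)
   have "\<bar>ga ^ m * (snd z - G (fst z))\<bar> <= 2 * real C * ga ^ m" using elim by (intro tn_error) auto
   hence "\<bar>ga ^ m * (snd z - G (fst z))\<bar> < d / 4" "\<bar>ga ^ m * (snd z - G (fst z))\<bar> <= 1" using m Ci i by linarith+
   moreover have "0 <= fst z" "fst z < 1" "fst z \<in> {0..<1}" using elim by auto
   ultimately show ?case unfolding T_pow[OF \<open>fst z \<in> {0..<1}\<close>] by - (rule less_imp_le[OF approx]; assumption)
   qed
  qed (use ci fi in auto)
  finally show ?thesis by (simp add: om.prob_space)
 qed
 define D where "D k = c (nat \<lfloor>real (b ^ (2 * m)) * frac (real (b ^ k) * fst z)\<rfloor>)" for k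
 have m': "2 * real C * ga ^ m < d / 4" "2 * real C * ga ^ m < 1" using m Ci i by linarith+
 have "(%k. ga ^ (m + k) * \<bar>snd z - G (fst z)\<bar>) \<longlonglongrightarrow> 0 * \<bar>snd z - G (fst z)\<bar>"
  using g0 g1 by (intro tendsto_mult tendsto_const) (simp add: power_add LIMSEQ_realpow_zero tendsto_mult_right_zero)
 hence "\<forall>\<^sub>F k in sequentially. ga ^ (m + k) * \<bar>snd z - G (fst z)\<bar> < min (d / 4 - 2 * real C * ga ^ m) (1 - 2 * real C * ga ^ m)"
  using m' by (intro order_tendstoD) auto
 then obtain k0 where k0: "!!k. k0 <= k ==> ga ^ (m + k) * \<bar>snd z - G (fst z)\<bar> < min (d / 4 - 2 * real C * ga ^ m) (1 - 2 * real C * ga ^ m)"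
  unfolding eventually_sequentially by blast
 have fD: "\<bar>f ((T ^^ (m + k)) z) - D k\<bar> <= e / 4" if k: "k0 <= k" for k
 proof -
  define x where "x = frac (real (b ^ k) * fst z)"
  define v where "v = nat \<lfloor>real (b ^ k) * fst z\<rfloor>"
  have kv: "real (b ^ k) * fst z = x + real v" using z by (simp add: x_def v_def frac_def)
  have "real (b ^ (m + k)) * fst z = real (b ^ m) * (real (b ^ k) * fst z)" by (simp add: power_add mult_ac)
  hence u: "real (b ^ (m + k)) * fst z = real (b ^ m) * x + real (b ^ m * v)" unfolding kv by (simp add: distrib_left)
  have fr: "frac (real (b ^ m) * x + real (b ^ m * v)) = frac (real (b ^ m) * x)"
   using floor_add_int[of "real (b ^ m) * x" "int (b ^ m * v)"] by (simp add: frac_def del: of_nat_mult of_nat_power)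
  \<comment> \<open>Two errors in the height: digits more than \<open>m\<close> steps in the past,
    controlled by \<open>G_tail\<close>, and the contracted initial distance to the graph of
    \<open>G\<close>.\<close>
  define et where "et = G (real (b ^ m) * x + real (b ^ m * v)) - G (real (b ^ m) * x) + ga ^ (m + k) * (snd z - G (fst z))"
  have "\<bar>ga ^ (m + k) * (snd z - G (fst z))\<bar> = ga ^ (m + k) * \<bar>snd z - G (fst z)\<bar>"
   using gp[of "m + k"] by (simp add: abs_mult)
  hence "\<bar>et\<bar> < d / 4" "\<bar>et\<bar> <= 1"
   using k0[OF k] G_tail[of "real (b ^ m) * x" m v] unfolding et_def by linarith+
  hence "\<bar>f (frac (real (b ^ m) * x), G (real (b ^ m) * x) + et) - c (nat \<lfloor>real (b ^ (2 * m)) * x\<rfloor>)\<bar> < e / 4"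
   by (intro approx) (auto simp: x_def frac_ge_0 frac_lt_1)
  moreover have "(T ^^ (m + k)) z = (frac (real (b ^ m) * x), G (real (b ^ m) * x) + et)"
   unfolding T_pow[OF z] u fr et_def by simp
  ultimately show ?thesis unfolding D_def x_def[symmetric] by simp
 qed
 have "\<forall>\<^sub>F N in sequentially. \<bar>(\<Sum>k<N. f ((T ^^ k) z)) / real N - avg\<bar> < e / 2"
 proof (rule averages_shift_close[where u="%k. f ((T ^^ k) z)" and v=D and m=m, OF _ _ fD])
  show "(%N. (\<Sum>k<N. D k) / real N) \<longlonglongrightarrow> avg" using normal unfolding D_def avg_def normal_base_def by blast
  show "\<bar>D k\<bar> <= F" "\<bar>f ((T ^^ k) z)\<bar> <= F" for k unfolding D_def c_def by (rule F)+
 qed (use e in auto)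
 then obtain N0 where N0: "!!N. N0 <= N ==> \<bar>(\<Sum>k<N. f ((T ^^ k) z)) / real N - avg\<bar> < e / 2"
  unfolding eventually_sequentially by blast
 show "\<exists>N0. \<forall>N\<ge>N0. norm ((\<Sum>k<N. f ((T ^^ k) z)) / real N - integral\<^sup>L om f) < e"
 proof (intro exI[of _ N0] allI impI)
  fix N assume "N0 <= N"
  from N0[OF this] mean e show "norm ((\<Sum>k<N. f ((T ^^ k) z)) / real N - integral\<^sup>L om f) < e"
   unfolding real_norm_def by linarith
 qed
qed

end

context solenoid_measure
begin

definition generic :: "real \<times> real => bool" where
 "generic z \<longleftrightarrow> (\<forall>f :: real \<times> real => real. continuous_on UNIV f & bounded (range f) -->
  (%n. (\<Sum>k<n. f ((T ^^ k) z)) / real n) \<longlonglongrightarrow> integral\<^sup>L om f)"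

text \<open>Whether \<open>birkhoff_continuous\<close> applies depends on the first coordinate only,
  so the exceptional points lie over a Lebesgue null set. The conclusion therefore holds both for
  area and for \<open>om\<close>, whose first marginal is Lebesgue measure.\<close>

lemma exceptional_set:
 "\<exists>N. N \<in> sets borel & emeasure lborel N = 0 & (\<forall>z. fst z \<in> {0..<1} - N --> generic z)"
proof -
 have "AE x in lborel. x \<in> {0..<1} --> normal_base b x"
  using base_expansion_normal[OF b0(1)] unfolding U01_def by (subst (asm) AE_restrict_space_iff) auto
 then obtain N where N: "N \<in> sets lborel" "emeasure lborel N = 0"
  "{x \<in> space lborel. ~ (x \<in> {0..<1} --> normal_base b x)} \<subseteq> N"
  by (elim AE_E) auto
 have "generic z" if "fst z \<in> {0..<1} - N" for z
  using that N(3) birkhoff_continuous[of z] unfolding generic_def by auto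
 thus ?thesis using N by auto
qed

lemma birkhoff_lborel: "AE z in lborel. z \<in> {0..<1} \<times> UNIV --> generic z"
proof -
 obtain N where N: "N \<in> sets borel" "emeasure lborel N = 0" "!!z. fst z \<in> {0..<1} - N ==> generic z"
  using exceptional_set by blast
 have "emeasure (lborel \<Otimes>\<^sub>M lborel) (N \<times> (UNIV :: real set)) = 0"
  using N(1,2) by (subst lborel.emeasure_pair_measure_Times) auto
 hence "N \<times> UNIV \<in> null_sets (lborel :: (real \<times> real) measure)"
  using N(1) by (intro null_setsI) (auto simp: lborel_prod intro: borel_Times)
 from AE_not_in[OF this] show ?thesis
  by eventually_elim (use N(3) in \<open>auto simp: mem_Times_iff\<close>)
qed

lemma birkhoff_om: "AE z in om. generic z"
proof -
 obtain N where N: "N \<in> sets borel" "emeasure lborel N = 0" "!!z. fst z \<in> {0..<1} - N ==> generic z"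
  using exceptional_set by blast
 have NU: "N \<times> UNIV \<in> sets om" unfolding sets_om using N(1) by (intro borel_Times) auto
 have "measure om (N \<times> UNIV) = (\<integral>z. indicator (N \<times> UNIV) z \<partial>om)" by (simp add: space_om)
 also have "... = (\<integral>z. indicator N (fst z) \<partial>om)"
  by (intro Bochner_Integration.integral_cong refl) (auto simp: indicator_def)
 also have "... = (\<integral>x. indicator N x \<partial>U01)" using N(1) by (intro marg[where B=1]) (auto simp: indicator_def)
 also have "... = 0"
 proof (rule integral_eq_zero_AE)
  have "AE x in lborel. x \<notin> N" using N by (intro AE_not_in null_setsI) auto
  hence "AE x in U01. x \<notin> N" unfolding U01_def by (subst AE_restrict_space_iff) auto
  thus "AE x in U01. indicator N x = (0 :: real)" by eventually_elim simp
 qed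
 finally have "N \<times> UNIV \<in> null_sets om" using NU by (intro null_setsI) (simp_all add: om.emeasure_eq_measure)
 from AE_not_in[OF this] supp show ?thesis
  by eventually_elim (use N(3) in \<open>auto simp: mem_Times_iff\<close>)
qed

text \<open>For invariant \<open>A\<close> the integral of \<open>indicator A * f\<close> does not
  change when \<open>f\<close> is replaced by its Birkhoff averages, and these tend to the constant
  \<open>integral\<^sup>L om f\<close>. Hence \<open>A\<close> is independent of all continuous
  functions, so of itself, and its measure equals its own square.\<close>

lemma ergodic:
 assumes A: "A \<in> sets borel" and TA: "T -` A = A"
 shows "measure om A = 0 | measure om A = 1"
proof -
 have [measurable]: "A \<in> sets borel" by (rule A)
 have TkA: "indicator A ((T ^^ k) z) = (indicator A z :: real)" for k z
 proof (induction k)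
  case (Suc k)
  have "T ((T ^^ k) z) \<in> A \<longleftrightarrow> (T ^^ k) z \<in> A" using TA by blast
  thus ?case using Suc by (simp add: indicator_def)
 qed simp
 have mA: "(\<integral>z. indicator A z \<partial>om) = measure om A" by (simp add: space_om)
 have split: "(\<integral>z. indicator A z * f z \<partial>om) = measure om A * integral\<^sup>L om f"
  if f: "continuous_on UNIV f" "bounded (range f)" for f :: "real \<times> real => real"
 proof -
  obtain F where F: "!!p. \<bar>f p\<bar> <= F" using f(2) unfolding bounded_iff by auto
  have fm [measurable]: "f \<in> borel_measurable borel" by (rule borel_measurable_continuous_onI[OF f(1)])
  have F0: "0 <= F" using F[of "(0,0)"] by linarith
  have ib: "\<bar>indicator A z * f p\<bar> <= F" for z p using F[of p] F0 by (auto simp: indicator_def)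
  have int: "integrable om (%z. indicator A z * f ((T ^^ k) z))" for k
   by (rule integrable_om_bounded[OF _ ib]) measurable
  have avg: "(\<integral>z. indicator A z * ((\<Sum>k<n. f ((T ^^ k) z)) / real n) \<partial>om) = (\<integral>z. indicator A z * f z \<partial>om)" if n: "0 < n" for n
  proof -
   have "(\<integral>z. indicator A z * ((\<Sum>k<n. f ((T ^^ k) z)) / real n) \<partial>om) = (\<integral>z. (\<Sum>k<n. indicator A z * f ((T ^^ k) z)) / real n \<partial>om)"
   by (simp add: sum_distrib_left)
   also have "... = (\<Sum>k<n. \<integral>z. indicator A z * f ((T ^^ k) z) \<partial>om) / real n"
   unfolding integral_divide_zero by (simp only: Bochner_Integration.integral_sum[OF int])
   also have "... = (\<Sum>k<n. \<integral>z. indicator A z * f z \<partial>om) / real n"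
   proof -
   have "(\<integral>z. indicator A z * f ((T ^^ k) z) \<partial>om) = (\<integral>z. indicator A z * f z \<partial>om)" for k
   using integral_Tn[of "%z. indicator A z * f z" k] unfolding TkA by simp
   thus ?thesis by simp
   qed
   finally show ?thesis using n by simp
  qed
  have "(%n. \<integral>z. indicator A z * ((\<Sum>k<n. f ((T ^^ k) z)) / real n) \<partial>om) \<longlonglongrightarrow> (\<integral>z. indicator A z * integral\<^sup>L om f \<partial>om)"
  proof (rule integral_dominated_convergence[where w="%_. F"])
   show "AE z in om. (%n. indicator A z * ((\<Sum>k<n. f ((T ^^ k) z)) / real n)) \<longlonglongrightarrow> indicator A z * integral\<^sup>L om f"
   using birkhoff_om
   proof eventually_elim
   case (elim z)
   thus ?case using f unfolding generic_def by (intro tendsto_mult tendsto_const) blast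
   qed
   show "AE z in om. norm (indicator A z * ((\<Sum>k<n. f ((T ^^ k) z)) / real n)) <= F" for n
   proof (rule AE_I2)
   fix z
   have "\<bar>\<Sum>k<n. f ((T ^^ k) z)\<bar> <= (\<Sum>k<n. F)" by (rule order_trans[OF sum_abs]) (intro sum_mono F)
   hence "\<bar>\<Sum>k<n. f ((T ^^ k) z)\<bar> / real n <= F" using F0 by (cases "n = 0") (auto simp: divide_le_eq mult.commute)
   thus "norm (indicator A z * ((\<Sum>k<n. f ((T ^^ k) z)) / real n)) <= F"
   using F0 by (auto simp: indicator_def)
   qed
  qed (auto simp: measurable_om)
  hence "(%n. \<integral>z. indicator A z * ((\<Sum>k<n. f ((T ^^ k) z)) / real n) \<partial>om) \<longlonglongrightarrow> measure om A * integral\<^sup>L om f"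
   using mA by simp
  moreover have "(%n. \<integral>z. indicator A z * ((\<Sum>k<n. f ((T ^^ k) z)) / real n) \<partial>om) \<longlonglongrightarrow> (\<integral>z. indicator A z * f z \<partial>om)"
   by (rule tendsto_eventually) (use avg in \<open>auto simp: eventually_sequentially intro!: exI[of _ 1]\<close>)
  ultimately show ?thesis by (rule LIMSEQ_unique[symmetric])
 qed
 let ?M = "density om (%z. ennreal (indicator A z))" and ?N = "density om (%z. ennreal (measure om A))"
 have fin: "finite_measure (density om (%z. ennreal (g z)))" if "g \<in> borel_measurable borel" "!!z. g z <= 1" for g :: "real \<times> real => real"
 proof (rule finite_measureI)
  have "emeasure (density om (%z. ennreal (g z))) (space om) = (\<integral>\<^sup>+z. ennreal (g z) \<partial>om)"
   using that(1) by (subst emeasure_density) (auto simp: measurable_om space_om sets_om)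
  also have "... <= (\<integral>\<^sup>+z. 1 \<partial>om)" using that(2) by (intro nn_integral_mono) (simp add: ennreal_le_1)
  finally have "emeasure (density om (%z. ennreal (g z))) (space om) <= 1" by (simp add: om.emeasure_space_1)
  thus "emeasure (density om (%z. ennreal (g z))) (space (density om (%z. ennreal (g z)))) ~= \<infinity>"
   by (auto simp: top_unique)
 qed
 have intd: "integral\<^sup>L (density om (%z. ennreal (g z))) f = (\<integral>z. g z * f z \<partial>om)"
  if "g \<in> borel_measurable borel" "f \<in> borel_measurable borel" "!!z. 0 <= g z" for g f :: "real \<times> real => real"
  using that integral_density[of f om g] by (simp add: measurable_om)
 have "?M = ?N"
 proof (rule measure_eqI_continuous)
  show "finite_measure ?M" by (rule fin) (auto simp: indicator_def)
  show "finite_measure ?N" by (rule fin) auto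
  fix f :: "real \<times> real => real" assume f: "continuous_on UNIV f" "bounded (range f)"
  have [measurable]: "f \<in> borel_measurable borel" by (rule borel_measurable_continuous_onI[OF f(1)])
  have "integral\<^sup>L ?M f = (\<integral>z. indicator A z * f z \<partial>om)" by (rule intd) auto
  moreover have "integral\<^sup>L ?N f = (\<integral>z. measure om A * f z \<partial>om)" by (rule intd) auto
  ultimately show "integral\<^sup>L ?M f = integral\<^sup>L ?N f" using split[OF f] by simp
 qed (simp_all add: sets_om)
 hence "integral\<^sup>L ?M (indicator A) = integral\<^sup>L ?N (indicator A :: _ => real)" by simp
 moreover have "integral\<^sup>L ?M (indicator A) = (\<integral>z. indicator A z * (indicator A z :: real) \<partial>om)" by (rule intd) auto
 moreover have "integral\<^sup>L ?N (indicator A) = (\<integral>z. measure om A * (indicator A z :: real) \<partial>om)" by (rule intd) auto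
 moreover have "(\<integral>z. indicator A z * (indicator A z :: real) \<partial>om) = (\<integral>z. indicator A z \<partial>om)"
  by (intro Bochner_Integration.integral_cong refl) (auto simp: indicator_def)
 ultimately have "measure om A = measure om A * measure om A" using mA by simp
 thus ?thesis by auto
qed

theorem SRB_om: "SRB_measure T om"
proof -
 have "emeasure om ({0..<1} \<times> UNIV) = 1"
 proof (rule om.emeasure_eq_1_AE)
  show "{0..<1} \<times> UNIV \<in> sets om" unfolding sets_om by (intro borel_Times) auto
  show "AE z in om. z \<in> {0..<1} \<times> UNIV" using supp by eventually_elim auto
 qed
 thus ?thesis unfolding SRB_measure_def ergodic_borel_prob_def
  using sets_om prob_om borel_T inv ergodic birkhoff_lborel[unfolded generic_def] by auto
qed

text \<open>Both measures prescribe the limits of the same averages at almost every point of a strip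
  of positive area, so their integrals of continuous functions agree.\<close>

theorem SRB_unique:
 assumes "SRB_measure T \<mu>"
 shows "\<mu> = om"
proof (rule measure_eqI_continuous)
 have mu: "sets \<mu> = sets borel" "prob_space \<mu>" using assms by (auto simp: SRB_measure_def ergodic_borel_prob_def)
 show "sets \<mu> = sets borel" "finite_measure \<mu>" "finite_measure om" "sets om = sets borel"
  using mu sets_om by (auto intro: prob_space.finite_measure om.finite_measure_axioms)
 fix f :: "real \<times> real => real" assume f: "continuous_on UNIV f" "bounded (range f)"
 have "AE z in lborel. z \<in> {0..<1} \<times> UNIV --> (%n. (\<Sum>k<n. f ((T ^^ k) z)) / real n) \<longlonglongrightarrow> integral\<^sup>L \<mu> f"
  using assms f unfolding SRB_measure_def by (elim conjE, elim eventually_mono) auto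
 hence ae: "AE z in (lborel :: (real \<times> real) measure). z \<in> {0..<1} \<times> UNIV --> integral\<^sup>L \<mu> f = integral\<^sup>L om f"
  using birkhoff_lborel[unfolded generic_def] by eventually_elim (use f in \<open>auto intro: LIMSEQ_unique\<close>)
 show "integral\<^sup>L \<mu> f = integral\<^sup>L om f"
 proof (rule ccontr)
  assume "integral\<^sup>L \<mu> f ~= integral\<^sup>L om f"
  with ae have "AE z in lborel. z \<notin> {0..<1 :: real} \<times> {0..<1 :: real}" by (auto elim!: eventually_mono)
  hence "emeasure lborel ({0..<1 :: real} \<times> {0..<1 :: real}) = 0"
   by (subst (asm) AE_iff_measurable[OF _ refl]) (auto intro!: borel_Times simp: Collect_mem_eq)
  moreover have "emeasure (lborel \<Otimes>\<^sub>M lborel) ({0..<1 :: real} \<times> {0..<1 :: real}) = 1"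
   by (subst lborel.emeasure_pair_measure_Times) auto
  ultimately show False by (simp add: lborel_prod)
 qed
qed

end

section \<open>Local dimension\<close>

lemma sum_inverse_card_fib:
 assumes "finite A"
 shows "(\<Sum>a\<in>A. 1 / rcard (fib A X a)) = rcard (X ` A)"
proof -
 have "(\<Sum>a\<in>A. 1 / rcard (fib A X a)) = (\<Sum>y\<in>X ` A. \<Sum>a\<in>{a \<in> A. X a = y}. 1 / rcard (fib A X a))"
  by (rule sum.image_gen[OF assms])
 also have "... = (\<Sum>y\<in>X ` A. 1)"
 proof (rule sum.cong[OF refl])
  fix y assume "y \<in> X ` A"
  then obtain a0 where a0: "a0 \<in> A" "y = X a0" by blast
  have "(\<Sum>a\<in>{a \<in> A. X a = y}. 1 / rcard (fib A X a)) = (\<Sum>a\<in>fib A X a0. 1 / rcard (fib A X a0))"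
   by (rule sum.cong) (auto simp: fib_def a0)
  also have "... = 1" using card_fib_pos[OF assms a0(1), of X] by simp
  finally show "(\<Sum>a\<in>{a \<in> A. X a = y}. 1 / rcard (fib A X a)) = 1" .
 qed
 finally show ?thesis by simp
qed

context solenoid_measure
begin

text \<open>Approximates the mass that the fibre measure over \<open>fst z\<close> gives to the
  interval of radius \<open>c * ga ^ n\<close> about \<open>snd z\<close>.\<close>

definition Q :: "nat => nat => real \<times> real => real" where
 "Q c n z = rcard {w \<in> {..<b ^ n}. \<bar>G (fst z + real w) - snd z\<bar> <= real c * ga ^ n} / real (b ^ n)"

lemma Q_sum: "Q c n z = (\<Sum>w<b ^ n. if \<bar>G (fst z + real w) - snd z\<bar> <= real c * ga ^ n then 1 else 0) / real (b ^ n)"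
 by (simp add: Q_def sum.inter_filter[symmetric])

lemma Nb_sum: "Nb c x n w = (\<Sum>w'<b ^ n. if \<bar>Gw x w' - Gw x w\<bar> <= real c * ga ^ n then 1 else 0) / real (b ^ n)"
 by (simp add: Nb_def sum.inter_filter[symmetric])

lemma borel_Q [measurable]: "Q c n \<in> borel_measurable borel"
 unfolding Q_sum borel_prod[symmetric] by measurable

lemma borel_Nb [measurable]: "(%x. Nb c x n w) \<in> borel_measurable borel"
 unfolding Nb_sum by measurable

lemma bn: "0 < b ^ n" "0 < real (b ^ n)" using b0 by auto

lemma ratio_bounds:
 "rcard {w \<in> {..<b ^ n}. P w} / real (b ^ n) <= 1" "0 <= rcard {w \<in> {..<b ^ n}. P w} / real (b ^ n)"
 "1 / (rcard {w \<in> {..<b ^ n}. P w} / real (b ^ n)) <= real (b ^ n)"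
proof -
 have "card {w \<in> {..<b ^ n}. P w} <= card {..<b ^ n}" by (intro card_mono) auto
 thus "rcard {w \<in> {..<b ^ n}. P w} / real (b ^ n) <= 1" using bn[of n] by (simp add: divide_le_eq_1 del: of_nat_power)
 show "0 <= rcard {w \<in> {..<b ^ n}. P w} / real (b ^ n)" by simp
 show "1 / (rcard {w \<in> {..<b ^ n}. P w} / real (b ^ n)) <= real (b ^ n)"
  using bn[of n] by (cases "card {w \<in> {..<b ^ n}. P w} = 0") (auto simp: divide_le_eq simp del: of_nat_power)
qed

lemma integral_words:
 fixes f :: "nat => real => real"
 assumes [measurable]: "!!w. f w \<in> borel_measurable borel" and B: "!!w x. \<bar>f w x\<bar> <= B"
 shows "(\<integral>z. f (nat \<lfloor>real (b ^ n) * fst z\<rfloor>) (frac (real (b ^ n) * fst z)) \<partial>om) = (\<Sum>w<b ^ n. \<integral>x. f w x \<partial>U01) / real (b ^ n)"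
  "integrable om (%z. f (nat \<lfloor>real (b ^ n) * fst z\<rfloor>) (frac (real (b ^ n) * fst z)))"
proof -
 have m: "(%x. f (nat \<lfloor>real (b ^ n) * x\<rfloor>) (frac (real (b ^ n) * x))) \<in> borel_measurable borel"
  by (rule measurable_compose_countable[where g="%x. nat \<lfloor>real (b ^ n) * x\<rfloor>"]) measurable
 have "(\<integral>z. f (nat \<lfloor>real (b ^ n) * fst z\<rfloor>) (frac (real (b ^ n) * fst z)) \<partial>om) = (\<integral>x. f (nat \<lfloor>real (b ^ n) * x\<rfloor>) (frac (real (b ^ n) * x)) \<partial>U01)"
  by (rule marg[OF m B])
 thus "(\<integral>z. f (nat \<lfloor>real (b ^ n) * fst z\<rfloor>) (frac (real (b ^ n) * fst z)) \<partial>om) = (\<Sum>w<b ^ n. \<integral>x. f w x \<partial>U01) / real (b ^ n)"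
  using integral_U01_blocks[OF bn(1)[of n], of f B] B by simp
 have "(fst :: real \<times> real => real) \<in> borel_measurable borel" unfolding borel_prod[symmetric] by measurable
 from measurable_compose[OF this m]
 show "integrable om (%z. f (nat \<lfloor>real (b ^ n) * fst z\<rfloor>) (frac (real (b ^ n) * fst z)))"
  by (rule integrable_om_bounded) (rule B)
qed

lemma orbit_form:
 assumes "fst z \<in> {0..<1} & \<bar>snd z\<bar> <= real C"
 obtains x w et where "x = frac (real (b ^ n) * fst z)" "w = nat \<lfloor>real (b ^ n) * fst z\<rfloor>" "0 <= x" "x < 1" "w < b ^ n"
  "\<bar>et\<bar> <= 2 * real C * ga ^ n" "(T ^^ n) z = (x, Gw x w + et)"
proof -
 define x where "x = frac (real (b ^ n) * fst z)"
 define w where "w = nat \<lfloor>real (b ^ n) * fst z\<rfloor>"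
 have xw: "real (b ^ n) * fst z = x + real w" using assms by (simp add: x_def w_def frac_def)
 have "real (b ^ n) * fst z < real (b ^ n) * 1" using assms bn[of n] by (intro mult_strict_left_mono) auto
 hence "w < b ^ n" using assms unfolding w_def by (simp add: nat_less_iff floor_less_iff del: of_nat_power)
 moreover have "(T ^^ n) z = (x, Gw x w + ga ^ n * (snd z - G (fst z)))"
  unfolding T_pow[OF conjunct1[OF assms]] prod.inject by (intro conjI, rule x_def[symmetric], simp only: xw)
 moreover have "\<bar>ga ^ n * (snd z - G (fst z))\<bar> <= 2 * real C * ga ^ n" using assms by (intro tn_error) simp
 ultimately show thesis using x_def w_def by (intro that[of x w]) (auto simp: frac_ge_0 frac_lt_1)
qed

text \<open>By invariance a point of \<open>om\<close> may be replaced by its image under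
  \<open>T ^^ n\<close>. That image is \<open>(x, G (x + w) + et)\<close> with \<open>x\<close>
  uniform, \<open>w\<close> an independent uniform word of length \<open>n\<close>, and
  \<open>et\<close> small, so that integrals over \<open>om\<close> become averages over
  words.\<close>

lemma integral_le_words:
 fixes h :: "real \<times> real => real"
 assumes h: "h \<in> borel_measurable borel" "!!z. \<bar>h z\<bar> <= B"
  and f: "!!w. f w \<in> borel_measurable borel" "!!w x. \<bar>f w x\<bar> <= B'"
  and le: "!!x w et. 0 <= x ==> x < 1 ==> w < b ^ n ==> \<bar>et\<bar> <= 2 * real C * ga ^ n ==> h (x, Gw x w + et) <= f w x"
 shows "integral\<^sup>L om h <= (\<integral>x. (\<Sum>w<b ^ n. f w x) / real (b ^ n) \<partial>U01)"
proof -
 note I = integral_words[of f B' n, OF f]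
 have [measurable]: "h \<in> borel_measurable borel" by fact
 have "integral\<^sup>L om h = (\<integral>z. h ((T ^^ n) z) \<partial>om)" by (rule integral_Tn[OF h(1), symmetric])
 also have "... <= (\<integral>z. f (nat \<lfloor>real (b ^ n) * fst z\<rfloor>) (frac (real (b ^ n) * fst z)) \<partial>om)"
 proof (rule integral_mono_AE[OF _ I(2)])
  show "integrable om (%z. h ((T ^^ n) z))" by (rule integrable_om_bounded[OF _ h(2)]) measurable
  show "AE z in om. h ((T ^^ n) z) <= f (nat \<lfloor>real (b ^ n) * fst z\<rfloor>) (frac (real (b ^ n) * fst z))"
   using supp
  proof eventually_elim
   case (elim z)
   show ?case by (rule orbit_form[OF elim, of n]) (use le in auto)
  qed
 qed
 also have "... = (\<Sum>w<b ^ n. \<integral>x. f w x \<partial>U01) / real (b ^ n)" by (rule I(1))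
 also have "... = (\<integral>x. (\<Sum>w<b ^ n. f w x) / real (b ^ n) \<partial>U01)"
  unfolding integral_divide_zero by (subst Bochner_Integration.integral_sum) (auto intro: integrable_U01_bounded[OF f])
 finally show ?thesis .
qed

lemma integral_ge_words:
 fixes h :: "real \<times> real => real"
 assumes h: "h \<in> borel_measurable borel" "!!z. \<bar>h z\<bar> <= B"
  and f: "!!w. f w \<in> borel_measurable borel" "!!w x. \<bar>f w x\<bar> <= B'"
  and le: "!!x w et. 0 <= x ==> x < 1 ==> w < b ^ n ==> \<bar>et\<bar> <= 2 * real C * ga ^ n ==> f w x <= h (x, Gw x w + et)"
 shows "(\<integral>x. (\<Sum>w<b ^ n. f w x) / real (b ^ n) \<partial>U01) <= integral\<^sup>L om h"
 using integral_le_words[of "%z. - h z" B "%w x. - f w x" B' n] h f le by (simp add: sum_negf)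

lemma G_shift:
 assumes "\<bar>x - x'\<bar> <= r"
 shows "\<bar>Gw x w - Gw x' w\<bar> <= real C * r"
 using G_lip[of "x + real w" "x' + real w"] mult_left_mono[OF assms, of "real C"] by simp

lemma measure_eq_integral: "A \<in> sets borel ==> measure om A = (\<integral>z. indicator A z \<partial>om)"
 by (simp add: space_om)

text \<open>Over a horizontal interval of radius \<open>ga ^ n\<close> the point of each word moves
  by at most \<open>C * ga ^ n\<close>, so a ball is comparable with a product of intervals. The
  constant \<open>1 + 3 * C\<close> adds the radius, this Lipschitz error and the tail
  \<open>2 * C\<close>.\<close>

lemma measure_ball_le: "measure om (ball z0 (ga ^ n)) <= 2 * ga ^ n * Q (1 + 3 * C) n z0"
proof -
 obtain x0 y0 where z0: "z0 = (x0, y0)" by (cases z0)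
 define r where "r = ga ^ n"
 have r: "0 < r" using gp by (simp add: r_def)
 define q where "q w = (if \<bar>Gw x0 w - y0\<bar> <= real (1 + 3 * C) * r then 1 else 0 :: real)" for w :: nat
 define f where "f w x = q w * indicator {x0 - r<..<x0 + r} x" for w x
 have fm: "f w \<in> borel_measurable borel" for w unfolding f_def by measurable
 have f1: "\<bar>f w x\<bar> <= 1" for w x by (simp add: f_def q_def indicator_def)
 have "measure om (ball z0 r) = (\<integral>z. indicator (ball z0 r) z \<partial>om)" by (rule measure_eq_integral) simp
 also have "... <= (\<integral>x. (\<Sum>w<b ^ n. f w x) / real (b ^ n) \<partial>U01)"
 proof (rule integral_le_words[where B=1, OF _ _ fm f1])
  fix x w et assume et: "\<bar>et\<bar> <= 2 * real C * ga ^ n"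
  show "indicator (ball z0 r) (x, Gw x w + et) <= f w x"
  proof (cases "(x, Gw x w + et) \<in> ball z0 r")
   case True
   hence d: "dist (x0, y0) (x, Gw x w + et) < r" by (simp add: z0)
   have xx: "\<bar>x0 - x\<bar> < r" using dist_fst_le[of "(x0, y0)" "(x, Gw x w + et)"] d by (simp add: dist_real_def)
   have yy: "\<bar>y0 - (Gw x w + et)\<bar> < r" using dist_snd_le[of "(x0, y0)" "(x, Gw x w + et)"] d by (simp add: dist_real_def)
   have "\<bar>Gw x0 w - y0\<bar> <= real C * r + 2 * real C * r + r"
   using G_shift[OF less_imp_le[OF xx], of w] yy et unfolding r_def[symmetric] by linarith
   hence "q w = 1" by (simp add: q_def algebra_simps)
   moreover have "x \<in> {x0 - r<..<x0 + r}" using xx by auto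
   ultimately show ?thesis unfolding f_def by (simp add: indicator_def)
  qed (simp add: f_def q_def)
 qed (auto simp: indicator_def)
 also have "... = (\<Sum>w<b ^ n. q w * (\<integral>x. indicator {x0 - r<..<x0 + r} x \<partial>U01)) / real (b ^ n)"
  unfolding integral_divide_zero Bochner_Integration.integral_sum[OF integrable_U01_bounded[OF fm f1]]
  unfolding f_def integral_mult_right_zero ..
 also have "... <= (\<Sum>w<b ^ n. q w * (2 * r)) / real (b ^ n)"
 proof (intro divide_right_mono sum_mono mult_left_mono)
  have "(\<integral>x. indicator {x0 - r<..<x0 + r} x \<partial>U01) <= (\<integral>x. indicator {x0 - r<..<x0 + r} x \<partial>lborel :: real)"
   unfolding integral_U01 using r by (intro integral_mono_AE' integrable_real_indicator) (auto simp: indicator_def)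
  also have "... = 2 * r" using r by simp
  finally show "(\<integral>x. indicator {x0 - r<..<x0 + r} x \<partial>U01) <= 2 * r" .
 qed (auto simp: q_def)
 also have "... = 2 * r * Q (1 + 3 * C) n z0"
  unfolding Q_sum q_def z0 r_def fst_conv snd_conv sum_distrib_right[symmetric] by simp
 finally show ?thesis by (simp add: r_def)
qed

lemma measure_ball_ge:
 assumes x0: "fst z0 \<in> {0..<1}"
 shows "ga ^ n / 2 * Q (4 * C) n z0 <= measure om (ball z0 (16 * real C * ga ^ n))"
proof -
 obtain x0 y0 where z0: "z0 = (x0, y0)" by (cases z0)
 define r where "r = ga ^ n"
 have r: "0 < r" "r <= 1" using gp by (auto simp: r_def)
 have C: "1 <= real C" using C1 by simp
 \<comment> \<open>A one-sided interval at \<open>x0\<close>, on the side on which it stays inside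
   the unit interval.\<close>
 define J where "J = (if x0 <= 1 / 2 then {x0..<x0 + r / 2} else {x0 - r / 2<..x0})"
 have J: "J \<in> sets borel" "J \<subseteq> {0..<1}" "measure lborel J = r / 2"
  using x0 r by (auto simp: J_def z0)
 have J4: "\<bar>x - x0\<bar> <= r" if "x \<in> J" for x
  using that r by (auto simp: J_def abs_le_iff split: if_splits)
 define q where "q w = (if \<bar>Gw x0 w - y0\<bar> <= real (4 * C) * r then 1 else 0 :: real)" for w :: nat
 define f where "f w x = q w * indicator J x" for w x
 have fm: "f w \<in> borel_measurable borel" for w unfolding f_def using J(1) by measurable
 have f1: "\<bar>f w x\<bar> <= 1" for w x by (simp add: f_def q_def indicator_def)
 have "ga ^ n / 2 * Q (4 * C) n z0 = (\<Sum>w<b ^ n. q w * (r / 2)) / real (b ^ n)"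
  unfolding Q_sum q_def z0 r_def fst_conv snd_conv sum_distrib_right[symmetric] by simp
 also have "... = (\<integral>x. (\<Sum>w<b ^ n. f w x) / real (b ^ n) \<partial>U01)"
 proof -
  have "(\<integral>x. indicator J x \<partial>U01) = (\<integral>x. indicator J x \<partial>lborel :: real)"
   unfolding integral_U01 using J(2) by (intro Bochner_Integration.integral_cong) (auto simp: indicator_def)
  also have "... = r / 2" using J by simp
  finally have e: "(\<integral>x. indicator J x \<partial>U01) = r / 2" .
  show ?thesis unfolding integral_divide_zero Bochner_Integration.integral_sum[OF integrable_U01_bounded[OF fm f1]]
   unfolding f_def integral_mult_right_zero e ..
 qed
 also have "... <= (\<integral>z. indicator (ball z0 (16 * real C * r)) z \<partial>om)"
 proof (rule integral_ge_words[where B=1, OF _ _ fm f1])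
  fix x w et assume et: "\<bar>et\<bar> <= 2 * real C * ga ^ n"
  show "f w x <= indicator (ball z0 (16 * real C * r)) (x, Gw x w + et)"
  proof (cases "x \<in> J & \<bar>Gw x0 w - y0\<bar> <= real (4 * C) * r")
   case True
   hence xx: "\<bar>x - x0\<bar> <= r" using J4 by blast
   have Cr: "r <= real C * r" using mult_right_mono[OF C, of r] r by simp
   have "\<bar>y0 - (Gw x w + et)\<bar> <= 7 * (real C * r)"
   using G_shift[OF xx, of w] True et unfolding r_def[symmetric] of_nat_mult by linarith
   moreover have "dist (x0, y0) (x, Gw x w + et) <= \<bar>x0 - x\<bar> + \<bar>y0 - (Gw x w + et)\<bar>"
   using sqrt_sum_squares_le_sum_abs[of "x0 - x" "y0 - (Gw x w + et)"] by (simp add: dist_Pair_Pair dist_real_def)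
   ultimately have "dist (x0, y0) (x, Gw x w + et) < 16 * (real C * r)" using xx Cr r by linarith
   hence "(x, Gw x w + et) \<in> ball z0 (16 * real C * r)" unfolding z0 by (simp add: mult.assoc)
   thus ?thesis by (simp add: f_def q_def indicator_def)
  qed (auto simp: f_def q_def)
 qed (auto simp: indicator_def)
 also have "... = measure om (ball z0 (16 * real C * r))" by (rule measure_eq_integral[symmetric]) simp
 finally show ?thesis by (simp add: r_def)
qed

lemma Q_le_Nb:
 assumes "\<bar>et\<bar> <= 2 * real C * ga ^ n"
 shows "Q c n (x, Gw x w + et) <= Nb (c + 2 * C) x n w"
proof -
 have "{w' \<in> {..<b ^ n}. \<bar>Gw x w' - (Gw x w + et)\<bar> <= real c * ga ^ n} \<subseteq>
   {w' \<in> {..<b ^ n}. \<bar>Gw x w' - Gw x w\<bar> <= real (c + 2 * C) * ga ^ n}"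
  using assms by (auto simp: distrib_right abs_le_iff)
 from card_mono[OF _ this] show ?thesis unfolding Q_def Nb_def by (intro divide_right_mono) auto
qed

lemma Nb_le_Q:
 assumes "\<bar>et\<bar> <= 2 * real C * ga ^ n"
 shows "Nb (2 * C) x n w <= Q (4 * C) n (x, Gw x w + et)"
proof -
 have "{w' \<in> {..<b ^ n}. \<bar>Gw x w' - Gw x w\<bar> <= real (2 * C) * ga ^ n} \<subseteq>
  {w' \<in> {..<b ^ n}. \<bar>Gw x w' - (Gw x w + et)\<bar> <= real (4 * C) * ga ^ n}"
  using assms by (auto simp: abs_le_iff)
 from card_mono[OF _ this] show ?thesis unfolding Q_def Nb_def by (intro divide_right_mono) auto
qed

lemma Nb_pos: assumes "w < b ^ n" shows "1 / real (b ^ n) <= Nb c x n w"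
proof -
 have "card {w} <= card {w' \<in> {..<b ^ n}. \<bar>Gw x w' - Gw x w\<bar> <= real c * ga ^ n}"
  using assms gp[of n] by (intro card_mono) auto
 thus ?thesis unfolding Nb_def by (intro divide_right_mono) auto
qed

lemma Q_moment:
 assumes s: "0 < s" and c: "1 <= c" and P: "!!x. 0 <= x ==> x <= 1 ==> Ph s x n <= p"
 shows "(\<integral>z. Q c n z powr s \<partial>om) <= 2 * (4 * real (c + 2 * C) + 1) powr s * p"
proof -
 define c' where "c' = c + 2 * C"
 define f where "f w x = Nb c' x n w powr s" for w x
 have fm: "f w \<in> borel_measurable borel" for w unfolding f_def by measurable
 have pw: "\<bar>t powr s\<bar> <= 1" if "0 <= t" "t <= 1" for t :: real using powr_mono2[of s t 1] that s by simp
 have f1: "\<bar>f w x\<bar> <= 1" for w x unfolding f_def Nb_def by (intro pw ratio_bounds)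
 have Q1: "\<bar>Q c n z powr s\<bar> <= 1" for z unfolding Q_def by (intro pw ratio_bounds)
 have "(\<integral>z. Q c n z powr s \<partial>om) <= (\<integral>x. (\<Sum>w<b ^ n. f w x) / real (b ^ n) \<partial>U01)"
 proof (rule integral_le_words[OF _ Q1 fm f1])
  fix x w et assume "\<bar>et\<bar> <= 2 * real C * ga ^ n"
  from Q_le_Nb[OF this] show "Q c n (x, Gw x w + et) powr s <= f w x"
   unfolding f_def c'_def using s by (intro powr_mono2) (auto simp: Q_def)
 qed measurable
 also have "... <= (\<integral>x. 2 * (4 * real c' + 1) powr s * p \<partial>U01)"
 proof (rule integral_mono)
  show "integrable U01 (%x. (\<Sum>w<b ^ n. f w x) / real (b ^ n))"
   by (intro integrable_divide Bochner_Integration.integrable_sum integrable_U01_bounded[OF fm f1])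
  fix x assume "x \<in> space U01"
  hence x: "0 <= x" "x <= 1" by (auto simp: space_U01)
  have "(\<Sum>w<b ^ n. f w x) / real (b ^ n) <= 2 * (4 * real c' + 1) powr s * Ph s x n"
   unfolding f_def using s c by (intro Nb_moment) (auto simp: c'_def)
  also have "... <= 2 * (4 * real c' + 1) powr s * p" using P[OF x] by (intro mult_left_mono) auto
  finally show "(\<Sum>w<b ^ n. f w x) / real (b ^ n) <= 2 * (4 * real c' + 1) powr s * p" .
 qed simp
 finally show ?thesis by (simp add: U01.prob_space c'_def)
qed

text \<open>The mean reciprocal of the cell mass is the number of occupied cells, and the points
  fill an interval of length at most \<open>2 * C\<close>. This will bound the fibre dimension by
  1.\<close>

lemma Q_inverse_moment: "(\<integral>z. 1 / Q (4 * C) n z \<partial>om) <= (2 * real C + 2) / ga ^ n"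
proof -
 define f where "f w x = 1 / Nb (2 * C) x n w" for w x
 have fm: "f w \<in> borel_measurable borel" for w unfolding f_def by measurable
 have f1: "\<bar>f w x\<bar> <= real (b ^ n)" for w x
  unfolding f_def using ratio_bounds(3) by (simp add: Nb_def del: of_nat_power)
 have Q1: "\<bar>1 / Q (4 * C) n z\<bar> <= real (b ^ n)" for z using ratio_bounds(3) by (simp add: Q_def del: of_nat_power)
 have "(\<integral>z. 1 / Q (4 * C) n z \<partial>om) <= (\<integral>x. (\<Sum>w<b ^ n. f w x) / real (b ^ n) \<partial>U01)"
 proof (rule integral_le_words[OF _ Q1 fm f1])
  fix x w et assume et: "\<bar>et\<bar> <= 2 * real C * ga ^ n" and w: "w < b ^ n"
  \<comment> \<open>Positivity is essential for comparing reciprocals, as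
    \<open>1 / 0 = 0\<close>.\<close>
  have "0 < Nb (2 * C) x n w" using Nb_pos[OF w, of "2 * C" x] bn(2)[of n] by (smt (verit) divide_pos_pos)
  thus "1 / Q (4 * C) n (x, Gw x w + et) <= f w x"
   unfolding f_def using Nb_le_Q[OF et, of x w] by (intro frac_le) auto
 qed measurable
 also have "... <= (\<integral>x. (2 * real C + 2) / ga ^ n \<partial>U01)"
 proof (rule integral_mono)
  show "integrable U01 (%x. (\<Sum>w<b ^ n. f w x) / real (b ^ n))"
   by (intro integrable_divide Bochner_Integration.integrable_sum integrable_U01_bounded[OF fm f1])
  fix x
  define X where "X w = gcell n (Gw x w)" for w :: nat
  have "f w x <= real (b ^ n) * (1 / rcard (fib {..<b ^ n} X w))" if w: "w < b ^ n" for w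
  proof -
   have "fib {..<b ^ n} X w \<subseteq> {w' \<in> {..<b ^ n}. \<bar>Gw x w' - Gw x w\<bar> <= real (2 * C) * ga ^ n}"
   proof
   fix w' assume w': "w' \<in> fib {..<b ^ n} X w"
   have "gcell n (Gw x w') = gcell n (Gw x w)" using w' by (simp add: fib_def X_def)
   hence "\<bar>Gw x w' / ga ^ n - Gw x w / ga ^ n\<bar> <= 1" by linarith
   hence "\<bar>Gw x w' - Gw x w\<bar> / ga ^ n <= 1"
   unfolding diff_divide_distrib[symmetric] abs_divide using gp(1)[of n] by simp
   hence "\<bar>Gw x w' - Gw x w\<bar> <= 1 * ga ^ n" using gp(1)[of n] by (simp add: divide_le_eq)
   also have "... <= real (2 * C) * ga ^ n" using C1 gp(1)[of n] by (intro mult_right_mono) auto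
   finally show "w' \<in> {w' \<in> {..<b ^ n}. \<bar>Gw x w' - Gw x w\<bar> <= real (2 * C) * ga ^ n}"
   using w' by (auto simp: fib_def)
   qed
   from card_mono[OF _ this] have "rcard (fib {..<b ^ n} X w) / real (b ^ n) <= Nb (2 * C) x n w"
   unfolding Nb_def by (intro divide_right_mono) auto
   moreover have "0 < rcard (fib {..<b ^ n} X w) / real (b ^ n)"
   using card_fib_pos[of "{..<b ^ n}" w X] w bn(2)[of n] by simp
   ultimately have "f w x <= 1 / (rcard (fib {..<b ^ n} X w) / real (b ^ n))" unfolding f_def by (intro frac_le) auto
   thus ?thesis by simp
  qed
  hence "(\<Sum>w<b ^ n. f w x) <= (\<Sum>w<b ^ n. real (b ^ n) * (1 / rcard (fib {..<b ^ n} X w)))" by (intro sum_mono) auto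
  also have "... = real (b ^ n) * rcard (X ` {..<b ^ n})"
   unfolding sum_distrib_left[symmetric] sum_inverse_card_fib[OF finite_lessThan] ..
  finally have "(\<Sum>w<b ^ n. f w x) / real (b ^ n) <= rcard (X ` {..<b ^ n})"
   using bn(2)[of n] by (simp add: divide_le_eq mult.commute)
  also have "... <= (2 * real C + 2) / ga ^ n"
  proof -
   define M where "M = nat \<lceil>2 * real C / ga ^ n\<rceil>"
   have M: "2 * real C / ga ^ n <= real M" "real M < 2 * real C / ga ^ n + 1"
   proof -
   have "real M = real_of_int \<lceil>2 * real C / ga ^ n\<rceil>" unfolding M_def using gp(1)[of n] by simp
   thus "2 * real C / ga ^ n <= real M" "real M < 2 * real C / ga ^ n + 1"
   using ceiling_correct[of "2 * real C / ga ^ n"] by linarith+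
   qed
   have "card ((%w. gcell n (Gw x w)) ` {..<b ^ n}) <= M + 1"
   proof (rule card_floor_image_le)
   fix w w'
   have "Gw x w - Gw x w' <= 2 * real C" using G_bound[of "x + real w"] G_bound[of "x + real w'"] by linarith
   hence "(Gw x w - Gw x w') / ga ^ n <= 2 * real C / ga ^ n" using gp(1)[of n] by (intro divide_right_mono) auto
   thus "Gw x w / ga ^ n - Gw x w' / ga ^ n <= real M" using M by (simp add: diff_divide_distrib)
   qed simp
   hence "rcard (X ` {..<b ^ n}) <= 2 * real C / ga ^ n + 2" unfolding X_def using M by linarith
   also have "... <= (2 * real C + 2) / ga ^ n" using gp[of n] by (simp add: add_divide_distrib le_divide_eq)
   finally show ?thesis .
  qed
  finally show "(\<Sum>w<b ^ n. f w x) / real (b ^ n) <= (2 * real C + 2) / ga ^ n" .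
 qed simp
 finally show ?thesis by (simp add: U01.prob_space)
qed

end

context solenoid_measure
begin

text \<open>The moments of \<open>Q\<close> decay exponentially by \<open>Ph_decay\<close> at rate
  \<open>\<beta> - ep / 2\<close>; compared with the claimed rate \<open>\<beta> - ep\<close> this
  leaves a geometric series for Borel-Cantelli. The radii are restricted to exponents that are
  multiples of the block length \<open>m\<close>.\<close>

lemma AE_measure_ball_le:
 assumes "0 < ep"
 shows "\<exists>m\<ge>1. AE z in om. \<forall>\<^sub>F l in sequentially.
  measure om (ball z (ga ^ (l * m))) <= 2 * ga ^ (l * m) * 2 powr (- ((\<beta> - ep) * real (l * m)))"
proof -
 obtain m s where m: "1 <= m" and s: "0 < s" "s <= 1"
  and P: "!!x l. 0 <= x ==> x <= 1 ==> Ph s x (l * m) <= 2 powr (- (s * (\<beta> - ep / 2) * real (l * m)))"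
  using Ph_decay[of "ep / 2"] assms by auto
 define c where "c = 1 + 3 * C"
 define K where "K = 2 * (4 * real (c + 2 * C) + 1) powr s"
 define V where "V l z = Q c (l * m) z powr s * 2 powr (s * ((\<beta> - ep) * real (l * m)))" for l z
 have Vm [measurable]: "V l \<in> borel_measurable borel" for l unfolding V_def by measurable
 have Q01: "0 <= Q c n z" "Q c n z <= 1" for n z unfolding Q_def by (rule ratio_bounds)+
 have "AE z in om. (%l. V l z) \<longlonglongrightarrow> 0"
 proof (rule AE_tendsto_zero_of_summable)
  show "V l \<in> borel_measurable om" for l by (simp add: measurable_om)
  show "0 <= V l z" for l z by (simp add: V_def)
  show "integrable om (V l)" for l
  proof (rule integrable_om_bounded[OF Vm])
   fix z
   have "Q c (l * m) z powr s <= 1 powr s" using Q01 s by (intro powr_mono2) auto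
   thus "\<bar>V l z\<bar> <= 2 powr (s * ((\<beta> - ep) * real (l * m)))" by (simp add: V_def abs_mult)
  qed
  show "(\<integral>z. V l z \<partial>om) <= K * (2 powr (- (s * (ep / 2) * real m))) ^ l" for l
  proof -
   have "(\<integral>z. V l z \<partial>om) = (\<integral>z. Q c (l * m) z powr s \<partial>om) * 2 powr (s * ((\<beta> - ep) * real (l * m)))"
   unfolding V_def by (rule integral_mult_left_zero)
   also have "... <= K * 2 powr (- (s * (\<beta> - ep / 2) * real (l * m))) * 2 powr (s * ((\<beta> - ep) * real (l * m)))"
   unfolding K_def using s P by (intro mult_right_mono Q_moment) (auto simp: c_def)
   also have "... = K * 2 powr (- (s * (ep / 2) * real m) * real l)"
   by (simp add: powr_add[symmetric] algebra_simps)
   also have "... = K * (2 powr (- (s * (ep / 2) * real m))) ^ l"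
   by (simp add: powr_realpow[symmetric] powr_powr)
   finally show ?thesis .
  qed
  have "0 < s * (ep / 2) * real m" using s assms m by simp
  hence "2 powr (- (s * (ep / 2) * real m)) < 2 powr 0" by (intro powr_less_mono) auto
  thus "summable (%l. K * (2 powr (- (s * (ep / 2) * real m))) ^ l)" by (intro summable_mult summable_geometric) simp
 qed
 hence "AE z in om. \<forall>\<^sub>F l in sequentially. measure om (ball z (ga ^ (l * m))) <= 2 * ga ^ (l * m) * 2 powr (- ((\<beta> - ep) * real (l * m)))"
 proof eventually_elim
  case (elim z)
  hence "\<forall>\<^sub>F l in sequentially. V l z < 1" by (rule order_tendstoD) simp
  thus ?case
  proof eventually_elim
   case (elim l)
   define t where "t = (\<beta> - ep) * real (l * m)"
   have "Q c (l * m) z * 2 powr t <= 1"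
   proof (rule ccontr)
   assume "~ ?thesis"
   hence "1 powr s <= (Q c (l * m) z * 2 powr t) powr s" using s by (intro powr_mono2) auto
   also have "... = V l z" using Q01 by (simp add: V_def t_def powr_mult powr_powr mult_ac)
   finally show False using elim by simp
   qed
   hence "Q c (l * m) z <= 2 powr (- t)" by (simp add: powr_minus field_simps)
   hence "2 * ga ^ (l * m) * Q c (l * m) z <= 2 * ga ^ (l * m) * 2 powr (- t)" using gp[of "l * m"] by (intro mult_left_mono) auto
   thus ?case using measure_ball_le[of z "l * m"] unfolding c_def t_def by linarith
  qed
 qed
 thus ?thesis using m by blast
qed

text \<open>The image under \<open>T ^^ n\<close> lies within \<open>2 * C * ga ^ n\<close> of the
  point of some word, and the width \<open>4 * C\<close> makes sure that this word is counted.
  Invariance removes \<open>T ^^ n\<close>. It bounds the fibre dimension by log b / log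
  (1/\<gamma>).\<close>

lemma AE_Q_ge: "AE z in om. \<forall>n. 1 / real (b ^ n) <= Q (4 * C) n z"
 unfolding AE_all_countable
proof
 fix n
 have "AE z in om. 1 / real (b ^ n) <= Q (4 * C) n ((T ^^ n) z)"
  using supp
 proof eventually_elim
  case (elim z)
  obtain x w et where o: "x = frac (real (b ^ n) * fst z)" "w = nat \<lfloor>real (b ^ n) * fst z\<rfloor>" "0 <= x" "x < 1" "w < b ^ n"
   "\<bar>et\<bar> <= 2 * real C * ga ^ n" "(T ^^ n) z = (x, Gw x w + et)" using orbit_form[OF elim] by metis
  show ?case unfolding o(7) using Nb_pos[OF o(5), of "2 * C" x] Nb_le_Q[OF o(6), of x w] by (rule order_trans)
 qed
 moreover have "Measurable.pred borel (%z. 1 / real (b ^ n) <= Q (4 * C) n z)" by measurable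
 ultimately show "AE z in om. 1 / real (b ^ n) <= Q (4 * C) n z" by (subst AE_Tn[of _ n])
qed

lemma AE_Q_ge_eventually:
 assumes "0 < ep"
 shows "AE z in om. \<forall>\<^sub>F n in sequentially. (ga ^ n) powr (1 + ep) <= Q (4 * C) n z"
proof -
 define V where "V n z = 1 / Q (4 * C) n z * (ga ^ n) powr (1 + ep)" for n z
 have Vm [measurable]: "V l \<in> borel_measurable borel" for l unfolding V_def by measurable
 have "AE z in om. (%n. V n z) \<longlonglongrightarrow> 0"
 proof (rule AE_tendsto_zero_of_summable)
  show "V l \<in> borel_measurable om" for l by (simp add: measurable_om)
  show "0 <= V l z" for l z by (simp add: V_def Q_def)
  show "integrable om (V n)" for n
  proof (rule integrable_om_bounded[OF Vm])
   fix z
   have "1 / Q (4 * C) n z <= real (b ^ n)" unfolding Q_def by (rule ratio_bounds)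
   moreover have "0 <= 1 / Q (4 * C) n z" by (simp add: Q_def)
   ultimately show "\<bar>V n z\<bar> <= real (b ^ n) * (ga ^ n) powr (1 + ep)"
   unfolding V_def abs_mult by (intro mult_mono) auto
  qed
  show "(\<integral>z. V n z \<partial>om) <= (2 * real C + 2) * (ga powr ep) ^ n" for n
  proof -
   have "(\<integral>z. V n z \<partial>om) = (\<integral>z. 1 / Q (4 * C) n z \<partial>om) * (ga ^ n) powr (1 + ep)"
   unfolding V_def by (rule integral_mult_left_zero)
   also have "... <= (2 * real C + 2) / ga ^ n * (ga ^ n) powr (1 + ep)" by (intro mult_right_mono Q_inverse_moment) simp
   also have "(ga ^ n) powr (1 + ep) = ga ^ n * (ga powr ep) ^ n"
   using g0 gp(1)[of n] by (simp add: powr_add powr_realpow[symmetric] powr_powr mult.commute)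
   finally show ?thesis using g0 by simp
  qed
  have "ga powr ep < 1" using powr_less_mono2[of ep ga 1] assms g0 g1 by simp
  thus "summable (%n. (2 * real C + 2) * (ga powr ep) ^ n)" by (intro summable_mult summable_geometric) simp
 qed
 thus ?thesis using AE_Q_ge
 proof eventually_elim
  case (elim z)
  hence "\<forall>\<^sub>F n in sequentially. V n z < 1" by (intro order_tendstoD(2)) auto
  thus ?case
  proof eventually_elim
   case (elim n)
   have "0 < 1 / real (b ^ n)" using bn[of n] by simp
   hence "0 < Q (4 * C) n z" using \<open>\<forall>n. 1 / real (b ^ n) <= Q (4 * C) n z\<close> by (meson less_le_trans)
   thus ?case using elim by (simp add: V_def divide_less_eq)
  qed
 qed
qed

text \<open>The base contributes 1 and the fibres \<open>d0\<close>. Upper bounds for balls come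
  from the hypothesis on \<open>\<beta>\<close>. Lower bounds come from one word per interval
  (\<open>AE_Q_ge\<close>) if log b <= log (1/\<gamma>), and from counting cells
  (\<open>AE_Q_ge_eventually\<close>) otherwise.\<close>

theorem exact_dimension:
 assumes beta: "min (log 2 (real b)) lam <= \<beta>"
 shows "exact_dimensional_with om (min (1 + ln (real b) / ln (1 / ga)) 2)"
proof -
 define d0 where "d0 = min (ln (real b) / ln (1 / ga)) 1"
 have lg: "0 < ln (1 / ga)" "0 < ln (real b)" using g0 g1 b by (auto simp: ln_div)
 have d0: "0 < d0" using lg by (simp add: d0_def)
 have lam: "lam * d0 <= \<beta>"
 proof -
  have "lam * (ln (real b) / ln (1 / ga)) = log 2 (real b)" using lg by (simp add: lam_def log_def)
  moreover have "lam * d0 = min (lam * (ln (real b) / ln (1 / ga))) lam"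
   using lam0 unfolding d0_def by (simp add: min_mult_distrib_left)
  ultimately show ?thesis using beta by simp
 qed
 \<comment> \<open>The tolerances run through \<open>inverse (Suc k)\<close>, so that one set of
   full measure serves all exponents.\<close>
 have up: "AE z in om. \<forall>k. \<exists>m\<ge>1. \<forall>\<^sub>F l in sequentially.
   measure om (ball z (ga ^ (l * m))) <= 2 * ga ^ (l * m) * 2 powr (- ((\<beta> - inverse (real (Suc k))) * real (l * m)))"
  unfolding AE_all_countable
 proof
  fix k
  show "AE z in om. \<exists>m\<ge>1. \<forall>\<^sub>F l in sequentially.
   measure om (ball z (ga ^ (l * m))) <= 2 * ga ^ (l * m) * 2 powr (- ((\<beta> - inverse (real (Suc k))) * real (l * m)))"
   using AE_measure_ball_le[of "inverse (real (Suc k))"] by (auto elim!: eventually_mono)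
 qed
 have low: "AE z in om. \<forall>k. \<forall>\<^sub>F n in sequentially. (ga ^ n) powr (1 + inverse (real (Suc k))) <= Q (4 * C) n z"
  unfolding AE_all_countable using AE_Q_ge_eventually by simp
 have "AE z in om. ((%r. ln (measure om (ball z r)) / ln r) \<longlongrightarrow> 1 + d0) (at_right 0)"
  using supp up low AE_Q_ge
 proof eventually_elim
  case (elim z)
  show ?case
  proof (rule local_dimension_limit)
   show "measure om (ball z r) <= measure om (ball z r')" if "r <= r'" for r r'
   using that by (intro om.finite_measure_mono subset_ball) (simp_all add: sets_om)
   show "1 <= 1 + d0" using d0 by simp
  next
   fix e assume e: "0 < e" "e < 1 + d0"
   have "0 < lam * (1 + d0 - e)" using lam0 e by simp
   then obtain k where k: "inverse (real (Suc k)) < lam * (1 + d0 - e)" using reals_Archimedean by blast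
   obtain m where m: "1 <= m" and ev: "\<forall>\<^sub>F l in sequentially.
   measure om (ball z (ga ^ (l * m))) <= 2 * ga ^ (l * m) * 2 powr (- ((\<beta> - inverse (real (Suc k))) * real (l * m)))"
   using elim(2) by blast
   have "ga ^ m <= ga ^ 1" using m g0 g1 by (intro power_decreasing) auto
   hence m1: "ga ^ m < 1" using g1 by simp
   have "\<forall>\<^sub>F l in sequentially. measure om (ball z ((ga ^ m) ^ l)) <= 2 * ((ga ^ m) ^ l) powr e"
   using ev
   proof eventually_elim
   case (elim l)
   define n where "n = l * m"
   have eq: "(ga ^ m) ^ l = ga ^ n" by (simp add: n_def power_mult[symmetric] mult.commute)
   have "ga ^ n * 2 powr (- ((\<beta> - inverse (real (Suc k))) * real n)) = 2 powr (- (real n * (lam + \<beta> - inverse (real (Suc k)))))"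
   unfolding gamma_powr by (simp add: powr_add[symmetric] algebra_simps del: of_nat_Suc)
   also have "... <= 2 powr (- (real n * (lam * e)))"
   proof -
   have "lam * e <= lam + \<beta> - inverse (real (Suc k))" using k lam unfolding right_diff_distrib distrib_left by linarith
   hence "real n * (lam * e) <= real n * (lam + \<beta> - inverse (real (Suc k)))" by (intro mult_left_mono) auto
   thus ?thesis by simp
   qed
   also have "... = (ga ^ n) powr e" unfolding gamma_powr powr_powr by (simp add: mult_ac)
   finally show ?case using elim unfolding eq n_def[symmetric] by linarith
   qed
   thus "\<exists>rh K. 0 < rh & rh < 1 & 0 < K & (\<forall>\<^sub>F l in sequentially. measure om (ball z (rh ^ l)) <= K * (rh ^ l) powr e)"
   using gp(1)[of m] m1 by (intro exI[of _ "ga ^ m"] exI[of _ 2]) auto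
  next
   fix e assume e: "1 + d0 < e"
   have "\<forall>\<^sub>F n in sequentially. (ga ^ n) powr (e - 1) <= Q (4 * C) n z"
   proof (cases "ln (real b) / ln (1 / ga) <= 1")
   case True
   hence d: "d0 * ln (1 / ga) = ln (real b)" using lg by (simp add: d0_def)
   have "ga powr d0 = exp (- ln (real b))" unfolding d[symmetric] using g0 by (simp add: powr_def ln_div)
   hence gb: "ga powr d0 = 1 / real b" unfolding exp_minus using b0 by (simp add: inverse_eq_divide)
   have "(ga ^ n) powr (e - 1) <= Q (4 * C) n z" for n
   proof -
   have "(ga ^ n) powr (e - 1) <= (ga ^ n) powr d0" using gp[of n] e by (intro powr_mono') auto
   also have "... = (ga powr d0) ^ n"
   using g0 by (simp add: powr_realpow[symmetric] powr_powr mult.commute)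
   also have "... = 1 / real (b ^ n)" unfolding gb by (simp add: power_divide)
   also have "... <= Q (4 * C) n z" using elim(4) by blast
   finally show ?thesis .
   qed
   thus ?thesis by simp
   next
   case False
   hence "0 < e - 2" using e by (simp add: d0_def)
   then obtain k where k: "inverse (real (Suc k)) < e - 2" using reals_Archimedean by blast
   from elim(3) have "\<forall>\<^sub>F n in sequentially. (ga ^ n) powr (1 + inverse (real (Suc k))) <= Q (4 * C) n z" by blast
   thus ?thesis
   proof eventually_elim
   case (elim n)
   have "(ga ^ n) powr (e - 1) <= (ga ^ n) powr (1 + inverse (real (Suc k)))" using gp[of n] k by (intro powr_mono') auto
   thus ?case using elim by linarith
   qed
   qed
   hence "\<forall>\<^sub>F n in sequentially. 1 / 2 * (ga ^ n) powr e <= measure om (ball z (16 * real C * ga ^ n))"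
   proof eventually_elim
   case (elim n)
   have "(ga ^ n) powr e = (ga ^ n) powr (1 + (e - 1))" by simp
   also have "... = ga ^ n * (ga ^ n) powr (e - 1)" unfolding powr_add using gp(1)[of n] by simp
   also have "... <= ga ^ n * Q (4 * C) n z" using elim gp(1)[of n] by (intro mult_left_mono) auto
   finally show ?case using measure_ball_ge[of z n] \<open>fst z \<in> {0..<1} & \<bar>snd z\<bar> <= real C\<close> by (auto simp: field_simps)
   qed
   thus "\<exists>rh K L. 0 < rh & rh < 1 & 0 < K & 0 < L & (\<forall>\<^sub>F l in sequentially. K * (rh ^ l) powr e <= measure om (ball z (L * rh ^ l)))"
   using g0 g1 C1 by (intro exI[of _ ga] exI[of _ "1 / 2"] exI[of _ "16 * real C"]) auto
  qed
 qed
 moreover have "1 + d0 = min (1 + ln (real b) / ln (1 / ga)) 2" by (simp add: d0_def min_def)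
 ultimately show ?thesis unfolding exact_dimensional_with_def by simp
qed

end

section \<open>Words as digit expansions of integers\<close>

context solenoid
begin

text \<open>Digits after place \<open>n\<close> change the argument of \<open>\<phi>\<close> in term
  \<open>n\<close> by an integer. The identity carries transversality from words to the integers
  that index \<open>Gw\<close>.\<close>

lemma S_fun_digits: "S_fun b ga \<phi> x (%k. (U div b ^ k) mod b) = Gw x U"
proof -
 have dig: "(\<Sum>k\<le>n. (U div b ^ k) mod b * b ^ k) = U mod b ^ Suc n" for n
 proof (induction n)
  case (Suc n)
  have "U mod b ^ Suc (Suc n) = b ^ Suc n * (U div b ^ Suc n mod b) + U mod b ^ Suc n"
   unfolding power_Suc2[of b "Suc n"] by (rule mod_mult2_eq)
  thus ?case using Suc by simp
 qed simp
 have "\<phi> ((x + (\<Sum>k\<le>n. real ((U div b ^ k) mod b) * real b ^ k)) / real b ^ Suc n) = \<phi> ((x + real U) / real b ^ (n + 1))" for n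
 proof -
  have "(\<Sum>k\<le>n. real ((U div b ^ k) mod b) * real b ^ k) = real (U mod b ^ Suc n)"
   unfolding dig[symmetric] by simp
  moreover have "real U = real (U mod b ^ Suc n) + real (b ^ Suc n) * real (U div b ^ Suc n)"
   unfolding of_nat_mult[symmetric] of_nat_add[symmetric] by simp
  ultimately have "(x + real U) / real b ^ (n + 1) = (x + (\<Sum>k\<le>n. real ((U div b ^ k) mod b) * real b ^ k)) / real b ^ Suc n + real (U div b ^ Suc n)"
   using b0 by (simp add: add_divide_distrib)
  thus ?thesis by (simp only: per_nat)
 qed
 thus ?thesis unfolding S_fun_def G_def by simp
qed

end

theorem theoremA:
  fixes b :: nat and \<gamma> :: real and \<phi> :: "real \<Rightarrow> real"
  assumes "b \<ge> 2"
    and "0 < \<gamma>" and "\<gamma> < 1"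
    and "real_analytic \<phi>"
    and "int_periodic \<phi>"
    and "condition_H b \<gamma> \<phi>"
  shows "(\<exists>\<omega>. SRB_measure (T_map b \<gamma> \<phi>) \<omega>) \<and>
         (\<forall>\<omega>. SRB_measure (T_map b \<gamma> \<phi>) \<omega> \<longrightarrow>
            exact_dimensional_with \<omega> (min (1 + ln (real b) / ln (1 / \<gamma>)) 2))"
proof -
 obtain M R where MR: "0 < M" "1 <= R"
  and der: "!!m x. ((deriv ^^ m) \<phi> has_real_derivative (deriv ^^ Suc m) \<phi> x) (at x)"
  and bd: "!!m x. \<bar>(deriv ^^ m) \<phi> x\<bar> <= M * R ^ m * fact m"
  using analytic_periodic_derivatives[OF assms(4,5)] by blast
 have bd0: "\<bar>\<phi> x\<bar> <= M" for x using bd[of 0 x] by simp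
 have lp: "\<bar>\<phi> x - \<phi> y\<bar> <= M * R * \<bar>x - y\<bar>" for x y
 proof -
  have "norm (\<phi> x - \<phi> y) <= M * R * norm (x - y)"
   by (rule field_differentiable_bound[where S=UNIV and f'="deriv \<phi>"])
   (use der[of 0] bd[of 1] in \<open>auto\<close>)
  thus ?thesis by simp
 qed
 \<comment> \<open>As \<open>R >= 1\<close>, the product \<open>M * R\<close> bounds both
   \<open>\<phi>\<close> and its Lipschitz constant; dividing by \<open>1 - \<gamma>\<close> gives
   the normalisation of \<open>solenoid\<close>.\<close>
 define C where "C = nat \<lceil>max 1 (M * R / (1 - \<gamma>))\<rceil>"
 have C: "max 1 (M * R / (1 - \<gamma>)) <= real C" unfolding C_def by (rule real_nat_ceiling_ge)
 have MC: "M * R <= real C * (1 - \<gamma>)" using C assms(3) by (simp add: divide_le_eq)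
 have "M * 1 <= M * R" using MR by (intro mult_left_mono) auto
 hence M1: "M <= real C * (1 - \<gamma>)" using MC by simp
 interpret solenoid b \<gamma> \<phi> C
 proof
  show "\<bar>\<phi> x\<bar> <= real C * (1 - \<gamma>)" for x using bd0[of x] M1 by linarith
  show "\<bar>\<phi> x - \<phi> y\<bar> <= real C * (1 - \<gamma>) * \<bar>x - y\<bar>" for x y
   using lp[of x y] mult_right_mono[OF MC, of "\<bar>x - y\<bar>"] by simp
  show "\<phi> (x + 1) = \<phi> x" for x using assms(5) by (simp add: int_periodic_def)
  show "1 <= C" using C by simp
 qed (use assms in auto)
 interpret family: analytic_family b \<gamma> \<phi> M R
  by unfold_locales (use assms MR der bd in auto)
 obtain K \<theta> where K: "0 < K" "0 < \<theta>" and tr: "!!i j rh. i \<in> words b ==> j \<in> words b ==> i 0 ~= j 0 ==> 0 < rh ==> rh <= 1 ==>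
   emeasure lborel {x \<in> {0..1}. \<bar>S_fun b \<gamma> \<phi> x i - S_fun b \<gamma> \<phi> x j\<bar> <= rh} <= ennreal (K * rh powr \<theta>)"
  using family.transversality by blast
 interpret transversal_solenoid b \<gamma> \<phi> C K \<theta>
 proof
  fix U U' :: nat and rh :: real assume h: "U mod b ~= U' mod b" "0 < rh" "rh <= 1"
  have "(%k. (W div b ^ k) mod b) \<in> words b" for W using b0 by (simp add: words_def)
  from tr[OF this this, of U U' rh] h
  show "emeasure lborel {x \<in> {0..1}. \<bar>Gw x U - Gw x U'\<bar> <= rh} <= ennreal (K * rh powr \<theta>)"
   by (simp add: S_fun_digits)
 qed (use K in auto)
 obtain \<omega> where om: "sets \<omega> = sets borel" "prob_space \<omega>" "AE z in \<omega>. fst z \<in> {0..<1} & \<bar>snd z\<bar> <= real C" "distr \<omega> \<omega> T = \<omega>"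
  "\<forall>(h :: real => real) B. h \<in> borel_measurable borel --> (\<forall>x. \<bar>h x\<bar> <= B) --> (\<integral>z. h (fst z) \<partial>\<omega>) = (\<integral>x. h x \<partial>U01)"
  using invariant_measure_exists by (elim exE conjE) (rule that)
 have om5: "(\<integral>z. h (fst z) \<partial>\<omega>) = (\<integral>x. h x \<partial>U01)" if "h \<in> borel_measurable borel" "!!x. \<bar>h x\<bar> <= B" for h :: "real => real" and B
  using om(5)[rule_format, of h B] that by simp
 interpret solenoid_measure b \<gamma> \<phi> C \<omega>
  by (rule solenoid_measure.intro[OF solenoid_axioms], rule solenoid_measure_axioms.intro) (fact om(1-4) om5)+
 show ?thesis using SRB_om SRB_unique exact_dimension[OF beta_ge] by blast
qed

end
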